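(* Let $\mathcal{Z}_1(s)$ denote the meromorphic continuation to $\mathbb{C}$ of the function defined for $\Re s > 1$ by $\mathcal{Z}_1(s) = \int_1^\infty |\zeta(\tfrac12 + ix)|^2 x^{-s}\,dx$, where $\zeta$ is the Riemann zeta-function. Let $t_0>0$ be fixed. Then for every $\varepsilon > 0$ there is a constant $C = C(\varepsilon)>0$ such that for all $\tfrac12 \le \sigma \le 1$ and all $t \ge t_0$, $$|\mathcal{Z}_1(\sigma + it)| \le C\left( t^{\frac12 - \sigma + \varepsilon} \max_{t - t^{\varepsilon} \le v \le t + t^{\varepsilon}} |\mathcal{Z}_1(\tfrac12 + iv)| + \bigl(t^{\frac{9-16\sigma}{7}} + t^{-1}\bigr)\log t \right).$$
   Context: The notation $f \ll_\varepsilon g$ in the paper means $|f| \le C(\varepsilon) g$ with a constant depending only on $\varepsilon$; the claim spells this out.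
   Formalization: The factor log t is replaced by |log t|, which is the same for t ≥ 1; with the signed logarithm the claim fails for small t₀, since at σ = 1/2 and t → 0 the right-hand side becomes negative. *)

theory Defs
  imports "HOL-Complex_Analysis.Complex_Analysis"
begin

text \<open>
  The meromorphic continuation to the whole plane of a function \<open>f\<close> given on a set \<open>A\<close>.
  Asking for a nicely meromorphic function excludes arbitrary values at isolated points, so
  that the continuation is literally unique when \<open>A\<close> is open and nonempty; by the library's
  convention its value at a pole is \<open>0\<close>.
\<close>
definition meromorphic_continuation ::
    "complex set \<Rightarrow> (complex \<Rightarrow> complex) \<Rightarrow> complex \<Rightarrow> complex" where
  "meromorphic_continuation A f =
     (THE g. g nicely_meromorphic_on UNIV \<and> (\<forall>s\<in>A. g s = f s))"

lemma nicely_meromorphic_unique: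
  assumes f: "f nicely_meromorphic_on UNIV" and g: "g nicely_meromorphic_on UNIV"
    and A: "open A" "A \<noteq> {}" and eq: "\<And>s. s \<in> A \<Longrightarrow> f s = g s"
  shows "f = g"
proof
  fix z
  have fm: "f meromorphic_on UNIV" and gm: "g meromorphic_on UNIV"
    using f g by (auto simp: nicely_meromorphic_on_def)
  define h where "h = (\<lambda>s. f s - g s)"
  have hm: "h meromorphic_on UNIV"
    unfolding h_def by (intro meromorphic_intros fm gm)
  obtain a where a: "a \<in> A" using A by blast
  have "eventually (\<lambda>s. s \<in> A) (at a)"
    using A(1) a eventually_at_topological by blast
  hence "eventually (\<lambda>s. h s = 0) (at a)"
    by eventually_elim (simp add: h_def eq)
  hence freq: "frequently (\<lambda>s. h s = 0) (at a)"
    by (intro eventually_frequently) auto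
  have "(\<forall>\<^sub>\<approx>s\<in>UNIV. h s = 0) \<or> (\<forall>\<^sub>\<approx>s\<in>UNIV. h s \<noteq> 0)"
    by (rule meromorphic_imp_constant_or_avoid[OF hm]) auto
  moreover have "\<not> (\<forall>\<^sub>\<approx>s\<in>UNIV. h s \<noteq> 0)"
    using freq by (auto simp: eventually_cosparse_open_eq frequently_def)
  ultimately have "eventually (\<lambda>s. h s = 0) (at z)"
    by (auto simp: eventually_cosparse_open_eq)
  hence ev: "eventually (\<lambda>s. f s = g s) (at z)"
    by eventually_elim (simp add: h_def)
  have pole: "is_pole f z \<longleftrightarrow> is_pole g z"
    by (rule is_pole_cong[OF ev refl])
  have lim: "f \<midarrow>z\<rightarrow> c \<longleftrightarrow> g \<midarrow>z\<rightarrow> c" for c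
    by (rule tendsto_cong[OF ev])
  have no: "\<not> is_pole f z" if "f \<midarrow>z\<rightarrow> c" for c
    using that not_tendsto_and_filterlim_at_infinity[of "at z" f c]
    by (auto simp: is_pole_def)
  consider "is_pole f z" "f z = 0" | "\<not> is_pole f z" "f \<midarrow>z\<rightarrow> f z"
    using f no unfolding nicely_meromorphic_on_def by blast
  thus "f z = g z"
  proof cases
    case 1
    hence "g z = 0"
      using g pole lim no unfolding nicely_meromorphic_on_def by blast
    thus ?thesis using 1 by simp
  next
    case 2
    hence "g \<midarrow>z\<rightarrow> g z"
      using g pole unfolding nicely_meromorphic_on_def by blast
    hence "f \<midarrow>z\<rightarrow> g z" using lim by blast
    thus ?thesis using 2 LIM_unique by blast
  qed
qed

lemma meromorphic_continuation_eqI: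
  assumes "g nicely_meromorphic_on UNIV" "open A" "A \<noteq> {}" "\<And>s. s \<in> A \<Longrightarrow> g s = f s"
  shows "meromorphic_continuation A f = g"
  unfolding meromorphic_continuation_def
proof (rule the_equality)
  show "g nicely_meromorphic_on UNIV \<and> (\<forall>s\<in>A. g s = f s)"
    using assms by blast
next
  fix k assume k: "k nicely_meromorphic_on UNIV \<and> (\<forall>s\<in>A. k s = f s)"
  show "k = g"
    by (rule nicely_meromorphic_unique[of k g A]) (use k assms in auto)
qed

definition zeta :: "complex \<Rightarrow> complex" where
  "zeta = meromorphic_continuation {s. Re s > 1} (\<lambda>s. \<Sum>n. of_nat (Suc n) powr (-s))"

definition Z1 :: "complex \<Rightarrow> complex" where
  "Z1 = meromorphic_continuation {s. Re s > 1}
     (\<lambda>s. LINT x:{1..}|lborel.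
            of_real ((cmod (zeta (Complex (1/2) x)))\<^sup>2) * of_real x powr (-s))"

end

theory Submission
  imports Defs "HOL-Real_Asymp.Real_Asymp"
begin

text \<open>
  Write \<open>L(p)\<close> for the Laplace transform of \<open>|\<zeta>(1/2 + ix)|\<^sup>2\<close> over \<open>x \<ge> 1\<close>, so that the Mellin
  transform of \<open>L\<close> is \<open>\<Gamma>(s) Z\<^sub>1(s)\<close>. On the critical line \<open>|\<zeta>(w)|\<^sup>2 = \<zeta>(w) \<zeta>(1 - w)\<close>; moving the line to
  \<open>Re w = 3/2\<close> and using the functional equation turns \<open>L\<close> into a Cauchy integral of the Lambert series
  \<open>\<Sum> 1/(exp(kz) - 1)\<close>, and a residue computation gives an expansion of \<open>p L(p)\<close> at \<open>p = 0\<close> to every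
  order in powers of \<open>p\<close> and \<open>ln p\<close>. Hence \<open>Z\<^sub>1\<close> continues meromorphically to the plane, is holomorphic for
  \<open>Re s > 0\<close> outside \<open>s = 1\<close>, and grows at most exponentially in vertical strips there.

  Integrating by parts \<open>k\<close> times, \<open>Z\<^sub>1 = R + O(t\<^sup>-\<^sup>k)\<close> on a line far to the right, with \<open>R = O(1/t)\<close>
  throughout the upper half-plane. The maximum principle on the rectangle with vertical sides on
  \<open>Re z = 1/2\<close> and on that line, and horizontal sides at height \<open>t \<plusminus> t\<^sup>\<epsilon>\<close>, applied to
  \<open>(Z\<^sub>1 - R)(z) X\<^sup>z\<^sup>-\<^sup>s\<close> with \<open>X\<close> a power of \<open>t\<close> slightly below \<open>t\<close> and damped by a doubly exponentially
  small factor, bounds \<open>Z\<^sub>1(s)\<close> for large \<open>t\<close> by the maximum on the left side and \<open>1/t\<close>. For bounded \<open>t\<close>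
  only \<open>t = 1\<close>, where the logarithm vanishes, needs care: there the maximum over \<open>v\<close> is bounded below because
  \<open>Z\<^sub>1\<close> does not vanish identically on a segment.
\<close>

subsection \<open>Parameter integrals and nicely meromorphic functions\<close>

text \<open>On Re w = 3/2 the functional equation yields exp(pi x / 2) times a Fourier transform, so
  the Laplace transform is directly accessible only for Re p > pi/2, while its behaviour at p = 0 is
  wanted. After exchanging integrals, the pole w = i (pi/2 - p) of the kernel crosses the contour
  exactly at Re p = pi/2, and this crossing costs a residue. As p tends to 0 the pole approaches i
  pi/2, on the edge of the strip where the numerator is holomorphic; there the Lambert series is
  singular, but up to a period this is its singularity at the origin. The growth available for
  \<open>Z1\<close> is only exp(4 |s|), while the rectangle has half-height t^\<epsilon>. A Gaussian
  factor could not beat this for small \<epsilon>; exp(-cos) decays like exp(-c exp(t^\<epsilon> /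
  B)) and does. On the right side, decay t^(-k) is known only from abscissa B = k + 6 on, so X = t
  would lose about t^6. Taking X = t^(1 - \<epsilon>) gains t^(-\<epsilon> B), which compensates
  once k is about 8/\<epsilon>; the price on the left side is a factor of at most
  t^\<epsilon>.\<close>

lemma holomorphic_on_integral:
  fixes h :: "complex \<Rightarrow> 'a \<Rightarrow> complex"
  assumes S: "open S"
    and meas: "\<And>z. z \<in> S \<Longrightarrow> h z \<in> borel_measurable M"
    and hol: "\<And>w. w \<in> space M \<Longrightarrow> (\<lambda>z. h z w) holomorphic_on S"
    and dom: "\<And>z0. z0 \<in> S \<Longrightarrow> \<exists>r>0. \<exists>G. integrable M G \<and>
                (\<forall>z\<in>ball z0 r \<inter> S. \<forall>w\<in>space M. cmod (h z w) \<le> G w)"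
  shows "(\<lambda>z. integral\<^sup>L M (h z)) holomorphic_on S"
proof -
  have "(\<lambda>z. integral\<^sup>L M (h z)) field_differentiable (at z0)" if z0: "z0 \<in> S" for z0
  proof -
    obtain r1 G where r1: "r1 > 0" and G: "integrable M G"
      and bd1: "\<And>z w. z \<in> ball z0 r1 \<inter> S \<Longrightarrow> w \<in> space M \<Longrightarrow> cmod (h z w) \<le> G w"
      using dom[OF z0] by blast
    obtain r2 where r2: "r2 > 0" "ball z0 r2 \<subseteq> S"
      using S z0 open_contains_ball by blast
    define r where "r = min r1 r2 / 4"
    have r: "r > 0" using r1 r2 by (simp add: r_def)
    have sub: "ball z0 (3 * r) \<subseteq> S" "ball z0 (3 * r) \<subseteq> ball z0 r1 \<inter> S"
      using r1 r2 by (auto simp: r_def)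
    have bd: "cmod (h z w) \<le> G w" if "z \<in> ball z0 (3*r)" "w \<in> space M" for z w
      using bd1 sub that by blast
    have int: "integrable M (h z)" if "z \<in> ball z0 (3*r)" for z
      by (rule Bochner_Integration.integrable_bound[OF G]) (use that sub meas bd in \<open>auto intro!: AE_I2 order_trans[OF bd]\<close>)
    \<comment> \<open>Cauchy's inequality on discs of radius r turns the majorant \<open>G\<close>
      of the integrand into the majorant \<open>G w / r\<close> of its derivative. The difference
      quotients are dominated by the same function, so dominated convergence applies.\<close>
    have dbd: "cmod (deriv (\<lambda>z. h z w) z) \<le> G w / r" if z: "z \<in> ball z0 r" and w: "w \<in> space M" for z w
    proof -
      have s: "cball z r \<subseteq> ball z0 (3*r)"
      proof
        fix x assume "x \<in> cball z r"
        hence "dist z x \<le> r" "dist z0 z < r" using z by auto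
        thus "x \<in> ball z0 (3*r)" using dist_triangle[of z0 x z] r by (auto simp: dist_commute)
      qed
      have s': "cball z r \<subseteq> S" using s sub by blast
      have h1: "(\<lambda>z. h z w) holomorphic_on cball z r"
        using hol[OF w] holomorphic_on_subset s' by blast
      have "norm ((deriv ^^ 1) (\<lambda>z. h z w) z) \<le> fact 1 * G w / r ^ 1"
      proof (rule Cauchy_inequality)
        show "(\<lambda>z. h z w) holomorphic_on ball z r" using h1 holomorphic_on_subset by (meson ball_subset_cball)
        show "continuous_on (cball z r) (\<lambda>z. h z w)" using h1 holomorphic_on_imp_continuous_on by blast
        fix x assume "norm (z - x) = r"
        hence "x \<in> cball z r" by (simp add: dist_norm)
        thus "cmod (h x w) \<le> G w" using bd s w by blast
      qed (use r in auto)
      thus ?thesis by simp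
    qed
    have lip: "cmod (h z w - h z0 w) \<le> G w / r * cmod (z - z0)" if z: "z \<in> ball z0 r" and w: "w \<in> space M" for z w
    proof (rule field_differentiable_bound[of "ball z0 r" "\<lambda>z. h z w" "deriv (\<lambda>z. h z w)"])
      show "((\<lambda>z. h z w) has_field_derivative deriv (\<lambda>z. h z w) y) (at y within ball z0 r)"
        if "y \<in> ball z0 r" for y
      proof -
        have "y \<in> S" using that sub r by force
        hence "(\<lambda>z. h z w) field_differentiable at y"
          using hol[OF w] S holomorphic_on_imp_differentiable_at by blast
        thus ?thesis using DERIV_deriv_iff_field_differentiable has_field_derivative_at_within by blast
      qed
    qed (use dbd w z r in auto)
    define d where "d = (\<lambda>w. deriv (\<lambda>z. h z w) z0)"
    have lim: "((\<lambda>z. (h z w - h z0 w) / (z - z0)) \<longlongrightarrow> d w) (at z0)" if w: "w \<in> space M" for w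
    proof -
      have "(\<lambda>z. h z w) field_differentiable at z0"
        using hol[OF w] S z0 holomorphic_on_imp_differentiable_at by blast
      hence "((\<lambda>z. h z w) has_field_derivative d w) (at z0)"
        unfolding d_def using DERIV_deriv_iff_field_differentiable by blast
      thus ?thesis by (simp add: has_field_derivative_iff)
    qed
    \<comment> \<open>The derivative is measurable in \<open>w\<close> as the limit of difference
      quotients along one fixed sequence tending to \<open>z0\<close>.\<close>
    have dm: "d \<in> borel_measurable M"
    proof (rule borel_measurable_LIMSEQ_metric)
      define zn where "zn = (\<lambda>n::nat. z0 + of_real (r / real (n + 2)))"
      have zn: "zn n \<in> ball z0 (3*r)" "zn n \<noteq> z0" for n
      proof -
        have "cmod (zn n - z0) = r / real (n + 2)"
          unfolding zn_def add_diff_cancel_left' norm_of_real using r by simp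
        moreover have "r / real (n + 2) \<le> r / 1"
          by (intro divide_left_mono) (use r in auto)
        moreover have "r / real (n + 2) > 0" using r by simp
        ultimately show "zn n \<in> ball z0 (3*r)" "zn n \<noteq> z0" using r by (auto simp: dist_norm norm_minus_commute)
      qed
      show "(\<lambda>w. (h (zn n) w - h z0 w) / (zn n - z0)) \<in> borel_measurable M" for n
        using meas[of "zn n"] meas[OF z0] zn(1)[of n] sub by auto
      have "zn \<longlonglongrightarrow> z0 + of_real 0"
        unfolding zn_def by (intro tendsto_intros) real_asymp
      hence "filterlim zn (at z0) sequentially"
        using zn(2) by (simp add: filterlim_at)
      thus "(\<lambda>n. (h (zn n) w - h z0 w) / (zn n - z0)) \<longlonglongrightarrow> d w" if "w \<in> space M" for w
        using lim[OF that] filterlim_compose by blast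
    qed
    have "((\<lambda>z. integral\<^sup>L M (h z)) has_field_derivative integral\<^sup>L M d) (at z0)"
      unfolding has_field_derivative_iff tendsto_at_iff_sequentially comp_def
    proof (intro allI impI)
      fix X assume X: "\<forall>i. X i \<in> UNIV - {z0}" and Xl: "X \<longlonglongrightarrow> z0"
      have "eventually (\<lambda>i. X i \<in> ball z0 r) sequentially"
        using Xl r by (auto simp: tendsto_iff dist_commute elim!: allE[of _ r])
      then obtain i0 where i0: "\<And>i. i \<ge> i0 \<Longrightarrow> X i \<in> ball z0 r"
        by (auto simp: eventually_sequentially)
      \<comment> \<open>Dropping the first \<open>i0\<close> terms puts the whole sequence into the
        ball where \<open>lip\<close> holds.\<close>
      let ?Y = "\<lambda>i. X (i + i0)"
      have Y: "?Y i \<in> ball z0 r" "?Y i \<in> ball z0 (3*r)" "?Y i \<noteq> z0" for i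
        using i0[of "i+i0"] X r by auto
      have fX: "filterlim ?Y (at z0) sequentially"
        using X Xl by (simp add: filterlim_at LIMSEQ_ignore_initial_segment)
      have "(\<lambda>i. integral\<^sup>L M (\<lambda>w. (h (?Y i) w - h z0 w) / (?Y i - z0))) \<longlonglongrightarrow> integral\<^sup>L M d"
      proof (rule integral_dominated_convergence[where w = "\<lambda>w. G w / r"])
        show "AE x in M. (\<lambda>i. (h (?Y i) x - h z0 x) / (?Y i - z0)) \<longlonglongrightarrow> d x"
          by (intro AE_I2) (rule filterlim_compose[OF lim fX])
        show "AE x in M. cmod ((h (?Y i) x - h z0 x) / (?Y i - z0)) \<le> G x / r" for i
        proof (intro AE_I2)
          fix x assume x: "x \<in> space M"
          have "cmod (?Y i - z0) > 0" using Y(3)[of i] by simp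
          thus "cmod ((h (?Y i) x - h z0 x) / (?Y i - z0)) \<le> G x / r"
            using lip[OF Y(1)[of i] x] by (simp only: norm_divide pos_divide_le_eq)
        qed
        show "(\<lambda>w. (h (?Y i) w - h z0 w) / (?Y i - z0)) \<in> borel_measurable M" for i
          using meas[of "?Y i"] meas[OF z0] Y(2)[of i] sub by auto
      qed (use dm G in auto)
      also have "(\<lambda>i. integral\<^sup>L M (\<lambda>w. (h (?Y i) w - h z0 w) / (?Y i - z0))) =
         (\<lambda>i. (integral\<^sup>L M (h (?Y i)) - integral\<^sup>L M (h z0)) / (?Y i - z0))"
        using int[OF Y(2)] int[of z0] r by auto
      finally show "(\<lambda>i. (integral\<^sup>L M (h (X i)) - integral\<^sup>L M (h z0)) / (X i - z0)) \<longlonglongrightarrow> integral\<^sup>L M d"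
        by (rule LIMSEQ_offset)
    qed
    thus ?thesis using field_differentiable_def by blast
  qed
  thus ?thesis using S by (simp add: holomorphic_on_def field_differentiable_at_within)
qed

lemma holomorphic_on_set_integral:
  fixes h :: "complex \<Rightarrow> real \<Rightarrow> complex"
  assumes S: "open S" and A: "A \<in> sets borel"
    and meas: "\<And>z. z \<in> S \<Longrightarrow> set_borel_measurable borel A (h z)"
    and hol: "\<And>x. x \<in> A \<Longrightarrow> (\<lambda>z. h z x) holomorphic_on S"
    and dom: "\<And>z0. z0 \<in> S \<Longrightarrow> \<exists>r>0. \<exists>G. set_integrable lborel A G \<and>
                (\<forall>z\<in>ball z0 r \<inter> S. \<forall>x\<in>A. cmod (h z x) \<le> G x)"
  shows "(\<lambda>z. LINT x:A|lborel. h z x) holomorphic_on S"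
  unfolding set_lebesgue_integral_def
proof (rule holomorphic_on_integral[OF S])
  show "(\<lambda>x. indicat_real A x *\<^sub>R h z x) \<in> borel_measurable lborel" if "z \<in> S" for z
    using meas[OF that] by (simp add: set_borel_measurable_def)
  show "(\<lambda>z. indicat_real A x *\<^sub>R h z x) holomorphic_on S" for x
    using hol[of x] by (cases "x \<in> A") auto
  fix z0 assume "z0 \<in> S"
  then obtain r G where rG: "r > 0" "set_integrable lborel A G"
     "\<And>z x. z \<in> ball z0 r \<inter> S \<Longrightarrow> x \<in> A \<Longrightarrow> cmod (h z x) \<le> G x"
    using dom by meson
  show "\<exists>r>0. \<exists>G. integrable lborel G \<and> (\<forall>z\<in>ball z0 r \<inter> S. \<forall>w\<in>space lborel.
          cmod (indicat_real A w *\<^sub>R h z w) \<le> G w)"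
    using rG by (intro exI[of _ r] conjI exI[of _ "\<lambda>x. indicat_real A x *\<^sub>R G x"])
      (auto simp: set_integrable_def indicator_def)
qed

text \<open>Local form of \<open>nicely_meromorphic_unique\<close>, for functions known only on
  half-planes or punctured half-planes. Connectedness of \<open>S\<close> gives the dichotomy for f
  - g; the value conventions of nicely meromorphic functions then decide equality at the point
  itself.\<close>

lemma nicely_meromorphic_eqI:
  assumes f: "f nicely_meromorphic_on S" and g: "g nicely_meromorphic_on S"
    and S: "open S" "connected S"
    and A: "open A" "A \<noteq> {}" "A \<subseteq> S" and eq: "\<And>s. s \<in> A \<Longrightarrow> f s = g s" and z: "z \<in> S"
  shows "f z = g z"
proof -
  have fm: "f meromorphic_on S" and gm: "g meromorphic_on S"
    using f g by (auto simp: nicely_meromorphic_on_def)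
  define h where "h = (\<lambda>s. f s - g s)"
  have hm: "h meromorphic_on S"
    unfolding h_def by (intro meromorphic_intros fm gm)
  obtain a where a: "a \<in> A" using A by blast
  have "eventually (\<lambda>s. s \<in> A) (at a)"
    using A(1) a eventually_at_topological by blast
  hence "eventually (\<lambda>s. h s = 0) (at a)"
    by eventually_elim (simp add: h_def eq)
  hence freq: "frequently (\<lambda>s. h s = 0) (at a)"
    by (intro eventually_frequently) auto
  have "(\<forall>\<^sub>\<approx>s\<in>S. h s = 0) \<or> (\<forall>\<^sub>\<approx>s\<in>S. h s \<noteq> 0)"
    by (rule meromorphic_imp_constant_or_avoid[OF hm]) (use S in auto)
  moreover have "\<not> (\<forall>\<^sub>\<approx>s\<in>S. h s \<noteq> 0)"
    using freq A a S by (auto simp: eventually_cosparse_open_eq frequently_def)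
  ultimately have "eventually (\<lambda>s. h s = 0) (at z)"
    using z S by (auto simp: eventually_cosparse_open_eq)
  hence ev: "eventually (\<lambda>s. f s = g s) (at z)"
    by eventually_elim (simp add: h_def)
  have pole: "is_pole f z \<longleftrightarrow> is_pole g z"
    by (rule is_pole_cong[OF ev refl])
  have lim: "f \<midarrow>z\<rightarrow> c \<longleftrightarrow> g \<midarrow>z\<rightarrow> c" for c
    by (rule tendsto_cong[OF ev])
  have no: "\<not> is_pole f z" if "f \<midarrow>z\<rightarrow> c" for c
    using that not_tendsto_and_filterlim_at_infinity[of "at z" f c]
    by (auto simp: is_pole_def)
  have f': "is_pole f z \<and> f z = 0 \<or> f \<midarrow>z\<rightarrow> f z"
    using f z unfolding nicely_meromorphic_on_def by blast
  have "is_pole g z \<and> g z = 0 \<or> g \<midarrow>z\<rightarrow> g z"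
    using g z unfolding nicely_meromorphic_on_def by blast
  hence g': "is_pole f z \<and> g z = 0 \<or> f \<midarrow>z\<rightarrow> g z"
    unfolding pole lim .
  show ?thesis
    using f' g' no LIM_unique[of f "f z" z "g z"] by auto
qed

lemma nicely_meromorphic_on_cong_open:
  assumes f: "f nicely_meromorphic_on S" and "open S" and eq: "\<And>z. z \<in> S \<Longrightarrow> g z = f z"
  shows "g nicely_meromorphic_on S"
proof -
  have ev: "eventually (\<lambda>w. g w = f w) (at z)" if "z \<in> S" for z
    using eventually_at_in_open'[OF assms(2) that] by eventually_elim (rule eq)
  have "g meromorphic_on S"
    by (subst meromorphic_on_cong'[where g = f and B = S])
       (use f ev in \<open>auto simp: nicely_meromorphic_on_def eventually_cosparse_open_eq[OF assms(2)]\<close>)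
  moreover have "is_pole g z \<and> g z = 0 \<or> g \<midarrow>z\<rightarrow> g z" if z: "z \<in> S" for z
  proof -
    have "is_pole f z \<and> f z = 0 \<or> f \<midarrow>z\<rightarrow> f z"
      using f z unfolding nicely_meromorphic_on_def by blast
    thus ?thesis
      unfolding eq[OF z] is_pole_cong[OF ev[OF z] refl] tendsto_cong[OF ev[OF z]] .
  qed
  ultimately show ?thesis
    unfolding nicely_meromorphic_on_def by blast
qed

lemma compact_norm_bound:
  fixes f :: "'a::topological_space \<Rightarrow> 'b::real_normed_vector"
  assumes "compact K" "continuous_on K f"
  obtains M where "\<And>x. x \<in> K \<Longrightarrow> norm (f x) \<le> M"
  using compact_imp_bounded[OF compact_continuous_image[OF assms(2,1)]] by (auto simp: bounded_iff)

lemma set_borel_measurable_continuous_on: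
  fixes f :: "real \<Rightarrow> 'a::{banach, second_countable_topology}"
  assumes "A \<in> sets borel" "continuous_on A f"
  shows "set_borel_measurable borel A f"
  unfolding set_borel_measurable_def using borel_measurable_continuous_on_indicator[OF assms] .

lemma norm_of_real_powr: "p > 0 \<Longrightarrow> cmod (complex_of_real p powr z) = p powr Re z"
  by (simp add: norm_powr_real_powr)

lemma set_integrable_continuous_bound:
  fixes g :: "real \<Rightarrow> 'a::{banach, second_countable_topology}"
  assumes "A \<in> sets borel" "continuous_on A g" "set_integrable lborel A f"
    and bd: "\<And>x. x \<in> A \<Longrightarrow> norm (g x) \<le> f x"
  shows "set_integrable lborel A g"
proof (rule set_integrable_bound[OF assms(3)])
  show "set_borel_measurable lborel A g"
    using set_borel_measurable_continuous_on[OF assms(1,2)] by (simp add: set_borel_measurable_def)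
  show "AE x in lborel. x \<in> A \<longrightarrow> norm (g x) \<le> norm (f x)"
    by (intro AE_I2 impI order_trans[OF bd]) auto
qed

lemma set_integral_sum:
  fixes f :: "'i \<Rightarrow> 'a \<Rightarrow> 'b::{banach, second_countable_topology}"
  assumes "\<And>i. i \<in> I \<Longrightarrow> set_integrable M A (f i)"
  shows "set_integrable M A (\<lambda>x. \<Sum>i\<in>I. f i x)"
    and "(LINT x:A|M. \<Sum>i\<in>I. f i x) = (\<Sum>i\<in>I. LINT x:A|M. f i x)"
  using assms unfolding set_integrable_def set_lebesgue_integral_def scaleR_sum_right
  by (auto intro: Bochner_Integration.integral_sum)

lemma connected_halfplane_Re_gt: "connected {s::complex. Re s > a}"
  by (intro convex_connected convex_halfspace_Re_gt)

text \<open>\<open>mellin_continuation\<close> reaches only Re s > -N for each N. The continuations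
  may disagree at their singularities, so these are removed first; afterwards the identity theorem
  makes them agree on overlaps.\<close>

lemma meromorphic_glue:
  fixes F :: "complex \<Rightarrow> complex"
  assumes F: "F holomorphic_on {s. Re s > a}"
    and h: "\<And>n::nat. \<exists>h. h meromorphic_on {s. Re s > - real n} \<and> (\<forall>s. Re s > a \<and> Re s > - real n \<longrightarrow> h s = F s)"
  obtains g where "g nicely_meromorphic_on UNIV" "\<And>s. Re s > a \<Longrightarrow> g s = F s"
proof -
  define H where "H = (\<lambda>n::nat. {s. Re s > - real n})"
  obtain h where hm: "\<And>n. h n meromorphic_on H n" and hF: "\<And>n s. Re s > a \<Longrightarrow> Re s > - real n \<Longrightarrow> h n s = F s"
    using h unfolding H_def by metis
  define k where "k = (\<lambda>n. remove_sings (h n))"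
  have kn: "k n nicely_meromorphic_on H n" for n
    unfolding k_def by (rule remove_sings_nicely_meromorphic[OF hm])
  have oH: "open (H n)" for n by (simp add: H_def open_halfspace_Re_gt)
  have kF: "k n s = F s" if s: "Re s > a" "Re s > - real n" for n s
  proof -
    have "open ({s. Re s > a} \<inter> H n)" by (simp add: open_halfspace_Re_gt oH open_Int)
    moreover have "F holomorphic_on ({s. Re s > a} \<inter> H n)" by (rule holomorphic_on_subset[OF F]) auto
    ultimately have "h n holomorphic_on ({s. Re s > a} \<inter> H n)"
      using hF by (subst holomorphic_cong[OF refl, of _ "h n" F]) (auto simp: H_def)
    from this have "h n analytic_on {s}" using s \<open>open ({s. Re s > a} \<inter> H n)\<close>
      unfolding analytic_at by (intro exI[of _ "{s. Re s > a} \<inter> H n"]) (auto simp: H_def)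
    thus ?thesis using hF s unfolding k_def by simp
  qed
  have kk: "k m s = k n s" if "m \<le> n" "s \<in> H m" for m n s
  proof (rule nicely_meromorphic_eqI[where f = "k m" and g = "k n" and z = s and S = "H m" and A = "{s. Re s > max a 0}"])
    show "k n nicely_meromorphic_on H m"
      by (rule nicely_meromorphic_on_subset[OF kn]) (use that in \<open>auto simp: H_def\<close>)
    have "of_real (max a 0 + 1) \<in> {s. Re s > max a 0}" by auto
    thus "{s. Re s > max a 0} \<noteq> {}" by blast
    show "open {s. Re s > max a 0}" by (rule open_halfspace_Re_gt)
  qed (use that kn oH kF in \<open>auto simp: H_def connected_halfplane_Re_gt\<close>)
  \<comment> \<open>This index n satisfies Re s > -n, so \<open>s\<close> lies in the domain of the
    chosen function.\<close>
  define g where "g = (\<lambda>s. k (nat \<lceil>- Re s\<rceil> + 1) s)"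
  have gk: "g s = k n s" if "s \<in> H n" for n s
  proof -
    have "s \<in> H (nat \<lceil>- Re s\<rceil> + 1)" unfolding H_def by simp linarith
    thus ?thesis using kk[of n "nat \<lceil>- Re s\<rceil> + 1" s] kk[of "nat \<lceil>- Re s\<rceil> + 1" n s] that
      unfolding g_def by (metis nat_le_linear)
  qed
  have gn: "g nicely_meromorphic_on H n" for n
    by (rule nicely_meromorphic_on_cong_open[OF kn oH gk])
  have "g nicely_meromorphic_on UNIV"
    unfolding nicely_meromorphic_on_def
  proof
    have U: "(\<Union>n. H n) = UNIV"
    proof -
      have "\<exists>n. s \<in> H n" for s
      proof -
        obtain n::nat where "- Re s < real n" using reals_Archimedean2 by blast
        thus ?thesis by (intro exI[of _ n]) (simp add: H_def)
      qed
      thus ?thesis by blast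
    qed
    have "g meromorphic_on (\<Union>n. H n)"
      using gn unfolding meromorphic_on_def nicely_meromorphic_on_def by blast
    thus "g meromorphic_on UNIV" using U by simp
    show "\<forall>z\<in>UNIV. is_pole g z \<and> g z = 0 \<or> g \<midarrow>z\<rightarrow> g z"
      using gn U unfolding nicely_meromorphic_on_def by blast
  qed
  moreover have "g s = F s" if "Re s > a" for s
  proof -
    obtain n::nat where "- Re s < real n" using reals_Archimedean2 by blast
    hence "s \<in> H n" by (simp add: H_def)
    thus ?thesis using gk kF[OF that] by (simp add: H_def)
  qed
  ultimately show ?thesis using that by blast
qed

subsection \<open>Continuation of Mellin transforms\<close>

text \<open>Taking norms in the complex Gamma integral gives the real integrand; its continuity
  supplies the Borel measurability needed to descend from \<open>lebesgue\<close> to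
  \<open>lborel\<close>.\<close>

lemma set_integrable_powr_exp:
  fixes R c :: real
  assumes "R > -1" "c > 0"
  shows "set_integrable lborel {0<..} (\<lambda>p. p powr R * exp (- c * p))"
proof -
  have "(\<lambda>t. complex_of_real t powr (of_real (R+1) - 1) / of_real (exp (c * t))) absolutely_integrable_on {0<..}"
    by (rule absolutely_integrable_Gamma_integral) (use assms in auto)
  hence "(\<lambda>t. norm (complex_of_real t powr (of_real (R+1) - 1) / of_real (exp (c * t)))) absolutely_integrable_on {0<..}"
    by (rule absolutely_integrable_norm[unfolded comp_def])
  hence "set_integrable lebesgue {0<..} (\<lambda>p. p powr R * exp (- c * p))"
    by (rule set_integrable_cong[THEN iffD1, OF refl refl, rotated])
       (auto simp: norm_divide norm_of_real_powr exp_minus field_simps)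
  moreover have "set_borel_measurable borel {0<..} (\<lambda>p. p powr R * exp (- c * p))"
    by (intro set_borel_measurable_continuous_on continuous_intros) auto
  ultimately show ?thesis
    unfolding set_integrable_def set_borel_measurable_def
    by (subst (asm) integrable_completion) auto
qed

text \<open>Powers of p contribute simple poles to a Mellin transform, powers times ln p double
  poles. These integrals are the polar parts in \<open>mellin_continuation\<close>.\<close>

lemma integral_Ioo_powr:
  fixes w :: complex
  assumes w: "Re w > 0"
  shows "set_integrable lborel {0<..<1} (\<lambda>p. of_real p powr (w - 1))"
    and "(LINT p:{0<..<1}|lborel. of_real p powr (w - 1)) = 1 / w"
    and "set_integrable lborel {0<..<1} (\<lambda>p. of_real (ln p) * of_real p powr (w - 1))"
    and "(LINT p:{0<..<1}|lborel. of_real (ln p) * of_real p powr (w - 1)) = - 1 / w\<^sup>2"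
proof -
  have w0: "w \<noteq> 0" using w by auto
  have real: "set_integrable lborel {0<..<1} (\<lambda>p. p powr (a - 1))" if a: "a > 0" for a :: real
  proof -
    have "((\<lambda>p. p powr (a - 1)) has_integral (1 / a)) {0<..<1}"
      using has_integral_powr_from_0[of "a - 1" 1] a by (simp add: has_integral_Icc_iff_Ioo)
    hence "(\<lambda>p. p powr (a - 1)) integrable_on {0<..<1}"
      by (rule has_integral_integrable)
    hence "(\<lambda>p. p powr (a - 1)) absolutely_integrable_on {0<..<1}"
      by (rule nonnegative_absolutely_integrable_1) auto
    moreover have "set_borel_measurable borel {0<..<1} (\<lambda>p. p powr (a - 1))"
      by (intro set_borel_measurable_continuous_on continuous_intros) auto
    ultimately show ?thesis
      unfolding set_integrable_def set_borel_measurable_def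
      by (subst (asm) integrable_completion) auto
  qed
  show i1: "set_integrable lborel {0<..<1} (\<lambda>p. complex_of_real p powr (w - 1))"
    by (rule set_integrable_continuous_bound[OF _ _ real[OF w]])
       (auto intro!: continuous_intros simp: norm_of_real_powr)
  have "((\<lambda>p. complex_of_real p powr (w - 1)) has_integral (of_real 1 powr w / w - of_real 0 powr w / w)) {0..1}"
    using w w0 by (intro fundamental_theorem_of_calculus_interior)
      (auto intro!: continuous_intros derivative_eq_intros has_vector_derivative_real_field)
  hence "((\<lambda>p. complex_of_real p powr (w - 1)) has_integral 1 / w) {0<..<1}"
    by (simp add: has_integral_Icc_iff_Ioo)
  thus "(LINT p:{0<..<1}|lborel. complex_of_real p powr (w - 1)) = 1 / w"
    using set_borel_integral_eq_integral(2)[OF i1] integral_unique by metis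
  show i2: "set_integrable lborel {0<..<1} (\<lambda>p. of_real (ln p) * complex_of_real p powr (w - 1))"
  proof (rule set_integrable_continuous_bound)
    show "set_integrable lborel {0<..<1} (\<lambda>p. (2 / Re w) * p powr (Re w / 2 - 1))"
      using real[of "Re w / 2"] w by (intro set_integrable_mult_right) auto
    fix p :: real assume p: "p \<in> {0<..<1}"
    \<comment> \<open>The logarithm is absorbed at the cost of half the exponent, by ln x \<le> x -
      1 at x = p^(-Re w / 2).\<close>
    have "ln (p powr (- (Re w / 2))) \<le> p powr (- (Re w / 2)) - 1"
      by (rule ln_le_minus_one) (use p in auto)
    moreover have "ln (p powr (- (Re w / 2))) = - ln p * (Re w / 2)"
      using p by (simp add: ln_powr)
    ultimately have "- ln p * (Re w / 2) \<le> p powr (- (Re w / 2))"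
      by linarith
    hence "- ln p \<le> (2 / Re w) * p powr (- (Re w / 2))"
      using w by (simp add: field_simps)
    hence "- ln p * p powr (Re w - 1) \<le> (2 / Re w) * p powr (- (Re w / 2)) * p powr (Re w - 1)"
      by (intro mult_right_mono) auto
    also have "\<dots> = (2 / Re w) * p powr (Re w / 2 - 1)"
      using p by (simp add: mult.assoc flip: powr_add)
    finally show "cmod (of_real (ln p) * complex_of_real p powr (w - 1)) \<le> (2 / Re w) * p powr (Re w / 2 - 1)"
      using p by (simp add: norm_mult norm_of_real_powr)
  qed (auto intro!: continuous_intros)
  \<comment> \<open>The primitive found by parts. It tends to its value \<open>F 0\<close> = 0 at
    the left end because p^w ln p tends to 0 for Re w > 0.\<close>
  define F where "F = (\<lambda>p. complex_of_real p powr w * of_real (ln p) / w - complex_of_real p powr w / w\<^sup>2)"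
  have "((\<lambda>p. of_real (ln p) * complex_of_real p powr (w - 1)) has_integral (F 1 - F 0)) {0..1}"
  proof (rule fundamental_theorem_of_calculus_interior)
    have "isCont F p" if "p > 0" for p
      unfolding F_def using that w0 by (intro continuous_intros) auto
    moreover have "(F \<longlongrightarrow> F 0) (at 0 within {0..1})"
    proof -
      have "((\<lambda>p. p powr Re w * ln p) \<longlongrightarrow> 0) (at_right 0)"
        using w by real_asymp
      hence "((\<lambda>p. complex_of_real p powr w * of_real (ln p)) \<longlongrightarrow> 0) (at_right 0)"
        by (rule tendsto_norm_zero_cancel[OF Lim_transform_eventually[OF tendsto_norm_zero]])
           (auto simp: eventually_at_right_less norm_mult norm_of_real_powr abs_mult
              intro!: eventually_mono[OF eventually_at_right_less])
      moreover have "((\<lambda>p. complex_of_real p powr w) \<longlongrightarrow> 0) (at_right 0)"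
      proof -
        have "((\<lambda>p. p powr Re w) \<longlongrightarrow> 0) (at_right 0)" using w by real_asymp
        thus ?thesis
          by (rule tendsto_norm_zero_cancel[OF Lim_transform_eventually])
             (auto simp: norm_of_real_powr intro!: eventually_mono[OF eventually_at_right_less])
      qed
      ultimately have "(F \<longlongrightarrow> 0 / w - 0 / w\<^sup>2) (at_right 0)"
        unfolding F_def using w0 by (intro tendsto_intros) auto
      hence "(F \<longlongrightarrow> F 0) (at_right 0)" by (simp add: F_def)
      thus ?thesis by (simp add: at_within_Icc_at_right)
    qed
    ultimately show "continuous_on {0..1} F"
      unfolding continuous_on by (metis atLeastAtMost_iff continuous_at_imp_continuous_at_within continuous_within less_eq_real_def)
    show "(F has_vector_derivative of_real (ln x) * complex_of_real x powr (w - 1)) (at x)"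
      if "x \<in> {0<..<1}" for x
    proof -
      have x: "complex_of_real x \<notin> \<real>\<^sub>\<le>\<^sub>0" "x > 0" using that by auto
      have e: "complex_of_real x powr w = of_real x * complex_of_real x powr (w - 1)"
        using that by (simp add: powr_diff)
      have d: "((\<lambda>p. p powr w * Ln p / w - p powr w / w\<^sup>2) has_field_derivative
             of_real (ln x) * complex_of_real x powr (w - 1)) (at (of_real x))"
        using x w0 by (auto intro!: derivative_eq_intros simp: e Ln_of_real field_simps power2_eq_square)
      have "((\<lambda>p. complex_of_real p powr w * Ln (of_real p) / w - of_real p powr w / w\<^sup>2) has_vector_derivative
             of_real (ln x) * complex_of_real x powr (w - 1)) (at x)"
        using has_vector_derivative_real_field[OF d] by simp
      thus ?thesis unfolding F_def
        by (rule has_vector_derivative_transform_within[where d = x])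
           (use x in \<open>auto simp: Ln_of_real dist_real_def\<close>)
    qed
  qed simp
  hence "((\<lambda>p. of_real (ln p) * complex_of_real p powr (w - 1)) has_integral (- 1 / w\<^sup>2)) {0<..<1}"
    by (simp add: has_integral_Icc_iff_Ioo F_def)
  thus "(LINT p:{0<..<1}|lborel. of_real (ln p) * complex_of_real p powr (w - 1)) = - 1 / w\<^sup>2"
    using set_borel_integral_eq_integral(2)[OF i2] integral_unique by metis
qed

text \<open>By induction on the order: \<open>pole_lemma_open\<close> makes (a z - a 0) / z
  holomorphic again, and \<open>pCons\<close> prepends the constant term. Only the existence of the
  polynomial matters later, so its coefficients stay implicit.\<close>

lemma holomorphic_taylor_poly:
  assumes "a holomorphic_on ball 0 d" "d > 0"
  shows "\<exists>(A::complex poly) K \<eta>. \<eta> > 0 \<and> (\<forall>p\<in>ball 0 \<eta>. cmod (a p - poly A p) \<le> K * cmod p ^ M)"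
  using assms(1)
proof (induction M arbitrary: a)
  case 0
  have "continuous_on (cball 0 (d/2)) a"
    by (intro holomorphic_on_imp_continuous_on[OF holomorphic_on_subset[OF 0]]) (use assms(2) in auto)
  then obtain K where K: "\<And>p. p \<in> cball 0 (d/2) \<Longrightarrow> cmod (a p) \<le> K"
    using compact_norm_bound[OF compact_cball] by blast
  show ?case
    by (rule exI[of _ 0], rule exI[of _ K], rule exI[of _ "d/2"]) (use K assms(2) in auto)
next
  case (Suc M)
  define a1 where "a1 = (\<lambda>z. if z = 0 then deriv a 0 else (a z - a 0) / (z - 0))"
  have "a1 holomorphic_on ball 0 d"
    unfolding a1_def by (rule pole_lemma_open[OF Suc.prems]) auto
  from Suc.IH[OF this] obtain A K \<eta> where A: "\<eta> > 0" "\<And>p. p \<in> ball 0 \<eta> \<Longrightarrow> cmod (a1 p - poly A p) \<le> K * cmod p ^ M"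
    by blast
  show ?case
  proof (rule exI[of _ "pCons (a 0) A"], rule exI[of _ K], rule exI[of _ \<eta>], intro conjI ballI)
    fix p :: complex assume p: "p \<in> ball 0 \<eta>"
    have eq: "a p - poly (pCons (a 0) A) p = p * (a1 p - poly A p)"
      by (simp add: a1_def field_simps)
    have "cmod p * cmod (a1 p - poly A p) \<le> cmod p * (K * cmod p ^ M)"
      by (intro mult_left_mono A(2) p) auto
    thus "cmod (a p - poly (pCons (a 0) A) p) \<le> K * cmod p ^ Suc M"
      unfolding eq norm_mult by (simp add: mult_ac)
  qed (use A in auto)
qed

text \<open>On (0, 1) the expansion of \<open>L\<close> at 0 is subtracted; it has an explicit
  rational Mellin transform, and the remainder O(p^(N+1)) has one that is holomorphic for Re s > -N.
  On [1, \<infinity>) the exponential decay makes the transform entire.\<close>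

lemma mellin_continuation:
  fixes L :: "real \<Rightarrow> complex" and a b :: "complex \<Rightarrow> complex" and N :: nat
  assumes contL: "continuous_on {0<..} L"
    and hol: "a holomorphic_on ball 0 d" "b holomorphic_on ball 0 d" and d: "d > 0"
    and near: "\<And>p. 0 < p \<Longrightarrow> p < d \<Longrightarrow>
       cmod (of_real p * L p - (a (of_real p) + b (of_real p) * of_real (ln p))) \<le> C * p ^ (N + 2)"
    and far: "\<And>p. p \<ge> 1 \<Longrightarrow> cmod (L p) \<le> C' * exp (- c * p)" and c: "c > 0"
  obtains \<Phi> where
    "\<Phi> meromorphic_on {s. Re s > - real N}"
    "\<Phi> holomorphic_on ({s. Re s > - real N} - {s. \<exists>n::nat. s = 1 - of_nat n})"
    "\<And>s. Re s > 1 \<Longrightarrow> set_integrable lborel {0<..} (\<lambda>p. L p * of_real p powr (s - 1))"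
    "\<And>s. Re s > 1 \<Longrightarrow> \<Phi> s = (LINT p:{0<..}|lborel. L p * of_real p powr (s - 1))"
    "\<And>\<alpha> \<beta>. \<alpha> > - real N \<Longrightarrow> \<exists>K. \<forall>s. \<alpha> \<le> Re s \<and> Re s \<le> \<beta> \<and> 1 \<le> \<bar>Im s\<bar> \<longrightarrow> cmod (\<Phi> s) \<le> K"
proof -
  obtain A K1 \<eta>1 where A: "\<eta>1 > 0" "\<And>p. p \<in> ball 0 \<eta>1 \<Longrightarrow> cmod (a p - poly A p) \<le> K1 * cmod p ^ (N+2)"
    using holomorphic_taylor_poly[OF hol(1) d] by metis
  \<comment> \<open>One order more than for \<open>A\<close>, since the factor |ln p| \<le> 1/p
    costs one power of p.\<close>
  obtain B K2 \<eta>2 where B: "\<eta>2 > 0" "\<And>p. p \<in> ball 0 \<eta>2 \<Longrightarrow> cmod (b p - poly B p) \<le> K2 * cmod p ^ (N+3)"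
    using holomorphic_taylor_poly[OF hol(2) d] by metis
  define \<eta> where "\<eta> = min (min d 1) (min \<eta>1 \<eta>2)"
  have \<eta>: "\<eta> > 0" "\<eta> \<le> 1" "\<eta> \<le> d" "\<eta> \<le> \<eta>1" "\<eta> \<le> \<eta>2" using A B d by (auto simp: \<eta>_def)
  define e where "e = (\<lambda>p. L p - (poly A (of_real p) + poly B (of_real p) * of_real (ln p)) / of_real p)"
  have e_near: "cmod (e p) \<le> (C + K1 + K2) * p ^ (N+1)" if p: "0 < p" "p < \<eta>" for p
  proof -
    have b1: "cmod (of_real p * L p - (a (of_real p) + b (of_real p) * of_real (ln p))) \<le> C * p ^ (N + 2)"
      using near[of p] p \<eta> by auto
    have b2: "cmod (a (of_real p) - poly A (of_real p)) \<le> K1 * p ^ (N+2)"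
      using A(2)[of "of_real p"] p \<eta> by auto
    have b3: "cmod (b (of_real p) - poly B (of_real p)) \<le> K2 * p ^ (N+3)"
      using B(2)[of "of_real p"] p \<eta> by auto
    have "ln (1/p) \<le> 1/p - 1" using p by (intro ln_le_minus_one) auto
    hence ln: "\<bar>ln p\<bar> \<le> 1 / p" using p \<eta> by (simp add: ln_div)
    have K2: "K2 * p ^ (N+3) \<ge> 0" using b3 norm_ge_zero order_trans by blast
    have "cmod ((b (of_real p) - poly B (of_real p)) * of_real (ln p)) \<le> (K2 * p ^ (N+3)) * (1/p)"
      unfolding norm_mult using b3 ln K2 by (intro mult_mono) auto
    also have "\<dots> = K2 * p ^ (N+2)" using p by (simp add: eval_nat_numeral)
    finally have b4: "cmod ((b (of_real p) - poly B (of_real p)) * of_real (ln p)) \<le> K2 * p ^ (N+2)" .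
    have "of_real p * e p = (of_real p * L p - (a (of_real p) + b (of_real p) * of_real (ln p))) + (a (of_real p) - poly A (of_real p)) + (b (of_real p) - poly B (of_real p)) * of_real (ln p)"
      using p by (simp add: e_def field_simps)
    hence "cmod (of_real p * e p) \<le> C * p ^ (N + 2) + K1 * p ^ (N+2) + K2 * p ^ (N+2)"
      using b1 b2 b4 by (metis (no_types, lifting) add_mono norm_triangle_mono)
    hence "p * cmod (e p) \<le> p * ((C + K1 + K2) * p ^ (N+1))"
      using p by (simp add: norm_mult algebra_simps)
    thus ?thesis using p by simp
  qed
  have conte: "continuous_on {0<..} e"
    unfolding e_def by (intro continuous_intros contL) auto
  have "continuous_on {\<eta>..1} e"
    by (rule continuous_on_subset[OF conte]) (use \<eta> in auto)
  then obtain K3 where "\<And>p. p \<in> {\<eta>..1} \<Longrightarrow> cmod (e p) \<le> K3"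
    using compact_norm_bound[OF compact_Icc] by blast
  hence K3: "\<And>p. \<eta> \<le> p \<Longrightarrow> p \<le> 1 \<Longrightarrow> cmod (e p) \<le> K3" by auto
  \<comment> \<open>Beyond \<eta> the remainder is merely bounded, but there p^(N+1) is at least
    \<eta>^(N+1), so one constant serves on all of (0, 1].\<close>
  define K where "K = max (C + K1 + K2) (max K3 0 / \<eta> ^ (N+1))"
  have K0: "K \<ge> 0" using \<eta> by (simp add: K_def le_max_iff_disj)
  have e_bd: "cmod (e p) \<le> K * p ^ (N+1)" if p: "0 < p" "p \<le> 1" for p
  proof (cases "p < \<eta>")
    case True
    have "(C + K1 + K2) * p ^ (N+1) \<le> K * p ^ (N+1)"
      using p by (intro mult_right_mono) (auto simp: K_def)
    thus ?thesis using e_near[OF p(1) True] by simp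
  next
    case False
    have "cmod (e p) \<le> max K3 0" using K3[of p] False p by auto
    also have "\<dots> = max K3 0 / \<eta> ^ (N+1) * \<eta> ^ (N+1)" using \<eta> by simp
    also have "\<dots> \<le> K * p ^ (N+1)"
      using False \<eta> p K0 by (intro mult_mono power_mono) (auto simp: K_def)
    finally show ?thesis .
  qed
  define I1 where "I1 = (\<lambda>s. LINT p:{0<..<1}|lborel. e p * of_real p powr (s - 1))"
  define I2 where "I2 = (\<lambda>s. LINT p:{1..}|lborel. L p * of_real p powr (s - 1))"
  have b1: "cmod (e p * of_real p powr (s - 1)) \<le> K" if "p \<in> {0<..<1}" "Re s > - real N" for p s
  proof -
    have "cmod (e p * of_real p powr (s - 1)) \<le> K * p ^ (N+1) * p powr (Re s - 1)"
      unfolding norm_mult using e_bd[of p] that K0 by (intro mult_mono) (auto simp: norm_of_real_powr)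
    also have "\<dots> = K * p powr (real N + Re s)"
      using that by (simp add: powr_add powr_diff flip: powr_realpow)
    also have "\<dots> \<le> K * 1"
      using that powr_mono'[of 0 "real N + Re s" p] K0 by (intro mult_left_mono) auto
    finally show ?thesis by simp
  qed
  have si1: "set_integrable lborel {0<..<1::real} (\<lambda>_. K)"
    by (auto simp: set_integrable_def)
  have i1: "set_integrable lborel {0<..<1} (\<lambda>p. e p * of_real p powr (s - 1))" if "Re s > - real N" for s
    by (rule set_integrable_continuous_bound[OF _ _ si1 b1])
       (use that in \<open>auto intro!: continuous_intros continuous_on_subset[OF conte]\<close>)
  have hol1: "I1 holomorphic_on {s. Re s > - real N}"
    unfolding I1_def
  proof (rule holomorphic_on_set_integral)
    show "\<exists>r>0. \<exists>G. set_integrable lborel {0<..<1} G \<and>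
        (\<forall>z\<in>ball z0 r \<inter> {s. - real N < Re s}. \<forall>x\<in>{0<..<1}. cmod (e x * of_real x powr (z - 1)) \<le> G x)" for z0
      using b1 si1 by (intro exI[of _ 1] conjI exI[of _ "\<lambda>_. K"]) auto
    show "set_borel_measurable borel {0<..<1} (\<lambda>p. e p * of_real p powr (z - 1))" for z
      by (intro set_borel_measurable_continuous_on continuous_intros continuous_on_subset[OF conte]) auto
  qed (auto intro!: holomorphic_intros simp: open_halfspace_Re_gt)
  have b2: "cmod (L p * of_real p powr (s - 1)) \<le> max C' 0 * (p powr R * exp (- c * p))"
    if "p \<in> {1..}" "Re s - 1 \<le> R" for p s R
  proof -
    have "cmod (L p * of_real p powr (s - 1)) \<le> (max C' 0 * exp (- c * p)) * p powr R"
      unfolding norm_mult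
    proof (intro mult_mono)
      have "C' * exp (- c * p) \<le> max C' 0 * exp (- c * p)" by (intro mult_right_mono) auto
      from order_trans[OF far this] show "cmod (L p) \<le> max C' 0 * exp (- c * p)" using that by auto
    qed (use that in \<open>auto simp: norm_of_real_powr intro!: powr_mono\<close>)
    thus ?thesis by (simp add: mult_ac)
  qed
  have si2: "set_integrable lborel {1..} (\<lambda>p. max C' 0 * (p powr R * exp (- c * p)))" if "R \<ge> 0" for R
    by (intro set_integrable_mult_right set_integrable_subset[OF set_integrable_powr_exp[of R c]]) (use that c in auto)
  have i2: "set_integrable lborel {1..} (\<lambda>p. L p * of_real p powr (s - 1))" for s
    by (rule set_integrable_continuous_bound[OF _ _ si2[of "\<bar>Re s\<bar>"] b2])
       (auto intro!: continuous_intros continuous_on_subset[OF contL])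
  have hol2: "I2 holomorphic_on UNIV"
    unfolding I2_def
  proof (rule holomorphic_on_set_integral)
    show "\<exists>r>0. \<exists>G. set_integrable lborel {1..} G \<and>
        (\<forall>z\<in>ball z0 r \<inter> UNIV. \<forall>x\<in>{1..}. cmod (L x * of_real x powr (z - 1)) \<le> G x)" for z0
    proof (intro exI[of _ "1::real"] exI[of _ "\<lambda>p. max C' 0 * (p powr \<bar>Re z0\<bar> * exp (- c * p))"] conjI ballI)
      fix z x assume z: "z \<in> ball z0 1 \<inter> UNIV" "x \<in> {1::real..}"
      have "\<bar>Re (z - z0)\<bar> \<le> cmod (z - z0)" by (rule abs_Re_le_cmod)
      hence "Re z - 1 \<le> \<bar>Re z0\<bar>" using z by (auto simp: dist_norm norm_minus_commute)
      thus "cmod (L x * of_real x powr (z - 1)) \<le> max C' 0 * (x powr \<bar>Re z0\<bar> * exp (- c * x))"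
        by (intro b2 z)
    qed (use si2 in auto)
    show "set_borel_measurable borel {1..} (\<lambda>p. L p * of_real p powr (z - 1))" for z
      by (intro set_borel_measurable_continuous_on continuous_intros continuous_on_subset[OF contL]) auto
  qed (auto intro!: holomorphic_intros)
  \<comment> \<open>The transforms over (0, 1) of p^(i-1) and p^(i-1) ln p: simple poles from
    \<open>A\<close> and double poles from \<open>B\<close>, all at points 1 - i.\<close>
  define P where "P = (\<lambda>s::complex. (\<Sum>i\<le>degree A. coeff A i * (1 / (s + of_nat i - 1))) +
                        (\<Sum>i\<le>degree B. coeff B i * (- 1 / (s + of_nat i - 1)\<^sup>2)))"
  define \<Phi> where "\<Phi> = (\<lambda>s. P s + I1 s + I2 s)"
  have Pm: "P meromorphic_on UNIV"
    unfolding P_def by (intro meromorphic_intros)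
  have o: "open {s. Re s > - real N}" by (rule open_halfspace_Re_gt)
  have "\<Phi> meromorphic_on {s. Re s > - real N}"
    unfolding \<Phi>_def
    by (intro meromorphic_on_add meromorphic_on_subset[OF Pm] analytic_on_imp_meromorphic_on)
       (use hol1 hol2 o in \<open>auto simp: analytic_on_open intro: holomorphic_on_subset\<close>)
  moreover have "\<Phi> holomorphic_on ({s. Re s > - real N} - {s. \<exists>n::nat. s = 1 - of_nat n})"
  proof -
    have "P holomorphic_on ({s. Re s > - real N} - {s. \<exists>n::nat. s = 1 - of_nat n})"
      unfolding P_def by (intro holomorphic_intros) (auto simp: algebra_simps eq_diff_eq)
    thus ?thesis unfolding \<Phi>_def
      by (intro holomorphic_intros holomorphic_on_subset[OF hol1] holomorphic_on_subset[OF hol2]) auto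
  qed
  moreover have "set_integrable lborel {0<..} (\<lambda>p. L p * of_real p powr (s - 1)) \<and>
       \<Phi> s = (LINT p:{0<..}|lborel. L p * of_real p powr (s - 1))" if s: "Re s > 1" for s
  proof -
    let ?A = "\<lambda>i p. coeff A i * (of_real p powr (s + of_nat i - 1 - 1))"
    let ?B = "\<lambda>i p. coeff B i * (of_real (ln p) * of_real p powr (s + of_nat i - 1 - 1))"
    have dec: "L p * of_real p powr (s - 1) = (\<Sum>i\<le>degree A. ?A i p) + (\<Sum>i\<le>degree B. ?B i p)
           + e p * of_real p powr (s - 1)" if p: "p \<in> {0<..<1}" for p
    proof -
      have pw: "complex_of_real p powr (s + of_nat i - 1 - 1) = of_real p ^ i * (of_real p powr (s - 1) / of_real p)" for i
        using p by (simp add: powr_add powr_diff powr_nat' add_diff_eq power2_eq_square flip: of_nat_Suc)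
      have "L p = e p + (poly A (of_real p) + poly B (of_real p) * of_real (ln p)) / of_real p"
        by (simp add: e_def)
      thus ?thesis unfolding pw poly_altdef
        by (simp add: sum_distrib_right sum_distrib_left add_divide_distrib sum_divide_distrib algebra_simps)
    qed
    have wi: "Re (s + of_nat i - 1) > 0" for i using s by simp
    have iA: "set_integrable lborel {0<..<1} (?A i)" "(LINT p:{0<..<1}|lborel. ?A i p) = coeff A i * (1 / (s + of_nat i - 1))" for i
      using integral_Ioo_powr(1,2)[OF wi[of i]] by (auto intro: set_integrable_mult_right)
    have iB: "set_integrable lborel {0<..<1} (?B i)" "(LINT p:{0<..<1}|lborel. ?B i p) = coeff B i * (- 1 / (s + of_nat i - 1)\<^sup>2)" for i
      using integral_Ioo_powr(3,4)[OF wi[of i]] by (auto intro: set_integrable_mult_right)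
    have iS: "set_integrable lborel {0<..<1} (\<lambda>p. \<Sum>i\<le>degree A. ?A i p)"
             "set_integrable lborel {0<..<1} (\<lambda>p. \<Sum>i\<le>degree B. ?B i p)"
      using iA iB by (auto intro!: set_integral_sum)
    have "Re s > - real N" using s by linarith
    note i1' = i1[OF this]
    have i0: "set_integrable lborel {0<..<1} (\<lambda>p. L p * of_real p powr (s - 1))"
      using set_integral_add(1)[OF set_integral_add(1)[OF iS] i1']
      by (rule set_integrable_cong[THEN iffD1, OF refl refl, rotated]) (simp add: dec)
    have "(LINT p:{0<..<1}|lborel. L p * of_real p powr (s - 1)) =
          (LINT p:{0<..<1}|lborel. (\<Sum>i\<le>degree A. ?A i p) + (\<Sum>i\<le>degree B. ?B i p) + e p * of_real p powr (s - 1))"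
      by (rule set_lebesgue_integral_cong) (use dec in auto)
    also have "\<dots> = P s + I1 s"
      using iA iB iS i1' by (simp add: set_integral_add set_integral_sum P_def I1_def)
    finally have v0: "(LINT p:{0<..<1}|lborel. L p * of_real p powr (s - 1)) = P s + I1 s" .
    have un: "{0<..<1} \<union> {1..} = {0::real<..}" by auto
    have "set_integrable lborel ({0<..<1} \<union> {1..}) (\<lambda>p. L p * of_real p powr (s - 1))"
      by (rule set_integrable_Un[OF i0 i2]) auto
    moreover have "(LINT p:({0<..<1} \<union> {1..})|lborel. L p * of_real p powr (s - 1)) = P s + I1 s + I2 s"
      by (subst set_integral_Un[OF _ i0 i2]) (auto simp: v0 I2_def)
    ultimately show ?thesis unfolding un \<Phi>_def by simp
  qed
  moreover have "\<exists>K'. \<forall>s. \<alpha> \<le> Re s \<and> Re s \<le> \<beta> \<and> 1 \<le> \<bar>Im s\<bar> \<longrightarrow> cmod (\<Phi> s) \<le> K'" if \<alpha>: "\<alpha> > - real N" for \<alpha> \<beta>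
  proof -
    define KP where "KP = (\<Sum>i\<le>degree A. cmod (coeff A i)) + (\<Sum>i\<le>degree B. cmod (coeff B i))"
    define R where "R = \<bar>\<beta>\<bar>"
    define K2 where "K2 = (LINT p:{1..}|lborel. max C' 0 * (p powr R * exp (- c * p)))"
    have "cmod (\<Phi> s) \<le> KP + K + K2" if s: "\<alpha> \<le> Re s" "Re s \<le> \<beta>" "1 \<le> \<bar>Im s\<bar>" for s
    proof -
      \<comment> \<open>All poles are real, so at height at least 1 every denominator has modulus at
        least 1.\<close>
      have n1: "cmod (s + of_nat i - 1) \<ge> 1" for i
        using abs_Im_le_cmod[of "s + of_nat i - 1"] s by simp
      have "cmod (1 / (s + of_nat i - 1)) \<le> 1" "cmod (- 1 / (s + of_nat i - 1)\<^sup>2) \<le> 1" for i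
        using n1[of i] by (auto simp: norm_divide norm_power divide_le_eq_1)
      hence "cmod (coeff A i * (1 / (s + of_nat i - 1))) \<le> cmod (coeff A i)"
            "cmod (coeff B i * (- 1 / (s + of_nat i - 1)\<^sup>2)) \<le> cmod (coeff B i)" for i
        unfolding norm_mult by (intro mult_left_le; simp)+
      hence "cmod (P s) \<le> KP"
        unfolding P_def KP_def
        by (intro order_trans[OF norm_triangle_ineq] add_mono order_trans[OF norm_sum] sum_mono)
      moreover have "cmod (I1 s) \<le> K"
      proof -
        have "cmod (I1 s) \<le> (LINT p:{0<..<1}|lborel. cmod (e p * of_real p powr (s - 1)))"
          unfolding I1_def by (rule set_integral_norm_bound) (use i1 s \<alpha> in auto)
        also have "\<dots> \<le> (LINT p:{0<..<1::real}|lborel. K)"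
          by (rule set_integral_mono) (use i1[of s] s \<alpha> si1 b1 in \<open>auto intro: set_integrable_norm\<close>)
        finally show ?thesis by (simp add: set_lebesgue_integral_def)
      qed
      moreover have "cmod (I2 s) \<le> K2"
      proof -
        have "cmod (I2 s) \<le> (LINT p:{1..}|lborel. cmod (L p * of_real p powr (s - 1)))"
          unfolding I2_def by (rule set_integral_norm_bound) (rule i2)
        also have "\<dots> \<le> K2" unfolding K2_def
          by (rule set_integral_mono) (use i2[of s] s si2[of R] b2 in \<open>auto intro: set_integrable_norm simp: R_def\<close>)
        finally show ?thesis .
      qed
      ultimately show ?thesis unfolding \<Phi>_def
        using norm_triangle_ineq[of "P s + I1 s" "I2 s"] norm_triangle_ineq[of "P s" "I1 s"] by linarith
    qed
    thus ?thesis by blast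
  qed
  ultimately show ?thesis using that by blast
qed

subsection \<open>The Lambert series near the origin\<close>

text \<open>The open right-angled sector shifted left by c. \<open>wedge 1\<close> leaves room for
  discs of radius 1/4 around the points of \<open>sector\<close>, and \<open>wedge 2\<close>
  contains the closure of \<open>wedge 1\<close>.\<close>

definition wedge :: "real \<Rightarrow> complex set" where
  "wedge c = {w. \<bar>Im w\<bar> < Re w + c}"

definition sector :: "complex set" where
  "sector = {w. \<bar>Im w\<bar> \<le> Re w}"

lemma open_wedge: "open (wedge c)"
  unfolding wedge_def by (intro open_Collect_less continuous_intros)

lemma convex_wedge: "convex (wedge c)"
proof -
  have "wedge c = {w. inner (Complex (-1) 1) w < c} \<inter> {w. inner (Complex (-1) (-1)) w < c}"
    by (auto simp: wedge_def inner_complex_def)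
  thus ?thesis by (simp add: convex_Int convex_halfspace_lt)
qed

lemma convex_sector: "convex sector"
proof -
  have eq: "sector = {w. inner (Complex (-1) 1) w \<le> 0} \<inter> {w. inner (Complex (-1) (-1)) w \<le> 0}"
    by (auto simp: sector_def inner_complex_def)
  show ?thesis unfolding eq by (intro convex_Int convex_halfspace_le)
qed

text \<open>This decay survives passing to a primitive (\<open>decaying_primitive\<close>) and, on
  the smaller \<open>sector\<close>, passing to derivatives
  (\<open>decaying_deriv_bound\<close>).\<close>

definition decaying :: "(complex \<Rightarrow> complex) \<Rightarrow> bool" where
  "decaying R \<longleftrightarrow> R holomorphic_on wedge 1 \<and> (\<exists>C. \<forall>w\<in>wedge 1. cmod (R w) \<le> C * exp (- Re w / 2))"

text \<open>The primitive is normalised to vanish at infinity. Integrating \<open>R\<close> along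
  horizontal rays shows that any primitive \<open>P\<close> is Cauchy along the integers, and
  subtracting its limit there leaves a function with the decay of \<open>R\<close>.\<close>

lemma decaying_primitive:
  assumes "decaying R"
  obtains Q where "decaying Q" "\<And>w. w \<in> wedge 1 \<Longrightarrow> (Q has_field_derivative R w) (at w)"
proof -
  obtain C where hol: "R holomorphic_on wedge 1" and C: "\<And>w. w \<in> wedge 1 \<Longrightarrow> cmod (R w) \<le> C * exp (- Re w / 2)"
    using assms unfolding decaying_def by blast
  have "0 \<in> wedge 1" by (simp add: wedge_def)
  hence C0: "C \<ge> 0" using order_trans[OF norm_ge_zero C] by fastforce
  obtain P where P0: "\<And>w. w \<in> wedge 1 \<Longrightarrow> (P has_field_derivative R w) (at w within wedge 1)"
    using holomorphic_convex_primitive'[OF convex_wedge open_wedge hol] by blast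
  have P: "(P has_field_derivative R w) (at w)" if "w \<in> wedge 1" for w
    using P0[OF that] at_within_open[OF that open_wedge] by simp
  have bd: "cmod (P (w + of_real T) - P w) \<le> 2 * C * exp (- Re w / 2)" if w: "w \<in> wedge 1" and T: "T \<ge> 0" for w T
  proof (cases "T = 0")
    case False
    have in_w: "w + of_real t \<in> wedge 1" if "t \<ge> 0" for t using w that by (simp add: wedge_def)
    have "cmod (P (w + of_real T) - P (w + of_real 0)) \<le> - 2 * C * exp (- (Re w + T) / 2) - (- 2 * C * exp (- (Re w + 0) / 2))"
    proof (rule differentiable_bound_general[where a = 0 and b = T and f = "\<lambda>t. P (w + of_real t)" and f' = "\<lambda>t. R (w + of_real t)"
          and \<phi> = "\<lambda>t. - 2 * C * exp (- (Re w + t) / 2)" and \<phi>' = "\<lambda>t. C * exp (- (Re w + t) / 2)"])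
      have d: "((\<lambda>t. P (w + of_real t)) has_vector_derivative R (w + of_real t)) (at t within X)" if "t \<ge> 0" for t X
      proof -
        have a: "((\<lambda>z. w + z) has_field_derivative 1) (at (complex_of_real t))"
          by (auto intro!: derivative_eq_intros)
        have "((\<lambda>z. P (w + z)) has_field_derivative R (w + of_real t) * 1) (at (of_real t))"
          by (rule DERIV_chain2[OF P[OF in_w[OF that]] a])
        from has_vector_derivative_real_field[OF this] show ?thesis by simp
      qed
      show "((\<lambda>t. P (w + of_real t)) has_vector_derivative R (w + of_real t)) (at t)" if "0 < t" "t < T" for t
        using d[of t UNIV] that by simp
      show "continuous_on {0..T} (\<lambda>t. P (w + of_real t))"
        unfolding continuous_on_eq_continuous_within
        using has_vector_derivative_continuous[OF d] by auto
      show "((\<lambda>t. - 2 * C * exp (- (Re w + t) / 2)) has_vector_derivative C * exp (- (Re w + t) / 2)) (at t)" for t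
        unfolding has_real_derivative_iff_has_vector_derivative[symmetric]
        by (auto intro!: derivative_eq_intros)
      show "cmod (R (w + of_real t)) \<le> C * exp (- (Re w + t) / 2)" if "0 < t" "t < T" for t
        using C[OF in_w, of t] that by simp
    qed (use T False in \<open>auto intro!: continuous_intros\<close>)
    also have "\<dots> \<le> 2 * C * exp (- Re w / 2)" using C0 by simp
    finally show ?thesis by simp
  qed (use C0 in auto)
  have "Cauchy (\<lambda>n. P (of_nat n))"
  proof (rule CauchyI')
    fix e :: real assume e: "e > 0"
    have "((\<lambda>n::nat. 2 * C * exp (- real n / 2)) \<longlongrightarrow> 0) at_top" by real_asymp
    from order_tendstoD(2)[OF this e] obtain M where M: "\<And>n. n \<ge> M \<Longrightarrow> 2 * C * exp (- real n / 2) < e"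
      by (auto simp: eventually_at_top_linorder)
    show "\<exists>M. \<forall>m\<ge>M. \<forall>n>m. dist (P (of_nat m)) (P (of_nat n)) < e"
    proof (intro exI[of _ M] allI impI)
      fix m n :: nat assume mn: "m \<ge> M" "n > m"
      have e2: "of_nat m + complex_of_real (real (n - m)) = of_nat n"
        using mn by (simp add: of_nat_diff)
      have "cmod (P (of_nat m + of_real (real (n - m))) - P (of_nat m)) \<le> 2 * C * exp (- real m / 2)"
        using bd[of "of_nat m" "real (n - m)"] by (simp add: wedge_def)
      thus "dist (P (of_nat m)) (P (of_nat n)) < e"
        unfolding e2 using M[OF mn(1)] by (simp add: dist_norm norm_minus_commute)
    qed
  qed
  then obtain l where l: "(\<lambda>n. P (of_nat n)) \<longlonglongrightarrow> l" using Cauchy_convergent_iff convergent_def by blast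
  define Q where "Q = (\<lambda>w. P w - l)"
  have Qd: "(Q has_field_derivative R w) (at w)" if "w \<in> wedge 1" for w
    unfolding Q_def using P[OF that] by (auto intro!: derivative_eq_intros)
  have Qb: "cmod (Q w) \<le> 2 * C * exp (- Re w / 2)" if w: "w \<in> wedge 1" for w
  proof -
    \<comment> \<open>The limit must not depend on the ray. Points of \<open>wedge 1\<close> have Re
      w > -1, so the segment from n to w + n stays in Re \<ge> n - 1, where \<open>R\<close> is
      exponentially small.\<close>
    have nb: "cmod (P (w + of_nat n) - P (of_nat n)) \<le> C * exp (- (real n - 1) / 2) * cmod w" for n
    proof -
      have cv: "convex (wedge 1 \<inter> {w. Re w \<ge> real n - 1})"
        by (intro convex_Int convex_wedge convex_halfspace_Re_ge)
      have "cmod (P (w + of_nat n) - P (of_nat n)) \<le> C * exp (- (real n - 1) / 2) * cmod (w + of_nat n - of_nat n)"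
      proof (rule field_differentiable_bound[OF cv])
        show "(P has_field_derivative R z) (at z within wedge 1 \<inter> {w. real n - 1 \<le> Re w})"
          if "z \<in> wedge 1 \<inter> {w. real n - 1 \<le> Re w}" for z
          using P that has_field_derivative_at_within by blast
        show "cmod (R z) \<le> C * exp (- (real n - 1) / 2)" if z: "z \<in> wedge 1 \<inter> {w. real n - 1 \<le> Re w}" for z
        proof -
          have "C * exp (- Re z / 2) \<le> C * exp (- (real n - 1) / 2)"
            using z C0 by (intro mult_left_mono) auto
          thus ?thesis using C[of z] z by auto
        qed
      qed (use w in \<open>auto simp: wedge_def\<close>)
      thus ?thesis by simp
    qed
    have "(\<lambda>n::nat. C * exp (- (real n - 1) / 2) * cmod w) \<longlonglongrightarrow> 0" by real_asymp
    hence "(\<lambda>n. P (w + of_nat n) - P (of_nat n)) \<longlonglongrightarrow> 0"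
      by (rule Lim_null_comparison[rotated]) (use nb in auto)
    from tendsto_add[OF this l] have "(\<lambda>n. P (w + of_nat n)) \<longlonglongrightarrow> l" by simp
    hence "(\<lambda>n. cmod (P w - P (w + of_nat n))) \<longlonglongrightarrow> cmod (Q w)"
      unfolding Q_def by (intro tendsto_intros)
    moreover have "cmod (P w - P (w + of_nat n)) \<le> 2 * C * exp (- Re w / 2)" for n
      using bd[OF w, of "real n"] by (simp add: norm_minus_commute)
    ultimately show ?thesis by (intro LIMSEQ_le_const2) auto
  qed
  have "Q holomorphic_on wedge 1"
    using Qd open_wedge by (auto simp: holomorphic_on_open)
  hence "decaying Q" using Qb unfolding decaying_def by blast
  thus ?thesis using Qd that by blast
qed

text \<open>Cauchy's inequality on discs of radius 1/4: the shift of Re w by 1/4 costs only the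
  constant factor exp(1/8).\<close>

lemma decaying_deriv_bound:
  assumes "decaying R"
  shows "\<exists>C. \<forall>w\<in>sector. cmod ((deriv ^^ m) R w) \<le> C * exp (- Re w / 2)"
proof -
  obtain C where hol: "R holomorphic_on wedge 1" and C: "\<And>w. w \<in> wedge 1 \<Longrightarrow> cmod (R w) \<le> C * exp (- Re w / 2)"
    using assms unfolding decaying_def by blast
  have "0 \<in> wedge 1" by (simp add: wedge_def)
  hence C0: "C \<ge> 0" using order_trans[OF norm_ge_zero C] by fastforce
  have "cmod ((deriv ^^ m) R w) \<le> fact m * (C * exp (- (Re w - 1/4) / 2)) / (1/4) ^ m" if w: "w \<in> sector" for w
  proof (rule Cauchy_inequality)
    have re: "\<bar>Re x - Re w\<bar> \<le> 1/4" "\<bar>Im x - Im w\<bar> \<le> 1/4" if "cmod (w - x) \<le> 1/4" for x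
      using abs_Re_le_cmod[of "w - x"] abs_Im_le_cmod[of "w - x"] that
      by (simp_all add: abs_minus_commute[of "Re x"] abs_minus_commute[of "Im x"])
    have sub: "cball w (1/4) \<subseteq> wedge 1"
    proof
      fix x assume "x \<in> cball w (1/4)"
      hence "\<bar>Re x - Re w\<bar> \<le> 1/4" "\<bar>Im x - Im w\<bar> \<le> 1/4" using re by (auto simp: dist_norm)
      thus "x \<in> wedge 1" using w unfolding sector_def wedge_def mem_Collect_eq by linarith
    qed
    show "R holomorphic_on ball w (1/4)" using hol sub ball_subset_cball by (blast intro: holomorphic_on_subset)
    show "continuous_on (cball w (1/4)) R"
      using hol sub holomorphic_on_imp_continuous_on holomorphic_on_subset by blast
    fix x assume x: "norm (w - x) = 1/4"
    have "\<bar>Re x - Re w\<bar> \<le> 1/4" using re(1)[of x] x by simp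
    hence "- Re x \<le> - (Re w - 1/4)" by (simp only: abs_le_iff) linarith
    hence "- Re x / 2 \<le> - (Re w - 1/4) / 2" by (rule divide_right_mono) simp
    hence "C * exp (- Re x / 2) \<le> C * exp (- (Re w - 1/4) / 2)"
      using C0 by (intro mult_left_mono) auto
    moreover have "x \<in> wedge 1" using sub x by (auto simp: dist_norm)
    ultimately show "cmod (R x) \<le> C * exp (- (Re w - 1/4) / 2)" using C[of x] by simp
  qed simp
  also have "fact m * (C * exp (- (Re w - 1/4) / 2)) / (1/4) ^ m = (fact m * C * exp (1/8) * 4 ^ m) * exp (- Re w / 2)" for w
  proof -
    have "- (Re w - 1/4) / 2 = 1/8 + - Re w / 2" by (simp add: field_simps)
    hence "exp (- (Re w - 1/4) / 2) = exp (1/8) * exp (- Re w / 2)" by (simp only: exp_add)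
    thus ?thesis by (simp add: power_one_over)
  qed
  finally show ?thesis by blast
qed

text \<open>A geometric series with ratio q = exp(-Re z / 2). In the sector |z| \<le> 2 Re z, and 1
  - q \<ge> Re z / 4 for Re z \<le> 1, which together give the constant 8.\<close>

lemma sum_exp_sector_bound:
  assumes z: "z \<in> sector" "z \<noteq> 0" "cmod z \<le> 1"
  shows "summable (\<lambda>k. exp (- Re (of_nat k * z) / 2))"
    and "(\<Sum>k. exp (- Re (of_nat k * z) / 2)) \<le> 8 / cmod z"
proof -
  have re: "Re z > 0" using z by (cases "Re z = 0") (auto simp: sector_def complex_eq_iff)
  have "cmod z \<le> \<bar>Re z\<bar> + \<bar>Im z\<bar>" by (rule cmod_le)
  hence cz: "cmod z \<le> 2 * Re z" using z re by (auto simp: sector_def)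
  have re1: "Re z \<le> 1" using complex_Re_le_cmod[of z] z by simp
  define q where "q = exp (- Re z / 2)"
  have q: "0 < q" "q < 1" using re by (auto simp: q_def)
  have eq: "exp (- Re (of_nat k * z) / 2) = q ^ k" for k
    by (simp add: q_def flip: exp_of_nat_mult)
  show "summable (\<lambda>k. exp (- Re (of_nat k * z) / 2))"
    unfolding eq using q by simp
  have "1 + Re z / 2 \<le> exp (Re z / 2)" by (rule exp_ge_add_one_self)
  hence "q \<le> 1 / (1 + Re z / 2)"
    using re by (auto simp: q_def exp_minus field_simps)
  also have "\<dots> \<le> 1 - Re z / 4"
  proof -
    have "1 \<le> (1 - Re z / 4) * (1 + Re z / 2)"
      using re re1 by (simp add: field_simps power2_eq_square mult_left_le)
    thus ?thesis using re by (simp add: pos_divide_le_eq)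
  qed
  finally have "cmod z / 8 \<le> 1 - q" using cz by simp
  hence "1 / (1 - q) \<le> 8 / cmod z" using z q by (simp add: field_simps)
  thus "(\<Sum>k. exp (- Re (of_nat k * z) / 2)) \<le> 8 / cmod z"
    unfolding eq using q by (simp add: suminf_geometric)
qed

lemma sector_mult: "z \<in> sector \<Longrightarrow> of_nat k * z \<in> sector"
  by (auto simp: sector_def abs_mult intro: mult_left_mono)

lemma sector_subset_wedge: "sector \<subseteq> wedge 1"
  by (auto simp: sector_def wedge_def)

text \<open>
  Existence of the Euler--Maclaurin expansion, without its coefficients: summing the Taylor
  expansions of a primitive \<open>Q\<close> over the grid \<open>k z\<close> telescopes on the left and expresses
  \<open>\<Sum>Q'(kz)\<close> through the sums of the higher derivatives, which have expansions by induction.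
\<close>
lemma grid_sum_deriv_expansion:
  assumes Q: "decaying Q" and j: "j \<ge> 1"
  shows "\<exists>(A::complex poly) C. \<forall>z\<in>sector. z \<noteq> 0 \<and> cmod z \<le> 1 \<longrightarrow>
    cmod (z * (\<Sum>k. (deriv ^^ j) Q (of_nat k * z)) - poly A z) \<le> C * cmod z ^ N"
  using j
proof (induction N arbitrary: j rule: less_induct)
  case (less N j)
  define D where "D = (\<lambda>i. (deriv ^^ i) Q)"
  have holQ: "Q holomorphic_on wedge 1" using Q by (simp add: decaying_def)
  have Dd: "(D i has_field_derivative D (Suc i) w) (at w)" if "w \<in> wedge 1" for i w
  proof -
    have "D i holomorphic_on wedge 1" unfolding D_def by (rule holomorphic_higher_deriv[OF holQ open_wedge])
    thus ?thesis using that open_wedge unfolding D_def by (simp add: holomorphic_derivI)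
  qed
  have "\<exists>C. \<forall>w\<in>sector. cmod (D i w) \<le> C * exp (- Re w / 2)" for i
    unfolding D_def by (rule decaying_deriv_bound[OF Q])
  then obtain CD where CD: "\<And>i w. w \<in> sector \<Longrightarrow> cmod (D i w) \<le> CD i * exp (- Re w / 2)" by metis
  have CD0: "CD i \<ge> 0" for i
    using order_trans[OF norm_ge_zero CD[of 0 i]] by (simp add: sector_def)
  define S where "S = (\<lambda>i z. \<Sum>k. D i (of_nat k * z))"
  have summ: "summable (\<lambda>k. D i (of_nat k * z))" if "z \<in> sector" "z \<noteq> 0" "cmod z \<le> 1" for i z
    by (rule summable_comparison_test'[OF summable_mult[OF sum_exp_sector_bound(1)[OF that], of "CD i"], of 0])
       (rule CD[OF sector_mult[OF that(1)]])
  have "\<exists>(A::complex poly) C. \<forall>z\<in>sector. z \<noteq> 0 \<and> cmod z \<le> 1 \<longrightarrow>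
      cmod (z * S (j + i) z - poly A z) \<le> C * cmod z ^ (N - i)" if "i \<in> {1..N}" for i
    using less.IH[of "N - i" "j + i"] that less.prems by (auto simp: S_def D_def)
  then obtain A C where AC: "\<And>i z. i \<in> {1..N} \<Longrightarrow> z \<in> sector \<Longrightarrow> z \<noteq> 0 \<Longrightarrow> cmod z \<le> 1 \<Longrightarrow>
       cmod (z * S (j + i) z - poly (A i) z) \<le> C i * cmod z ^ (N - i)" by metis
  define B where "B = CD (j + N + 1) / fact (N+1)"
  have B0: "B \<ge> 0" using CD0 by (simp add: B_def)
  \<comment> \<open>Read off by solving the telescoped identity \<open>eq\<close> below for
    \<open>z * S j z\<close>: the boundary term is \<open>- D (j-1) 0\<close>, and each
    \<open>z * S (j+i) z\<close> enters with weight z^i / (i+1)!.\<close>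
  define A' where "A' = - [:D (j-1) 0:] - (\<Sum>i\<in>{1..N}. smult (1 / fact (Suc i)) (monom 1 i * A i))"
  define C' where "C' = 8 * B + (\<Sum>i\<in>{1..N}. \<bar>C i\<bar>)"
  show ?case
  proof (intro exI[of _ A'] exI[of _ C'] ballI impI, elim conjE)
    fix z assume z: "z \<in> sector" "z \<noteq> 0" "cmod z \<le> 1"
    note sm = summ[OF z]
    define E where "E = (\<lambda>k. D (j-1) (of_nat (Suc k) * z) - (\<Sum>i\<le>N+1. D (j-1+i) (of_nat k * z) * z ^ i / fact i))"
    have re: "Re z \<ge> 0" using z by (auto simp: sector_def)
    have Ebd: "cmod (E k) \<le> B * cmod z ^ (N+2) * exp (- Re (of_nat k * z) / 2)" for k
    proof -
      \<comment> \<open>The segment from kz to (k+1)z moves to the right, so on \<open>T\<close> the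
        next derivative is bounded by its decay at kz. This makes the Taylor remainders summable in
        k.\<close>
      define T where "T = sector \<inter> {w. Re w \<ge> Re (of_nat k * z)}"
      have "cmod (D (j-1+0) (of_nat (Suc k) * z) - (\<Sum>i\<le>N+1. D (j-1+i) (of_nat k * z) * (of_nat (Suc k) * z - of_nat k * z) ^ i / fact i))
          \<le> (CD (j + N + 1) * exp (- Re (of_nat k * z) / 2)) * cmod (of_nat (Suc k) * z - of_nat k * z) ^ Suc (N+1) / fact (N+1)"
      proof (rule complex_Taylor[of T "N+1" "\<lambda>i. D (j-1+i)"])
        show "convex T" unfolding T_def by (intro convex_Int convex_sector convex_halfspace_Re_ge)
        show "(D (j-1+i) has_field_derivative D (j-1+Suc i) x) (at x within T)" if "x \<in> T" for i x
          using Dd[of x "j-1+i"] that sector_subset_wedge by (auto simp: T_def intro: has_field_derivative_at_within)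
        show "cmod (D (j - 1 + Suc (N + 1)) x) \<le> CD (j + N + 1) * exp (- Re (of_nat k * z) / 2)" if "x \<in> T" for x
        proof -
          have "cmod (D (j + N + 1) x) \<le> CD (j + N + 1) * exp (- Re x / 2)"
            using CD that by (auto simp: T_def)
          also have "\<dots> \<le> CD (j + N + 1) * exp (- Re (of_nat k * z) / 2)"
            using that CD0 by (intro mult_left_mono) (auto simp: T_def)
          finally show ?thesis using less.prems by (simp add: Suc_diff_le)
        qed
        show "of_nat k * z \<in> T" "of_nat (Suc k) * z \<in> T"
          using sector_mult[OF z(1)] re by (auto simp: T_def mult_right_mono algebra_simps simp del: of_nat_Suc) (simp add: algebra_simps)
      qed
      also have "of_nat (Suc k) * z - of_nat k * z = z" by (simp add: algebra_simps)
      finally show ?thesis unfolding E_def B_def by (simp add: mult_ac)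
    qed
    have sE: "summable E"
      by (rule summable_comparison_test'[OF summable_mult[OF sum_exp_sector_bound(1)[OF z]] Ebd])
    have sEn: "summable (\<lambda>k. cmod (E k))"
      by (rule summable_comparison_test'[OF summable_mult[OF sum_exp_sector_bound(1)[OF z]], of 0]) (use Ebd in auto)
    have "cmod (suminf E) \<le> (\<Sum>k. cmod (E k))" by (rule summable_norm[OF sEn])
    also have "\<dots> \<le> (\<Sum>k. B * cmod z ^ (N+2) * exp (- Re (of_nat k * z) / 2))"
      by (intro suminf_le Ebd sEn summable_mult sum_exp_sector_bound[OF z])
    also have "\<dots> = B * cmod z ^ (N+2) * (\<Sum>k. exp (- Re (of_nat k * z) / 2))"
      by (intro suminf_mult sum_exp_sector_bound[OF z])
    also have "\<dots> \<le> B * cmod z ^ (N+2) * (8 / cmod z)"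
      by (intro mult_left_mono sum_exp_sector_bound[OF z]) (use B0 in auto)
    also have "\<dots> = 8 * B * (cmod z ^ N * cmod z)" using z by (simp add: field_simps power_add power2_eq_square)
    also have "\<dots> \<le> 8 * B * (cmod z ^ N * 1)" using B0 z by (intro mult_left_mono) auto
    finally have Eb: "cmod (suminf E) \<le> 8 * B * cmod z ^ N" by simp
    have "(\<lambda>k. \<Sum>i\<le>N+1. D (j-1+i) (of_nat k * z) * z ^ i / fact i) sums (\<Sum>i\<le>N+1. S (j-1+i) z * z ^ i / fact i)"
      unfolding S_def by (intro sums_sum sums_divide sums_mult2 summable_sums sm)
    hence "(\<lambda>k. E k + (\<Sum>i\<le>N+1. D (j-1+i) (of_nat k * z) * z ^ i / fact i)) sums (suminf E + (\<Sum>i\<le>N+1. S (j-1+i) z * z ^ i / fact i))"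
      using sE by (intro sums_add) auto
    hence "(\<lambda>k. D (j-1) (of_nat (Suc k) * z)) sums (suminf E + (\<Sum>i\<le>N+1. S (j-1+i) z * z ^ i / fact i))"
      by (simp add: E_def)
    moreover have "(\<lambda>k. D (j-1) (of_nat (Suc k) * z)) sums (S (j-1) z - D (j-1) 0)"
      using sums_Suc_imp[of "\<lambda>k. D (j-1) (of_nat k * z)"] summable_sums[OF sm[of "j-1"]]
      by (subst sums_Suc_iff) (simp add: S_def)
    \<comment> \<open>The left side is the sum of \<open>D (j-1)\<close> over the grid points from z
      on, which is the full sum without the term at 0.\<close>
    ultimately have eq: "S (j-1) z - D (j-1) 0 = suminf E + (\<Sum>i\<le>N+1. S (j-1+i) z * z ^ i / fact i)"
      by (rule sums_unique2[symmetric])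
    \<comment> \<open>\<open>S (j-1) z\<close> cancels against the left side of \<open>eq\<close>,
      so no expansion of it is required. The later sums need precision only N - i, because the
      factor z^i restores the missing order; this is what makes the induction on \<open>N\<close>
      work.\<close>
    have spl: "(\<Sum>i\<le>N+1. S (j-1+i) z * z ^ i / fact i) =
       S (j-1) z + z * S j z + (\<Sum>i\<in>{1..N}. S (j+i) z * z ^ Suc i / fact (Suc i))"
    proof -
      have "(\<Sum>i\<le>N+1. S (j-1+i) z * z ^ i / fact i) = S (j-1) z + (\<Sum>i\<le>N. S (j-1+Suc i) z * z ^ Suc i / fact (Suc i))"
        by (simp add: sum.atMost_Suc_shift del: sum.atMost_Suc)
      also have "(\<Sum>i\<le>N. S (j-1+Suc i) z * z ^ Suc i / fact (Suc i)) = (\<Sum>i\<in>{0..N}. S (j+i) z * z ^ Suc i / fact (Suc i))"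
        using less.prems by (intro sum.cong) (auto simp: atMost_atLeast0)
      also have "\<dots> = z * S j z + (\<Sum>i\<in>{1..N}. S (j+i) z * z ^ Suc i / fact (Suc i))"
        by (subst sum.atLeast_Suc_atMost) (auto simp: mult.commute)
      finally show ?thesis by simp
    qed
    have h1: "poly A' z = - D (j-1) 0 - (\<Sum>i\<in>{1..N}. z ^ i / fact (Suc i) * poly (A i) z)"
      by (simp add: A'_def poly_sum poly_monom)
    have h2: "(\<Sum>i\<in>{1..N}. z ^ i / fact (Suc i) * (z * S (j+i) z - poly (A i) z)) =
       (\<Sum>i\<in>{1..N}. S (j+i) z * z ^ Suc i / fact (Suc i)) - (\<Sum>i\<in>{1..N}. z ^ i / fact (Suc i) * poly (A i) z)"
      unfolding sum_subtractf[symmetric] by (intro sum.cong refl) (simp add: right_diff_distrib mult_ac)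
    have id: "z * S j z - poly A' z = - suminf E - (\<Sum>i\<in>{1..N}. z ^ i / fact (Suc i) * (z * S (j+i) z - poly (A i) z))"
      using eq unfolding spl h1 h2 by (simp add: algebra_simps)
    have "cmod (z * S j z - poly A' z) \<le> cmod (suminf E) + cmod (\<Sum>i\<in>{1..N}. z ^ i / fact (Suc i) * (z * S (j+i) z - poly (A i) z))"
      unfolding id using norm_triangle_ineq4[of "- suminf E"] by simp
    also have "\<dots> \<le> cmod (suminf E) + (\<Sum>i\<in>{1..N}. cmod (z ^ i / fact (Suc i) * (z * S (j+i) z - poly (A i) z)))"
      by (intro add_left_mono norm_sum)
    finally have "cmod (z * S j z - poly A' z) \<le> cmod (suminf E) + (\<Sum>i\<in>{1..N}. cmod (z ^ i / fact (Suc i) * (z * S (j+i) z - poly (A i) z)))" .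
    also have "\<dots> \<le> 8 * B * cmod z ^ N + (\<Sum>i\<in>{1..N}. \<bar>C i\<bar> * cmod z ^ N)"
    proof (intro add_mono Eb sum_mono)
      fix i assume i: "i \<in> {1..N}"
      have "cmod (z ^ i / fact (Suc i) * (z * S (j+i) z - poly (A i) z)) \<le> cmod z ^ i * (\<bar>C i\<bar> * cmod z ^ (N - i))"
        unfolding norm_mult
      proof (intro mult_mono)
        have "cmod (z ^ i / fact (Suc i)) = cmod z ^ i / fact (Suc i)" by (simp add: norm_divide norm_power del: fact_Suc)
        also have "\<dots> \<le> cmod z ^ i / 1" by (intro divide_left_mono fact_ge_1) auto
        finally show "cmod (z ^ i / fact (Suc i)) \<le> cmod z ^ i" by simp
        have "C i * cmod z ^ (N - i) \<le> \<bar>C i\<bar> * cmod z ^ (N - i)" by (intro mult_right_mono) auto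
        thus "cmod (z * S (j + i) z - poly (A i) z) \<le> \<bar>C i\<bar> * cmod z ^ (N - i)"
          using AC[OF i z] by simp
      qed auto
      also have "\<dots> = \<bar>C i\<bar> * cmod z ^ N" using i by (simp flip: power_add)
      finally show "cmod (z ^ i / fact (Suc i) * (z * S (j+i) z - poly (A i) z)) \<le> \<bar>C i\<bar> * cmod z ^ N" .
    qed
    also have "\<dots> = C' * cmod z ^ N" by (simp add: C'_def sum_distrib_right distrib_right)
    finally show "cmod (z * (\<Sum>k. (deriv ^^ j) Q (of_nat k * z)) - poly A' z) \<le> C' * cmod z ^ N"
      by (simp add: S_def D_def)
  qed
qed

text \<open>A primitive of \<open>R\<close> brings this into the form with j = 1. Omitting the grid
  point 0 changes the polynomial by the linear term z R(0).\<close>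

lemma grid_sum_expansion:
  assumes R: "decaying R"
  shows "\<exists>(A::complex poly) C. \<forall>z\<in>sector. z \<noteq> 0 \<and> cmod z \<le> 1 \<longrightarrow>
    summable (\<lambda>k. R (of_nat (Suc k) * z)) \<and>
    cmod (z * (\<Sum>k. R (of_nat (Suc k) * z)) - poly A z) \<le> C * cmod z ^ N"
proof -
  obtain Q where Q: "decaying Q" and Qd: "\<And>w. w \<in> wedge 1 \<Longrightarrow> (Q has_field_derivative R w) (at w)"
    using decaying_primitive[OF R] by blast
  obtain A C where AC: "\<And>z. z \<in> sector \<Longrightarrow> z \<noteq> 0 \<Longrightarrow> cmod z \<le> 1 \<Longrightarrow>
    cmod (z * (\<Sum>k. (deriv ^^ 1) Q (of_nat k * z)) - poly A z) \<le> C * cmod z ^ N"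
    using grid_sum_deriv_expansion[OF Q, of 1 N] by auto
  obtain C1 where C1: "\<And>w. w \<in> wedge 1 \<Longrightarrow> cmod (R w) \<le> C1 * exp (- Re w / 2)"
    using R unfolding decaying_def by blast
  show ?thesis
  proof (intro exI[of _ "A - [:0, R 0:]"] exI[of _ C] ballI impI, elim conjE, intro conjI)
    fix z assume z: "z \<in> sector" "z \<noteq> 0" "cmod z \<le> 1"
    have w: "of_nat k * z \<in> wedge 1" for k using sector_mult[OF z(1)] sector_subset_wedge by blast
    have dR: "(deriv ^^ 1) Q (of_nat k * z) = R (of_nat k * z)" for k
      using DERIV_imp_deriv[OF Qd[OF w]] by simp
    have sm: "summable (\<lambda>k. R (of_nat k * z))"
      by (rule summable_comparison_test'[OF summable_mult[OF sum_exp_sector_bound(1)[OF z], of C1], of 0]) (use C1[OF w] in auto)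
    thus "summable (\<lambda>k. R (of_nat (Suc k) * z))" by (subst summable_Suc_iff)
    have "(\<Sum>k. R (of_nat k * z)) = R 0 + (\<Sum>k. R (of_nat (Suc k) * z))"
      using suminf_split_head[OF sm] by simp
    thus "cmod (z * (\<Sum>k. R (of_nat (Suc k) * z)) - poly (A - [:0, R 0:]) z) \<le> C * cmod z ^ N"
      using AC[OF z] unfolding dR by (simp add: algebra_simps)
  qed
qed

text \<open>The other zeros 2 pi i n of exp w - 1 lie on the imaginary axis, where the wedge only
  reaches height 2 < 2 pi.\<close>

lemma exp_eq_1_wedge: "w \<in> wedge 2 \<Longrightarrow> exp w = 1 \<longleftrightarrow> w = 0"
proof -
  assume w: "w \<in> wedge 2"
  have "w = 0" if "exp w = 1"
  proof -
    from that[unfolded exp_eq_1] obtain n::int where n: "Re w = 0" "Im w = of_int (2 * n) * pi" by blast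
    have "\<bar>of_int n :: real\<bar> * (2 * pi) < 2" using w n by (simp add: wedge_def abs_mult mult_ac)
    moreover have "2 * pi > 2" using pi_gt3 by simp
    ultimately have "\<bar>of_int n :: real\<bar> < 1" by (smt (verit) mult_le_cancel_right1)
    hence "n = 0" by linarith
    thus ?thesis using n by (simp add: complex_eq_iff)
  qed
  thus ?thesis by auto
qed

text \<open>1/(exp w - 1) has a pole at 0 and cannot be summed over a grid by the method above.
  Subtracting exp(-w)/w removes the pole, keeps the decay, and has a grid sum that is an explicit
  logarithm.\<close>

lemma planck_decaying:
  obtains \<rho> where "decaying \<rho>" "\<And>w. w \<in> wedge 1 \<Longrightarrow> w \<noteq> 0 \<Longrightarrow> \<rho> w = 1 / (exp w - 1) - exp (- w) / w"
proof -
  define \<phi> where "\<phi> = (\<lambda>z. if z = 0 then deriv exp 0 else (exp z - exp 0) / (z - 0) :: complex)"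
  have \<phi>: "\<phi> holomorphic_on wedge 2" unfolding \<phi>_def by (rule pole_lemma_open[OF _ open_wedge]) (intro holomorphic_intros)
  have \<phi>0: "\<phi> w \<noteq> 0" if "w \<in> wedge 2" for w
    using exp_eq_1_wedge[OF that] by (auto simp: \<phi>_def DERIV_imp_deriv[OF DERIV_exp])
  \<comment> \<open>This is w times the desired function. Its zero at the origin makes the second
    division by w removable.\<close>
  define h where "h = (\<lambda>w. 1 / \<phi> w - exp (- w))"
  have h: "h holomorphic_on wedge 2" unfolding h_def by (intro holomorphic_intros \<phi>) (use \<phi>0 in auto)
  have h0: "h 0 = 0" by (simp add: h_def \<phi>_def DERIV_imp_deriv[OF DERIV_exp])
  define \<rho> where "\<rho> = (\<lambda>z. if z = 0 then deriv h 0 else (h z - h 0) / (z - 0))"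
  have \<rho>: "\<rho> holomorphic_on wedge 2" unfolding \<rho>_def by (rule pole_lemma_open[OF h open_wedge])
  have eq: "\<rho> w = 1 / (exp w - 1) - exp (- w) / w" if "w \<noteq> 0" for w
    using that by (simp add: \<rho>_def h0) (simp add: h_def \<phi>_def field_simps)
  have sub: "wedge 1 \<subseteq> wedge 2" by (auto simp: wedge_def)
  \<comment> \<open>A compact subset of \<open>wedge 2\<close> containing the part of
    \<open>wedge 1\<close> with Re w \<le> 1, where the estimate rests on continuity alone.\<close>
  define K where "K = {w::complex. \<bar>Im w\<bar> \<le> Re w + 1} \<inter> {w. Re w \<le> 1}"
  have "K \<subseteq> cbox (Complex (-1) (-2)) (Complex 1 2)"
    by (auto simp: K_def in_cbox_complex_iff)
  moreover have "closed K" unfolding K_def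
    by (intro closed_Int closed_Collect_le continuous_intros)
  ultimately have "compact K" using bounded_cbox bounded_subset compact_eq_bounded_closed by metis
  moreover have "K \<subseteq> wedge 2" by (auto simp: K_def wedge_def)
  ultimately have "compact (\<rho> ` K)"
    by (intro compact_continuous_image holomorphic_on_imp_continuous_on holomorphic_on_subset[OF \<rho>])
  then obtain M where M: "\<And>w. w \<in> K \<Longrightarrow> cmod (\<rho> w) \<le> M"
    using compact_imp_bounded[THEN bounded_iff[THEN iffD1]] by (meson imageI)
  have "cmod (\<rho> w) \<le> max 3 (max M 0 * exp (1/2)) * exp (- Re w / 2)" if w: "w \<in> wedge 1" for w
  proof (cases "Re w \<le> 1")
    case True
    hence "cmod (\<rho> w) \<le> max M 0 * 1" using M[of w] w by (auto simp: K_def wedge_def)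
    also have "\<dots> \<le> max M 0 * (exp (1/2) * exp (- Re w / 2))"
      using True by (intro mult_left_mono) (auto simp flip: exp_add)
    also have "\<dots> \<le> max 3 (max M 0 * exp (1/2)) * exp (- Re w / 2)"
      unfolding mult.assoc[symmetric] by (intro mult_right_mono) auto
    finally show ?thesis .
  next
    case False
    have e2: "exp (Re w) \<ge> 2" using exp_ge_add_one_self[of "Re w"] False by linarith
    have "cmod (exp w) - cmod 1 \<le> cmod (exp w - 1)" by (rule norm_triangle_ineq2)
    hence "exp (Re w) / 2 \<le> cmod (exp w - 1)" using e2 by simp
    hence "cmod (1 / (exp w - 1)) \<le> 1 / (exp (Re w) / 2)"
      unfolding norm_divide norm_one by (intro divide_left_mono mult_pos_pos) (auto intro: less_le_trans[of 0 "exp (Re w) / 2"])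
    hence a: "cmod (1 / (exp w - 1)) \<le> 2 * exp (- Re w)" by (simp add: exp_minus field_simps)
    have "cmod w \<ge> 1" using complex_Re_le_cmod[of w] False by simp
    hence "exp (- Re w) / cmod w \<le> exp (- Re w) / 1" by (intro divide_left_mono) auto
    hence "cmod (exp (- w) / w) \<le> exp (- Re w)" unfolding norm_divide norm_exp_eq_Re by simp
    moreover have "w \<noteq> 0" using False by auto
    hence "\<rho> w = 1 / (exp w - 1) - exp (- w) / w" by (rule eq)
    ultimately have "cmod (\<rho> w) \<le> 3 * exp (- Re w)"
      using a norm_triangle_ineq4[of "1 / (exp w - 1)" "exp (- w) / w"] by simp
    also have "\<dots> \<le> max 3 (max M 0 * exp (1/2)) * exp (- Re w / 2)"
      using False by (intro mult_mono) auto
    finally show ?thesis .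
  qed
  hence "decaying \<rho>" unfolding decaying_def using holomorphic_on_subset[OF \<rho> sub] by blast
  thus ?thesis using eq that by blast
qed

text \<open>For Re z > 0 this is the generating series of the divisor function, the sum of d(n)
  exp(-n z).\<close>

definition lambert :: "complex \<Rightarrow> complex" where
  "lambert z = (\<Sum>k. 1 / (exp (of_nat (Suc k) * z) - 1))"

text \<open>The subtracted terms exp(-kz)/(kz) sum to -Ln(1 - exp(-z))/z and carry the logarithmic
  singularity; what remains is a grid sum of a decaying function.\<close>

lemma lambert_expansion:
  "\<exists>(A::complex poly) C. \<forall>z\<in>sector. z \<noteq> 0 \<and> cmod z \<le> 1 \<longrightarrow>
    cmod (z * lambert z + Ln (1 - exp (- z)) - poly A z) \<le> C * cmod z ^ N"
proof -
  obtain \<rho> where \<rho>: "decaying \<rho>" "\<And>w. w \<in> wedge 1 \<Longrightarrow> w \<noteq> 0 \<Longrightarrow> \<rho> w = 1 / (exp w - 1) - exp (- w) / w"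
    using planck_decaying by blast
  obtain A C where "\<forall>z\<in>sector. z \<noteq> 0 \<and> cmod z \<le> 1 \<longrightarrow> summable (\<lambda>k. \<rho> (of_nat (Suc k) * z)) \<and>
    cmod (z * (\<Sum>k. \<rho> (of_nat (Suc k) * z)) - poly A z) \<le> C * cmod z ^ N"
    using grid_sum_expansion[OF \<rho>(1), of N] by (elim exE)
  hence AC: "\<And>z. z \<in> sector \<Longrightarrow> z \<noteq> 0 \<Longrightarrow> cmod z \<le> 1 \<Longrightarrow> summable (\<lambda>k. \<rho> (of_nat (Suc k) * z)) \<and>
    cmod (z * (\<Sum>k. \<rho> (of_nat (Suc k) * z)) - poly A z) \<le> C * cmod z ^ N"
    by blast
  show ?thesis
  proof (intro exI[of _ A] exI[of _ C] ballI impI, elim conjE)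
    fix z assume z: "z \<in> sector" "z \<noteq> 0" "cmod z \<le> 1"
    have re: "Re z > 0" using z by (cases "Re z = 0") (auto simp: sector_def complex_eq_iff)
    have w: "of_nat (Suc k) * z \<in> wedge 1" for k using sector_mult[OF z(1)] sector_subset_wedge by blast
    have lt: "cmod (- exp (- z)) < 1" using re by simp
    have "(\<lambda>n. (-1)^Suc n / of_nat n * (- exp (- z))^n) sums ln (1 + (- exp (- z)))"
      by (rule Ln_series[OF lt])
    \<comment> \<open>The term n = 0 is 0 because division by 0 gives 0, so the index may be shifted
      to start at 1.\<close>
    hence "(\<lambda>n. (-1)^Suc (Suc n) / of_nat (Suc n) * (- exp (- z))^Suc n) sums (ln (1 + (- exp (- z))) - 0)"
      by (subst sums_Suc_iff) simp
    hence "(\<lambda>n. - (exp (- z) ^ Suc n / of_nat (Suc n))) sums ln (1 - exp (- z))"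
      by (simp add: power_minus[of "exp (- z)"] del: of_nat_Suc power_Suc) (simp add: field_simps)
    from sums_minus[OF this] have "(\<lambda>n. exp (- z) ^ Suc n / of_nat (Suc n)) sums (- Ln (1 - exp (- z)))" by simp
    from sums_divide[OF this, of z]
    have s1: "(\<lambda>n. exp (- (of_nat (Suc n) * z)) / (of_nat (Suc n) * z)) sums (- Ln (1 - exp (- z)) / z)"
      by (simp add: divide_divide_eq_left flip: exp_of_nat_mult del: of_nat_Suc power_Suc)
    have s2: "(\<lambda>k. \<rho> (of_nat (Suc k) * z)) sums (\<Sum>k. \<rho> (of_nat (Suc k) * z))"
      using AC[OF z] by blast
    have nz: "of_nat (Suc k) * z \<noteq> 0" for k using z by (simp del: of_nat_Suc)
    have "(\<lambda>k. 1 / (exp (of_nat (Suc k) * z) - 1)) sums (- Ln (1 - exp (- z)) / z + (\<Sum>k. \<rho> (of_nat (Suc k) * z)))"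
      using sums_add[OF s1 s2] by (simp only: \<rho>(2)[OF w nz] add_diff_eq diff_add_cancel add.commute[of "exp _ / _"]) simp
    hence "lambert z = - Ln (1 - exp (- z)) / z + (\<Sum>k. \<rho> (of_nat (Suc k) * z))"
      unfolding lambert_def by (rule sums_unique[symmetric])
    hence "z * lambert z + Ln (1 - exp (- z)) = z * (\<Sum>k. \<rho> (of_nat (Suc k) * z))"
      using z by (simp add: ring_distribs del: of_nat_Suc)
    thus "cmod (z * lambert z + Ln (1 - exp (- z)) - poly A z) \<le> C * cmod z ^ N"
      using AC[OF z] by simp
  qed
qed

subsection \<open>Zeta and its functional equation\<close>

lemma set_integral_Ioi_scale:
  fixes f :: "real \<Rightarrow> complex"
  assumes f: "set_integrable lborel {0<..} f" and c: "c > 0"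
  shows "set_integrable lborel {0<..} (\<lambda>u. f (c * u))"
    and "(LINT u:{0<..}|lborel. f (c * u)) = (LINT u:{0<..}|lborel. f u) / of_real c"
proof -
  have ind: "indicat_real {0<..} (0 + c * x) = indicat_real {0<..} x" for x
    using c by (auto simp: indicator_def zero_less_mult_iff)
  have "integrable lborel (\<lambda>x. indicat_real {0<..} (0 + c * x) *\<^sub>R f (0 + c * x))"
    using f[unfolded set_integrable_def] c by (intro lborel_integrable_real_affine) auto
  thus "set_integrable lborel {0<..} (\<lambda>u. f (c * u))"
    unfolding ind by (simp add: set_integrable_def)
  have "(LINT u:{0<..}|lborel. f u) = \<bar>c\<bar> *\<^sub>R (LINT x|lborel. indicat_real {0<..} (0 + c * x) *\<^sub>R f (0 + c * x))"
    unfolding set_lebesgue_integral_def using c by (intro lborel_integral_real_affine) auto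
  thus "(LINT u:{0<..}|lborel. f (c * u)) = (LINT u:{0<..}|lborel. f u) / of_real c"
    unfolding ind using c by (simp add: set_lebesgue_integral_def scaleR_conv_of_real)
qed

text \<open>The substitution u = exp y turns Mellin integrals into Fourier integrals. It is done for
  real integrands first; the complex case splits into real and imaginary parts.\<close>

lemma integral_exp_substitution_real:
  fixes f :: "real \<Rightarrow> real"
  assumes f: "set_integrable lborel {0<..} f"
  shows "integrable lborel (\<lambda>y. exp y * f (exp y))"
    and "(LINT y|lborel. exp y * f (exp y)) = (LINT u:{0<..}|lborel. f u)"
proof -
  have ai: "f absolutely_integrable_on {0<..}"
    using f unfolding set_integrable_def by (subst integrable_completion) auto
  have "((\<lambda>x. \<bar>exp x\<bar> * f (exp x)) absolutely_integrable_on UNIV \<and>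
      integral UNIV (\<lambda>x. \<bar>exp x\<bar> * f (exp x)) = integral {0<..} f) \<longleftrightarrow>
      (f absolutely_integrable_on range exp \<and> integral (range exp) f = integral {0<..} f)"
    by (rule has_absolute_integral_change_of_variables_1')
       (auto intro!: derivative_eq_intros simp: inj_on_def)
  moreover have "range (exp :: real \<Rightarrow> real) = {0<..}"
    by (auto simp: image_iff) (metis exp_ln)
  ultimately have 1: "(\<lambda>x. exp x * f (exp x)) absolutely_integrable_on UNIV"
    and 2: "integral UNIV (\<lambda>x. exp x * f (exp x)) = integral {0<..} f"
    using ai by auto
  have "(\<lambda>u. indicat_real {0<..} u *\<^sub>R f u) \<in> borel_measurable borel"
    using borel_measurable_integrable[OF f[unfolded set_integrable_def]] by simp
  hence "(\<lambda>y. indicat_real {0<..} (exp y) *\<^sub>R f (exp y)) \<in> borel_measurable borel"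
    by (rule measurable_compose[rotated]) simp
  hence m: "(\<lambda>y. exp y * f (exp y)) \<in> borel_measurable borel" by simp
  show 3: "integrable lborel (\<lambda>y. exp y * f (exp y))"
    using 1 m unfolding set_integrable_def by (subst (asm) integrable_completion) auto
  hence "set_integrable lborel UNIV (\<lambda>y. exp y * f (exp y))" by (simp add: set_integrable_def)
  from set_borel_integral_eq_integral(2)[OF this] set_borel_integral_eq_integral(2)[OF f] 2
  show "(LINT y|lborel. exp y * f (exp y)) = (LINT u:{0<..}|lborel. f u)"
    by (simp add: set_lebesgue_integral_def)
qed

lemma integral_exp_substitution:
  fixes f :: "real \<Rightarrow> complex"
  assumes f: "set_integrable lborel {0<..} f"
  shows "integrable lborel (\<lambda>y. of_real (exp y) * f (exp y))"
    and "(LINT y|lborel. of_real (exp y) * f (exp y)) = (LINT u:{0<..}|lborel. f u)"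
proof -
  have r: "set_integrable lborel {0<..} (\<lambda>u. Re (f u))" "set_integrable lborel {0<..} (\<lambda>u. Im (f u))"
    using integrable_Re[OF f[unfolded set_integrable_def]] integrable_Im[OF f[unfolded set_integrable_def]]
    by (simp_all add: set_integrable_def)
  note R = integral_exp_substitution_real[OF r(1)] and I = integral_exp_substitution_real[OF r(2)]
  have eq: "of_real (exp y) * f (exp y) = of_real (exp y * Re (f (exp y))) + \<i> * of_real (exp y * Im (f (exp y)))" for y
    by (simp add: complex_eq_iff)
  have f_eq: "(LINT u:{0<..}|lborel. f u) = of_real (LINT u:{0<..}|lborel. Re (f u)) + \<i> * of_real (LINT u:{0<..}|lborel. Im (f u))"
    using f unfolding set_integrable_def set_lebesgue_integral_def
    by (simp add: complex_eq_iff flip: integral_Re integral_Im)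
  show "integrable lborel (\<lambda>y. of_real (exp y) * f (exp y))"
    unfolding eq using R(1) I(1) by (intro Bochner_Integration.integrable_add integrable_mult_right integrable_of_real) auto
  show "(LINT y|lborel. of_real (exp y) * f (exp y)) = (LINT u:{0<..}|lborel. f u)"
    unfolding eq f_eq R(2)[symmetric] I(2)[symmetric]
    by (subst Bochner_Integration.integral_add)
       (simp_all only: integrable_mult_right integrable_of_real R(1) I(1) integral_mult_right_zero integral_complex_of_real)
qed

text \<open>Replacing h(u) by h(a u) multiplies the Mellin transform by a^(-w), so a sum of dilates
  multiplies it by a Dirichlet series. The same scaling applied to the norms shows that the L1 norms
  of the terms are summable, which permits termwise integration.\<close>

lemma mellin_dilation_sum:
  fixes h :: "real \<Rightarrow> complex" and a c :: "nat \<Rightarrow> real"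
  assumes int: "set_integrable lborel {0<..} (\<lambda>u. h u * of_real u powr (w - 1))"
    and a: "\<And>k. a k > 0"
    and c: "summable (\<lambda>k. \<bar>c k\<bar> * a k powr (- Re w))"
    and pt: "\<And>u. u > 0 \<Longrightarrow> summable (\<lambda>k. norm (of_real (c k) * h (a k * u)))"
  shows "set_integrable lborel {0<..} (\<lambda>u. (\<Sum>k. of_real (c k) * h (a k * u)) * of_real u powr (w - 1))"
    and "(LINT u:{0<..}|lborel. (\<Sum>k. of_real (c k) * h (a k * u)) * of_real u powr (w - 1)) =
         (\<Sum>k. of_real (c k) * of_real (a k) powr (- w)) * (LINT u:{0<..}|lborel. h u * of_real u powr (w - 1))"
proof -
  define g where "g = (\<lambda>u. h u * of_real u powr (w - 1))"
  define H where "H = (LINT u:{0<..}|lborel. g u)"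
  define f where "f = (\<lambda>k u. indicat_real {0<..} u *\<^sub>R (of_real (c k) * h (a k * u) * of_real u powr (w - 1)))"
  have gi: "set_integrable lborel {0<..} g" using int by (simp add: g_def)
  have f_eq: "f k u = (of_real (c k) * of_real (a k) powr (1 - w)) * (indicat_real {0<..} u *\<^sub>R g (a k * u))" for k u
  proof (cases "u > 0")
    case True
    have "complex_of_real (a k * u) powr (w - 1) = of_real (a k) powr (w - 1) * of_real u powr (w - 1)"
      using a[of k] True by (simp add: powr_times_real)
    moreover have "complex_of_real (a k) powr (1 - w) * of_real (a k) powr (w - 1) = 1"
      using a[of k] by (simp flip: powr_add)
    ultimately show ?thesis by (simp add: f_def g_def mult_ac)
  qed (simp add: f_def)
  have fi: "integrable lborel (f k)" for k
    unfolding f_eq by (rule integrable_mult_right)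
       (use set_integral_Ioi_scale(1)[OF gi a[of k]] in \<open>simp add: set_integrable_def\<close>)
  have fI: "integral\<^sup>L lborel (f k) = of_real (c k) * of_real (a k) powr (- w) * H" for k
  proof -
    have "integral\<^sup>L lborel (f k) = (of_real (c k) * of_real (a k) powr (1 - w)) * (H / of_real (a k))"
      unfolding f_eq H_def set_integral_Ioi_scale(2)[OF gi a[of k], symmetric] unfolding set_lebesgue_integral_def
      by (rule integral_mult_right_zero)
    also have "of_real (a k) powr (1 - w) = of_real (a k) * of_real (a k) powr (- w)"
      using a[of k] by (simp add: powr_diff powr_minus field_simps)
    finally show ?thesis using a[of k] by simp
  qed
  \<comment> \<open>The norms are kept complex-valued so that the scaling lemma, stated for complex
    functions, applies to them too.\<close>
  define Hn where "Hn = (LINT u:{0<..}|lborel. complex_of_real (cmod (g u)))"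
  have gn: "set_integrable lborel {0<..} (\<lambda>u. complex_of_real (cmod (g u)))"
    using integrable_of_real[OF set_integrable_norm[OF gi, unfolded set_integrable_def], where 'a = complex]
    by (simp add: set_integrable_def scaleR_conv_of_real)
  have fN: "(LINT u|lborel. norm (f k u)) = \<bar>c k\<bar> * a k powr (- Re w) * Re Hn" for k
  proof -
    have "complex_of_real (norm (f k u)) = of_real (\<bar>c k\<bar> * a k powr (1 - Re w)) * (indicat_real {0<..} u *\<^sub>R of_real (cmod (g (a k * u))))" for u
      unfolding f_eq using a[of k] by (simp add: norm_mult norm_of_real_powr scaleR_conv_of_real)
    hence "(LINT u|lborel. complex_of_real (norm (f k u))) =
        (LINT u|lborel. of_real (\<bar>c k\<bar> * a k powr (1 - Re w)) * (indicat_real {0<..} u *\<^sub>R complex_of_real (cmod (g (a k * u)))))"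
      by (intro Bochner_Integration.integral_cong refl)
    also have "\<dots> = of_real (\<bar>c k\<bar> * a k powr (1 - Re w)) * (Hn / of_real (a k))"
      unfolding Hn_def set_integral_Ioi_scale(2)[OF gn a[of k], symmetric]
      unfolding set_lebesgue_integral_def by (rule integral_mult_right_zero)
    finally have "complex_of_real (LINT u|lborel. norm (f k u)) = of_real (\<bar>c k\<bar> * a k powr (1 - Re w)) * (Hn / of_real (a k))"
      unfolding integral_complex_of_real .
    from arg_cong[OF this, of Re] have "(LINT u|lborel. norm (f k u)) = \<bar>c k\<bar> * a k powr (1 - Re w) * (Re Hn / a k)" by simp
    also have "a k powr (1 - Re w) = a k * a k powr (- Re w)"
      using a[of k] by (simp add: powr_diff powr_minus field_simps)
    finally show ?thesis using a[of k] by simp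
  qed
  have s1: "AE x in lborel. summable (\<lambda>k. norm (f k x))"
  proof (intro AE_I2)
    fix u :: real
    show "summable (\<lambda>k. norm (f k u))"
    proof (cases "u > 0")
      case True
      have "norm (f k u) = norm (of_real (c k) * h (a k * u)) * u powr (Re w - 1)" for k
        using True by (simp add: f_def norm_mult norm_of_real_powr)
      thus ?thesis using summable_mult2[OF pt[OF True]] by simp
    qed (simp add: f_def)
  qed
  have s2: "summable (\<lambda>k. LINT u|lborel. norm (f k u))"
    unfolding fN using summable_mult2[OF c] by simp
  have fs: "(\<Sum>k. f k u) = indicat_real {0<..} u *\<^sub>R ((\<Sum>k. of_real (c k) * h (a k * u)) * of_real u powr (w - 1))" for u
  proof (cases "u > 0")
    case True
    have "summable (\<lambda>k. of_real (c k) * h (a k * u))" by (rule summable_norm_cancel[OF pt[OF True]])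
    thus ?thesis using True by (simp add: f_def suminf_mult2)
  qed (simp add: f_def)
  show "set_integrable lborel {0<..} (\<lambda>u. (\<Sum>k. of_real (c k) * h (a k * u)) * of_real u powr (w - 1))"
    using integrable_suminf[OF fi s1 s2] unfolding fs set_integrable_def .
  have "(\<lambda>k. integral\<^sup>L lborel (f k)) sums (LINT u|lborel. (\<Sum>k. f k u))"
    by (rule sums_integral[OF fi s1 s2])
  hence s: "(\<lambda>k. of_real (c k) * of_real (a k) powr (- w) * H) sums (LINT u|lborel. (\<Sum>k. f k u))"
    unfolding fI .
  have "summable (\<lambda>k. of_real (c k) * complex_of_real (a k) powr (- w))"
    by (rule summable_norm_cancel) (use c a in \<open>simp add: norm_mult norm_of_real_powr\<close>)
  hence "(\<lambda>k. of_real (c k) * of_real (a k) powr (- w) * H) sums ((\<Sum>k. of_real (c k) * of_real (a k) powr (- w)) * H)"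
    by (intro sums_mult2 summable_sums)
  from sums_unique2[OF s this]
  show "(LINT u:{0<..}|lborel. (\<Sum>k. of_real (c k) * h (a k * u)) * of_real u powr (w - 1)) =
         (\<Sum>k. of_real (c k) * of_real (a k) powr (- w)) * (LINT u:{0<..}|lborel. h u * of_real u powr (w - 1))"
    unfolding fs H_def g_def set_lebesgue_integral_def .
qed

definition dzeta :: "complex \<Rightarrow> complex" where
  "dzeta s = (\<Sum>n. of_nat (Suc n) powr (- s))"

lemma summable_Suc_powr: "r < -1 \<Longrightarrow> summable (\<lambda>n. real (Suc n) powr r)"
  by (subst summable_Suc_iff[of "\<lambda>n. real n powr r"]) (simp add: summable_real_powr_iff)

lemma norm_Suc_powr: "cmod (of_nat (Suc n) powr s) = real (Suc n) powr Re s"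
  using norm_of_real_powr[of "real (Suc n)" s] by simp

lemma dzeta_sums: "Re s > 1 \<Longrightarrow> (\<lambda>n. of_nat (Suc n) powr (- s)) sums dzeta s"
  unfolding dzeta_def
  by (intro summable_sums summable_norm_cancel[of "\<lambda>n. of_nat (Suc n) powr (- s)"])
     (simp add: norm_Suc_powr summable_Suc_powr del: of_nat_Suc)

lemma mellin_exp:
  assumes "Re s > 0"
  shows "set_integrable lborel {0<..} (\<lambda>u. of_real (exp (- u)) * complex_of_real u powr (s - 1))"
    and "(LINT u:{0<..}|lborel. of_real (exp (- u)) * complex_of_real u powr (s - 1)) = Gamma s"
proof -
  have eq: "of_real (exp (- u)) * complex_of_real u powr (s - 1) = of_real u powr (s - 1) / of_real (exp u)" for u
    by (simp add: exp_minus field_simps)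
  show i: "set_integrable lborel {0<..} (\<lambda>u. of_real (exp (- u)) * complex_of_real u powr (s - 1))"
  proof (rule set_integrable_continuous_bound[OF _ _ set_integrable_powr_exp[of "Re s - 1" 1]])
    show "norm (of_real (exp (- x)) * complex_of_real x powr (s - 1)) \<le> x powr (Re s - 1) * exp (- 1 * x)"
      if "x \<in> {0<..}" for x
      using that by (simp add: norm_mult norm_of_real_powr)
  qed (use assms in \<open>auto intro!: continuous_intros\<close>)
  show "(LINT u:{0<..}|lborel. of_real (exp (- u)) * complex_of_real u powr (s - 1)) = Gamma s"
    using set_borel_integral_eq_integral(2)[OF i] Gamma_integral_complex'[OF assms]
    unfolding eq by (simp add: integral_unique)
qed

text \<open>A majorant geometric in k, from 1/(exp(n u) - 1) = q^n / (1 - q^n) with q = exp(-u) and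
  1 - q^n \<ge> 1 - q.\<close>

lemma planck_bound:
  fixes u :: real assumes "u > 0"
  shows "cmod (1 / (exp (of_real (real (Suc k) * u)) - 1)) \<le> exp (- u) ^ Suc k / (1 - exp (- u))"
proof -
  have e1: "exp (- u) < 1" using assms by simp
  have "complex_of_real (1 / (exp (real (Suc k) * u) - 1)) = 1 / (exp (of_real (real (Suc k) * u)) - 1)"
    by (simp only: exp_of_real of_real_divide of_real_1 of_real_diff)
  moreover have "exp (real (Suc k) * u) > 1" using assms by simp
  ultimately have "cmod (1 / (exp (of_real (real (Suc k) * u)) - 1)) = 1 / (exp (real (Suc k) * u) - 1)"
    by (metis abs_of_pos diff_gt_0_iff_gt norm_of_real zero_less_divide_1_iff)
  also have "\<dots> = exp (- u) ^ Suc k / (1 - exp (- u) ^ Suc k)"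
  proof -
    have "exp (- u) ^ Suc k = exp (- (real (Suc k) * u))"
      by (simp only: exp_of_nat_mult[symmetric] mult_minus_right)
    hence e: "exp (- u) ^ Suc k = 1 / exp (real (Suc k) * u)"
      by (simp only: exp_minus inverse_eq_divide)
    have "1 / (E - 1) = (1 / E) / (1 - 1 / E)" if "E > 1" for E :: real using that by (simp add: field_simps)
    from this[OF \<open>exp (real (Suc k) * u) > 1\<close>] show ?thesis unfolding e .
  qed
  also have "\<dots> \<le> exp (- u) ^ Suc k / (1 - exp (- u))"
  proof (intro divide_left_mono)
    have "exp (- u) ^ Suc k \<le> exp (- u) ^ 1" using e1 by (intro power_decreasing) auto
    thus le: "1 - exp (- u) \<le> 1 - exp (- u) ^ Suc k" by (simp del: power_Suc)
    thus "0 < (1 - exp (- u) ^ Suc k) * (1 - exp (- u))" using e1 by (intro mult_pos_pos) linarith+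
  qed simp
  finally show ?thesis .
qed

lemma planck_summable:
  fixes u :: real assumes "u > 0"
  shows "summable (\<lambda>k. cmod (1 / (exp (of_real (real (Suc k) * u)) - 1)))"
proof (rule summable_comparison_test')
  show "summable (\<lambda>k. exp (- u) ^ Suc k / (1 - exp (- u)))"
    using assms by (intro summable_divide) (simp add: summable_Suc_iff)
qed (use planck_bound[OF assms] in \<open>auto simp del: power_Suc of_nat_Suc\<close>)

text \<open>Riemann's integral: 1/(exp u - 1) is the sum of the dilates exp(-k u), which turns the
  transform \<open>Gamma\<close> of exp(-u) into its product with the zeta series.\<close>

lemma mellin_planck:
  assumes s: "Re s > 1"
  shows "set_integrable lborel {0<..} (\<lambda>u. 1 / (exp (of_real u) - 1) * complex_of_real u powr (s - 1))"
    and "(LINT u:{0<..}|lborel. 1 / (exp (of_real u) - 1) * complex_of_real u powr (s - 1)) = Gamma s * dzeta s"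
proof -
  have c: "summable (\<lambda>k. \<bar>1\<bar> * real (Suc k) powr (- Re s))"
    using summable_Suc_powr[of "- Re s"] s by simp
  have gs: "(\<lambda>k. exp (- u) ^ Suc k) sums (exp (- u) / (1 - exp (- u)))" if "u > 0" for u :: real
    using sums_mult[OF geometric_sums[of "exp (- u)"], of "exp (- u)"] that by simp
  have pt: "summable (\<lambda>k. norm (of_real 1 * complex_of_real (exp (- (real (Suc k) * u)))))" if "u > 0" for u
    using sums_summable[OF gs[OF that]]
    by (simp only: of_real_1 mult_1 norm_of_real abs_exp_cancel exp_of_nat_mult[symmetric] mult_minus_right)
  have sum_eq: "(\<Sum>k. of_real 1 * complex_of_real (exp (- (real (Suc k) * u)))) = 1 / (exp (of_real u) - 1)" if "u > 0" for u
  proof -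
    have "(\<lambda>k. complex_of_real (exp (- u) ^ Suc k)) sums of_real (exp (- u) / (1 - exp (- u)))"
      using gs[OF that] by (subst sums_of_real_iff)
    moreover have "exp (- u) / (1 - exp (- u)) = 1 / (exp u - 1)"
      using that by (simp add: exp_minus field_simps)
    ultimately have "(\<Sum>k. complex_of_real (exp (- u) ^ Suc k)) = of_real (1 / (exp u - 1))"
      by (simp only: sums_iff)
    thus ?thesis
      by (simp only: of_real_1 mult_1 of_real_divide of_real_diff exp_of_real exp_of_nat_mult[symmetric] mult_minus_right)
  qed
  have ce: "(\<Sum>k. of_real 1 * complex_of_real (real (Suc k)) powr (- s)) = dzeta s"
    by (simp add: dzeta_def)
  have s0: "Re s > 0" using s by simp
  note M = mellin_dilation_sum[of "\<lambda>u. of_real (exp (- u))" s "\<lambda>k. real (Suc k)" "\<lambda>_. 1", OF mellin_exp(1)[OF s0] _ c pt]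
  show "set_integrable lborel {0<..} (\<lambda>u. 1 / (exp (of_real u) - 1) * complex_of_real u powr (s - 1))"
    by (rule set_integrable_cong[THEN iffD1, OF refl refl _ M(1)]) (use sum_eq in auto)
  have "(LINT u:{0<..}|lborel. 1 / (exp (of_real u) - 1) * complex_of_real u powr (s - 1)) =
        (LINT u:{0<..}|lborel. (\<Sum>k. of_real 1 * complex_of_real (exp (- (real (Suc k) * u)))) * complex_of_real u powr (s - 1))"
    by (rule set_lebesgue_integral_cong) (use sum_eq in auto)
  also have "\<dots> = Gamma s * dzeta s"
    using M(2) unfolding ce mellin_exp(2)[OF s0] by (simp add: mult.commute)
  finally show "(LINT u:{0<..}|lborel. 1 / (exp (of_real u) - 1) * complex_of_real u powr (s - 1)) = Gamma s * dzeta s" .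
qed

text \<open>The Lambert series is the sum of the dilates of 1/(exp u - 1), so one further factor
  \<open>dzeta\<close> appears.\<close>

lemma mellin_lambert:
  assumes s: "Re s > 1"
  shows "set_integrable lborel {0<..} (\<lambda>u. lambert (of_real u) * complex_of_real u powr (s - 1))"
    and "(LINT u:{0<..}|lborel. lambert (of_real u) * complex_of_real u powr (s - 1)) = Gamma s * (dzeta s)\<^sup>2"
proof -
  have c: "summable (\<lambda>k. \<bar>1\<bar> * real (Suc k) powr (- Re s))"
    using summable_Suc_powr[of "- Re s"] s by simp
  have pt: "summable (\<lambda>k. norm (of_real 1 * (1 / (exp (complex_of_real (real (Suc k) * u)) - 1))))" if "u > 0" for u
    using planck_summable[OF that] by simp
  have le: "lambert (of_real u) = (\<Sum>k. of_real 1 * (1 / (exp (complex_of_real (real (Suc k) * u)) - 1)))" for u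
    by (simp add: lambert_def)
  have ce: "(\<Sum>k. of_real 1 * complex_of_real (real (Suc k)) powr (- s)) = dzeta s"
    by (simp add: dzeta_def)
  note M = mellin_dilation_sum[of "\<lambda>u. 1 / (exp (complex_of_real u) - 1)" s "\<lambda>k. real (Suc k)" "\<lambda>_. 1", OF mellin_planck(1)[OF s] _ c pt]
  show "set_integrable lborel {0<..} (\<lambda>u. lambert (of_real u) * complex_of_real u powr (s - 1))"
    unfolding le by (rule M(1)) auto
  show "(LINT u:{0<..}|lborel. lambert (of_real u) * complex_of_real u powr (s - 1)) = Gamma s * (dzeta s)\<^sup>2"
    unfolding le using M(2) unfolding ce mellin_planck(2)[OF s] by (simp add: power2_eq_square mult_ac)
qed

text \<open>A series is an integral over the counting measure, so
  \<open>holomorphic_on_integral\<close> covers it.\<close>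

lemma holomorphic_on_suminf:
  fixes f :: "nat \<Rightarrow> complex \<Rightarrow> complex"
  assumes S: "open S" and hol: "\<And>n. f n holomorphic_on S"
    and dom: "\<And>z0. z0 \<in> S \<Longrightarrow> \<exists>r>0. \<exists>G. summable G \<and> (\<forall>z\<in>ball z0 r \<inter> S. \<forall>n. cmod (f n z) \<le> G n)"
  shows "(\<lambda>z. \<Sum>n. f n z) holomorphic_on S"
proof -
  have G0: "integrable (count_space UNIV) G" if "summable G" "\<And>n. 0 \<le> G n" for G :: "nat \<Rightarrow> real"
    using that by (simp add: integrable_count_space_nat_iff)
  have *: "\<exists>r>0. \<exists>G. integrable (count_space UNIV) G \<and> (\<forall>z\<in>ball z0 r \<inter> S. \<forall>n\<in>space (count_space UNIV). cmod (f n z) \<le> G n)"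
    if z0: "z0 \<in> S" for z0
  proof -
    obtain r G where rG: "r > 0" "summable G" "\<And>z n. z \<in> ball z0 r \<inter> S \<Longrightarrow> cmod (f n z) \<le> G n"
      using dom[OF z0] by blast
    have "0 \<le> G n" for n using order_trans[OF norm_ge_zero rG(3)[of z0 n]] rG(1) z0 by auto
    thus ?thesis using rG G0[OF rG(2)] by (intro exI[of _ r] conjI exI[of _ G]) auto
  qed
  have "(\<lambda>z. integral\<^sup>L (count_space UNIV) (\<lambda>n. f n z)) holomorphic_on S"
    by (rule holomorphic_on_integral[OF S _ _ *]) (auto intro: hol)
  moreover have "integral\<^sup>L (count_space UNIV) (\<lambda>n. f n z) = (\<Sum>n. f n z)" if zS: "z \<in> S" for z
  proof (rule integral_count_space_nat)
    obtain r G where rG: "r > 0" "summable G" "\<And>z' n. z' \<in> ball z r \<inter> S \<Longrightarrow> cmod (f n z') \<le> G n"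
      using dom[OF zS] by blast
    have "summable (\<lambda>n. cmod (f n z))"
      by (rule summable_comparison_test'[OF rG(2)]) (use rG(3)[of z] rG(1) zS in auto)
    thus "integrable (count_space UNIV) (\<lambda>n. f n z)" by (simp add: integrable_count_space_nat_iff)
  qed
  ultimately show ?thesis by (simp cong: holomorphic_cong)
qed

section \<open>Continuation of zeta to Re s > -1 by trapezoidal sums\<close>

definition trap :: "nat \<Rightarrow> complex \<Rightarrow> complex" where
  "trap n s = (of_nat n powr (-s) + of_nat (Suc n) powr (-s)) / 2
              - (of_nat (Suc n) powr (1-s) - of_nat n powr (1-s)) / (1-s)"

text \<open>\<open>trap n s\<close> is the trapezoidal rule minus the exact integral of x^(-s) over
  [n, n+1]. Taylor expansions at n of the primitive and of x^(-s) cancel up to the third derivative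
  s (s+1) x^(-s-2) of the primitive.\<close>

lemma trap_bound:
  assumes n: "n \<ge> 1" and s: "s \<noteq> 1" "Re s \<ge> -2"
  shows "cmod (trap n s) \<le> cmod s * cmod (s+1) * real n powr (- Re s - 2)"
proof -
  \<comment> \<open>Chosen so that \<open>f i\<close> is the i-th derivative of x^(1-s) /
    (1-s).\<close>
  define c where "c = (\<lambda>i::nat. (\<Prod>j<i. (1 - s - of_nat j)) / (1 - s))"
  define f where "f = (\<lambda>i x. c i * x powr (1 - s - of_nat i))"
  define S where "S = closed_segment (complex_of_real (real n)) (of_real (real n + 1))"
  have S: "\<exists>r. x = of_real r \<and> r \<ge> real n" if "x \<in> S" for x
    using that unfolding S_def closed_segment_of_real by (auto simp: closed_segment_eq_real_ivl)
  have der: "(f i has_field_derivative f (Suc i) x) (at x within S)" if x: "x \<in> S" for i x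
  proof -
    obtain r where r: "x = of_real r" "r \<ge> real n" using S[OF x] by blast
    hence "x \<notin> \<real>\<^sub>\<le>\<^sub>0" using n by auto
    have "c (Suc i) = c i * (1 - s - of_nat i)" by (simp add: c_def)
    moreover have "1 - s - of_nat (Suc i) = 1 - s - of_nat i - 1" by simp
    ultimately have "f (Suc i) x = c i * ((1 - s - of_nat i) * x powr (1 - s - of_nat i - 1))"
      unfolding f_def by (simp only: mult.assoc)
    moreover have "(f i has_field_derivative c i * ((1 - s - of_nat i) * x powr (1 - s - of_nat i - 1))) (at x within S)"
      unfolding f_def using \<open>x \<notin> \<real>\<^sub>\<le>\<^sub>0\<close>
      by (intro DERIV_cmult has_field_derivative_at_within[OF has_field_derivative_powr])
    ultimately show ?thesis by simp
  qed
  define B where "B = cmod s * cmod (s+1) * real n powr (- Re s - 2)"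
  have c3: "c 0 = 1 / (1-s)" "c 1 = 1" "c (Suc 0) = 1" "c 2 = - s" "c 3 = s * (s + 1)"
    using s by (auto simp: c_def numeral_3_eq_3 numeral_2_eq_2 divide_simps) (auto simp: algebra_simps)
  have bd: "cmod (f 3 x) \<le> B" if x: "x \<in> S" for x
  proof -
    obtain r where r: "x = of_real r" "r \<ge> real n" using S[OF x] by blast
    have "r powr (- Re s - 2) \<le> real n powr (- Re s - 2)"
      using r n s by (intro powr_mono2') auto
    moreover have "- Re s - 2 = - 2 - Re s" by simp
    ultimately have "r powr (- 2 - Re s) \<le> real n powr (- Re s - 2)" by metis
    moreover have "1 - s - of_nat 3 = - s - 2" by simp
    ultimately show ?thesis using r n unfolding f_def c3 B_def r(1) norm_mult
      by (auto simp: norm_of_real_powr intro!: mult_left_mono)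
  qed
  have cS: "convex S" by (simp add: S_def)
  have mem: "of_real (real n) \<in> S" "of_real (real n + 1) \<in> S" by (auto simp: S_def)
  have T1: "cmod (f 0 (of_real (real n + 1)) - (\<Sum>i\<le>2. f i (of_real (real n)) * (of_real (real n + 1) - of_real (real n)) ^ i / fact i))
     \<le> B * cmod (of_real (real n + 1) - complex_of_real (real n)) ^ Suc 2 / fact 2"
    by (rule complex_Taylor[OF cS]) (use der bd mem in \<open>auto simp: numeral_3_eq_3\<close>)
  have T2: "cmod (f 1 (of_real (real n + 1)) - (\<Sum>i\<le>1. f (Suc i) (of_real (real n)) * (of_real (real n + 1) - of_real (real n)) ^ i / fact i))
     \<le> B * cmod (of_real (real n + 1) - complex_of_real (real n)) ^ Suc 1 / fact 1"
    using complex_Taylor[OF cS, of 1 "\<lambda>i. f (Suc i)" B "of_real (real n)" "of_real (real n + 1)"] der bd mem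
    by (auto simp: numeral_3_eq_3)
  have one: "of_real (real n + 1) - complex_of_real (real n) = 1" by simp
  define R1 where "R1 = f 0 (of_real (real n + 1)) - (f 0 (of_real (real n)) + f 1 (of_real (real n)) + f 2 (of_real (real n)) / 2)"
  define R2 where "R2 = f 1 (of_real (real n + 1)) - (f 1 (of_real (real n)) + f 2 (of_real (real n)))"
  have R1: "cmod R1 \<le> B / 2" using T1 unfolding one R1_def by (simp add: numeral_2_eq_2)
  have R2: "cmod R2 \<le> B" using T2 unfolding one R2_def by (simp add: numeral_2_eq_2)
  have "trap n s = (f 1 (of_real (real n)) + f 1 (of_real (real n + 1))) / 2 - (f 0 (of_real (real n + 1)) - f 0 (of_real (real n)))"
    using s by (simp add: trap_def f_def c3 diff_divide_distrib add.commute)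
  also have "\<dots> = R2 / 2 - R1" unfolding R1_def R2_def by (simp add: field_simps)
  also have "cmod \<dots> \<le> cmod (R2 / 2) + cmod R1" by (rule norm_triangle_ineq4)
  also have "\<dots> \<le> B" using R1 R2 by simp
  finally show ?thesis unfolding B_def .
qed

text \<open>Summing the trapezoidal errors of \<open>x\<^sup>-\<^sup>s\<close>, which are \<open>O(n^(-Re s - 2))\<close>, continues \<open>\<zeta>\<close> to \<open>Re s > -1\<close>.\<close>
definition zeta_em :: "complex \<Rightarrow> complex" where
  "zeta_em s = 1 / (s - 1) + 1 / 2 + (\<Sum>n. trap (Suc n) s)"

lemma trap_summable:
  assumes "s \<noteq> 1" "Re s > -1"
  shows "summable (\<lambda>n. cmod (trap (Suc n) s))"
  by (rule summable_comparison_test'[OF summable_mult[OF summable_Suc_powr[of "- Re s - 2"], of "cmod s * cmod (s+1)"]])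
     (use trap_bound[of "Suc _" s] assms in auto)

lemma zeta_em_holomorphic: "zeta_em holomorphic_on {s. Re s > -1} - {1}"
proof -
  have op: "open ({s. Re s > -1} - {1})" by (intro open_Diff open_halfspace_Re_gt) auto
  have "(\<lambda>s. \<Sum>n. trap (Suc n) s) holomorphic_on {s. Re s > -1} - {1}"
  proof (rule holomorphic_on_suminf[OF op])
    show "trap (Suc n) holomorphic_on {s. Re s > -1} - {1}" for n
      unfolding trap_def by (intro holomorphic_intros) (auto simp del: of_nat_Suc)
    fix z0 assume z0: "z0 \<in> {s. Re s > -1} - {1}"
    \<comment> \<open>Within this radius Re z \<ge> (Re z0 - 1)/2 > -1, so the exponent in the
      majorant \<open>G\<close> is below -1.\<close>
    define r where "r = min 1 ((Re z0 + 1) / 2)"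
    define G where "G = (\<lambda>n. (cmod z0 + 1) * (cmod z0 + 2) * real (Suc n) powr (- ((Re z0 - 1) / 2) - 2))"
    have "cmod (trap (Suc n) z) \<le> G n" if z: "z \<in> ball z0 r \<inter> ({s. Re s > -1} - {1})" for z n
    proof -
      have d: "cmod (z - z0) < 1" "cmod (z - z0) < (Re z0 + 1) / 2"
        using z by (auto simp: r_def dist_norm norm_minus_commute)
      have "Re z0 - Re z \<le> cmod (z - z0)" using abs_Re_le_cmod[of "z - z0"] by simp
      hence re: "Re z \<ge> (Re z0 - 1) / 2" using d by (simp add: field_simps)
      have n1: "cmod z \<le> cmod z0 + 1" using norm_triangle_ineq[of z0 "z - z0"] d by simp
      have n2: "cmod (z + 1) \<le> cmod z0 + 2" using norm_triangle_ineq[of z 1] n1 by simp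
      have "cmod (trap (Suc n) z) \<le> cmod z * cmod (z+1) * real (Suc n) powr (- Re z - 2)"
        using trap_bound[of "Suc n" z] z by auto
      also have "\<dots> \<le> G n" unfolding G_def
        using n1 n2 re by (intro mult_mono powr_mono) auto
      finally show ?thesis .
    qed
    moreover have "summable G" unfolding G_def
      using z0 by (intro summable_mult summable_Suc_powr) (auto simp: field_simps)
    ultimately show "\<exists>r>0. \<exists>G. summable G \<and> (\<forall>z\<in>ball z0 r \<inter> ({s. Re s > -1} - {1}). \<forall>n. cmod (trap (Suc n) z) \<le> G n)"
      using z0 by (intro exI[of _ r] conjI exI[of _ G]) (auto simp: r_def)
  qed
  thus ?thesis unfolding zeta_em_def by (intro holomorphic_intros) auto
qed

text \<open>Polynomial growth comes from the factor |s| |s+1| in \<open>trap_bound\<close>; distance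
  1/2 from the real axis controls the term 1/(s-1).\<close>

lemma zeta_em_bound:
  assumes "\<sigma> > -1"
  shows "\<exists>K\<ge>0. \<forall>s. Re s \<ge> \<sigma> \<and> \<bar>Im s\<bar> \<ge> 1/2 \<longrightarrow> cmod (zeta_em s) \<le> K * (1 + cmod s)\<^sup>2"
proof -
  define M where "M = (\<Sum>n. real (Suc n) powr (- \<sigma> - 2))"
  have sm: "summable (\<lambda>n. real (Suc n) powr (- \<sigma> - 2))" using assms by (intro summable_Suc_powr) auto
  have M0: "M \<ge> 0" unfolding M_def by (intro suminf_nonneg sm) auto
  have "cmod (zeta_em s) \<le> (M + 3) * (1 + cmod s)\<^sup>2" if s: "Re s \<ge> \<sigma>" "\<bar>Im s\<bar> \<ge> 1/2" for s
  proof -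
    have s1: "s \<noteq> 1" using s by auto
    have t: "cmod (trap (Suc n) s) \<le> (1 + cmod s)\<^sup>2 * real (Suc n) powr (- \<sigma> - 2)" for n
    proof -
      have "cmod (s + 1) \<le> 1 + cmod s" using norm_triangle_ineq[of s 1] by simp
      hence "cmod s * cmod (s+1) * real (Suc n) powr (- Re s - 2) \<le> ((1 + cmod s) * (1 + cmod s)) * real (Suc n) powr (- \<sigma> - 2)"
        using s by (intro mult_mono powr_mono) auto
      thus ?thesis using trap_bound[of "Suc n" s] s s1 assms by (simp add: power2_eq_square)
    qed
    have ts: "summable (\<lambda>n. cmod (trap (Suc n) s))" using trap_summable[OF s1] s assms by simp
    have "cmod (\<Sum>n. trap (Suc n) s) \<le> (\<Sum>n. cmod (trap (Suc n) s))" by (rule summable_norm[OF ts])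
    also have "\<dots> \<le> (\<Sum>n. (1 + cmod s)\<^sup>2 * real (Suc n) powr (- \<sigma> - 2))"
      by (intro suminf_le t ts summable_mult sm)
    also have "\<dots> = (1 + cmod s)\<^sup>2 * M" unfolding M_def by (intro suminf_mult sm)
    finally have a: "cmod (\<Sum>n. trap (Suc n) s) \<le> (1 + cmod s)\<^sup>2 * M" .
    have "cmod (s - 1) \<ge> 1/2" using abs_Im_le_cmod[of "s - 1"] s by simp
    hence "cmod (1 / (s - 1)) \<le> 2" by (simp add: norm_divide divide_le_eq)
    hence "cmod (zeta_em s) \<le> 3 * 1 + (1 + cmod s)\<^sup>2 * M"
      unfolding zeta_em_def using a norm_triangle_ineq[of "1 / (s - 1) + 1/2" "\<Sum>n. trap (Suc n) s"]
        norm_triangle_ineq[of "1 / (s - 1)" "1/2"] by (simp add: norm_divide)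
    also have "\<dots> \<le> 3 * (1 + cmod s)\<^sup>2 + (1 + cmod s)\<^sup>2 * M"
      by (intro add_right_mono mult_left_mono one_le_power) auto
    finally show ?thesis by (simp add: algebra_simps)
  qed
  thus ?thesis using M0 by (intro exI[of _ "M + 3"]) auto
qed

lemma zeta_em_cnj: "Re s > -1 \<Longrightarrow> s \<noteq> 1 \<Longrightarrow> zeta_em (cnj s) = cnj (zeta_em s)"
proof -
  assume s: "Re s > -1" "s \<noteq> 1"
  have p: "of_nat (Suc n) powr (cnj w) = cnj (of_nat (Suc n) powr w)" for n w
    using cnj_powr[of "of_nat (Suc n)" w] by (simp del: of_nat_Suc)
  have t: "trap (Suc n) (cnj s) = cnj (trap (Suc n) s)" for n
    using p[of n "- s"] p[of "Suc n" "- s"] p[of n "1 - s"] p[of "Suc n" "1 - s"]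
    by (simp add: trap_def del: of_nat_Suc)
  have "(\<lambda>n. trap (Suc n) s) sums (\<Sum>n. trap (Suc n) s)"
    using summable_norm_cancel[OF trap_summable[OF s(2,1)]] by (rule summable_sums)
  hence "(\<lambda>n. cnj (trap (Suc n) s)) sums cnj (\<Sum>n. trap (Suc n) s)" by (simp add: sums_cnj)
  thus ?thesis unfolding zeta_em_def t by (simp add: sums_iff)
qed

text \<open>The trapezoids count every term of the series once, except that n = 1 is counted by
  half, and the exact integrals telescope to 1/(s-1).\<close>

lemma zeta_em_eq_dzeta:
  assumes s: "Re s > 1"
  shows "zeta_em s = dzeta s"
proof -
  have d: "(\<lambda>n. of_nat (Suc n) powr (-s)) sums dzeta s" by (rule dzeta_sums[OF s])
  have d': "(\<lambda>n. of_nat (Suc (Suc n)) powr (-s)) sums (dzeta s - 1)"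
    using d by (subst sums_Suc_iff) (simp add: algebra_simps)
  have "(\<lambda>n. of_nat (Suc n) powr (1 - s)) \<longlonglongrightarrow> (0::complex)"
  proof (rule tendsto_norm_zero_cancel)
    have "(\<lambda>n. real (Suc n) powr (1 - Re s)) \<longlonglongrightarrow> 0" using s by real_asymp
    thus "(\<lambda>n. cmod (of_nat (Suc n) powr (1 - s))) \<longlonglongrightarrow> 0" unfolding norm_Suc_powr by simp
  qed
  from telescope_sums[OF this]
  have t: "(\<lambda>n. of_nat (Suc (Suc n)) powr (1 - s) - of_nat (Suc n) powr (1 - s)) sums (0 - 1 :: complex)"
    by simp
  have "(\<lambda>n. trap (Suc n) s) sums ((dzeta s + (dzeta s - 1)) / 2 - (0 - 1) / (1 - s))"
    unfolding trap_def by (intro sums_diff sums_divide sums_add d d' t)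
  hence "(\<Sum>n. trap (Suc n) s) = dzeta s - 1/2 + 1 / (1 - s)"
    by (simp add: sums_iff field_simps)
  moreover have "1 / (s - 1) = - (1 / (1 - s))" by (metis minus_diff_eq minus_divide_right)
  ultimately show ?thesis unfolding zeta_em_def by simp
qed

text \<open>\<open>zeta\<close> is a definite description, so it is usable only after a continuation
  to the whole plane has been exhibited. The Mellin transform of 1/(exp p - 1) provides one;
  multiplying by the entire function \<open>rGamma\<close> removes \<open>Gamma\<close> without
  creating poles.\<close>

lemma zeta_props:
  shows zeta_nicely_meromorphic: "zeta nicely_meromorphic_on UNIV"
    and zeta_eq_dzeta: "\<And>s. Re s > 1 \<Longrightarrow> zeta s = dzeta s"
proof -
  obtain \<rho> where \<rho>: "decaying \<rho>" "\<And>w. w \<in> wedge 1 \<Longrightarrow> w \<noteq> 0 \<Longrightarrow> \<rho> w = 1 / (exp w - 1) - exp (- w) / w"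
    using planck_decaying by blast
  have sub: "ball 0 (1/2) \<subseteq> wedge 1"
  proof
    fix w :: complex assume "w \<in> ball 0 (1/2)"
    thus "w \<in> wedge 1" using abs_Re_le_cmod[of w] abs_Im_le_cmod[of w] by (auto simp: wedge_def)
  qed
  define L where "L = (\<lambda>p::real. 1 / (exp (complex_of_real p) - 1))"
  have ne: "exp (complex_of_real p) \<noteq> 1" if "p > 0" for p
  proof
    assume "exp (complex_of_real p) = 1"
    hence "complex_of_real (exp p) = of_real 1" by (simp add: exp_of_real)
    hence "exp p = 1" unfolding of_real_eq_iff .
    thus False using that by simp
  qed
  have "\<exists>h. h meromorphic_on {s. Re s > - real N} \<and> (\<forall>s. Re s > 1 \<and> Re s > - real N \<longrightarrow> h s = dzeta s)" for N
  proof -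
    have "dzeta s = dzeta s" for s by simp
    obtain \<Phi> where \<Phi>: "\<Phi> meromorphic_on {s. Re s > - real N}"
      "\<And>s. Re s > 1 \<Longrightarrow> \<Phi> s = (LINT p:{0<..}|lborel. L p * of_real p powr (s - 1))"
    \<comment> \<open>Near 0 the product p L(p) equals a holomorphic function exactly, so there is
      no logarithmic part and the error constant is 0.\<close>
    proof (rule mellin_continuation[of L "\<lambda>w. exp (- w) + w * \<rho> w" "1/2" "\<lambda>_. 0" 0 N 2 1])
      show "continuous_on {0<..} L" unfolding L_def using ne by (intro continuous_intros) auto
      show "(\<lambda>w. exp (- w) + w * \<rho> w) holomorphic_on ball 0 (1/2)"
        using \<rho>(1) sub by (intro holomorphic_intros) (auto simp: decaying_def intro: holomorphic_on_subset)
      show "cmod (of_real p * L p - (exp (- of_real p) + of_real p * \<rho> (of_real p) + 0 * of_real (ln p))) \<le> 0 * p ^ (N + 2)"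
        if "0 < p" "p < 1/2" for p
      proof -
        have "\<rho> (of_real p) = 1 / (exp (of_real p) - 1) - exp (- of_real p) / of_real p"
          using that by (intro \<rho>(2)) (auto simp: wedge_def)
        thus ?thesis using that by (simp add: L_def right_diff_distrib)
      qed
      show "cmod (L p) \<le> 2 * exp (- 1 * p)" if "p \<ge> 1" for p
      proof -
        have "cmod (L p) \<le> exp (- p) / (1 - exp (- p))" using planck_bound[of p 0] that by (simp add: L_def)
        moreover have "exp (- p) \<le> 1/2"
        proof -
          have "exp p \<ge> 2" using exp_ge_add_one_self[of p] that by linarith
          thus ?thesis by (simp add: exp_minus field_simps)
        qed
        hence "exp (- p) / (1 - exp (- p)) \<le> exp (- p) / (1/2)" using that by (intro divide_left_mono) auto
        ultimately show ?thesis by simp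
      qed
    qed auto
    have "rGamma meromorphic_on {s. Re s > - real N}"
      by (intro analytic_on_imp_meromorphic_on analytic_intros)
    hence "(\<lambda>s. rGamma s * \<Phi> s) meromorphic_on {s. Re s > - real N}"
      by (intro meromorphic_intros \<Phi>(1))
    moreover have "rGamma s * \<Phi> s = dzeta s" if "Re s > 1" for s
    proof -
      have "s \<notin> \<int>\<^sub>\<le>\<^sub>0" using that by (auto elim!: nonpos_Ints_cases)
      hence "rGamma s * Gamma s = 1" by (simp add: rGamma_inverse_Gamma Gamma_eq_zero_iff)
      thus ?thesis using \<Phi>(2)[OF that] mellin_planck(2)[OF that] unfolding L_def
        by (metis mult.assoc mult_1)
    qed
    ultimately show ?thesis by blast
  qed
  moreover have "dzeta holomorphic_on {s. Re s > 1}"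
  proof -
    have "zeta_em holomorphic_on {s. Re s > 1}" by (rule holomorphic_on_subset[OF zeta_em_holomorphic]) auto
    thus ?thesis by (rule holomorphic_transform) (auto simp: zeta_em_eq_dzeta)
  qed
  ultimately obtain g where g: "g nicely_meromorphic_on UNIV" "\<And>s. Re s > 1 \<Longrightarrow> g s = dzeta s"
    using meromorphic_glue[of dzeta 1] by blast
  have "zeta = g" unfolding zeta_def
  proof (rule meromorphic_continuation_eqI[OF g(1)])
    show "open {s. Re s > 1}" by (rule open_halfspace_Re_gt)
    have "2 \<in> {s. Re s > 1}" by simp
    thus "{s. Re s > 1} \<noteq> {}" by blast
  qed (use g(2) in \<open>auto simp: dzeta_def\<close>)
  thus "zeta nicely_meromorphic_on UNIV" "\<And>s. Re s > 1 \<Longrightarrow> zeta s = dzeta s" using g by auto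
qed

lemma zeta_eq_zeta_em:
  assumes "Re s > -1" "s \<noteq> 1"
  shows "zeta s = zeta_em s"
proof (rule nicely_meromorphic_eqI[where f = zeta and g = zeta_em and z = s and S = "{s. Re s > -1} - {1}" and A = "{s. Re s > 1}"])
  have op: "open ({s. Re s > -1} - {1})" by (intro open_Diff open_halfspace_Re_gt) auto
  show "zeta nicely_meromorphic_on {s. Re s > -1} - {1}"
    by (rule nicely_meromorphic_on_subset[OF zeta_nicely_meromorphic]) auto
  show "zeta_em nicely_meromorphic_on {s. Re s > -1} - {1}"
    by (intro analytic_on_imp_nicely_meromorphic_on) (use zeta_em_holomorphic op in \<open>auto simp: analytic_on_open\<close>)
  show "connected ({s. Re s > -1} - {1})"
    by (intro connected_open_delete open_halfspace_Re_gt connected_halfplane_Re_gt) auto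
  have "2 \<in> {s. Re s > 1}" by simp
  thus "{s. Re s > 1} \<noteq> {}" by blast
qed (use assms in \<open>auto simp: zeta_eq_dzeta zeta_em_eq_dzeta intro!: open_Diff open_halfspace_Re_gt\<close>)

section \<open>Partial fractions and the functional equation\<close>

text \<open>Logarithmic differentiation of the reflection formula gives pi cot(pi z) = Digamma(1-z)
  - Digamma(z), and the limit formula for \<open>Digamma\<close> expands both terms.\<close>

lemma pi_cot_sums:
  fixes z :: complex
  assumes z: "z \<notin> \<int>"
  shows "(\<lambda>n. 2 * z / (z\<^sup>2 - of_nat (Suc n) ^ 2)) sums (of_real pi * cot (of_real pi * z) - 1 / z)"
proof -
  have z0: "z \<noteq> 0" "1 - z \<noteq> 0" using z by auto
  have nz: "z \<notin> \<int>\<^sub>\<le>\<^sub>0" "1 - z \<notin> \<int>\<^sub>\<le>\<^sub>0"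
    using z nonpos_Ints_Int[of z] nonpos_Ints_Int[of "1 - z"] by (auto dest: Ints_diff[of 1 "1 - z"])
  have sn: "sin (of_real pi * z) \<noteq> 0"
    using z by (auto simp: sin_eq_0)
  have refl: "Digamma (1 - z) - Digamma z = of_real pi * cot (of_real pi * z)"
  proof -
    \<comment> \<open>By reflection \<open>g\<close> is constant off the integers, so the derivative
      computed by the product rule must vanish.\<close>
    define g where "g = (\<lambda>z::complex. Gamma z * Gamma (1 - z) * sin (of_real pi * z))"
    have op: "open (- \<int> :: complex set)" by (intro open_Compl closed_Ints)
    have "g w = of_real pi" if "w \<in> - \<int>" for w
    proof -
      have "sin (of_real pi * w) \<noteq> 0" using that by (auto simp: sin_eq_0)
      thus ?thesis unfolding g_def Gamma_reflection_complex by simp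
    qed
    hence "(g has_field_derivative 0) (at z)"
      using z op by (intro has_field_derivative_transform_within_open[of "\<lambda>_. of_real pi" 0 z "- \<int>" g]) auto
    moreover have "(g has_field_derivative
        Gamma z * Gamma (1 - z) * ((Digamma z - Digamma (1 - z)) * sin (of_real pi * z) + of_real pi * cos (of_real pi * z))) (at z)"
      unfolding g_def using nz by (auto intro!: derivative_eq_intros simp: algebra_simps)
    ultimately have "Gamma z * Gamma (1 - z) * ((Digamma z - Digamma (1 - z)) * sin (of_real pi * z) + of_real pi * cos (of_real pi * z)) = 0"
      using DERIV_unique by metis
    hence "(Digamma z - Digamma (1 - z)) * sin (of_real pi * z) + of_real pi * cos (of_real pi * z) = 0"
      using nz by (simp add: Gamma_eq_zero_iff)
    thus ?thesis using sn by (simp add: cot_def field_simps)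
  qed
  have "(\<lambda>m. (of_real (ln (real m)) - (\<Sum>n<m. inverse (1 - z + of_nat n))) - (of_real (ln (real m)) - (\<Sum>n<m. inverse (z + of_nat n))))
      \<longlonglongrightarrow> Digamma (1 - z) - Digamma z"
    by (intro tendsto_diff Digamma_LIMSEQ z0)
  moreover have "(\<lambda>m. inverse (z + of_nat m)) \<longlonglongrightarrow> 0"
    by (intro tendsto_inverse_0[THEN filterlim_compose] tendsto_add_filterlim_at_infinity[OF tendsto_const] tendsto_of_nat)
  \<comment> \<open>Adding inverse(z + m), which tends to 0, and removing inverse z shifts one sum
    by an index, so that its terms pair up with those of the other.\<close>
  ultimately have "(\<lambda>m. ((of_real (ln (real m)) - (\<Sum>n<m. inverse (1 - z + of_nat n))) - (of_real (ln (real m)) - (\<Sum>n<m. inverse (z + of_nat n)))) + inverse (z + of_nat m) - inverse z)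
      \<longlonglongrightarrow> of_real pi * cot (of_real pi * z) + 0 - inverse z"
    unfolding refl by (intro tendsto_intros)
  moreover have "((of_real (ln (real m)) - (\<Sum>n<m. inverse (1 - z + of_nat n))) - (of_real (ln (real m)) - (\<Sum>n<m. inverse (z + of_nat n)))) + inverse (z + of_nat m) - inverse z
       = (\<Sum>n<m. 2 * z / (z\<^sup>2 - of_nat (Suc n) ^ 2))" for m
  proof -
    have t: "2 * z / (z\<^sup>2 - of_nat (Suc n) ^ 2) = inverse (z + of_nat (Suc n)) - inverse (1 - z + of_nat n)" for n
    proof -
      define A B where "A = z + of_nat (Suc n)" and "B = of_nat (Suc n) - z"
      have nz: "A \<noteq> 0" "B \<noteq> 0"
        using z Ints_minus[OF Ints_of_nat[of "Suc n"]] unfolding A_def B_def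
        by (auto simp: add_eq_0_iff2 simp del: of_nat_Suc)
      have e1: "1 - z + of_nat n = B" by (simp add: B_def)
      have e2: "z\<^sup>2 - of_nat (Suc n) ^ 2 = - (A * B)"
        by (simp add: power2_eq_square algebra_simps A_def B_def)
      have e3: "B - A = - (2 * z)" by (simp add: A_def B_def)
      have "inverse A - inverse B = (B - A) / (A * B)" using nz by (simp add: field_simps)
      thus ?thesis unfolding e1 e2 e3 A_def[symmetric] by simp
    qed
    have "(\<Sum>n<m. inverse (z + of_nat n)) + inverse (z + of_nat m) = inverse z + (\<Sum>n<m. inverse (z + of_nat (Suc n)))"
      using sum.lessThan_Suc_shift[of "\<lambda>n. inverse (z + of_nat n)" m] by simp
    thus ?thesis unfolding t sum_subtractf by (simp add: algebra_simps)
  qed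
  ultimately show ?thesis by (simp add: sums_def inverse_eq_divide)
qed

text \<open>The cotangent expansion on the imaginary axis: cot(i u/2) = -i coth(u/2) and coth(u/2) =
  1 + 2/(exp u - 1).\<close>

lemma planck_partial_fractions:
  fixes u :: real
  assumes u: "u > 0"
  shows "(\<lambda>k. 2 * u / (u\<^sup>2 + (2 * pi * real (Suc k))\<^sup>2)) sums (1 / (exp u - 1) - 1 / u + 1 / 2)"
proof -
  define z where "z = \<i> * of_real (u / (2 * pi))"
  have "Im z \<noteq> 0" using u by (simp add: z_def)
  hence z: "z \<notin> \<int>" by (auto elim!: Ints_cases)
  have t: "2 * z / (z\<^sup>2 - of_nat (Suc n) ^ 2) = - 2 * pi * \<i> * of_real (2 * u / (u\<^sup>2 + (2 * pi * real (Suc n))\<^sup>2))" for n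
  proof -
    have e1: "z\<^sup>2 - of_nat (Suc n) ^ 2 = - of_real ((u\<^sup>2 + (2 * pi * real (Suc n))\<^sup>2) / (2 * pi)\<^sup>2)"
      by (simp add: z_def power_mult_distrib power_divide add_divide_distrib del: of_nat_Suc)
    have e2: "2 * z / (- of_real (X / (2 * pi)\<^sup>2)) = - 2 * pi * \<i> * of_real (2 * u / X)" for X
      by (simp add: z_def field_simps power2_eq_square)
    show ?thesis unfolding e1 e2 ..
  qed
  have c: "of_real pi * cot (of_real pi * z) - 1 / z = - 2 * pi * \<i> * of_real (1 / (exp u - 1) - 1 / u + 1 / 2)"
  proof -
    have a: "of_real pi * z = \<i> * of_real (u / 2)" by (simp add: z_def)
    have e: "exp (\<i> * (\<i> * complex_of_real (u/2))) = of_real (exp (- u/2))" "exp (- (\<i> * (\<i> * complex_of_real (u/2)))) = of_real (exp (u/2))"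
    proof -
      have "\<i> * (\<i> * complex_of_real (u/2)) = of_real (- u/2)" "- (\<i> * (\<i> * complex_of_real (u/2))) = of_real (u/2)"
        by (simp_all flip: mult.assoc)
      thus "exp (\<i> * (\<i> * complex_of_real (u/2))) = of_real (exp (- u/2))"
           "exp (- (\<i> * (\<i> * complex_of_real (u/2)))) = of_real (exp (u/2))"
        by (simp_all only: exp_of_real)
    qed
    have E: "exp (u/2) * exp (u/2) = exp u" "exp (u/2) * exp (- u/2) = 1" by (simp_all flip: exp_add)
    have ne: "exp (u/2) - exp (- u/2) \<noteq> 0" using u by simp
    have "cot (\<i> * of_real (u / 2)) = - \<i> * of_real ((exp (u/2) + exp (- u/2)) / (exp (u/2) - exp (- u/2)))"
    proof -
      have "((x + y) / 2) / ((x - y) / (2 * \<i>)) = - \<i> * ((y + x) / (y - x))" if "y - x \<noteq> 0" for x y :: complex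
      proof -
        have "y \<noteq> x" using that by auto
        thus ?thesis by (simp add: divide_simps) (simp add: algebra_simps)
      qed
      from this[of "of_real (exp (u/2))" "of_real (exp (- u/2))"] show ?thesis
        unfolding cot_def cos_exp_eq sin_exp_eq e using ne by (simp flip: of_real_diff)
    qed
    also have "(exp (u/2) + exp (- u/2)) / (exp (u/2) - exp (- u/2)) = (exp u + 1) / (exp u - 1)"
    proof -
      have "(exp (u/2) + exp (- u/2)) / (exp (u/2) - exp (- u/2)) = (exp (u/2) * (exp (u/2) + exp (- u/2))) / (exp (u/2) * (exp (u/2) - exp (- u/2)))"
        by simp
      thus ?thesis unfolding ring_distribs E .
    qed
    also have "\<dots> = 1 + 2 * (1 / (exp u - 1))" using u by (simp add: field_simps)
    finally have c1: "of_real pi * cot (of_real pi * z) = - of_real pi * (\<i> * of_real (1 + 2 * (1 / (exp u - 1))))"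
      unfolding a by simp
    have c2: "1 / z = - 2 * pi * \<i> * of_real (1 / u)" using u by (simp add: z_def field_simps)
    show ?thesis unfolding c1 c2 of_real_add of_real_diff of_real_mult by (simp add: algebra_simps)
  qed
  have "(\<lambda>n. - 2 * pi * \<i> * of_real (2 * u / (u\<^sup>2 + (2 * pi * real (Suc n))\<^sup>2))) sums (- 2 * pi * \<i> * of_real (1 / (exp u - 1) - 1 / u + 1 / 2))"
    using pi_cot_sums[OF z] unfolding t c .
  from sums_mult[OF this, of "1 / (- 2 * pi * \<i>)"]
  have "(\<lambda>n. complex_of_real (2 * u / (u\<^sup>2 + (2 * pi * real (Suc n))\<^sup>2))) sums of_real (1 / (exp u - 1) - 1 / u + 1 / 2)"
    by (simp add: mult.assoc[symmetric] del: of_nat_Suc of_real_add of_real_diff of_real_divide of_real_mult)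
  thus ?thesis unfolding sums_of_real_iff .
qed

text \<open>The substitution v = c sqrt(t/(1-t)) gives the Beta integral with parameters (s+1)/2 and
  (1-s)/2. These add up to 1, so the reflection formula evaluates it.\<close>

lemma beta_integral_squares:
  fixes s c :: real
  assumes s: "-1 < s" "s < 1" and c: "c > 0"
  shows "set_integrable lborel {0<..} (\<lambda>v. 2 * v / (v\<^sup>2 + c\<^sup>2) * v powr (s - 1))"
    and "(LINT v:{0<..}|lborel. 2 * v / (v\<^sup>2 + c\<^sup>2) * v powr (s - 1)) = c powr (s - 1) * pi / cos (pi * s / 2)"
proof -
  define a b where "a = (s + 1) / 2" and "b = (1 - s) / 2"
  have ab: "a > 0" "b > 0" "a + b = 1" using s by (auto simp: a_def b_def field_simps)
  define f where "f = (\<lambda>v. 2 * v / (v\<^sup>2 + c\<^sup>2) * v powr (s - 1))"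
  define g where "g = (\<lambda>t. c * (t powr (1/2) * (1 - t) powr (- (1/2))))"
  \<comment> \<open>The logarithmic derivative of \<open>g\<close> is 1/(2t) + 1/(2(1-t)) =
    1/(2t(1-t)).\<close>
  define g' where "g' = (\<lambda>t. g t / (2 * t * (1 - t)))"
  have gpos: "g t > 0" if "t \<in> {0<..<1}" for t using that c by (simp add: g_def)
  have g2: "(g t)\<^sup>2 = c\<^sup>2 * t / (1 - t)" if "t \<in> {0<..<1}" for t
  proof -
    have "(t powr (1/2))\<^sup>2 = t" "((1 - t) powr (- (1/2)))\<^sup>2 = 1 / (1 - t)"
      by (subst powr_power; use that in \<open>simp add: powr_minus_divide\<close>)+
    thus ?thesis by (simp add: g_def power_mult_distrib)
  qed
  have der: "(g has_field_derivative g' t) (at t within {0<..<1})" if t: "t \<in> {0<..<1}" for t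
  proof -
    have "(g has_field_derivative c * ((1/2) * t powr (1/2 - 1) * (1 - t) powr (- (1/2)) + t powr (1/2) * ((1/2) * (1 - t) powr (- (1/2) - 1)))) (at t within {0<..<1})"
      unfolding g_def using t by (auto intro!: derivative_eq_intros simp: field_simps)
    also have "c * ((1/2) * t powr (1/2 - 1) * (1 - t) powr (- (1/2)) + t powr (1/2) * ((1/2) * (1 - t) powr (- (1/2) - 1)))
       = g t / (2 * t) + g t / (2 * (1 - t))"
    proof -
      have "t powr (1/2 - 1) = t powr (1/2) / t" using t by (subst powr_diff) auto
      moreover have "(1 - t) powr (- (1/2) - 1) = (1 - t) powr (- (1/2)) / (1 - t)" using t by (subst powr_diff) auto
      ultimately show ?thesis using t by (simp only: g_def) (simp add: field_simps)
    qed
    also have "\<dots> = g' t" using t by (simp add: g'_def divide_simps) (simp add: algebra_simps)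
    finally show ?thesis .
  qed
  have inj: "inj_on g {0<..<1}"
  proof (rule inj_onI)
    fix x y assume xy: "x \<in> {0<..<1}" "y \<in> {0<..<1}" "g x = g y"
    hence "c\<^sup>2 * x / (1 - x) = c\<^sup>2 * y / (1 - y)" using g2 by metis
    thus "x = y" using xy c by (simp add: divide_simps) (simp add: algebra_simps)
  qed
  have img: "g ` {0<..<1} = {0<..}"
  proof
    show "g ` {0<..<1} \<subseteq> {0<..}" using gpos by auto
    show "{0<..} \<subseteq> g ` {0<..<1}"
    proof
      fix v :: real assume v: "v \<in> {0<..}"
      define t where "t = v\<^sup>2 / (v\<^sup>2 + c\<^sup>2)"
      have pos: "v\<^sup>2 > 0" "c\<^sup>2 > 0" using v c by auto
      have "p / (p + q) \<in> {0<..<1}" if "p > 0" "q > 0" for p q :: real using that by (simp add: field_simps)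
      from this[OF pos] have t: "t \<in> {0<..<1}" by (simp add: t_def)
      have "1 - t = c\<^sup>2 / (v\<^sup>2 + c\<^sup>2)" using pos by (simp add: t_def field_simps)
      hence "(g t)\<^sup>2 = v\<^sup>2" using pos unfolding g2[OF t] by (simp add: t_def)
      hence "g t = v" using gpos[OF t] v by (simp add: power2_eq_iff)
      thus "v \<in> g ` {0<..<1}" using t by blast
    qed
  qed
  have fg: "\<bar>g' t\<bar> * f (g t) = c powr (s - 1) * (t powr (a - 1) * (1 - t) powr (b - 1))" if t: "t \<in> {0<..<1}" for t
  proof -
    note gp = gpos[OF t]
    have den: "(g t)\<^sup>2 + c\<^sup>2 = c\<^sup>2 / (1 - t)" using t by (simp add: g2[OF t] field_simps)
    have "\<bar>g' t\<bar> * f (g t) = (g t / (2 * t * (1 - t))) * (2 * g t / (c\<^sup>2 / (1 - t)) * (g t) powr (s - 1))"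
      using t gp by (simp add: g'_def f_def den)
    also have "\<dots> = (g t)\<^sup>2 * g t powr (s - 1) / (t * c\<^sup>2)"
    proof -
      have "x / (2 * t * r) * (2 * x / (q / r) * P) = x\<^sup>2 * P / (t * q)" if "r \<noteq> 0" "t \<noteq> 0" "q \<noteq> 0" for x r q P :: real
        using that by (simp add: field_simps power2_eq_square)
      thus ?thesis using t c by (metis (no_types, lifting) diff_gt_0_iff_gt greaterThanLessThan_iff less_irrefl zero_less_power)
    qed
    also have "\<dots> = g t powr (s - 1) / (1 - t)"
      using t c by (simp add: g2[OF t])
    also have "g t powr (s - 1) = c powr (s - 1) * (t powr (1/2 * (s - 1)) * (1 - t) powr (- (1/2) * (s - 1)))"
      using t c by (simp add: g_def powr_mult powr_powr)
    also have "1/2 * (s - 1) = a - 1" by (simp add: a_def field_simps)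
    also have "- (1/2) * (s - 1) = (b - 1) + 1" by (simp add: b_def field_simps)
    also have "c powr (s - 1) * (t powr (a - 1) * (1 - t) powr (b - 1 + 1)) / (1 - t) =
       c powr (s - 1) * (t powr (a - 1) * (1 - t) powr (b - 1))"
    proof -
      have "(1 - t) powr (b - 1 + 1) = (1 - t) powr (b - 1) * (1 - t)"
        by (subst powr_add) (use t in simp)
      thus ?thesis using t by (simp only:) simp
    qed
    finally show ?thesis .
  qed
  have "((\<lambda>t. t powr (a - 1) * (1 - t) powr (b - 1)) has_integral Beta a b) {0..1}"
    by (rule has_integral_Beta_real[OF ab(1,2)])
  hence B: "((\<lambda>t. c powr (s - 1) * (t powr (a - 1) * (1 - t) powr (b - 1))) has_integral c powr (s - 1) * Beta a b) {0<..<1}"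
    by (intro has_integral_mult_right) (simp add: has_integral_Icc_iff_Ioo)
  have B2: "((\<lambda>t. \<bar>g' t\<bar> * f (g t)) has_integral c powr (s - 1) * Beta a b) {0<..<1}"
    using B by (rule has_integral_eq[rotated]) (use fg in auto)
  have nn: "(\<lambda>t. \<bar>g' t\<bar> * f (g t)) absolutely_integrable_on {0<..<1}"
    by (rule nonnegative_absolutely_integrable_1) (use B2 fg in \<open>auto simp: has_integral_integrable\<close>)
  have "f absolutely_integrable_on (g ` {0<..<1}) \<and> integral (g ` {0<..<1}) f = c powr (s - 1) * Beta a b"
    using has_absolute_integral_change_of_variables_1'[OF _ der inj, of f "c powr (s - 1) * Beta a b"] nn B2
    by (auto simp: integral_unique)
  hence 1: "f absolutely_integrable_on {0<..}" and 2: "integral {0<..} f = c powr (s - 1) * Beta a b"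
    by (auto simp: img)
  have "set_borel_measurable borel {0<..} f" unfolding f_def
    by (intro set_borel_measurable_continuous_on continuous_intros) (use c in \<open>auto simp: add_nonneg_eq_0_iff\<close>)
  hence si: "set_integrable lborel {0<..} f"
    using 1 unfolding set_integrable_def set_borel_measurable_def by (subst (asm) integrable_completion) auto
  thus "set_integrable lborel {0<..} (\<lambda>v. 2 * v / (v\<^sup>2 + c\<^sup>2) * v powr (s - 1))" by (simp add: f_def)
  have ba: "complex_of_real b = 1 - of_real a" by (simp add: a_def b_def field_simps)
  have "complex_of_real (Gamma a * Gamma b) = Gamma (of_real a) * Gamma (of_real b)"
    by (simp add: Gamma_complex_of_real)
  also have "\<dots> = of_real pi / sin (of_real pi * of_real a)"
    unfolding ba by (rule Gamma_reflection_complex)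
  also have "\<dots> = complex_of_real (pi / sin (pi * a))" by (simp flip: sin_of_real)
  finally have "Gamma a * Gamma b = pi / sin (pi * a)" unfolding of_real_eq_iff .
  moreover have "sin (pi * a) = cos (pi * s / 2)"
    unfolding sin_cos_eq a_def by (simp add: field_simps cos_diff)
  ultimately have "Beta a b = pi / cos (pi * s / 2)" using ab by (simp add: Beta_def)
  thus "(LINT v:{0<..}|lborel. 2 * v / (v\<^sup>2 + c\<^sup>2) * v powr (s - 1)) = c powr (s - 1) * pi / cos (pi * s / 2)"
    using set_borel_integral_eq_integral(2)[OF si] 2 by (simp add: f_def)
qed

lemma integral_Ici_FTC:
  fixes F f :: "real \<Rightarrow> 'a::euclidean_space"
  assumes D: "\<And>x. x \<ge> 1 \<Longrightarrow> (F has_vector_derivative f x) (at x)"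
    and cont: "continuous_on {1..} f"
    and int: "set_integrable lborel {1..} f"
    and lim: "(F \<longlongrightarrow> 0) at_top"
  shows "(LINT x:{1..}|lborel. f x) = - F 1"
proof -
  have "(LBINT x=ereal 1..\<infinity>. f x) = 0 - F 1"
  proof (rule interval_integral_FTC_integrable[where F = F])
    show "set_integrable lborel (einterval (ereal 1) \<infinity>) f"
      by (rule set_integrable_subset[OF int]) (auto simp: einterval_def)
    show "(F has_vector_derivative f x) (at x)" if "ereal 1 < ereal x" for x
      using D[of x] that by simp
    show "isCont f x" if "ereal 1 < ereal x" for x
      using continuous_on_interior[OF cont, of x] that by simp
    have "isCont F 1" using D[of 1] has_vector_derivative_continuous by auto
    hence "(F \<longlongrightarrow> F 1) (at_right 1)"
      by (auto simp: isCont_def intro: tendsto_within_subset)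
    thus "((F \<circ> real_of_ereal) \<longlongrightarrow> F 1) (at_right (ereal 1))"
      unfolding ereal_tendsto_simps .
    show "((F \<circ> real_of_ereal) \<longlongrightarrow> 0) (at_left \<infinity>)"
      unfolding ereal_tendsto_simps by (rule lim)
  qed auto
  moreover have "(LBINT x=ereal 1..\<infinity>. f x) = (LINT x:{1..}|lborel. f x)"
  proof -
    have "AE x in lborel. indicat_real {1<..} x *\<^sub>R f x = indicat_real {1..} x *\<^sub>R f x"
      using AE_lborel_singleton[of "1::real"] by eventually_elim (auto simp: indicator_def)
    moreover have "set_integrable lborel {1<..} f"
      by (rule set_integrable_subset[OF int]) auto
    ultimately have "(LINT x:{1<..}|lborel. f x) = (LINT x:{1..}|lborel. f x)"
      using int unfolding set_lebesgue_integral_def set_integrable_def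
      by (intro integral_cong_AE borel_measurable_integrable)
    thus ?thesis by (simp add: interval_integral_to_infinity_eq)
  qed
  ultimately show ?thesis by simp
qed

lemma integral_Ici_powr:
  fixes w :: complex
  assumes w: "Re w < 0"
  shows "set_integrable lborel {1..} (\<lambda>u. of_real u powr (w - 1))"
    and "(LINT u:{1..}|lborel. of_real u powr (w - 1)) = - 1 / w"
proof -
  have w0: "w \<noteq> 0" using w by auto
  have "set_integrable lborel {1..} (\<lambda>u::real. u powr (Re w - 1))"
  proof -
    have "((\<lambda>u. u powr (Re w - 1)) has_integral - (1 powr (Re w - 1 + 1)) / (Re w - 1 + 1)) {1..}"
      by (rule has_integral_powr_to_inf) (use w in auto)
    hence "(\<lambda>u. u powr (Re w - 1)) absolutely_integrable_on {1..}"
      by (intro nonnegative_absolutely_integrable_1) (auto simp: has_integral_integrable)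
    moreover have "set_borel_measurable borel {1..} (\<lambda>u::real. u powr (Re w - 1))"
      by (intro set_borel_measurable_continuous_on continuous_intros) auto
    ultimately show ?thesis
      unfolding set_integrable_def set_borel_measurable_def by (subst (asm) integrable_completion) auto
  qed
  thus i: "set_integrable lborel {1..} (\<lambda>u. complex_of_real u powr (w - 1))"
    by (rule set_integrable_continuous_bound[rotated 2]) (auto intro!: continuous_intros simp: norm_of_real_powr)
  have "(LINT u:{1..}|lborel. complex_of_real u powr (w - 1)) = - (complex_of_real 1 powr w / w)"
  proof (rule integral_Ici_FTC[where F = "\<lambda>u. complex_of_real u powr w / w"])
    show "((\<lambda>u. complex_of_real u powr w / w) has_vector_derivative complex_of_real x powr (w - 1)) (at x)"
      if "x \<ge> 1" for x
      using that w0 by (auto intro!: derivative_eq_intros has_vector_derivative_real_field)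
    have "((\<lambda>u. u powr Re w) \<longlongrightarrow> 0) at_top" using w by real_asymp
    hence "((\<lambda>u. complex_of_real u powr w) \<longlongrightarrow> 0) at_top"
      by (rule tendsto_norm_zero_cancel[OF Lim_transform_eventually])
         (auto simp: norm_of_real_powr intro!: eventually_mono[OF eventually_gt_at_top[of 0]])
    from tendsto_divide[OF this tendsto_const w0]
    show "((\<lambda>u. complex_of_real u powr w / w) \<longlongrightarrow> 0) at_top" by simp
  qed (auto intro!: continuous_intros i)
  thus "(LINT u:{1..}|lborel. complex_of_real u powr (w - 1)) = - 1 / w" by simp
qed

text \<open>
  For \<open>-1 < s < 0\<close>, \<open>\<Gamma>(s) \<zeta>(s)\<close> is the Mellin transform of \<open>1/(e\<^sup>u - 1) - 1/u + 1/2\<close>, which is evaluated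
  termwise on the partial fractions \<open>\<Sum> 2u/(u\<^sup>2 + (2\<pi>k)\<^sup>2)\<close>.
\<close>
lemma zeta_functional_equation_real:
  fixes s :: real
  assumes s: "-1 < s" "s < 0"
  shows "zeta (of_real s) = rGamma (of_real s) * dzeta (1 - of_real s) * of_real ((2 * pi) powr (s - 1) * pi / cos (pi * s / 2))"
proof -
  define \<rho> where "\<rho> = (\<lambda>u::real. 1 / (exp u - 1) - 1 / u + 1 / 2)"
  \<comment> \<open>The k-th partial fraction is the dilate h(u/k)/k, so the Dirichlet series
    produced by \<open>mellin_dilation_sum\<close> is the one at 1 - s.\<close>
  define h where "h = (\<lambda>v::real. 2 * v / (v\<^sup>2 + (2 * pi)\<^sup>2))"
  define M where "M = (\<Sum>k. 2 / (2 * pi * real (Suc k))\<^sup>2)"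
  have sM: "summable (\<lambda>k. 2 / (2 * pi * real (Suc k))\<^sup>2)"
  proof -
    have "summable (\<lambda>k. (2 / (2 * pi)\<^sup>2) * real (Suc k) powr (-2))"
      by (intro summable_mult summable_Suc_powr) auto
    moreover have "(2 / (2 * pi)\<^sup>2) * real (Suc k) powr (-2) = 2 / (2 * pi * real (Suc k))\<^sup>2" for k
      by (simp add: powr_minus_divide powr_numeral power_mult_distrib del: of_nat_Suc)
    ultimately show ?thesis by (simp only:)
  qed
  have term_eq: "of_real (1 / real (Suc k)) * complex_of_real (h (1 / real (Suc k) * u)) = of_real (2 * u / (u\<^sup>2 + (2 * pi * real (Suc k))\<^sup>2))" if "u > 0" for u k
  proof -
    have "1 / n * (2 * (1 / n * u) / ((1 / n * u)\<^sup>2 + (2 * pi)\<^sup>2)) = 2 * u / (u\<^sup>2 + (2 * pi * n)\<^sup>2)" if n: "n > 0" for n :: real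
    proof -
      have "(1 / n * u)\<^sup>2 + (2 * pi)\<^sup>2 = (u\<^sup>2 + (2 * pi * n)\<^sup>2) / n\<^sup>2" using n by (simp add: field_simps)
      moreover have "u\<^sup>2 + (2 * pi * n)\<^sup>2 > 0" using \<open>u > 0\<close> by (intro add_pos_nonneg) auto
      ultimately show ?thesis using n by (simp add: field_simps power2_eq_square)
    qed
    from this[of "real (Suc k)"] show ?thesis unfolding h_def of_real_mult[symmetric]
      by (simp only: of_nat_0_less_iff zero_less_Suc)
  qed
  have pos_term: "0 \<le> 2 * u / (u\<^sup>2 + (2 * pi * real (Suc k))\<^sup>2)" if "u > 0" for u k
    using that by (intro divide_nonneg_nonneg add_nonneg_nonneg) auto
  have \<rho>_sums: "(\<lambda>k. 2 * u / (u\<^sup>2 + (2 * pi * real (Suc k))\<^sup>2)) sums \<rho> u" if "u > 0" for u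
    unfolding \<rho>_def by (rule planck_partial_fractions[OF that])
  have \<rho>_nonneg: "0 \<le> \<rho> u" if "u > 0" for u
    by (rule sums_le[OF pos_term[OF that] sums_zero \<rho>_sums[OF that]])
  \<comment> \<open>Linear vanishing at 0 lets the integral over (0, 1) converge as far as Re z >
    -1.\<close>
  have \<rho>_le: "\<rho> u \<le> M * u" if "u > 0" for u
  proof -
    have "\<rho> u = (\<Sum>k. 2 * u / (u\<^sup>2 + (2 * pi * real (Suc k))\<^sup>2))" using \<rho>_sums[OF that] by (simp add: sums_iff)
    also have "\<dots> \<le> (\<Sum>k. 2 / (2 * pi * real (Suc k))\<^sup>2 * u)"
    proof (rule suminf_le[OF _ sums_summable[OF \<rho>_sums[OF that]] summable_mult2[OF sM]])
      fix k
      have "2 * u / (u\<^sup>2 + (2 * pi * real (Suc k))\<^sup>2) \<le> 2 * u / (2 * pi * real (Suc k))\<^sup>2"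
        using that by (intro divide_left_mono mult_pos_pos add_nonneg_pos) auto
      thus "2 * u / (u\<^sup>2 + (2 * pi * real (Suc k))\<^sup>2) \<le> 2 / (2 * pi * real (Suc k))\<^sup>2 * u" by (simp del: of_nat_Suc)
    qed
    also have "\<dots> = M * u" unfolding M_def using suminf_mult2[OF sM] by simp
    finally show ?thesis .
  qed
  have cont_\<rho>: "continuous_on {0<..} \<rho>" unfolding \<rho>_def by (intro continuous_intros) auto
  \<comment> \<open>The terms -1/u + 1/2 of \<open>\<rho>\<close> are kept only on (0, 1), where
    they regularise the integrand; on [1, \<infinity>) they would spoil the decay.\<close>
  define J0 where "J0 = (\<lambda>z. LINT u:{0<..<1}|lborel. of_real (\<rho> u) * complex_of_real u powr (z - 1))"
  define J1 where "J1 = (\<lambda>z. LINT u:{1..}|lborel. of_real (1 / (exp u - 1)) * complex_of_real u powr (z - 1))"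
  have M0: "M \<ge> 0" unfolding M_def by (intro suminf_nonneg sM) auto
  have b0: "cmod (of_real (\<rho> u) * complex_of_real u powr (z - 1)) \<le> M * u powr (e - 1)"
    if "u \<in> {0<..<1}" "Re z \<ge> e - 1" for u z e
  proof -
    have "cmod (of_real (\<rho> u) * complex_of_real u powr (z - 1)) \<le> (M * u) * u powr (Re z - 1)"
      using that \<rho>_nonneg[of u] \<rho>_le[of u] by (simp add: norm_mult norm_of_real_powr mult_right_mono)
    also have "\<dots> = M * (u powr 1 * u powr (Re z - 1))" by (subst powr_one) (use that in auto)
    also have "u powr 1 * u powr (Re z - 1) = u powr (Re z)" by (subst powr_add[symmetric]) simp
    also have "M * u powr (Re z) \<le> M * u powr (e - 1)" using that M0 by (intro mult_left_mono powr_mono') auto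
    finally show ?thesis .
  qed
  have si0: "set_integrable lborel {0<..<1} (\<lambda>u. M * u powr (e - 1))" if "e > 0" for e :: real
  proof -
    have "set_integrable lborel {0<..<1} (\<lambda>u. cmod (complex_of_real u powr (of_real e - 1)))"
      by (rule set_integrable_norm[OF integral_Ioo_powr(1)]) (use that in simp)
    hence "set_integrable lborel {0<..<1} (\<lambda>u. u powr (e - 1))"
      by (rule set_integrable_cong[THEN iffD1, OF refl refl, rotated]) (auto simp: norm_of_real_powr)
    thus ?thesis by (rule set_integrable_mult_right)
  qed
  have i0: "set_integrable lborel {0<..<1} (\<lambda>u. of_real (\<rho> u) * complex_of_real u powr (z - 1))" if "Re z > -1" for z
    by (rule set_integrable_continuous_bound[OF _ _ si0[of "Re z + 1"] b0])
       (use that in \<open>auto intro!: continuous_intros continuous_on_subset[OF cont_\<rho>]\<close>)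
  have hol0: "J0 holomorphic_on {z. Re z > -1}"
    unfolding J0_def
  proof (rule holomorphic_on_set_integral)
    show "\<exists>r>0. \<exists>G. set_integrable lborel {0<..<1} G \<and>
        (\<forall>z\<in>ball z0 r \<inter> {z. - 1 < Re z}. \<forall>x\<in>{0<..<1}. cmod (of_real (\<rho> x) * of_real x powr (z - 1)) \<le> G x)"
      if "z0 \<in> {z. - 1 < Re z}" for z0
    proof (intro exI[of _ "(Re z0 + 1) / 2"] exI[of _ "\<lambda>u. M * u powr ((Re z0 + 1) / 2 - 1)"] conjI ballI)
      fix z x assume z: "z \<in> ball z0 ((Re z0 + 1) / 2) \<inter> {z. - 1 < Re z}" "x \<in> {0<..<1::real}"
      have "\<bar>Re (z0 - z)\<bar> \<le> cmod (z0 - z)" by (rule abs_Re_le_cmod)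
      hence "Re z0 - Re z \<le> (Re z0 + 1) / 2" using z by (auto simp: dist_norm)
      hence "(Re z0 + 1) / 2 - 1 \<le> Re z" by (simp add: field_simps)
      thus "cmod (of_real (\<rho> x) * of_real x powr (z - 1)) \<le> M * x powr ((Re z0 + 1) / 2 - 1)"
        using b0 z by blast
    next
      show "set_integrable lborel {0<..<1} (\<lambda>u. M * u powr ((Re z0 + 1) / 2 - 1))"
        by (rule si0) (use that in simp)
      show "0 < (Re z0 + 1) / 2" using that by simp
    qed
    show "set_borel_measurable borel {0<..<1} (\<lambda>u. of_real (\<rho> u) * complex_of_real u powr (z - 1))" for z
      by (intro set_borel_measurable_continuous_on continuous_intros continuous_on_subset[OF cont_\<rho>]) auto
  qed (auto intro!: holomorphic_intros simp: open_halfspace_Re_gt)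
  have e1: "1 / (exp u - 1) \<le> 2 * exp (- u)" if "u \<ge> 1" for u :: real
  proof -
    have e2: "exp u \<ge> 2" using exp_ge_add_one_self[of u] that by linarith
    have "1 / (exp u - 1) \<le> 1 / (exp u / 2)" using e2 that by (intro divide_left_mono mult_pos_pos) auto
    thus ?thesis by (simp add: exp_minus inverse_eq_divide)
  qed
  have b1: "cmod (of_real (1 / (exp u - 1)) * complex_of_real u powr (z - 1)) \<le> 2 * (u powr R * exp (- 1 * u))"
    if "u \<in> {1..}" "Re z - 1 \<le> R" for u z R
  proof -
    have "cmod (of_real (1 / (exp u - 1)) * complex_of_real u powr (z - 1)) = 1 / (exp u - 1) * u powr (Re z - 1)"
    proof -
      have r0: "0 \<le> 1 / (exp u - 1)" using that by simp
      show ?thesis unfolding norm_mult norm_of_real abs_of_nonneg[OF r0]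
        using that by (simp add: norm_of_real_powr)
    qed
    also have "\<dots> \<le> 2 * exp (- u) * u powr R"
      using that e1[of u] by (intro mult_mono powr_mono) auto
    finally show ?thesis by (simp add: mult_ac)
  qed
  have si1: "set_integrable lborel {1..} (\<lambda>u::real. 2 * (u powr R * exp (- 1 * u)))" if "R \<ge> 0" for R
    by (intro set_integrable_mult_right set_integrable_subset[OF set_integrable_powr_exp[of R 1]]) (use that in auto)
  have i1: "set_integrable lborel {1..} (\<lambda>u. of_real (1 / (exp u - 1)) * complex_of_real u powr (z - 1))" for z
    by (rule set_integrable_continuous_bound[OF _ _ si1[of "\<bar>Re z\<bar>"] b1])
       (auto intro!: continuous_intros)
  have hol1: "J1 holomorphic_on UNIV"
    unfolding J1_def
  proof (rule holomorphic_on_set_integral)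
    show "\<exists>r>0. \<exists>G. set_integrable lborel {1..} G \<and>
        (\<forall>z\<in>ball z0 r \<inter> UNIV. \<forall>x\<in>{1..}. cmod (of_real (1 / (exp x - 1)) * of_real x powr (z - 1)) \<le> G x)" for z0
    proof (intro exI[of _ "1::real"] exI[of _ "\<lambda>u. 2 * (u powr \<bar>Re z0\<bar> * exp (- 1 * u))"] conjI ballI)
      fix z x assume z: "z \<in> ball z0 1 \<inter> UNIV" "x \<in> {1::real..}"
      have "\<bar>Re (z - z0)\<bar> \<le> cmod (z - z0)" by (rule abs_Re_le_cmod)
      hence "Re z - 1 \<le> \<bar>Re z0\<bar>" using z by (auto simp: dist_norm norm_minus_commute)
      thus "cmod (of_real (1 / (exp x - 1)) * of_real x powr (z - 1)) \<le> 2 * (x powr \<bar>Re z0\<bar> * exp (- 1 * x))"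
        by (intro b1 z)
    qed (use si1 in auto)
    show "set_borel_measurable borel {1..} (\<lambda>u. of_real (1 / (exp u - 1)) * complex_of_real u powr (z - 1))" for z
      by (intro set_borel_measurable_continuous_on continuous_intros) auto
  qed (auto intro!: holomorphic_intros)
  \<comment> \<open>The rational terms are the integral of (1/u - 1/2) u^(z-1) over (0, 1) when Re z
    > 1, and that of (-1/u + 1/2) u^(z-1) over [1, \<infinity>) when -1 < Re z < 0. Hence one
    formula covers both ranges.\<close>
  define H where "H = (\<lambda>z. J0 z + J1 z + 1 / (z - 1) - 1 / (2 * z))"
  have un: "{0<..<1} \<union> {1..} = {0::real<..}" by auto
  have H_right: "H z = Gamma z * dzeta z" if z: "Re z > 1" for z
  proof -
    have pw: "complex_of_real u powr (z - 1) / of_real u = of_real u powr (z - 1 - 1)" if "u \<in> {0<..<1}" for u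
      using that by (simp add: powr_diff power2_eq_square)
    have iz: "set_integrable lborel {0<..<1} (\<lambda>u. complex_of_real u powr (z - 1 - 1))"
             "(LINT u:{0<..<1}|lborel. complex_of_real u powr (z - 1 - 1)) = 1 / (z - 1)"
      using integral_Ioo_powr(1,2)[of "z - 1"] z by auto
    have iz2: "set_integrable lborel {0<..<1} (\<lambda>u. 1/2 * complex_of_real u powr (z - 1))"
              "(LINT u:{0<..<1}|lborel. 1/2 * complex_of_real u powr (z - 1)) = 1/2 * (1 / z)"
      using integral_Ioo_powr(1,2)[of z] z by (auto intro!: set_integrable_mult_right)
    have dec: "1 / (exp (of_real u) - 1) * complex_of_real u powr (z - 1) =
        of_real (\<rho> u) * of_real u powr (z - 1) + of_real u powr (z - 1 - 1) - 1/2 * of_real u powr (z - 1)" if u: "u \<in> {0<..<1}" for u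
    proof -
      have e: "1 / (exp (of_real u) - 1) = complex_of_real (\<rho> u) + 1 / of_real u - 1 / 2"
        by (simp add: \<rho>_def exp_of_real)
      show ?thesis unfolding pw[OF u, symmetric] e by (simp add: ring_distribs)
    qed
    have z1: "Re z > -1" using z by simp
    have "(LINT u:{0<..<1}|lborel. 1 / (exp (of_real u) - 1) * complex_of_real u powr (z - 1)) =
        (LINT u:{0<..<1}|lborel. of_real (\<rho> u) * of_real u powr (z - 1) + of_real u powr (z - 1 - 1) - 1/2 * complex_of_real u powr (z - 1))"
      by (rule set_lebesgue_integral_cong) (use dec in auto)
    also have "\<dots> = J0 z + 1 / (z - 1) - 1/2 * (1 / z)"
      using i0[OF z1] iz iz2 by (simp only: set_integral_add set_integral_diff J0_def)
    finally have A: "(LINT u:{0<..<1}|lborel. 1 / (exp (of_real u) - 1) * complex_of_real u powr (z - 1)) = J0 z + 1 / (z - 1) - 1/2 * (1 / z)" .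
    have J1': "J1 z = (LINT u:{1..}|lborel. 1 / (exp (of_real u) - 1) * complex_of_real u powr (z - 1))"
      unfolding J1_def by (simp add: exp_of_real)
    note full = mellin_planck[OF z]
    have sub: "set_integrable lborel {0<..<1} (\<lambda>u. 1 / (exp (of_real u) - 1) * complex_of_real u powr (z - 1))"
              "set_integrable lborel {1..} (\<lambda>u. 1 / (exp (of_real u) - 1) * complex_of_real u powr (z - 1))"
      by (rule set_integrable_subset[OF full(1)]; auto)+
    have "Gamma z * dzeta z = (LINT u:{0<..<1} \<union> {1..}|lborel. 1 / (exp (of_real u) - 1) * complex_of_real u powr (z - 1))"
      unfolding un by (rule full(2)[symmetric])
    also have "\<dots> = (J0 z + 1 / (z - 1) - 1/2 * (1 / z)) + J1 z"
      unfolding A[symmetric] J1' by (rule set_integral_Un[OF _ sub]) auto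
    finally show ?thesis by (simp add: H_def)
  qed
  \<comment> \<open>Besides the pole at 1, the point 0 is removed because of the summand 1/(2z) in
    \<open>H\<close>.\<close>
  define T where "T = {z. Re z > -1} - {0, 1::complex}"
  have openT: "open T" unfolding T_def by (intro open_Diff open_halfspace_Re_gt) auto
  have connT: "connected T" unfolding T_def
    by (intro connected_open_delete_finite open_halfspace_Re_gt connected_halfplane_Re_gt) auto
  have eq: "rGamma z * H z = zeta_em z" if "z \<in> T" for z
  proof (rule nicely_meromorphic_eqI[where f = "\<lambda>z. rGamma z * H z" and g = zeta_em and z = z and S = T and A = "{z. Re z > 1}"])
    have "(\<lambda>z. rGamma z * H z) holomorphic_on T"
      unfolding H_def by (intro holomorphic_intros holomorphic_on_subset[OF hol0] holomorphic_on_subset[OF hol1]) (auto simp: T_def)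
    thus "(\<lambda>z. rGamma z * H z) nicely_meromorphic_on T"
      using openT by (intro analytic_on_imp_nicely_meromorphic_on) (auto simp: analytic_on_open)
    have "zeta_em holomorphic_on T"
      by (rule holomorphic_on_subset[OF zeta_em_holomorphic]) (auto simp: T_def)
    thus "zeta_em nicely_meromorphic_on T"
      using openT by (intro analytic_on_imp_nicely_meromorphic_on) (auto simp: analytic_on_open)
    have "2 \<in> {z. Re z > 1}" by simp
    thus "{z. Re z > 1} \<noteq> {}" by blast
    show "rGamma z * H z = zeta_em z" if "z \<in> {z. Re z > 1}" for z
    proof -
      have "z \<notin> \<int>\<^sub>\<le>\<^sub>0" using that by (auto elim!: nonpos_Ints_cases)
      hence "rGamma z * Gamma z = 1" by (simp add: rGamma_inverse_Gamma Gamma_eq_zero_iff)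
      thus ?thesis using that H_right[of z] zeta_em_eq_dzeta[of z] by (simp flip: mult.assoc)
    qed
  qed (use that openT connT in \<open>auto simp: T_def open_halfspace_Re_gt\<close>)
  define s' where "s' = complex_of_real s"
  have sT: "s' \<in> T" using s by (auto simp: T_def s'_def)
  have re: "Re s' > -1" "Re s' < 0" "Re (s' - 1) < 0" using s by (auto simp: s'_def)
  have LH: "(LINT u:{0<..}|lborel. of_real (\<rho> u) * complex_of_real u powr (s' - 1)) = H s'"
  proof -
    have dec: "of_real (\<rho> u) * complex_of_real u powr (s' - 1) =
       of_real (1 / (exp u - 1)) * complex_of_real u powr (s' - 1) - of_real u powr (s' - 1 - 1) + 1/2 * of_real u powr (s' - 1)" if u: "u \<in> {1..}" for u
    proof -
      have "complex_of_real u powr (s' - 1 - 1) = of_real u powr (s' - 1) / of_real u" using u by (simp add: powr_diff power2_eq_square)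
      thus ?thesis by (simp add: \<rho>_def algebra_simps)
    qed
    have j1: "set_integrable lborel {1..} (\<lambda>u. complex_of_real u powr (s' - 1 - 1))"
       "(LINT u:{1..}|lborel. complex_of_real u powr (s' - 1 - 1)) = - 1 / (s' - 1)"
      using integral_Ici_powr[OF re(3)] by auto
    have j2: "set_integrable lborel {1..} (\<lambda>u. 1/2 * complex_of_real u powr (s' - 1))"
       "(LINT u:{1..}|lborel. 1/2 * complex_of_real u powr (s' - 1)) = 1/2 * (- 1 / s')"
      using integral_Ici_powr[OF re(2)] by (auto intro!: set_integrable_mult_right)
    note j3 = set_integral_add[OF set_integral_diff(1)[OF i1[of s'] j1(1)] j2(1)]
    have k: "set_integrable lborel {1..} (\<lambda>u. of_real (\<rho> u) * complex_of_real u powr (s' - 1))"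
      by (rule set_integrable_cong[THEN iffD1, OF refl refl _ j3(1)]) (use dec in auto)
    have kv: "(LINT u:{1..}|lborel. of_real (\<rho> u) * complex_of_real u powr (s' - 1)) = J1 s' - (- 1 / (s' - 1)) + 1/2 * (- 1 / s')"
    proof -
      have "(LINT u:{1..}|lborel. of_real (\<rho> u) * complex_of_real u powr (s' - 1)) =
         (LINT u:{1..}|lborel. of_real (1 / (exp u - 1)) * complex_of_real u powr (s' - 1) - of_real u powr (s' - 1 - 1) + 1/2 * complex_of_real u powr (s' - 1))"
        by (rule set_lebesgue_integral_cong) (use dec in auto)
      also have "\<dots> = J1 s' - (- 1 / (s' - 1)) + 1/2 * (- 1 / s')"
        unfolding j3(2) j2(2) set_integral_diff(2)[OF i1[of s'] j1(1)] j1(2) J1_def ..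
      finally show ?thesis .
    qed
    have "(LINT u:{0<..<1} \<union> {1..}|lborel. of_real (\<rho> u) * complex_of_real u powr (s' - 1)) = J0 s' + (J1 s' - (- 1 / (s' - 1)) + 1/2 * (- 1 / s'))"
      unfolding J0_def kv[symmetric] by (rule set_integral_Un[OF _ i0[OF re(1)] k]) auto
    thus ?thesis unfolding un H_def by simp
  qed
  have s1: "s < 1" using s by simp
  note beta = beta_integral_squares[OF s(1) s1, of "2 * pi"]
  have beta1: "set_integrable lborel {0<..} (\<lambda>v. h v * v powr (s - 1))"
    and beta2: "(LINT v:{0<..}|lborel. h v * v powr (s - 1)) = (2 * pi) powr (s - 1) * pi / cos (pi * s / 2)"
    using beta by (auto simp: h_def)
  have hc: "of_real (h u) * complex_of_real u powr (s' - 1) = of_real (h u * u powr (s - 1))" if "u \<in> {0<..}" for u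
  proof -
    have "s' - 1 = of_real (s - 1)" by (simp add: s'_def)
    thus ?thesis using powr_of_real[of u "s - 1"] that by (simp only: of_real_mult greaterThan_iff less_imp_le)
  qed
  have hi: "set_integrable lborel {0<..} (\<lambda>u. of_real (h u) * complex_of_real u powr (s' - 1))"
  proof -
    have "set_integrable lborel {0<..} (\<lambda>u. complex_of_real (h u * u powr (s - 1)))"
      using integrable_of_real[OF beta1[unfolded set_integrable_def], where 'a = complex]
      by (simp add: set_integrable_def scaleR_conv_of_real)
    thus ?thesis by (rule set_integrable_cong[THEN iffD1, OF refl refl, rotated]) (rule hc[symmetric])
  qed
  have hv: "(LINT u:{0<..}|lborel. of_real (h u) * complex_of_real u powr (s' - 1)) = of_real ((2 * pi) powr (s - 1) * pi / cos (pi * s / 2))"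
  proof -
    have "(LINT u:{0<..}|lborel. of_real (h u) * complex_of_real u powr (s' - 1)) = (LINT u:{0<..}|lborel. complex_of_real (h u * u powr (s - 1)))"
      by (rule set_lebesgue_integral_cong) (use hc in auto)
    also have "\<dots> = of_real (LINT v:{0<..}|lborel. h v * v powr (s - 1))" by (rule set_integral_complex_of_real)
    finally show ?thesis unfolding beta2 .
  qed
  have inv_powr: "(1 / real (Suc k)) powr (- s) = real (Suc k) powr s" for k
    by (simp add: powr_divide powr_minus_divide del: of_nat_Suc)
  have c: "summable (\<lambda>k. \<bar>1 / real (Suc k)\<bar> * (1 / real (Suc k)) powr (- Re s'))"
  proof -
    have "\<bar>1 / real (Suc k)\<bar> * (1 / real (Suc k)) powr (- Re s') = real (Suc k) powr (s - 1)" for k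
      using inv_powr[of k] by (simp add: s'_def powr_diff del: of_nat_Suc)
    thus ?thesis using summable_Suc_powr[of "s - 1"] s by (simp del: of_nat_Suc)
  qed
  have pt: "summable (\<lambda>k. norm (of_real (1 / real (Suc k)) * complex_of_real (h (1 / real (Suc k) * u))))" if "u > 0" for u
    unfolding term_eq[OF that] norm_of_real abs_of_nonneg[OF pos_term[OF that]]
    by (rule sums_summable[OF \<rho>_sums[OF that]])
  have \<rho>_eq: "(\<Sum>k. of_real (1 / real (Suc k)) * complex_of_real (h (1 / real (Suc k) * u))) = of_real (\<rho> u)" if "u > 0" for u
    unfolding term_eq[OF that] using \<rho>_sums[OF that] by (simp add: sums_iff suminf_of_real[symmetric] del: of_nat_Suc of_real_divide of_real_mult of_real_add)
  have dz: "(\<Sum>k. of_real (1 / real (Suc k)) * complex_of_real (1 / real (Suc k)) powr (- s')) = dzeta (1 - s')"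
  proof -
    have "of_real (1 / real (Suc k)) * complex_of_real (1 / real (Suc k)) powr (- s') = of_nat (Suc k) powr (- (1 - s'))" for k
    proof -
      have "complex_of_real (1 / real (Suc k)) powr (- s') = of_real ((1 / real (Suc k)) powr (- s))"
        unfolding s'_def of_real_minus[symmetric] by (rule powr_of_real) (auto simp del: of_nat_Suc)
      also have "\<dots> = of_nat (Suc k) powr s'"
        unfolding inv_powr s'_def using powr_of_real[of "real (Suc k)" s] by (simp del: of_nat_Suc)
      finally show ?thesis by (simp add: powr_diff del: of_nat_Suc)
    qed
    thus ?thesis by (simp add: dzeta_def del: of_nat_Suc)
  qed
  have "(LINT u:{0<..}|lborel. of_real (\<rho> u) * complex_of_real u powr (s' - 1)) =
     (LINT u:{0<..}|lborel. (\<Sum>k. of_real (1 / real (Suc k)) * complex_of_real (h (1 / real (Suc k) * u))) * complex_of_real u powr (s' - 1))"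
    by (rule set_lebesgue_integral_cong) (use \<rho>_eq in auto)
  also have "\<dots> = dzeta (1 - s') * of_real ((2 * pi) powr (s - 1) * pi / cos (pi * s / 2))"
    unfolding hv[symmetric] dz[symmetric]
    by (rule mellin_dilation_sum(2)[OF hi _ c pt]) auto
  finally have "H s' = dzeta (1 - s') * of_real ((2 * pi) powr (s - 1) * pi / cos (pi * s / 2))"
    unfolding LH .
  moreover have "zeta s' = rGamma s' * H s'"
    using eq[OF sT] zeta_eq_zeta_em[of s'] sT by (auto simp: T_def)
  ultimately show ?thesis unfolding s'_def by (simp add: mult.assoc)
qed

text \<open>The equation for real s in (-1, 0) spreads to the strip by the identity theorem and is
  used at s = 1 - w. Reflection of \<open>rGamma\<close> and the double-angle formula trade 1/cos
  for a cosine, written as two exponentials because these separate the growing and the decaying part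
  on Re w = 3/2.\<close>

lemma zeta_functional_equation:
  assumes w: "1 < Re w" "Re w < 2"
  shows "zeta w * zeta (1 - w) = of_real (2 * pi) powr (- w) * (exp (\<i> * of_real pi * w / 2) + exp (- (\<i> * of_real pi * w / 2))) * (Gamma w * (dzeta w)\<^sup>2)"
proof -
  define S where "S = {s::complex. -1 < Re s} \<inter> {s. Re s < 0}"
  have openS: "open S" unfolding S_def by (intro open_Int open_halfspace_Re_gt open_halfspace_Re_lt)
  have "convex S" unfolding S_def by (intro convex_Int convex_halfspace_Re_gt convex_halfspace_Re_lt)
  hence connS: "connected S" by (rule convex_connected)
  define R where "R = (\<lambda>s::complex. rGamma s * dzeta (1 - s) * (of_real (2 * pi) powr (s - 1) * of_real pi / cos (of_real pi * s / 2)))"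
  have cos0: "cos (of_real pi * s / 2) \<noteq> 0" if "s \<in> S" for s
  proof
    assume "cos (of_real pi * s / 2) = 0"
    then obtain n::int where "of_real pi * s / 2 = of_real (n * pi) + of_real pi / 2"
      by (auto simp: cos_eq_0)
    hence "of_real pi * s = of_real pi * (2 * of_int n + 1)" by (simp add: field_simps)
    hence "s = of_real (2 * of_int n + 1)" by (subst (asm) mult_cancel_left) simp
    hence "Re s = 2 * of_int n + 1" by simp
    hence "-1 < 2 * real_of_int n + 1" "2 * real_of_int n + 1 < 0" using that by (auto simp: S_def)
    hence "n > -1" "n < 0" by linarith+
    thus False by simp
  qed
  have dzh: "dzeta holomorphic_on {s. Re s > 1}"
  proof -
    have "zeta_em holomorphic_on {s. Re s > 1}" by (rule holomorphic_on_subset[OF zeta_em_holomorphic]) auto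
    thus ?thesis by (rule holomorphic_transform) (auto simp: zeta_em_eq_dzeta)
  qed
  have "(dzeta \<circ> (\<lambda>s. 1 - s)) holomorphic_on S"
    by (rule holomorphic_on_compose_gen[OF _ dzh]) (auto intro!: holomorphic_intros simp: S_def)
  hence "(\<lambda>s. dzeta (1 - s)) holomorphic_on S" by (simp add: comp_def)
  hence "R holomorphic_on S" unfolding R_def using cos0 by (intro holomorphic_intros) auto
  moreover have "zeta holomorphic_on S"
  proof -
    have "zeta_em holomorphic_on S" by (rule holomorphic_on_subset[OF zeta_em_holomorphic]) (auto simp: S_def)
    moreover have "zeta_em s = zeta s" if "s \<in> S" for s
      using zeta_eq_zeta_em[of s] that by (force simp: S_def)
    ultimately show ?thesis by (rule holomorphic_transform)
  qed
  ultimately have hd: "(\<lambda>s. zeta s - R s) holomorphic_on S" by (intro holomorphic_intros)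
  have lp: "complex_of_real (-1/2) islimpt of_real ` {-1<..<0}"
  proof (rule islimpt_isCont_image[where f = complex_of_real])
    show "(-1/2::real) islimpt {-1<..<0}" by (rule open_imp_islimpt) auto
    show "\<forall>\<^sub>F y in at (-1/2::real). complex_of_real y \<noteq> complex_of_real (-1/2)"
      by (auto simp: eventually_at_filter simp flip: of_real_minus of_real_divide)
  qed auto
  have "zeta (1 - w) - R (1 - w) = 0"
  proof (rule analytic_continuation[OF hd openS connS _ _ lp])
    show "zeta z - R z = 0" if "z \<in> of_real ` {-1<..<0}" for z
    proof -
      from that obtain s :: real where "z = of_real s" "s \<in> {-1<..<0}" by (elim imageE)
      hence s: "z = of_real s" "-1 < s" "s < 0" by auto
      have "complex_of_real ((2 * pi) powr (s - 1)) = of_real (2 * pi) powr (of_real s - 1)"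
        using powr_of_real[of "2 * pi" "s - 1"] by simp
      moreover have "complex_of_real (cos (pi * s / 2)) = cos (of_real pi * of_real s / 2)"
        by (simp flip: cos_of_real)
      ultimately show ?thesis using zeta_functional_equation_real[OF s(2,3)] unfolding R_def s(1) by simp
    qed
  qed (use w in \<open>auto simp: S_def\<close>)
  hence z1: "zeta (1 - w) = rGamma (1 - w) * dzeta w * (of_real (2 * pi) powr (- w) * of_real pi / cos (of_real pi * (1 - w) / 2))"
    by (simp add: R_def)
  define x where "x = of_real pi * w / 2"
  have c: "cos (of_real pi * (1 - w) / 2) = sin x"
    unfolding sin_cos_eq x_def by (simp add: field_simps)
  have sx: "sin x \<noteq> 0" using cos0[of "1 - w"] w unfolding c by (simp add: S_def)
  have "w \<notin> \<int>\<^sub>\<le>\<^sub>0" using w by (auto elim!: nonpos_Ints_cases)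
  hence g: "rGamma w * Gamma w = 1" by (simp add: rGamma_inverse_Gamma Gamma_eq_zero_iff)
  have "rGamma w * rGamma (1 - w) = sin (of_real pi * w) / of_real pi" by (rule rGamma_reflection_complex)
  also have "of_real pi * w = 2 * x" by (simp add: x_def)
  finally have "rGamma w * rGamma (1 - w) = 2 * sin x * cos x / of_real pi" by (simp add: sin_double)
  hence "rGamma (1 - w) = Gamma w * (2 * sin x * cos x / of_real pi)" using g
    by (metis mult.assoc mult.commute mult_1)
  hence "zeta (1 - w) = Gamma w * dzeta w * of_real (2 * pi) powr (- w) * (2 * cos x)"
    unfolding z1 c using sx by simp
  moreover have "2 * cos x = exp (\<i> * of_real pi * w / 2) + exp (- (\<i> * of_real pi * w / 2))"
    by (simp add: cos_exp_eq x_def mult.assoc)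
  moreover have "zeta w = dzeta w" using zeta_eq_dzeta w by simp
  ultimately show ?thesis by (simp add: power2_eq_square)
qed

lemma real_planck_bound:
  fixes x :: real assumes "x > 0"
  shows "1 / (exp (real (Suc k) * x) - 1) \<le> exp (- x) ^ Suc k / (1 - exp (- x))"
proof -
  have "exp (complex_of_real (real (Suc k) * x)) - 1 = of_real (exp (real (Suc k) * x) - 1)"
    by (simp only: exp_of_real of_real_diff of_real_1)
  hence "cmod (1 / (exp (of_real (real (Suc k) * x)) - 1)) = \<bar>1 / (exp (real (Suc k) * x) - 1)\<bar>"
    by (metis norm_divide norm_of_real norm_one abs_divide abs_one)
  thus ?thesis using planck_bound[OF assms, of k] by linarith
qed

lemma planck_bound_complex:
  assumes "Re z > 0"
  shows "cmod (1 / (exp (of_nat (Suc k) * z) - 1)) \<le> exp (- Re z) ^ Suc k / (1 - exp (- Re z))"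
proof -
  have e: "exp (real (Suc k) * Re z) > 1" using assms by simp
  have "cmod (exp (of_nat (Suc k) * z)) - cmod 1 \<le> cmod (exp (of_nat (Suc k) * z) - 1)" by (rule norm_triangle_ineq2)
  hence "exp (real (Suc k) * Re z) - 1 \<le> cmod (exp (of_nat (Suc k) * z) - 1)"
    unfolding norm_exp_eq_Re by (simp del: of_nat_Suc)
  hence "cmod (1 / (exp (of_nat (Suc k) * z) - 1)) \<le> 1 / (exp (real (Suc k) * Re z) - 1)"
    unfolding norm_divide norm_one using e by (intro divide_left_mono mult_pos_pos) linarith+
  thus ?thesis using real_planck_bound[OF assms, of k] by linarith
qed

lemma lambert_holomorphic: "lambert holomorphic_on {z. Re z > 0}"
  unfolding lambert_def
proof (rule holomorphic_on_suminf)
  show "open {z::complex. Re z > 0}" by (rule open_halfspace_Re_gt)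
  have ne: "exp (of_nat (Suc n) * z) \<noteq> 1" if "Re z > 0" for n z
  proof
    assume "exp (of_nat (Suc n) * z) = 1"
    hence "cmod (exp (of_nat (Suc n) * z)) = 1" by simp
    hence "real (Suc n) * Re z = 0" unfolding norm_exp_eq_Re by (simp del: of_nat_Suc)
    thus False using that by simp
  qed
  show "(\<lambda>z. 1 / (exp (of_nat (Suc n) * z) - 1)) holomorphic_on {z. Re z > 0}" for n
    using ne by (intro holomorphic_intros) (auto simp del: of_nat_Suc)
  fix z0 :: complex assume z0: "z0 \<in> {z. Re z > 0}"
  define x where "x = Re z0 / 2"
  have x: "x > 0" using z0 by (simp add: x_def)
  show "\<exists>r>0. \<exists>G. summable G \<and> (\<forall>z\<in>ball z0 r \<inter> {z. Re z > 0}. \<forall>n. cmod (1 / (exp (of_nat (Suc n) * z) - 1)) \<le> G n)"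
  proof (rule exI[of _ x], intro conjI x exI[of _ "\<lambda>n. exp (- x) ^ Suc n / (1 - exp (- x))"] ballI allI)
    show "summable (\<lambda>n. exp (- x) ^ Suc n / (1 - exp (- x)))"
      using x by (intro summable_divide) (simp add: summable_Suc_iff)
    fix z n assume z: "z \<in> ball z0 x \<inter> {z. Re z > 0}"
    have "Re z0 - Re z \<le> cmod (z0 - z)" using abs_Re_le_cmod[of "z0 - z"] by simp
    hence "Re z \<ge> x" using z by (auto simp: dist_norm x_def)
    hence e: "exp (- Re z) \<le> exp (- x)" "exp (- x) < 1" using x by auto
    have "cmod (1 / (exp (of_nat (Suc n) * z) - 1)) \<le> exp (- Re z) ^ Suc n / (1 - exp (- Re z))"
      by (rule planck_bound_complex) (use z in auto)
    also have "\<dots> \<le> exp (- x) ^ Suc n / (1 - exp (- x))"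
      using e by (intro frac_le power_mono) auto
    finally show "cmod (1 / (exp (of_nat (Suc n) * z) - 1)) \<le> exp (- x) ^ Suc n / (1 - exp (- x))" .
  qed
qed

lemma integral_Ici_exp:
  fixes a :: complex
  assumes a: "Re a > 0"
  shows "set_integrable lborel {1..} (\<lambda>x. exp (- (a * of_real x)))"
    and "(LINT x:{1..}|lborel. exp (- (a * of_real x))) = exp (- a) / a"
proof -
  have a0: "a \<noteq> 0" using a by auto
  have "set_integrable lborel {1..} (\<lambda>x::real. x powr 0 * exp (- Re a * x))"
    by (rule set_integrable_subset[OF set_integrable_powr_exp[of 0 "Re a"]]) (use a in auto)
  thus i: "set_integrable lborel {1..} (\<lambda>x. exp (- (a * of_real x)))"
    by (rule set_integrable_continuous_bound[rotated 2]) (auto intro!: continuous_intros)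
  have "(LINT x:{1..}|lborel. exp (- (a * of_real x))) = - (- exp (- (a * of_real 1)) / a)"
  proof (rule integral_Ici_FTC[where F = "\<lambda>x. - exp (- (a * of_real x)) / a"])
    show "((\<lambda>x. - exp (- (a * of_real x)) / a) has_vector_derivative exp (- (a * of_real x))) (at x)" for x
    proof -
      have "((\<lambda>z. - exp (- (a * z)) / a) has_field_derivative exp (- (a * of_real x))) (at (of_real x))"
        using a0 by (auto intro!: derivative_eq_intros)
      from has_vector_derivative_real_field[OF this] show ?thesis by simp
    qed
    have "((\<lambda>x::real. exp (- (Re a * x))) \<longlongrightarrow> 0) at_top" using a by real_asymp
    hence "((\<lambda>x. exp (- (a * complex_of_real x))) \<longlongrightarrow> 0) at_top"
      by (intro tendsto_norm_zero_cancel[of "\<lambda>x. exp (- (a * complex_of_real x))"]) simp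
    from tendsto_divide[OF tendsto_minus[OF this] tendsto_const a0]
    show "((\<lambda>x. - exp (- (a * of_real x)) / a) \<longlongrightarrow> 0) at_top" by simp
  qed (auto intro!: continuous_intros i)
  thus "(LINT x:{1..}|lborel. exp (- (a * of_real x))) = exp (- a) / a" by simp
qed

subsection \<open>The Laplace transform of the squared zeta-function\<close>

text \<open>The holomorphic function of \<open>w\<close> that equals \<open>|\<zeta>(w)|\<^sup>2\<close> on the critical line.\<close>
definition zz :: "complex \<Rightarrow> complex" where
  "zz w = zeta w * zeta (1 - w)"

text \<open>In this strip both w and 1 - w lie to the right of Re = -1, so \<open>zeta_em\<close>
  represents both factors; Im w > 0 avoids the poles at 1 and 0.\<close>

lemma zz_holomorphic: "zz holomorphic_on {w. -1 < Re w \<and> Re w < 2 \<and> Im w > 0}"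
proof -
  have "zeta_em holomorphic_on {w. -1 < Re w \<and> Re w < 2 \<and> Im w > 0}"
    by (rule holomorphic_on_subset[OF zeta_em_holomorphic]) auto
  moreover have "(zeta_em \<circ> (\<lambda>w. 1 - w)) holomorphic_on {w. -1 < Re w \<and> Re w < 2 \<and> Im w > 0}"
    by (rule holomorphic_on_compose_gen[OF _ zeta_em_holomorphic]) (auto intro!: holomorphic_intros)
  ultimately have "(\<lambda>w. zeta_em w * zeta_em (1 - w)) holomorphic_on {w. -1 < Re w \<and> Re w < 2 \<and> Im w > 0}"
    unfolding comp_def by (rule holomorphic_on_mult)
  moreover have "zeta_em w * zeta_em (1 - w) = zz w" if "w \<in> {w. -1 < Re w \<and> Re w < 2 \<and> Im w > 0}" for w
  proof -
    have "w \<noteq> 1" "1 - w \<noteq> 1" using that by auto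
    thus ?thesis using that by (simp add: zz_def zeta_eq_zeta_em)
  qed
  ultimately show ?thesis by (rule holomorphic_transform)
qed

lemma zz_bound:
  obtains K where "K \<ge> 0"
    "\<And>w. -1/2 \<le> Re w \<Longrightarrow> Re w \<le> 3/2 \<Longrightarrow> Im w \<ge> 1/2 \<Longrightarrow> cmod (zz w) \<le> K * (4 + Im w) ^ 4"
proof -
  obtain K where K: "K \<ge> 0" "\<And>s. Re s \<ge> -1/2 \<Longrightarrow> \<bar>Im s\<bar> \<ge> 1/2 \<Longrightarrow> cmod (zeta_em s) \<le> K * (1 + cmod s)\<^sup>2"
    using zeta_em_bound[of "-1/2"] by auto
  have "cmod (zz w) \<le> K\<^sup>2 * (4 + Im w) ^ 4" if w: "-1/2 \<le> Re w" "Re w \<le> 3/2" "Im w \<ge> 1/2" for w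
  proof -
    have n: "cmod (zeta_em s) \<le> K * (4 + Im w)\<^sup>2" if s: "Re s \<ge> -1/2" "Re s \<le> 3/2" "\<bar>Im s\<bar> = Im w" for s
    proof -
      have "cmod s \<le> \<bar>Re s\<bar> + \<bar>Im s\<bar>" by (rule cmod_le)
      hence "1 + cmod s \<le> 4 + Im w" using s by auto
      hence "(1 + cmod s)\<^sup>2 \<le> (4 + Im w)\<^sup>2" by (intro power_mono) auto
      moreover have "cmod (zeta_em s) \<le> K * (1 + cmod s)\<^sup>2" using K(2)[of s] s w by auto
      ultimately show ?thesis using K(1) mult_left_mono by (meson order_trans)
    qed
    have "w \<noteq> 1" "1 - w \<noteq> 1" using w by auto
    hence "zz w = zeta_em w * zeta_em (1 - w)" using w by (simp add: zz_def zeta_eq_zeta_em)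
    also have "cmod \<dots> \<le> (K * (4 + Im w)\<^sup>2) * (K * (4 + Im w)\<^sup>2)"
      unfolding norm_mult using K(1) w by (intro mult_mono n) auto
    also have "\<dots> = K\<^sup>2 * (4 + Im w) ^ 4" by (simp add: power2_eq_square power4_eq_xxxx mult_ac)
    finally show ?thesis .
  qed
  thus ?thesis using that[of "K\<^sup>2"] by auto
qed

lemma poly_exp_integrable:
  fixes e :: real assumes "e > 0"
  shows "set_integrable lborel {1..} (\<lambda>x::real. K * (4 + x) ^ 4 * exp (- e * x))"
proof -
  have "set_integrable lborel {1..} (\<lambda>x::real. \<bar>K\<bar> * 5 ^ 4 * (x powr 4 * exp (- e * x)))"
    by (intro set_integrable_mult_right set_integrable_subset[OF set_integrable_powr_exp[of 4 e]]) (use assms in auto)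
  thus ?thesis
  proof (rule set_integrable_continuous_bound[rotated 2])
    fix x :: real assume x: "x \<in> {1..}"
    have "(4 + x) ^ 4 \<le> (5 * x) ^ 4" using x by (intro power_mono) auto
    hence "\<bar>K\<bar> * (4 + x) ^ 4 * exp (- e * x) \<le> \<bar>K\<bar> * (5 * x) ^ 4 * exp (- e * x)"
      by (intro mult_right_mono mult_left_mono) auto
    also have "\<dots> = \<bar>K\<bar> * 5 ^ 4 * (x powr 4 * exp (- e * x))" using x by (simp add: power_mult_distrib powr_numeral)
    finally show "norm (K * (4 + x) ^ 4 * exp (- e * x)) \<le> \<bar>K\<bar> * 5 ^ 4 * (x powr 4 * exp (- e * x))"
      using x by (simp add: abs_mult)
  qed (auto intro!: continuous_intros)
qed

text \<open>The abscissa c is a parameter because the line of integration moves from 1/2, where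
  \<open>zz\<close> is the squared modulus, to 3/2, where the zeta series converges.\<close>

definition lap :: "real \<Rightarrow> complex \<Rightarrow> complex" where
  "lap c p = (LINT x:{1..}|lborel. zz (Complex c x) * exp (- (p * of_real x)))"

lemma zz_line_continuous:
  assumes "-1 < c" "c < 2"
  shows "continuous_on {0<..} (\<lambda>x. zz (Complex c x))"
proof -
  have "continuous_on {0<..} (zz \<circ> (\<lambda>x. Complex c x))"
  proof (rule continuous_on_compose)
    show "continuous_on {0<..} (\<lambda>x. Complex c x)" unfolding Complex_eq by (intro continuous_intros)
    show "continuous_on ((\<lambda>x. Complex c x) ` {0<..}) zz"
      by (rule holomorphic_on_imp_continuous_on[OF holomorphic_on_subset[OF zz_holomorphic]]) (use assms in auto)
  qed
  thus ?thesis by (simp add: comp_def)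
qed

lemma lap_integrable:
  assumes "-1/2 \<le> c" "c \<le> 3/2" "Re p > 0"
  shows "set_integrable lborel {1..} (\<lambda>x. zz (Complex c x) * exp (- (p * of_real x)))"
proof -
  obtain K where K: "K \<ge> 0" "\<And>w. -1/2 \<le> Re w \<Longrightarrow> Re w \<le> 3/2 \<Longrightarrow> Im w \<ge> 1/2 \<Longrightarrow> cmod (zz w) \<le> K * (4 + Im w) ^ 4"
    using zz_bound by blast
  show ?thesis
  proof (rule set_integrable_continuous_bound[OF _ _ poly_exp_integrable[OF assms(3), of K]])
    show "continuous_on {1..} (\<lambda>x. zz (Complex c x) * exp (- (p * of_real x)))"
      by (intro continuous_intros continuous_on_subset[OF zz_line_continuous]) (use assms in auto)
    show "norm (zz (Complex c x) * exp (- (p * of_real x))) \<le> K * (4 + x) ^ 4 * exp (- Re p * x)" if "x \<in> {1..}" for x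
      using K(2)[of "Complex c x"] assms that by (auto simp: norm_mult intro!: mult_right_mono)
  qed auto
qed

lemma lap_holomorphic:
  assumes "-1/2 \<le> c" "c \<le> 3/2"
  shows "lap c holomorphic_on {p. Re p > 0}"
  unfolding lap_def
proof (rule holomorphic_on_set_integral)
  obtain K where K: "K \<ge> 0" "\<And>w. -1/2 \<le> Re w \<Longrightarrow> Re w \<le> 3/2 \<Longrightarrow> Im w \<ge> 1/2 \<Longrightarrow> cmod (zz w) \<le> K * (4 + Im w) ^ 4"
    using zz_bound by blast
  show "open {p::complex. Re p > 0}" by (rule open_halfspace_Re_gt)
  fix p :: complex assume p: "p \<in> {p. Re p > 0}"
  show "set_borel_measurable borel {1..} (\<lambda>x. zz (Complex c x) * exp (- (p * of_real x)))"
    by (intro set_borel_measurable_continuous_on continuous_intros continuous_on_subset[OF zz_line_continuous]) (use assms in auto)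
  show "\<exists>r>0. \<exists>G. set_integrable lborel {1..} G \<and>
        (\<forall>z\<in>ball p r \<inter> {p. Re p > 0}. \<forall>x\<in>{1..}. cmod (zz (Complex c x) * exp (- (z * of_real x))) \<le> G x)"
  proof (rule exI[of _ "Re p / 2"], intro conjI exI[of _ "\<lambda>x. K * (4 + x) ^ 4 * exp (- (Re p / 2) * x)"] ballI)
    show "set_integrable lborel {1..} (\<lambda>x. K * (4 + x) ^ 4 * exp (- (Re p / 2) * x))"
      by (rule poly_exp_integrable) (use p in simp)
    fix z x assume z: "z \<in> ball p (Re p / 2) \<inter> {p. Re p > 0}" "x \<in> {1::real..}"
    have "Re p - Re z \<le> cmod (p - z)" using abs_Re_le_cmod[of "p - z"] by simp
    hence re: "Re z \<ge> Re p / 2" using z by (auto simp: dist_norm)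
    have "cmod (zz (Complex c x) * exp (- (z * of_real x))) = cmod (zz (Complex c x)) * exp (- (Re z * x))"
      by (simp add: norm_mult)
    also have "\<dots> \<le> (K * (4 + x) ^ 4) * exp (- (Re p / 2) * x)"
      using K(2)[of "Complex c x"] K(1) assms z re by (intro mult_mono) (auto simp: mult_right_mono)
    finally show "cmod (zz (Complex c x) * exp (- (z * of_real x))) \<le> K * (4 + x) ^ 4 * exp (- (Re p / 2) * x)" .
  qed (use p in simp)
qed (auto intro!: holomorphic_intros)

text \<open>Cauchy's theorem on the half-strip above height 1: the left side gives
  \<open>lap (1/2)\<close>, the right side \<open>lap (3/2)\<close> with a phase, and the bottom
  edge an entire function of p. A primitive of the integrand on a convex domain replaces contour
  integrals.\<close>

lemma lap_shift:
  obtains h where "h holomorphic_on UNIV"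
    "\<And>p. p > 0 \<Longrightarrow> lap (1/2) (of_real p) = h (of_real p) + exp (\<i> * of_real p) * lap (3/2) (of_real p)"
proof -
  define \<Omega> where "\<Omega> = {w::complex. -1 < Re w \<and> Re w < 2 \<and> Im w > 0}"
  have \<Omega>_eq: "\<Omega> = {w. Re w > -1} \<inter> {w. Re w < 2} \<inter> {w. Im w > 0}" by (auto simp: \<Omega>_def)
  have open\<Omega>: "open \<Omega>" unfolding \<Omega>_eq
    by (intro open_Int open_halfspace_Re_gt open_halfspace_Re_lt open_halfspace_Im_gt)
  have conv\<Omega>: "convex \<Omega>" unfolding \<Omega>_eq
    by (intro convex_Int convex_halfspace_Re_gt convex_halfspace_Re_lt convex_halfspace_Im_gt)
  obtain K where K: "K \<ge> 0" "\<And>w. -1/2 \<le> Re w \<Longrightarrow> Re w \<le> 3/2 \<Longrightarrow> Im w \<ge> 1/2 \<Longrightarrow> cmod (zz w) \<le> K * (4 + Im w) ^ 4"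
    using zz_bound by blast
  define h where "h = (\<lambda>p. - \<i> * (LINT \<sigma>:{1/2..3/2}|lborel. zz (Complex \<sigma> 1) * exp (\<i> * p * (Complex \<sigma> 1 - 1/2))))"
  have czz1: "continuous_on {1/2..3/2} (\<lambda>\<sigma>. zz (Complex \<sigma> 1))"
  proof -
    have "continuous_on {1/2..3/2} (zz \<circ> (\<lambda>\<sigma>. Complex \<sigma> 1))"
    proof (rule continuous_on_compose)
      show "continuous_on {1/2..3/2} (\<lambda>\<sigma>. Complex \<sigma> 1)" unfolding Complex_eq by (intro continuous_intros)
      show "continuous_on ((\<lambda>\<sigma>. Complex \<sigma> 1) ` {1/2..3/2}) zz"
        by (rule holomorphic_on_imp_continuous_on[OF holomorphic_on_subset[OF zz_holomorphic]]) auto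
    qed
    thus ?thesis by (simp add: comp_def)
  qed
  have cC1: "continuous_on {1/2..3/2} (\<lambda>\<sigma>. Complex \<sigma> 1)" unfolding Complex_eq by (intro continuous_intros)
  have "h holomorphic_on UNIV"
    unfolding h_def
  proof (intro holomorphic_on_mult holomorphic_on_const holomorphic_on_set_integral)
    show "set_borel_measurable borel {1/2..3/2} (\<lambda>\<sigma>. zz (Complex \<sigma> 1) * exp (\<i> * p * (Complex \<sigma> 1 - 1/2)))" for p
      by (intro set_borel_measurable_continuous_on continuous_intros czz1 cC1) auto
    obtain B where B: "\<And>\<sigma>. \<sigma> \<in> {1/2..3/2} \<Longrightarrow> cmod (zz (Complex \<sigma> 1)) \<le> B"
      using compact_norm_bound[OF compact_Icc czz1] by blast
    fix z0 :: complex
    show "\<exists>r>0. \<exists>G. set_integrable lborel {1/2..3/2} G \<and>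
        (\<forall>z\<in>ball z0 r \<inter> UNIV. \<forall>x\<in>{1/2..3/2}. cmod (zz (Complex x 1) * exp (\<i> * z * (Complex x 1 - 1/2))) \<le> G x)"
    proof (rule exI[of _ "1::real"], intro conjI exI[of _ "\<lambda>_. B * exp ((cmod z0 + 1) * 2)"] ballI)
      show "set_integrable lborel {1/2..3/2::real} (\<lambda>_. B * exp ((cmod z0 + 1) * 2))"
        by (auto simp: set_integrable_def)
      fix z and x :: real assume z: "z \<in> ball z0 1 \<inter> UNIV" "x \<in> {1/2..3/2}"
      have "cmod z \<le> cmod z0 + 1" using z norm_triangle_ineq2[of z z0] by (auto simp: dist_norm norm_minus_commute)
      moreover have "cmod (Complex x 1 - 1/2) \<le> 2"
        using cmod_le[of "Complex x 1 - 1/2"] z by auto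
      ultimately have "cmod (\<i> * z * (Complex x 1 - 1/2)) \<le> (cmod z0 + 1) * 2"
        unfolding norm_mult by (intro mult_mono) auto
      hence "cmod (exp (\<i> * z * (Complex x 1 - 1/2))) \<le> exp ((cmod z0 + 1) * 2)"
        using norm_exp[of "\<i> * z * (Complex x 1 - 1/2)"] by (meson exp_le_cancel_iff order_trans)
      moreover have "0 \<le> B" using B[OF z(2)] norm_ge_zero order_trans by blast
      ultimately show "cmod (zz (Complex x 1) * exp (\<i> * z * (Complex x 1 - 1/2))) \<le> B * exp ((cmod z0 + 1) * 2)"
        unfolding norm_mult using B[OF z(2)] by (intro mult_mono) auto
    qed simp
  qed (auto intro!: holomorphic_intros)
  moreover have "lap (1/2) (of_real p) = h (of_real p) + exp (\<i> * of_real p) * lap (3/2) (of_real p)" if p: "p > 0" for p :: real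
  proof -
    \<comment> \<open>On Re w = c the exponential equals exp(-p x) times the phase exp(i p (c -
      1/2)).\<close>
    define k where "k = (\<lambda>w. zz w * exp (\<i> * of_real p * (w - 1/2)))"
    have kh: "k holomorphic_on \<Omega>" unfolding k_def using zz_holomorphic by (auto intro!: holomorphic_intros simp: \<Omega>_def)
    obtain P where P: "\<And>w. w \<in> \<Omega> \<Longrightarrow> (P has_field_derivative k w) (at w within \<Omega>)"
      using holomorphic_convex_primitive'[OF conv\<Omega> open\<Omega> kh] by blast
    have Pd: "(P has_field_derivative k w) (at w)" if "w \<in> \<Omega>" for w
      using P[OF that] at_within_open[OF that open\<Omega>] by simp
    have vert: "((\<lambda>x. k (Complex c x) * \<i>) has_integral (P (Complex c T) - P (Complex c 1))) {1..T}" if c: "-1 < c" "c < 2" and T: "T \<ge> 1" for c T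
    proof (rule fundamental_theorem_of_calculus[OF T])
      fix x assume "x \<in> {1..T}"
      hence "Complex c x \<in> \<Omega>" using c by (auto simp: \<Omega>_def)
      from Pd[OF this] have 1: "(P has_field_derivative k (Complex c x)) (at (of_real c + \<i> * of_real x))" by (simp add: Complex_eq)
      have 2: "((\<lambda>z. of_real c + \<i> * z) has_field_derivative \<i>) (at (complex_of_real x))"
        by (auto intro!: derivative_eq_intros)
      have "((\<lambda>z. P (of_real c + \<i> * z)) has_field_derivative k (Complex c x) * \<i>) (at (of_real x))"
        by (rule DERIV_chain2[OF 1 2])
      from has_vector_derivative_real_field[OF this]
      show "((\<lambda>x. P (Complex c x)) has_vector_derivative k (Complex c x) * \<i>) (at x within {1..T})"
        by (simp add: Complex_eq)
    qed
    have horiz: "((\<lambda>\<sigma>. k (Complex \<sigma> 1)) has_integral (P (Complex (3/2) 1) - P (Complex (1/2) 1))) {1/2..3/2}"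
    proof (rule fundamental_theorem_of_calculus)
      fix x :: real assume "x \<in> {1/2..3/2}"
      hence "Complex x 1 \<in> \<Omega>" by (auto simp: \<Omega>_def)
      from Pd[OF this] have 1: "(P has_field_derivative k (Complex x 1)) (at (of_real x + \<i>))" by (simp add: Complex_eq)
      have 2: "((\<lambda>z. z + \<i>) has_field_derivative 1) (at (complex_of_real x))"
        by (auto intro!: derivative_eq_intros)
      have "((\<lambda>z. P (z + \<i>)) has_field_derivative k (Complex x 1) * 1) (at (of_real x))"
        by (rule DERIV_chain2[OF 1 2])
      from has_vector_derivative_real_field[OF this]
      show "((\<lambda>x. P (Complex x 1)) has_vector_derivative k (Complex x 1)) (at x within {1/2..3/2})"
        by (simp add: Complex_eq)
    qed simp
    have hval: "h (of_real p) = - \<i> * (P (Complex (3/2) 1) - P (Complex (1/2) 1))"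
    proof -
      have "set_integrable lborel {1/2..3/2} (\<lambda>\<sigma>. k (Complex \<sigma> 1))"
        unfolding k_def by (rule borel_integrable_compact[of "{1/2..3/2}", unfolded set_integrable_def[symmetric]])
           (auto intro!: continuous_intros czz1 cC1)
      from set_borel_integral_eq_integral(2)[OF this] integral_unique[OF horiz]
      show ?thesis unfolding h_def k_def by simp
    qed
    have line: "((\<lambda>T. P (Complex c T) - P (Complex c 1)) \<longlongrightarrow> \<i> * (exp (\<i> * of_real p * (of_real c - 1/2)) * lap c (of_real p))) at_top"
      if c: "-1/2 \<le> c" "c \<le> 3/2" for c
    proof -
      have keq: "k (Complex c x) = exp (\<i> * of_real p * (of_real c - 1/2)) * (zz (Complex c x) * exp (- (of_real p * of_real x)))" for x
      proof -
        have "\<i> * of_real p * (Complex c x - 1/2) = \<i> * of_real p * (of_real c - 1/2) + - (of_real p * of_real x)"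
          by (simp add: Complex_eq algebra_simps)
        hence "exp (\<i> * of_real p * (Complex c x - 1/2)) = exp (\<i> * of_real p * (of_real c - 1/2)) * exp (- (of_real p * of_real x))"
          by (simp only: exp_add)
        thus ?thesis by (simp add: k_def mult_ac)
      qed
      have i: "set_integrable lborel {1..} (\<lambda>x. k (Complex c x) * \<i>)"
        unfolding keq using lap_integrable[OF c, of "of_real p"] p by (intro set_integrable_mult_left set_integrable_mult_right) auto
      have t: "((\<lambda>T. LINT x:{1..T}|lborel. k (Complex c x) * \<i>) \<longlongrightarrow> (LINT x:{1..}|lborel. k (Complex c x) * \<i>)) at_top"
        by (rule tendsto_set_lebesgue_integral_at_top[OF _ i]) auto
      have v: "(LINT x:{1..}|lborel. k (Complex c x) * \<i>) = \<i> * (exp (\<i> * of_real p * (of_real c - 1/2)) * lap c (of_real p))"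
        unfolding keq lap_def by (simp add: mult.commute)
      have ev: "eventually (\<lambda>T. (LINT x:{1..T}|lborel. k (Complex c x) * \<i>) = P (Complex c T) - P (Complex c 1)) at_top"
        using eventually_ge_at_top[of 1]
      proof eventually_elim
        case (elim T)
        have "set_integrable lborel {1..T} (\<lambda>x. k (Complex c x) * \<i>)"
          by (rule set_integrable_subset[OF i]) auto
        from set_borel_integral_eq_integral(2)[OF this] integral_unique[OF vert[OF _ _ elim, of c]] c
        show ?case by simp
      qed
      show ?thesis using Lim_transform_eventually[OF t ev] unfolding v .
    qed
    \<comment> \<open>The top edge vanishes in the limit: polynomial growth of \<open>zz\<close>
      against exp(-p T).\<close>
    have t0: "((\<lambda>T. P (Complex (3/2) T) - P (Complex (1/2) T)) \<longlongrightarrow> 0) at_top"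
    proof (rule Lim_null_comparison)
      show "eventually (\<lambda>T. cmod (P (Complex (3/2) T) - P (Complex (1/2) T)) \<le> K * (4 + T) ^ 4 * exp (- p * T)) at_top"
        using eventually_ge_at_top[of 1]
      proof eventually_elim
        case (elim T)
        define S where "S = closed_segment (Complex (1/2) T) (Complex (3/2) T)"
        have S: "1/2 \<le> Re w \<and> Re w \<le> 3/2 \<and> Im w = T" if "w \<in> S" for w
          using that unfolding S_def by (auto simp: closed_segment_same_Im closed_segment_eq_real_ivl)
        have "cmod (P (Complex (3/2) T) - P (Complex (1/2) T)) \<le> (K * (4 + T) ^ 4 * exp (- p * T)) * cmod (Complex (3/2) T - Complex (1/2) T)"
        proof (rule field_differentiable_bound[of S P k])
          show "(P has_field_derivative k w) (at w within S)" if "w \<in> S" for w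
            using S[OF that] Pd[of w] elim by (auto simp: \<Omega>_def intro: has_field_derivative_at_within)
          show "cmod (k w) \<le> K * (4 + T) ^ 4 * exp (- p * T)" if "w \<in> S" for w
          proof -
            have "cmod (exp (\<i> * of_real p * (w - 1/2))) = exp (- p * T)" using S[OF that] by simp
            moreover have "cmod (zz w) \<le> K * (4 + T) ^ 4" using S[OF that] K(2)[of w] elim by auto
            ultimately show ?thesis unfolding k_def norm_mult using K(1) elim by (intro mult_mono) auto
          qed
        qed (auto simp: S_def)
        also have "Complex (3/2) T - Complex (1/2) T = 1" by (simp add: complex_eq_iff)
        finally show ?case by simp
      qed
      show "((\<lambda>T. K * (4 + T) ^ 4 * exp (- p * T)) \<longlongrightarrow> 0) at_top" using p by real_asymp
    qed
    have "((\<lambda>T. (P (Complex (3/2) T) - P (Complex (3/2) 1)) - (P (Complex (1/2) T) - P (Complex (1/2) 1)) + (P (Complex (3/2) 1) - P (Complex (1/2) 1))) \<longlongrightarrow>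
       \<i> * (exp (\<i> * of_real p * (of_real (3/2) - 1/2)) * lap (3/2) (of_real p)) - \<i> * (exp (\<i> * of_real p * (of_real (1/2) - 1/2)) * lap (1/2) (of_real p)) + (P (Complex (3/2) 1) - P (Complex (1/2) 1))) at_top"
      by (intro tendsto_intros line) auto
    hence t1: "((\<lambda>T. P (Complex (3/2) T) - P (Complex (1/2) T)) \<longlongrightarrow>
       \<i> * (exp (\<i> * of_real p) * lap (3/2) (of_real p)) - \<i> * lap (1/2) (of_real p) + (P (Complex (3/2) 1) - P (Complex (1/2) 1))) at_top"
      by (simp add: algebra_simps)
    have "0 = \<i> * (exp (\<i> * of_real p) * lap (3/2) (of_real p)) - \<i> * lap (1/2) (of_real p) + (P (Complex (3/2) 1) - P (Complex (1/2) 1))"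
      by (rule tendsto_unique[OF trivial_limit_at_top_linorder t0 t1])
    hence "\<i> * lap (1/2) (of_real p) = \<i> * (h (of_real p) + exp (\<i> * of_real p) * lap (3/2) (of_real p))"
      unfolding hval by (simp add: algebra_simps)
    thus ?thesis by simp
  qed
  ultimately show ?thesis using that by blast
qed

text \<open>
  The integrand of \<open>\<Gamma>(w) \<zeta>(w)\<^sup>2 = \<integral> lambert(u) u\<^sup>w\<^sup>-\<^sup>1 du\<close> after \<open>u = 2\<pi> e\<^sup>y\<close>, which makes the
  right-hand side of the functional equation on \<open>Re w = 3/2\<close> a Fourier transform.
\<close>
definition Psi :: "complex \<Rightarrow> complex" where
  "Psi y = lambert (of_real (2 * pi) * exp y) * exp (3/2 * y)"

lemma Re_exp_pos: "\<bar>Im y\<bar> < pi/2 \<Longrightarrow> Re (exp y) > 0"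
  by (simp add: Re_exp cos_gt_zero_pi abs_less_iff)

definition strip :: "complex set" where
  "strip = {y. \<bar>Im y\<bar> < pi/2}"

lemma open_strip: "open strip" and convex_strip: "convex strip"
proof -
  have eq: "strip = {y. Im y < pi/2} \<inter> {y. Im y > - (pi/2)}" by (auto simp: strip_def)
  show "open strip" unfolding eq by (intro open_Int open_halfspace_Im_gt open_halfspace_Im_lt)
  show "convex strip" unfolding eq by (intro convex_Int convex_halfspace_Im_gt convex_halfspace_Im_lt)
qed

lemma Psi_holomorphic: "Psi holomorphic_on strip"
proof -
  have "(lambert \<circ> (\<lambda>y. of_real (2 * pi) * exp y)) holomorphic_on strip"
    by (rule holomorphic_on_compose_gen[OF _ lambert_holomorphic])
       (auto intro!: holomorphic_intros mult_pos_pos simp: strip_def Re_exp_pos)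
  thus ?thesis unfolding Psi_def comp_def by (intro holomorphic_intros)
qed

lemma Psi_fourier:
  fixes x :: real
  defines "w \<equiv> Complex (3/2) x"
  shows "integrable lborel (\<lambda>y. Psi (of_real y) * exp (\<i> * of_real x * of_real y))"
    and "(LINT y|lborel. Psi (of_real y) * exp (\<i> * of_real x * of_real y)) =
         of_real (2 * pi) powr (- w) * (Gamma w * (dzeta w)\<^sup>2)"
proof -
  have w1: "Re w > 1" by (simp add: w_def)
  define g where "g = (\<lambda>u. lambert (of_real u) * complex_of_real u powr (w - 1))"
  have g: "set_integrable lborel {0<..} g" "(LINT u:{0<..}|lborel. g u) = Gamma w * (dzeta w)\<^sup>2"
    using mellin_lambert[OF w1] by (simp_all add: g_def)
  have g': "set_integrable lborel {0<..} (\<lambda>u. g (2 * pi * u))"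
    "(LINT u:{0<..}|lborel. g (2 * pi * u)) = Gamma w * (dzeta w)\<^sup>2 / of_real (2 * pi)"
    using set_integral_Ioi_scale[OF g(1), of "2 * pi"] g(2) by auto
  have eq: "of_real (exp y) * g (2 * pi * exp y) = of_real (2 * pi) powr (w - 1) * (Psi (of_real y) * exp (\<i> * of_real x * of_real y))" for y
  proof -
    have "complex_of_real (2 * pi * exp y) powr (w - 1) = of_real (2 * pi) powr (w - 1) * of_real (exp y) powr (w - 1)"
      by (simp add: powr_times_real)
    also have "complex_of_real (exp y) powr (w - 1) = exp ((w - 1) * of_real y)"
      by (simp add: powr_def Ln_of_real)
    finally have p: "complex_of_real (2 * pi * exp y) powr (w - 1) = of_real (2 * pi) powr (w - 1) * exp ((w - 1) * of_real y)" .
    have e: "complex_of_real (exp y) * exp ((w - 1) * of_real y) = exp (3/2 * of_real y) * exp (\<i> * of_real x * of_real y)"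
      by (simp add: w_def Complex_eq exp_of_real[symmetric] algebra_simps flip: exp_add)
    have "of_real (exp y) * g (2 * pi * exp y) = lambert (of_real (2 * pi * exp y)) * of_real (2 * pi) powr (w - 1) * (complex_of_real (exp y) * exp ((w - 1) * of_real y))"
      unfolding g_def p by simp
    also have "\<dots> = of_real (2 * pi) powr (w - 1) * (Psi (of_real y) * exp (\<i> * of_real x * of_real y))"
      unfolding e Psi_def by (simp add: exp_of_real)
    finally show ?thesis .
  qed
  note S = integral_exp_substitution[OF g'(1)]
  have nz: "complex_of_real (2 * pi) powr (w - 1) \<noteq> 0" by simp
  have "integrable lborel (\<lambda>y. (1 / of_real (2 * pi) powr (w - 1)) * (of_real (exp y) * g (2 * pi * exp y)))"
    by (rule integrable_mult_right[OF S(1)])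
  thus "integrable lborel (\<lambda>y. Psi (of_real y) * exp (\<i> * of_real x * of_real y))"
    unfolding eq using nz by (simp del: powr_eq_0_iff)
  have "of_real (2 * pi) powr (w - 1) * (LINT y|lborel. Psi (of_real y) * exp (\<i> * of_real x * of_real y)) = Gamma w * (dzeta w)\<^sup>2 / of_real (2 * pi)"
    using S(2) unfolding eq g'(2) by (simp only: integral_mult_right_zero)
  hence "(LINT y|lborel. Psi (of_real y) * exp (\<i> * of_real x * of_real y)) = (1 / (of_real (2 * pi) powr (w - 1) * of_real (2 * pi))) * (Gamma w * (dzeta w)\<^sup>2)"
    using nz by (simp add: field_simps)
  also have "1 / (complex_of_real (2 * pi) powr (w - 1) * of_real (2 * pi)) = of_real (2 * pi) powr (- w)"
    by (simp add: powr_diff powr_minus field_simps)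
  finally show "(LINT y|lborel. Psi (of_real y) * exp (\<i> * of_real x * of_real y)) =
         of_real (2 * pi) powr (- w) * (Gamma w * (dzeta w)\<^sup>2)" .
qed

text \<open>The value of exp(-i pi w / 2) at w = 3/2; along w = 3/2 + i x it is multiplied by exp(pi
  x / 2).\<close>

definition kappa :: complex where "kappa = exp (- (\<i> * of_real pi * (3/4)))"

lemma zz_line_eq:
  fixes x :: real
  shows "zz (Complex (3/2) x) = (kappa * exp (of_real (pi/2 * x)) + cnj kappa * exp (- of_real (pi/2 * x)))
           * (LINT y|lborel. Psi (of_real y) * exp (\<i> * of_real x * of_real y))"
proof -
  define w where "w = Complex (3/2) x"
  have e: "\<i> * of_real pi * w / 2 = \<i> * of_real pi * (3/4) - of_real (pi/2 * x)"
    by (simp add: w_def complex_eq_iff)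
  have c: "cnj kappa = exp (\<i> * of_real pi * (3/4))"
    unfolding kappa_def by (simp add: exp_cnj)
  have "zz w = of_real (2 * pi) powr (- w) * (exp (\<i> * of_real pi * w / 2) + exp (- (\<i> * of_real pi * w / 2))) * (Gamma w * (dzeta w)\<^sup>2)"
    unfolding zz_def by (rule zeta_functional_equation) (auto simp: w_def)
  also have "exp (\<i> * of_real pi * w / 2) + exp (- (\<i> * of_real pi * w / 2)) = kappa * exp (of_real (pi/2 * x)) + cnj kappa * exp (- of_real (pi/2 * x))"
  proof -
    have "exp (A - X) + exp (- (A - X)) = exp (- A) * exp X + exp A * exp (- X)" for A X :: complex
      by (simp flip: exp_add)
    thus ?thesis unfolding e c unfolding kappa_def .
  qed
  finally show ?thesis unfolding w_def Psi_fourier(2) by (simp add: mult_ac)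
qed

text \<open>The integral of exp(-a x) over x \<ge> 1. It acts as a Cauchy kernel 1/a with a harmless
  entire numerator.\<close>

definition EE :: "complex \<Rightarrow> complex" where "EE a = exp (- a) / a"

lemma Psi_integrable: "integrable lborel (\<lambda>y. Psi (of_real y))"
  using Psi_fourier(1)[of 0] by simp

lemma Psi_continuous: "continuous_on UNIV (\<lambda>y::real. Psi (of_real y))"
proof -
  have "continuous_on UNIV (Psi \<circ> complex_of_real)"
    by (intro continuous_on_compose continuous_intros
          holomorphic_on_imp_continuous_on[OF holomorphic_on_subset[OF Psi_holomorphic]])
       (auto simp: strip_def)
  thus ?thesis by (simp add: comp_def)
qed

text \<open>Fubini, justified by the factor exp(-(Re p - c) x) and the integrability of
  \<open>Psi\<close>; the integral over x is evaluated by \<open>integral_Ici_exp\<close>.\<close>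

lemma laplace_fourier_swap:
  fixes c :: real and p :: complex
  assumes p: "Re p > c"
  shows "(LINT x:{1..}|lborel. exp (of_real (c * x)) * (LINT y|lborel. Psi (of_real y) * exp (\<i> * of_real x * of_real y)) * exp (- (p * of_real x)))
       = (LINT y|lborel. Psi (of_real y) * EE (p - of_real c - \<i> * of_real y))" (is "?L = _")
    and "set_integrable lborel {1..} (\<lambda>x. exp (of_real (c * x)) * (LINT y|lborel. Psi (of_real y) * exp (\<i> * of_real x * of_real y)) * exp (- (p * of_real x)))"
    and "integrable lborel (\<lambda>y. Psi (of_real y) * EE (p - of_real c - \<i> * of_real y))"
proof -
  define a where "a = p - of_real c"
  have a: "Re a > 0" using p by (simp add: a_def)
  define F where "F = (\<lambda>x y. (indicat_real {1..} x *\<^sub>R exp (- (a * of_real x))) * (Psi (of_real y) * exp (\<i> * of_real x * of_real y)))"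
  have cP: "(\<lambda>y::real. Psi (of_real y)) \<in> borel_measurable borel"
    using Psi_continuous by (rule borel_measurable_continuous_onI)
  have Fm: "case_prod F \<in> borel_measurable (lborel \<Otimes>\<^sub>M lborel)"
  proof -
    have 1: "(\<lambda>z::real\<times>real. Psi (of_real (snd z))) \<in> borel_measurable (lborel \<Otimes>\<^sub>M lborel)"
      by (rule measurable_compose[OF _ cP]) simp
    have 2: "(\<lambda>z::real\<times>real. exp (\<i> * of_real (fst z) * of_real (snd z))) \<in> borel_measurable (lborel \<Otimes>\<^sub>M lborel)"
      by measurable
    have 3: "(\<lambda>z::real\<times>real. indicat_real {1..} (fst z) *\<^sub>R exp (- (a * of_real (fst z)))) \<in> borel_measurable (lborel \<Otimes>\<^sub>M lborel)"
      by measurable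
    show ?thesis unfolding F_def split_beta using 1 2 3 by (intro borel_measurable_times)
  qed
  have ie: "set_integrable lborel {1..} (\<lambda>x. exp (- (a * of_real x)))" by (rule integral_Ici_exp(1)[OF a])
  have nF: "norm (F x y) = (indicat_real {1..} x * exp (- (Re a * x))) * norm (Psi (of_real y))" for x y
    by (simp add: F_def norm_mult)
  have FI: "integrable (lborel \<Otimes>\<^sub>M lborel) (case_prod F)"
  proof (rule lborel_pair.Fubini_integrable[OF Fm])
    have "(LINT y|lborel. norm (case_prod F (x, y))) = (indicat_real {1..} x * exp (- (Re a * x))) * (LINT y|lborel. norm (Psi (of_real y)))" for x
      by (simp only: split_conv nF integral_mult_right_zero)
    moreover have "integrable lborel (\<lambda>x. indicat_real {1..} x * exp (- (Re a * x)))"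
      using set_integrable_norm[OF ie] by (simp add: set_integrable_def)
    ultimately show "integrable lborel (\<lambda>x. LINT y|lborel. norm (case_prod F (x, y)))"
      by (simp only: integrable_mult_left)
    show "AE x in lborel. integrable lborel (\<lambda>y. case_prod F (x, y))"
      unfolding split_conv F_def by (intro AE_I2 integrable_mult_right Psi_fourier(1))
  qed
  have FIy: "(LINT x|lborel. F x y) = Psi (of_real y) * EE (a - \<i> * of_real y)" for y
  proof -
    have re: "Re (a - \<i> * of_real y) > 0" using a by simp
    have "F x y = Psi (of_real y) * (indicat_real {1..} x *\<^sub>R exp (- ((a - \<i> * of_real y) * of_real x)))" for x
      by (simp add: F_def algebra_simps flip: exp_add)
    hence "(LINT x|lborel. F x y) = Psi (of_real y) * (LINT x:{1..}|lborel. exp (- ((a - \<i> * of_real y) * of_real x)))"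
      by (simp only: integral_mult_right_zero set_lebesgue_integral_def)
    thus ?thesis unfolding integral_Ici_exp(2)[OF re] EE_def .
  qed
  have FIx: "(LINT y|lborel. F x y) = indicat_real {1..} x *\<^sub>R (exp (of_real (c * x)) * (LINT y|lborel. Psi (of_real y) * exp (\<i> * of_real x * of_real y)) * exp (- (p * of_real x)))" for x
  proof -
    have "exp (of_real (c * x)) * exp (- (p * of_real x)) = exp (- (a * of_real x))"
      by (simp add: a_def algebra_simps flip: exp_add)
    thus ?thesis unfolding F_def integral_mult_right_zero
      by (simp add: mult_ac)
  qed
  have ae: "integrable lborel (\<lambda>y. LINT x|lborel. F x y)" by (rule lborel_pair.integrable_snd[OF FI])
  have ae2: "integrable lborel (\<lambda>x. LINT y|lborel. F x y)" using lborel_pair.integrable_fst[OF FI] by simp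
  show "?L = (LINT y|lborel. Psi (of_real y) * EE (p - of_real c - \<i> * of_real y))"
    using lborel_pair.Fubini_integral[OF FI] unfolding FIy FIx a_def[symmetric] set_lebesgue_integral_def by simp
  show "set_integrable lborel {1..} (\<lambda>x. exp (of_real (c * x)) * (LINT y|lborel. Psi (of_real y) * exp (\<i> * of_real x * of_real y)) * exp (- (p * of_real x)))"
    using ae2 unfolding FIx set_integrable_def .
  show "integrable lborel (\<lambda>y. Psi (of_real y) * EE (p - of_real c - \<i> * of_real y))"
    using ae unfolding FIy a_def .
qed

text \<open>The first integral is singular along Re p = pi/2 and must be continued across this line;
  the second is harmless for Re p > -pi/2, hence near p = 0.\<close>

lemma lap_eq_cauchy:
  assumes p: "Re p > pi/2"
  shows "lap (3/2) p = kappa * (LINT y|lborel. Psi (of_real y) * EE (p - of_real (pi/2) - \<i> * of_real y))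
          + cnj kappa * (LINT y|lborel. Psi (of_real y) * EE (p + of_real (pi/2) - \<i> * of_real y))"
proof -
  have p2: "Re p > - (pi/2)" using p pi_gt_zero by linarith
  note A = laplace_fourier_swap[OF p] and B = laplace_fourier_swap[OF p2]
  have "lap (3/2) p = (LINT x:{1..}|lborel. kappa * (exp (of_real (pi/2 * x)) * (LINT y|lborel. Psi (of_real y) * exp (\<i> * of_real x * of_real y)) * exp (- (p * of_real x)))
       + cnj kappa * (exp (of_real (- (pi/2) * x)) * (LINT y|lborel. Psi (of_real y) * exp (\<i> * of_real x * of_real y)) * exp (- (p * of_real x))))"
    unfolding lap_def zz_line_eq by (simp add: algebra_simps)
  also have "\<dots> = kappa * (LINT y|lborel. Psi (of_real y) * EE (p - of_real (pi/2) - \<i> * of_real y))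
          + cnj kappa * (LINT y|lborel. Psi (of_real y) * EE (p - of_real (- (pi/2)) - \<i> * of_real y))"
    unfolding A(1)[symmetric] B(1)[symmetric]
    by (subst set_integral_add(2)) (use A(2) B(2) in \<open>auto intro!: set_integrable_mult_right\<close>)
  finally show ?thesis by simp
qed

text \<open>Hypothesis \<open>far\<close> keeps the pole of \<open>EE\<close> uniformly away from
  the contour near each \<open>z0\<close>. The kernel is then bounded there, and \<open>Psi\<close>
  supplies an integrable majorant.\<close>

lemma cauchy_transform_holomorphic:
  fixes b :: real
  assumes S: "open S" and A: "A \<in> sets borel"
    and far: "\<And>z0. z0 \<in> S \<Longrightarrow> \<exists>\<delta>>0. \<forall>z\<in>ball z0 \<delta> \<inter> S. \<forall>y\<in>A. cmod (z + of_real b - \<i> * of_real y) \<ge> \<delta>"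
  shows "(\<lambda>z. LINT y:A|lborel. Psi (of_real y) * EE (z + of_real b - \<i> * of_real y)) holomorphic_on S"
proof (rule holomorphic_on_set_integral[OF S A])
  have cP [measurable]: "(\<lambda>y::real. Psi (of_real y)) \<in> borel_measurable borel"
    using Psi_continuous by (rule borel_measurable_continuous_onI)
  note [measurable] = A
  show "set_borel_measurable borel A (\<lambda>y. Psi (of_real y) * EE (z + of_real b - \<i> * of_real y))" for z
    unfolding set_borel_measurable_def EE_def by measurable
  show "(\<lambda>z. Psi (of_real y) * EE (z + of_real b - \<i> * of_real y)) holomorphic_on S" if y: "y \<in> A" for y
  proof -
    have "z + of_real b - \<i> * of_real y \<noteq> 0" if zS: "z \<in> S" for z
    proof -
      obtain \<delta> where "\<delta> > 0" "\<forall>z'\<in>ball z \<delta> \<inter> S. \<forall>y\<in>A. cmod (z' + of_real b - \<i> * of_real y) \<ge> \<delta>"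
        using far[OF zS] by blast
      hence "cmod (z + of_real b - \<i> * of_real y) > 0" using zS y by (metis IntI centre_in_ball less_le_trans)
      thus ?thesis by simp
    qed
    thus ?thesis unfolding EE_def by (intro holomorphic_intros)
  qed
  fix z0 assume z0: "z0 \<in> S"
  then obtain \<delta> where \<delta>: "\<delta> > 0" "\<And>z y. z \<in> ball z0 \<delta> \<inter> S \<Longrightarrow> y \<in> A \<Longrightarrow> cmod (z + of_real b - \<i> * of_real y) \<ge> \<delta>"
    using far by meson
  define B where "B = exp (\<bar>Re z0\<bar> + 1 + \<bar>b\<bar>) / \<delta>"
  show "\<exists>r>0. \<exists>G. set_integrable lborel A G \<and>
        (\<forall>z\<in>ball z0 r \<inter> S. \<forall>y\<in>A. cmod (Psi (of_real y) * EE (z + of_real b - \<i> * of_real y)) \<le> G y)"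
  proof (rule exI[of _ "min \<delta> 1"], intro conjI exI[of _ "\<lambda>y. cmod (Psi (of_real y)) * B"] ballI)
    have "set_integrable lborel UNIV (\<lambda>y. cmod (Psi (of_real y)) * B)"
      using integrable_mult_left[OF integrable_norm[OF Psi_integrable], of B] by (simp add: set_integrable_def)
    thus "set_integrable lborel A (\<lambda>y. cmod (Psi (of_real y)) * B)"
      by (rule set_integrable_subset) (use A in auto)
    fix z y assume z: "z \<in> ball z0 (min \<delta> 1) \<inter> S" "y \<in> A"
    have "Re z0 - Re z \<le> cmod (z0 - z)" using abs_Re_le_cmod[of "z0 - z"] by simp
    hence "- Re z - b \<le> \<bar>Re z0\<bar> + 1 + \<bar>b\<bar>" using z by (auto simp: dist_norm)
    hence "cmod (EE (z + of_real b - \<i> * of_real y)) \<le> B"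
      unfolding EE_def B_def norm_divide using \<delta> z by (intro frac_le) auto
    thus "cmod (Psi (of_real y) * EE (z + of_real b - \<i> * of_real y)) \<le> cmod (Psi (of_real y)) * B"
      unfolding norm_mult by (intro mult_left_mono) auto
  qed (use \<delta> in auto)
qed

section \<open>Cauchy integrals over rectangles and the continuation across Re p = pi/2\<close>

lemma linepath_cauchy_holomorphic:
  assumes "continuous_on (closed_segment a b) f"
  shows "(\<lambda>w. contour_integral (linepath a b) (\<lambda>u. f u / (u - w))) holomorphic_on - closed_segment a b"
proof -
  define F where "F = (\<lambda>w. contour_integral (linepath a b) (\<lambda>u. f u / (u - w)))"
  have int: "((\<lambda>u. f u / (u - w) ^ 1) has_contour_integral F w) (linepath a b)" if "w \<in> UNIV - path_image (linepath a b)" for w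
  proof -
    have "continuous_on (closed_segment a b) (\<lambda>u. f u / (u - w))"
      using that by (intro continuous_intros assms) auto
    thus ?thesis unfolding F_def power_one_right
      by (intro has_contour_integral_integral contour_integrable_continuous_linepath)
  qed
  have "\<exists>D. (F has_field_derivative D) (at w)" if "w \<in> - closed_segment a b" for w
    using Cauchy_next_derivative(2)[of "linepath a b" f "cmod (b - a)" UNIV 1 F w] int assms that
    by auto
  moreover have "open (- closed_segment a b)" by (simp add: closed_segment open_Compl)
  ultimately have "F holomorphic_on - closed_segment a b" by (simp add: holomorphic_on_open)
  thus ?thesis by (simp add: F_def)
qed

text \<open>The numerator once \<open>EE (p - of_real (pi/2) - \<i> * of_real y)\<close> is written
  as a Cauchy kernel in y: exp(i y) is the y-dependent part of its exponential.\<close>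

definition Theta :: "complex \<Rightarrow> complex" where "Theta y = Psi y * exp (\<i> * y)"

lemma Theta_holomorphic: "Theta holomorphic_on strip"
  unfolding Theta_def by (intro holomorphic_intros Psi_holomorphic)

definition Cint :: "complex \<Rightarrow> complex \<Rightarrow> complex \<Rightarrow> complex" where
  "Cint a b w = contour_integral (linepath a b) (\<lambda>u. Theta u / (u - w))"

lemma Cint_has:
  assumes "closed_segment a b \<subseteq> strip" "w \<notin> closed_segment a b"
  shows "((\<lambda>u. Theta u / (u - w)) has_contour_integral Cint a b w) (linepath a b)"
  unfolding Cint_def
proof (intro has_contour_integral_integral contour_integrable_continuous_linepath)
  show "continuous_on (closed_segment a b) (\<lambda>u. Theta u / (u - w))"
    using assms(2) by (intro continuous_intros holomorphic_on_imp_continuous_on[OF holomorphic_on_subset[OF Theta_holomorphic assms(1)]]) auto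
qed

lemma Cint_holomorphic:
  "closed_segment a b \<subseteq> strip \<Longrightarrow> Cint a b holomorphic_on - closed_segment a b"
  unfolding Cint_def[abs_def]
  by (intro linepath_cauchy_holomorphic holomorphic_on_imp_continuous_on[OF holomorphic_on_subset[OF Theta_holomorphic]])

lemma segment_strip: "a \<in> strip \<Longrightarrow> b \<in> strip \<Longrightarrow> closed_segment a b \<subseteq> strip"
  by (rule closed_segment_subset[OF _ _ convex_strip])

text \<open>A rectangle on the base [-1, 1] of height a < pi/2 stays in the strip where
  \<open>Theta\<close> is holomorphic. Both cases are needed: the pole below the base before the
  crossing, inside the rectangle after it.\<close>

lemma Cint_rectangle:
  assumes a: "0 < a" "a < pi/2" and w: "w \<in> strip" "w \<notin> cbox (-1) (Complex 1 a) - box (-1) (Complex 1 a)"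
  shows "Cint (-1) 1 w + (Cint 1 (Complex 1 a) w + (Cint (Complex 1 a) (Complex (-1) a) w + Cint (Complex (-1) a) (-1) w))
     = (if w \<in> box (-1) (Complex 1 a) then 2 * of_real pi * \<i> * Theta w else 0)"
proof -
  define \<gamma> where "\<gamma> = rectpath (-1) (Complex 1 a)"
  have \<gamma>_eq: "\<gamma> = linepath (-1) 1 +++ linepath 1 (Complex 1 a) +++ linepath (Complex 1 a) (Complex (-1) a) +++ linepath (Complex (-1) a) (-1)"
    by (simp add: \<gamma>_def rectpath_def Let_def Complex_eq)
  have pim: "path_image \<gamma> = cbox (-1) (Complex 1 a) - box (-1) (Complex 1 a)"
    unfolding \<gamma>_def by (rule path_image_rectpath_cbox_minus_box) (use a in auto)
  have pim2: "path_image \<gamma> = closed_segment (-1) 1 \<union> (closed_segment 1 (Complex 1 a) \<union> (closed_segment (Complex 1 a) (Complex (-1) a) \<union> closed_segment (Complex (-1) a) (-1)))"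
    unfolding \<gamma>_eq by (simp add: path_image_join)
  have cs: "(-1) \<in> strip" "1 \<in> strip" "Complex 1 a \<in> strip" "Complex (-1) a \<in> strip"
    using a by (auto simp: strip_def)
  have wn: "w \<notin> path_image \<gamma>" using w(2) unfolding pim .
  have "((\<lambda>u. Theta u / (u - w)) has_contour_integral
     (Cint (-1) 1 w + (Cint 1 (Complex 1 a) w + (Cint (Complex 1 a) (Complex (-1) a) w + Cint (Complex (-1) a) (-1) w)))) \<gamma>"
    unfolding \<gamma>_eq using wn unfolding pim2
    by (intro has_contour_integral_join Cint_has segment_strip cs valid_path_join valid_path_linepath) auto
  moreover have "((\<lambda>u. Theta u / (u - w)) has_contour_integral (2 * pi * \<i> * winding_number \<gamma> w * Theta w)) \<gamma>"
  proof (rule Cauchy_integral_formula_convex_simple[OF convex_strip Theta_holomorphic])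
    show "w \<in> interior strip" using w(1) open_strip interior_open by blast
    have "path_image \<gamma> \<subseteq> strip" unfolding pim2 using segment_strip cs by auto
    thus "path_image \<gamma> \<subseteq> strip - {w}" using wn by blast
  qed (auto simp: \<gamma>_def)
  ultimately have "Cint (-1) 1 w + (Cint 1 (Complex 1 a) w + (Cint (Complex 1 a) (Complex (-1) a) w + Cint (Complex (-1) a) (-1) w))
      = 2 * pi * \<i> * winding_number \<gamma> w * Theta w"
    by (rule has_contour_integral_unique)
  moreover have "winding_number \<gamma> w = (if w \<in> box (-1) (Complex 1 a) then 1 else 0)"
  proof (cases "w \<in> box (-1) (Complex 1 a)")
    case True
    thus ?thesis unfolding \<gamma>_def by (simp add: winding_number_rectpath)
  next
    case False
    hence "w \<notin> cbox (-1) (Complex 1 a)" using w(2) by blast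
    hence "winding_number \<gamma> w = 0"
      by (intro winding_number_zero_outside[of \<gamma> "cbox (-1) (Complex 1 a)"]) (auto simp: \<gamma>_def pim[unfolded \<gamma>_def] convex_box)
    thus ?thesis using False by simp
  qed
  ultimately show ?thesis by simp
qed

text \<open>With w = i (pi/2 - p) the argument of \<open>EE\<close> equals -i (y - w), which
  exhibits the Cauchy kernel 1/(y - w).\<close>

lemma cauchy_integral_near:
  assumes w: "w = \<i> * (of_real (pi/2) - p)" "w \<notin> closed_segment (-1) 1"
  shows "(LINT y:{-1..1}|lborel. Psi (of_real y) * EE (p + of_real (- (pi/2)) - \<i> * of_real y)) = exp (of_real (pi/2) - p) * \<i> * Cint (-1) 1 w"
proof -
  have nz: "of_real y - w \<noteq> 0" if "y \<in> {-1..1}" for y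
  proof
    assume "of_real y - w = 0"
    hence "w = of_real y" by simp
    hence "w \<in> closed_segment (-1) 1" using that closed_segment_of_real[of "-1" 1] by (auto simp: closed_segment_eq_real_ivl)
    thus False using w(2) by simp
  qed
  have eq: "Psi (of_real y) * EE (p + of_real (- (pi/2)) - \<i> * of_real y) = (exp (of_real (pi/2) - p) * \<i>) * (Theta (of_real y) / (of_real y - w))" if y: "y \<in> {-1..1}" for y
  proof -
    have d: "p + of_real (- (pi/2)) - \<i> * of_real y = - \<i> * (of_real y - w)"
      unfolding w(1) by (simp add: algebra_simps)
    have e: "exp (- (p + of_real (- (pi/2)) - \<i> * of_real y)) = exp (of_real (pi/2) - p) * exp (\<i> * of_real y)"
    proof -
      have "- (p + of_real (- (pi/2)) - \<i> * of_real y) = (of_real (pi/2) - p) + \<i> * of_real y" by simp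
      thus ?thesis by (simp only: exp_add)
    qed
    have i: "1 / (- \<i> * (of_real y - w)) = \<i> * (1 / (of_real y - w))" using nz[OF y] by (simp add: divide_simps)
    have "EE (p + of_real (- (pi/2)) - \<i> * of_real y) = exp (of_real (pi/2) - p) * exp (\<i> * of_real y) * (1 / (- \<i> * (of_real y - w)))"
      unfolding EE_def e unfolding d by simp
    thus ?thesis unfolding i Theta_def by simp
  qed
  have c: "continuous_on {-1..1} (\<lambda>y::real. Theta (of_real y) / (of_real y - w))"
  proof -
    have "continuous_on {-1..1} (Theta \<circ> complex_of_real)"
      by (intro continuous_on_compose continuous_intros holomorphic_on_imp_continuous_on[OF holomorphic_on_subset[OF Theta_holomorphic]])
         (auto simp: strip_def)
    thus ?thesis unfolding comp_def using nz by (intro continuous_intros) auto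
  qed
  have si: "set_integrable lborel {-1..1} (\<lambda>y::real. Theta (of_real y) / (of_real y - w))"
    by (rule borel_integrable_compact[of "{-1..1}", unfolded set_integrable_def[symmetric]]) (use c in auto)
  have "(LINT y:{-1..1}|lborel. Psi (of_real y) * EE (p + of_real (- (pi/2)) - \<i> * of_real y)) =
     (LINT y:{-1..1}|lborel. (exp (of_real (pi/2) - p) * \<i>) * (Theta (of_real y) / (of_real y - w)))"
    by (rule set_lebesgue_integral_cong) (use eq in auto)
  also have "\<dots> = (exp (of_real (pi/2) - p) * \<i>) * (LINT y:{-1..1}|lborel. Theta (of_real y) / (of_real y - w))"
    by (rule set_integral_mult_right)
  also have "(LINT y:{-1..1}|lborel. Theta (of_real y) / (of_real y - w)) = Cint (-1) 1 w"
    unfolding Cint_def set_borel_integral_eq_integral(2)[OF si]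
    by (subst contour_integral_linepath_Reals_eq) auto
  finally show ?thesis .
qed

text \<open>
  Moving the contour \<open>[-1, 1]\<close> to the other three sides of a rectangle continues the Cauchy
  integral across \<open>Re p = \<pi>/2\<close>; moving it back picks up the residue at
  \<open>w = \<i>(\<pi>/2 - p)\<close>, which carries the whole singularity of the Laplace transform at \<open>p = 0\<close>.
\<close>
lemma lap_boundary:
  obtains h where "h holomorphic_on {p. \<bar>Im p\<bar> < 1 \<and> \<bar>Re p\<bar> < pi/2}"
    "\<And>p. 0 < p \<Longrightarrow> p < pi/2 \<Longrightarrow> lap (3/2) (of_real p) = h (of_real p) +
        2 * of_real pi * exp (- (\<i> * (3/2) * of_real p)) * lambert (2 * of_real pi * \<i> * exp (- (\<i> * of_real p)))"
proof -
  define U where "U = {p::complex. \<bar>Im p\<bar> < 1}"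
  have U_eq: "U = {p. Im p < 1} \<inter> {p. Im p > -1}" by (auto simp: U_def)
  have openU: "open U" unfolding U_eq by (intro open_Int open_halfspace_Im_gt open_halfspace_Im_lt)
  have convU: "convex U" unfolding U_eq by (intro convex_Int convex_halfspace_Im_gt convex_halfspace_Im_lt)
  \<comment> \<open>For |Im p| < 1 the pole has |Re w| < 1, so it can meet the real axis only inside
    [-1, 1]. The rest of the axis causes no singularity.\<close>
  define Ifar where "Ifar = (\<lambda>p. LINT y:- {-1..1}|lborel. Psi (of_real y) * EE (p + of_real (- (pi/2)) - \<i> * of_real y))"
  define I2 where "I2 = (\<lambda>p. LINT y:UNIV|lborel. Psi (of_real y) * EE (p + of_real (pi/2) - \<i> * of_real y))"
  define w where "w = (\<lambda>p. \<i> * (of_real (pi/2) - p))"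
  have w_parts: "Re (w p) = Im p" "Im (w p) = pi/2 - Re p" for p by (simp_all add: w_def)
  have hol_far: "Ifar holomorphic_on U"
    unfolding Ifar_def
  proof (rule cauchy_transform_holomorphic[OF openU])
    fix z0 assume z0: "z0 \<in> U"
    define \<delta> where "\<delta> = (1 - \<bar>Im z0\<bar>) / 2"
    have \<delta>: "\<delta> > 0" using z0 by (simp add: \<delta>_def U_def)
    have "cmod (z + of_real (- (pi/2)) - \<i> * of_real y) \<ge> \<delta>" if "z \<in> ball z0 \<delta>" "y \<in> - {-1..1}" for z y
    proof -
      have "\<bar>Im (z0 - z)\<bar> < \<delta>" using abs_Im_le_cmod[of "z0 - z"] that by (auto simp: dist_norm)
      moreover have "\<bar>Im z\<bar> - \<bar>Im z0\<bar> \<le> \<bar>Im (z0 - z)\<bar>"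
        using abs_triangle_ineq2[of "Im z" "Im z0"] by (simp add: abs_minus_commute)
      moreover have "\<bar>Im z0\<bar> = 1 - 2 * \<delta>" by (simp add: \<delta>_def field_simps)
      ultimately have "\<bar>Im z\<bar> \<le> 1 - \<delta>" by linarith
      moreover have "\<bar>y\<bar> > 1" using that by auto
      ultimately have "\<delta> \<le> \<bar>Im (z + of_real (- (pi/2)) - \<i> * of_real y)\<bar>" by simp
      also have "\<dots> \<le> cmod (z + of_real (- (pi/2)) - \<i> * of_real y)" by (rule abs_Im_le_cmod)
      finally show ?thesis .
    qed
    thus "\<exists>\<delta>>0. \<forall>z\<in>ball z0 \<delta> \<inter> U. \<forall>y\<in>- {-1..1}. cmod (z + of_real (- (pi/2)) - \<i> * of_real y) \<ge> \<delta>"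
      using \<delta> by blast
  qed auto
  have hol_2: "I2 holomorphic_on {p. Re p > - (pi/2)}"
    unfolding I2_def
  proof (rule cauchy_transform_holomorphic[OF open_halfspace_Re_gt])
    fix z0 :: complex assume z0: "z0 \<in> {p. Re p > - (pi/2)}"
    define \<delta> where "\<delta> = (Re z0 + pi/2) / 2"
    have \<delta>: "\<delta> > 0" using z0 by (simp add: \<delta>_def)
    have "cmod (z + of_real (pi/2) - \<i> * of_real y) \<ge> \<delta>" if "z \<in> ball z0 \<delta>" for z and y :: real
    proof -
      have "\<bar>Re (z0 - z)\<bar> < \<delta>" using abs_Re_le_cmod[of "z0 - z"] that by (auto simp: dist_norm)
      hence "Re z0 - Re z < \<delta>" using abs_ge_self[of "Re (z0 - z)"] by simp
      moreover have "Re z0 = 2 * \<delta> - pi/2" by (simp add: \<delta>_def field_simps)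
      ultimately have "\<delta> \<le> Re (z + of_real (pi/2) - \<i> * of_real y)" by simp
      also have "\<dots> \<le> cmod (z + of_real (pi/2) - \<i> * of_real y)" by (rule complex_Re_le_cmod)
      finally show ?thesis .
    qed
    thus "\<exists>\<delta>>0. \<forall>z\<in>ball z0 \<delta> \<inter> {p. Re p > - (pi/2)}. \<forall>y\<in>UNIV. cmod (z + of_real (pi/2) - \<i> * of_real y) \<ge> \<delta>"
      using \<delta> by blast
  qed auto
  have seg0: "closed_segment (-1) 1 \<subseteq> {y. Im y = 0}"
    by (rule closed_segment_subset) (auto simp: convex_def)
  \<comment> \<open>The integral over the base itself, considered for |Re p| < pi/2: the pole is
    then above the real axis and this is holomorphic, but it is not the continuation of the
    transform.\<close>
  define h where "h = (\<lambda>p. kappa * Ifar p + cnj kappa * I2 p + kappa * (exp (of_real (pi/2) - p) * \<i> * Cint (-1) 1 (w p)))"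
  have s1: "closed_segment (-1) 1 \<subseteq> strip" by (intro segment_strip) (auto simp: strip_def)
  have "h holomorphic_on {p. \<bar>Im p\<bar> < 1 \<and> \<bar>Re p\<bar> < pi/2}"
  proof -
    have "(Cint (-1) 1 \<circ> w) holomorphic_on {p. \<bar>Im p\<bar> < 1 \<and> \<bar>Re p\<bar> < pi/2}"
    proof (rule holomorphic_on_compose_gen[OF _ Cint_holomorphic[OF s1]])
      show "w holomorphic_on {p. \<bar>Im p\<bar> < 1 \<and> \<bar>Re p\<bar> < pi/2}" unfolding w_def by (intro holomorphic_intros)
      have "Im (w p) \<noteq> 0" if "\<bar>Re p\<bar> < pi/2" for p using that by (auto simp: w_parts)
      thus "w ` {p. \<bar>Im p\<bar> < 1 \<and> \<bar>Re p\<bar> < pi/2} \<subseteq> - closed_segment (-1) 1" using seg0 by blast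
    qed
    thus ?thesis unfolding h_def comp_def
      by (intro holomorphic_intros holomorphic_on_subset[OF hol_far] holomorphic_on_subset[OF hol_2]) (auto simp: U_def)
  qed
  moreover have "lap (3/2) (of_real p) = h (of_real p) +
        2 * of_real pi * exp (- (\<i> * (3/2) * of_real p)) * lambert (2 * of_real pi * \<i> * exp (- (\<i> * of_real p)))"
    if p: "0 < p" "p < pi/2" for p
  proof -
    \<comment> \<open>The midpoint between the height pi/2 - p of the pole and the edge pi/2 of the
      strip.\<close>
    define a where "a = (pi - p) / 2"
    have a: "0 < a" "a < pi/2" "pi/2 - p < a" using p by (auto simp: a_def)
    define R where "R = {p::complex. Re p > pi/2 - a} \<inter> U"
    have openR: "open R" unfolding R_def by (intro open_Int openU open_halfspace_Re_gt)
    have "convex R" unfolding R_def by (intro convex_Int convU convex_halfspace_Re_gt)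
    hence connR: "connected R" by (rule convex_connected)
    define C3 where "C3 = (\<lambda>v. Cint 1 (Complex 1 a) v + (Cint (Complex 1 a) (Complex (-1) a) v + Cint (Complex (-1) a) (-1) v))"
    \<comment> \<open>The actual continuation: the base is replaced by minus the other three sides,
      which a pole coming up through the base does not meet. For Re p > pi/2 both agree because the
      rectangle contains no pole.\<close>
    define G where "G = (\<lambda>p. kappa * Ifar p + cnj kappa * I2 p - kappa * (exp (of_real (pi/2) - p) * \<i> * C3 (w p)))"
    have cs: "(-1) \<in> strip" "1 \<in> strip" "Complex 1 a \<in> strip" "Complex (-1) a \<in> strip"
      using a by (auto simp: strip_def)
    have sides: "closed_segment 1 (Complex 1 a) \<subseteq> {y. Re y = 1}" "closed_segment (Complex (-1) a) (-1) \<subseteq> {y. Re y = -1}"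
       "closed_segment (Complex 1 a) (Complex (-1) a) \<subseteq> {y. Im y = a}"
      by (rule closed_segment_subset; auto simp: convex_def algebra_simps simp flip: distrib_right)+
    have wR: "\<bar>Re (w q)\<bar> < 1" "Im (w q) < a" if "q \<in> R" for q using that by (auto simp: R_def U_def w_parts)
    have "G holomorphic_on R"
    proof -
      have "(Cint x y \<circ> w) holomorphic_on R" if "closed_segment x y \<subseteq> strip" "closed_segment x y \<subseteq> {z. Re z = 1} \<or> closed_segment x y \<subseteq> {z. Re z = -1} \<or> closed_segment x y \<subseteq> {z. Im z = a}" for x y
      proof (rule holomorphic_on_compose_gen[OF _ Cint_holomorphic[OF that(1)]])
        show "w holomorphic_on R" unfolding w_def by (intro holomorphic_intros)
        show "w ` R \<subseteq> - closed_segment x y" using that(2) wR by fastforce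
      qed
      note H = this[unfolded comp_def]
      have "(\<lambda>p. C3 (w p)) holomorphic_on R" unfolding C3_def
        by (intro holomorphic_on_add H segment_strip cs) (use sides in auto)
      moreover have "R \<subseteq> {p. Re p > - (pi/2)}" using a by (auto simp: R_def)
      ultimately show ?thesis unfolding G_def
        by (intro holomorphic_intros holomorphic_on_subset[OF hol_far] holomorphic_on_subset[OF hol_2]) (auto simp: R_def)
    qed
    moreover have "lap (3/2) holomorphic_on R"
      by (rule holomorphic_on_subset[OF lap_holomorphic]) (use a in \<open>auto simp: R_def\<close>)
    moreover have eq1: "lap (3/2) q = G q" if q: "q \<in> {q. Re q > pi/2} \<inter> {q. Re q < pi} \<inter> U" for q
    proof -
      have wq: "Im (w q) < 0" "Im (w q) > - (pi/2)" using q by (auto simp: w_parts)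
      have "w q \<in> strip" using wq a by (auto simp: strip_def)
      moreover have "w q \<notin> cbox (-1) (Complex 1 a)" using wq by (auto simp: in_cbox_complex_iff)
      moreover have "w q \<notin> box (-1) (Complex 1 a)" using wq by (auto simp: in_box_complex_iff)
      ultimately have "Cint (-1) 1 (w q) + C3 (w q) = 0" using Cint_rectangle[OF a(1,2), of "w q"] unfolding C3_def by simp
      hence C: "Cint (-1) 1 (w q) = - C3 (w q)" by (simp add: eq_neg_iff_add_eq_0)
      have wn: "w q \<notin> closed_segment (-1) 1" using wq seg0 by auto
      have i: "set_integrable lborel UNIV (\<lambda>y. Psi (of_real y) * EE (q + of_real (- (pi/2)) - \<i> * of_real y))"
        using laplace_fourier_swap(3)[of "pi/2" q] q by (simp add: set_integrable_def)
      have "(LINT y|lborel. Psi (of_real y) * EE (q - of_real (pi/2) - \<i> * of_real y)) =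
         (LINT y:({-1..1} \<union> - {-1..1})|lborel. Psi (of_real y) * EE (q + of_real (- (pi/2)) - \<i> * of_real y))"
        by (simp add: set_lebesgue_integral_def)
      also have "\<dots> = (LINT y:{-1..1}|lborel. Psi (of_real y) * EE (q + of_real (- (pi/2)) - \<i> * of_real y)) + Ifar q"
        unfolding Ifar_def by (rule set_integral_Un; (rule set_integrable_subset[OF i])?; simp)
      also have "(LINT y:{-1..1}|lborel. Psi (of_real y) * EE (q + of_real (- (pi/2)) - \<i> * of_real y)) = exp (of_real (pi/2) - q) * \<i> * Cint (-1) 1 (w q)"
        by (rule cauchy_integral_near[OF _ wn]) (simp add: w_def)
      finally have e: "(LINT y|lborel. Psi (of_real y) * EE (q - of_real (pi/2) - \<i> * of_real y)) = exp (of_real (pi/2) - q) * \<i> * (- C3 (w q)) + Ifar q"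
        unfolding C .
      have "lap (3/2) q = kappa * (exp (of_real (pi/2) - q) * \<i> * (- C3 (w q)) + Ifar q) + cnj kappa * I2 q"
        using lap_eq_cauchy[of q] q unfolding e by (simp add: I2_def set_lebesgue_integral_def)
      thus ?thesis by (simp add: G_def algebra_simps)
    qed
    ultimately have eqR: "lap (3/2) q = G q" if "q \<in> R" for q
    proof -
      show ?thesis
      proof (rule nicely_meromorphic_eqI[where f = "lap (3/2)" and g = G and z = q and S = R and A = "{q. Re q > pi/2} \<inter> {q. Re q < pi} \<inter> U"])
        show "lap (3/2) nicely_meromorphic_on R" "G nicely_meromorphic_on R"
          using \<open>lap (3/2) holomorphic_on R\<close> \<open>G holomorphic_on R\<close> openR
          by (auto intro!: analytic_on_imp_nicely_meromorphic_on simp: analytic_on_open)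
        have "of_real (3 * pi / 4) \<in> {q. Re q > pi/2} \<inter> {q. Re q < pi} \<inter> U" by (simp add: U_def)
        thus "{q. Re q > pi/2} \<inter> {q. Re q < pi} \<inter> U \<noteq> {}" by blast
        show "open ({q. Re q > pi/2} \<inter> {q. Re q < pi} \<inter> U)"
          by (intro open_Int openU open_halfspace_Re_gt open_halfspace_Re_lt)
        show "{q. Re q > pi/2} \<inter> {q. Re q < pi} \<inter> U \<subseteq> R" using a by (auto simp: R_def)
      qed (use openR connR eq1 that in auto)
    qed
    \<comment> \<open>Now the pole lies inside the rectangle, and passing back from the three sides
      to the base produces the residue.\<close>
    define v where "v = w (of_real p)"
    have vp: "Re v = 0" "Im v = pi/2 - p" by (simp_all add: v_def w_parts)
    have "v \<in> strip" using p by (auto simp: strip_def vp)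
    moreover have "v \<in> box (-1) (Complex 1 a)" using p a by (auto simp: in_box_complex_iff vp)
    ultimately have "Cint (-1) 1 v + C3 v = 2 * of_real pi * \<i> * Theta v"
      using Cint_rectangle[OF a(1,2), of v] unfolding C3_def by simp
    hence C: "C3 v = 2 * of_real pi * \<i> * Theta v - Cint (-1) 1 v" by (simp add: algebra_simps)
    have "of_real p \<in> R" using p a by (simp add: R_def U_def)
    from eqR[OF this] have "lap (3/2) (of_real p) = h (of_real p) + 2 * of_real pi * (kappa * (exp (of_real (pi/2) - of_real p) * Theta v))"
      unfolding G_def h_def v_def[symmetric] C by (simp add: algebra_simps)
    also have "kappa * (exp (of_real (pi/2) - of_real p) * Theta v) = exp (- (\<i> * (3/2) * of_real p)) * lambert (2 * of_real pi * \<i> * exp (- (\<i> * of_real p)))"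
    proof -
      have e1: "exp (of_real (pi/2) - of_real p) * exp (\<i> * v) = 1"
        unfolding v_def w_def by (simp add: algebra_simps flip: exp_add)
      have "\<i> * (of_real (pi/2) - of_real p) = \<i> * of_real (pi/2) + - (\<i> * of_real p)" by (simp add: algebra_simps)
      hence e2: "exp v = \<i> * exp (- (\<i> * of_real p))"
        unfolding v_def w_def by (simp only: exp_add) (simp add: exp_eq_polar)
      have e3: "kappa * exp (3/2 * v) = exp (- (\<i> * (3/2) * of_real p))"
        unfolding kappa_def v_def w_def by (simp add: algebra_simps flip: exp_add)
      have "kappa * (exp (of_real (pi/2) - of_real p) * Theta v) = (kappa * exp (3/2 * v)) * (exp (of_real (pi/2) - of_real p) * exp (\<i> * v)) * lambert (of_real (2 * pi) * exp v)"
        unfolding Theta_def Psi_def by (simp add: mult_ac)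
      thus ?thesis unfolding e1 e3 e2 by (simp add: mult_ac)
    qed
    finally show ?thesis by (simp add: mult_ac)
  qed
  ultimately show ?thesis using that by blast
qed

text \<open>
  Periodicity identifies the argument \<open>2\<pi>\<i> e\<^sup>-\<^sup>i\<^sup>p\<close> of the Lambert series in the lemma above, which tends to
  \<open>2\<pi>\<i>\<close> as \<open>p \<rightarrow> 0\<close>, with a point near the origin.
\<close>
lemma lambert_periodic: "lambert (u + 2 * of_real pi * \<i>) = lambert u"
proof -
  have "exp (of_nat (Suc k) * (u + 2 * of_real pi * \<i>)) = exp (of_nat (Suc k) * u)" for k
  proof -
    have "of_nat (Suc k) * (u + 2 * of_real pi * \<i>) = of_nat (Suc k) * u + of_int (2 * int (Suc k)) * (of_real pi * \<i>)"
      by (simp add: algebra_simps)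
    moreover have "exp (of_int (2 * int (Suc k)) * (of_real pi * \<i>)) = 1"
      using exp_integer_2pi[of "of_nat (Suc k)"] by (simp add: mult_ac)
    ultimately show ?thesis by (simp only: exp_add mult_1_right)
  qed
  thus ?thesis unfolding lambert_def by (simp only:)
qed

text \<open>Up to the period 2 pi i the Lambert argument is z(p) = p n(p) with n(0) = 2 pi, so it
  lies in \<open>sector\<close> for small p > 0. In Ln(1 - exp(-z)) = ln p + Ln n + Ln m only the
  first term is singular at p = 0.\<close>

lemma lap_expansion:
  "\<exists>a b d C. d > 0 \<and> a holomorphic_on ball 0 d \<and> b holomorphic_on ball 0 d \<and>
     (\<forall>p. 0 < p \<and> p < d \<longrightarrow>
        cmod (of_real p * lap (1/2) (of_real p) - (a (of_real p) + b (of_real p) * of_real (ln p))) \<le> C * p ^ M)"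
proof -
  obtain h0 where h0: "h0 holomorphic_on UNIV"
    "\<And>p. p > 0 \<Longrightarrow> lap (1/2) (of_real p) = h0 (of_real p) + exp (\<i> * of_real p) * lap (3/2) (of_real p)"
    using lap_shift by blast
  obtain h1 where h1: "h1 holomorphic_on {p. \<bar>Im p\<bar> < 1 \<and> \<bar>Re p\<bar> < pi/2}"
    "\<And>p. 0 < p \<Longrightarrow> p < pi/2 \<Longrightarrow> lap (3/2) (of_real p) = h1 (of_real p) +
        2 * of_real pi * exp (- (\<i> * (3/2) * of_real p)) * lambert (2 * of_real pi * \<i> * exp (- (\<i> * of_real p)))"
    using lap_boundary by blast
  obtain A C0 where "\<forall>z\<in>sector. z \<noteq> 0 \<and> cmod z \<le> 1 \<longrightarrow>
    cmod (z * lambert z + Ln (1 - exp (- z)) - poly A z) \<le> C0 * cmod z ^ M"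
    using lambert_expansion[of M] by (elim exE)
  hence AC: "cmod (z * lambert z + Ln (1 - exp (- z)) - poly A z) \<le> C0 * cmod z ^ M"
    if "z \<in> sector" "z \<noteq> 0" "cmod z \<le> 1" for z using that by blast
  define f where "f = (\<lambda>p. 2 * of_real pi * \<i> * exp (- (\<i> * p)))"
  \<comment> \<open>The quotient (f(p) - f(0))/p with its singularity at 0 removed. Its value there
    is the derivative of \<open>f\<close> at 0, namely 2 pi.\<close>
  define n where "n = (\<lambda>p. if p = 0 then deriv f 0 else (f p - f 0) / (p - 0))"
  have n_hol: "n holomorphic_on UNIV" unfolding n_def
    by (rule pole_lemma_open) (auto simp: f_def intro!: holomorphic_intros)
  have "(f has_field_derivative 2 * of_real pi) (at 0)"
    unfolding f_def by (auto intro!: derivative_eq_intros)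
  hence n0: "n 0 = 2 * of_real pi" by (simp add: n_def DERIV_imp_deriv)
  define z where "z = (\<lambda>p. p * n p)"
  have zf: "z p = f p - 2 * of_real pi * \<i>" for p by (simp add: z_def n_def f_def)
  have z_hol: "z holomorphic_on UNIV" unfolding z_def by (intro holomorphic_intros n_hol)
  define e where "e = (\<lambda>z::complex. - exp (- z))"
  \<comment> \<open>Likewise (1 - exp(-z))/z, which is 1 at the origin and hence has a holomorphic
    logarithm nearby.\<close>
  define m where "m = (\<lambda>z. if z = 0 then deriv e 0 else (e z - e 0) / (z - 0))"
  have m_hol: "m holomorphic_on UNIV" unfolding m_def
    by (rule pole_lemma_open) (auto simp: e_def intro!: holomorphic_intros)
  have "(e has_field_derivative 1) (at 0)" unfolding e_def by (auto intro!: derivative_eq_intros)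
  hence m0: "m 0 = 1" by (simp add: m_def DERIV_imp_deriv)
  have mz: "1 - exp (- w) = w * m w" for w by (simp add: m_def e_def)
  have mz_hol: "(\<lambda>p. m (z p)) holomorphic_on UNIV"
    using holomorphic_on_compose_gen[OF z_hol m_hol] by (simp add: comp_def)
  have "isCont n 0" using holomorphic_on_imp_continuous_on[OF n_hol] by (simp add: continuous_on_eq_continuous_at)
  then obtain d1 where d1: "d1 > 0" "\<And>p. dist p 0 < d1 \<Longrightarrow> dist (n p) (n 0) < 1"
    unfolding continuous_at_eps_delta by (metis zero_less_one)
  have "isCont (\<lambda>p. m (z p)) 0" using holomorphic_on_imp_continuous_on[OF mz_hol] by (simp add: continuous_on_eq_continuous_at)
  then obtain d2 where d2: "d2 > 0" "\<And>p. dist p 0 < d2 \<Longrightarrow> dist (m (z p)) (m (z 0)) < 1/2"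
    unfolding continuous_at_eps_delta by (metis half_gt_zero_iff zero_less_one)
  \<comment> \<open>The cap 1/8 matches the bound |n(p)| \<le> 8 and guarantees |z(p)| \<le> 1, the
    range of \<open>lambert_expansion\<close>.\<close>
  define d where "d = min (min d1 d2) (1/8)"
  have d: "d > 0" "d \<le> d1" "d \<le> d2" "d \<le> 1/8" using d1 d2 by (auto simp: d_def)
  have n_near: "cmod (n p - 2 * of_real pi) < 1" if "p \<in> ball 0 d" for p
    using d1(2)[of p] that d by (auto simp: dist_norm n0)
  have n_re: "Re (n p) > 5" "\<bar>Im (n p)\<bar> < 1" "cmod (n p) \<le> 8" if "p \<in> ball 0 d" for p
  proof -
    have "\<bar>Re (n p - 2 * of_real pi)\<bar> < 1" "\<bar>Im (n p - 2 * of_real pi)\<bar> < 1"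
      using abs_Re_le_cmod[of "n p - 2 * of_real pi"] abs_Im_le_cmod[of "n p - 2 * of_real pi"] n_near[OF that] by linarith+
    thus "Re (n p) > 5" "\<bar>Im (n p)\<bar> < 1" using pi_gt3 by auto
    have "pi < 7/2" using pi_less_4 pi_approx by simp
    moreover have "cmod (n p) \<le> cmod (n p - 2 * of_real pi) + cmod (2 * of_real pi)"
      using norm_triangle_ineq[of "n p - 2 * of_real pi" "2 * of_real pi"] by simp
    ultimately show "cmod (n p) \<le> 8" using n_near[OF that] by (simp add: norm_mult)
  qed
  have m_re: "Re (m (z p)) > 0" if "p \<in> ball 0 d" for p
  proof -
    have "cmod (m (z p) - 1) < 1/2" using d2(2)[of p] that d by (auto simp: dist_norm z_def m0)
    moreover have "1 - Re (m (z p)) \<le> cmod (m (z p) - 1)" using abs_Re_le_cmod[of "m (z p) - 1"] by simp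
    ultimately show ?thesis by simp
  qed
  \<comment> \<open>Collects the two entire or holomorphic contributions of the contour shifts and
    the regular part of the Lambert expansion; \<open>b\<close> takes the coefficient of ln
    p.\<close>
  define a where "a = (\<lambda>p. p * (h0 p + exp (\<i> * p) * h1 p) + 2 * of_real pi * exp (- (\<i> * p / 2)) / n p * (poly A (z p) - Ln (n p) - Ln (m (z p))))"
  define b where "b = (\<lambda>p. - (2 * of_real pi * exp (- (\<i> * p / 2)) / n p))"
  have n_ne: "n p \<noteq> 0" "n p \<notin> \<real>\<^sub>\<le>\<^sub>0" if "p \<in> ball 0 d" for p
    using n_re(1)[OF that] by (auto simp: complex_nonpos_Reals_iff)
  have m_ne: "m (z p) \<notin> \<real>\<^sub>\<le>\<^sub>0" if "p \<in> ball 0 d" for p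
    using m_re[OF that] by (auto simp: complex_nonpos_Reals_iff)
  have ball_sub: "ball 0 d \<subseteq> {p. \<bar>Im p\<bar> < 1 \<and> \<bar>Re p\<bar> < pi/2}"
  proof
    fix p :: complex assume p: "p \<in> ball 0 d"
    hence "cmod p < 1" using d by simp
    thus "p \<in> {p. \<bar>Im p\<bar> < 1 \<and> \<bar>Re p\<bar> < pi/2}"
      using abs_Re_le_cmod[of p] abs_Im_le_cmod[of p] pi_gt3 by auto
  qed
  have "poly A holomorphic_on UNIV"
    unfolding holomorphic_on_def field_differentiable_def using poly_DERIV has_field_derivative_at_within by blast
  hence polyA: "(\<lambda>p. poly A (z p)) holomorphic_on ball 0 d"
    using holomorphic_on_compose_gen[OF holomorphic_on_subset[OF z_hol subset_UNIV] _ subset_UNIV]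
    by (simp add: comp_def)
  have "a holomorphic_on ball 0 d"
    unfolding a_def
    by (intro holomorphic_intros polyA holomorphic_on_subset[OF h0(1)] holomorphic_on_subset[OF h1(1)] ball_sub
          holomorphic_on_subset[OF n_hol] holomorphic_on_subset[OF mz_hol]) (use n_ne m_ne in auto)
  moreover have "b holomorphic_on ball 0 d"
    unfolding b_def by (intro holomorphic_intros holomorphic_on_subset[OF n_hol]) (use n_ne in auto)
  moreover have "cmod (of_real p * lap (1/2) (of_real p) - (a (of_real p) + b (of_real p) * of_real (ln p))) \<le> (2 * pi * \<bar>C0\<bar> * 8 ^ M) * p ^ M"
    if p: "0 < p" "p < d" for p
  proof -
    define q where "q = complex_of_real p"
    have q: "q \<in> ball 0 d" using p by (simp add: q_def)
    have p2: "p < pi/2" using p d pi_gt3 by simp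
    have re_z: "Re (z q) = p * Re (n q)" "Im (z q) = p * Im (n q)" by (simp_all add: z_def q_def)
    have zs: "z q \<in> sector"
    proof -
      have "\<bar>p * Im (n q)\<bar> \<le> p * Re (n q)" using n_re[OF q] p by (simp add: abs_mult)
      thus ?thesis unfolding sector_def re_z mem_Collect_eq .
    qed
    have z0: "z q \<noteq> 0" using p n_ne[OF q] by (simp add: z_def q_def)
    have zle: "cmod (z q) \<le> 8 * p" using n_re(3)[OF q] p by (simp add: z_def q_def norm_mult mult_right_mono mult.commute)
    hence z1: "cmod (z q) \<le> 1" using p d by simp
    have rz: "Re (z q) > 0" using n_re[OF q] p by (simp add: re_z)
    have ln1: "Ln (1 - exp (- z q)) = of_real (ln p) + Ln (n q) + Ln (m (z q))"
    proof -
      have mn0: "m (z q) \<noteq> 0" using m_re[OF q] by auto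
      \<comment> \<open>Both arguments are below pi/2 in modulus, so the principal logarithm is
        additive here.\<close>
      have "\<bar>Im (Ln (z q))\<bar> < pi/2" "\<bar>Im (Ln (m (z q)))\<bar> < pi/2"
        using Re_Ln_pos_lt[OF z0] Re_Ln_pos_lt[OF mn0] rz m_re[OF q] by auto
      hence "Ln (z q * m (z q)) = Ln (z q) + Ln (m (z q))"
        by (intro Ln_times_simple z0 mn0) auto
      moreover have "Ln (z q) = of_real (ln p) + Ln (n q)"
        unfolding z_def q_def by (subst Ln_times_of_real) (use p n_ne[OF q] in \<open>auto simp: q_def Ln_of_real\<close>)
      ultimately show ?thesis unfolding mz by simp
    qed
    have lam: "lambert (2 * of_real pi * \<i> * exp (- (\<i> * q))) = lambert (z q)"
      using lambert_periodic[of "z q"] by (simp add: zf f_def)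
    have "lap (1/2) q = h0 q + exp (\<i> * q) * (h1 q + 2 * of_real pi * exp (- (\<i> * (3/2) * q)) * lambert (z q))"
      using h0(2)[OF p(1)] h1(2)[OF p(1) p2] unfolding q_def[symmetric] lam by simp
    also have "\<dots> = h0 q + exp (\<i> * q) * h1 q + 2 * of_real pi * exp (- (\<i> * q / 2)) * lambert (z q)"
    proof -
      have "exp (\<i> * q) * exp (- (\<i> * (3/2) * q)) = exp (- (\<i> * q / 2))"
        by (simp flip: exp_add)
      thus ?thesis by (simp add: distrib_left flip: mult.assoc)
    qed
    finally have L: "lap (1/2) q = h0 q + exp (\<i> * q) * h1 q + 2 * of_real pi * exp (- (\<i> * q / 2)) * lambert (z q)" .
    define R where "R = z q * lambert (z q) + Ln (1 - exp (- z q)) - poly A (z q)"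
    have Rb: "cmod R \<le> C0 * cmod (z q) ^ M" unfolding R_def by (rule AC[OF zs z0 z1])
    have ql: "q * lambert (z q) = (R + poly A (z q) - of_real (ln p) - Ln (n q) - Ln (m (z q))) / n q"
    proof -
      have "R + poly A (z q) - of_real (ln p) - Ln (n q) - Ln (m (z q)) = (q * lambert (z q)) * n q"
      proof -
        have zq: "z q = q * n q" by (simp add: z_def)
        have "R + poly A (z q) - of_real (ln p) - Ln (n q) - Ln (m (z q)) = z q * lambert (z q)"
          unfolding R_def ln1 by simp
        also have "\<dots> = (q * n q) * lambert (z q)" using zq by metis
        finally show ?thesis by (simp only: mult_ac)
      qed
      thus ?thesis using n_ne[OF q] by simp
    qed
    have "q * lap (1/2) q = q * (h0 q + exp (\<i> * q) * h1 q) + 2 * of_real pi * exp (- (\<i> * q / 2)) * (q * lambert (z q))"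
      unfolding L by (simp add: algebra_simps)
    also have "\<dots> = a q + b q * of_real (ln p) + 2 * of_real pi * exp (- (\<i> * q / 2)) * R / n q"
      unfolding ql a_def b_def using n_ne[OF q] by (simp add: divide_simps) (simp add: algebra_simps)
    finally have "q * lap (1/2) q - (a q + b q * of_real (ln p)) = 2 * of_real pi * exp (- (\<i> * q / 2)) * R / n q" by simp
    hence "cmod (q * lap (1/2) q - (a q + b q * of_real (ln p))) = 2 * pi * cmod R / cmod (n q)"
      by (simp add: norm_mult norm_divide q_def)
    also have "\<dots> \<le> 2 * pi * cmod R / 1"
      using n_re(1)[OF q] complex_Re_le_cmod[of "n q"] by (intro divide_left_mono) auto
    also have "\<dots> \<le> 2 * pi * (\<bar>C0\<bar> * (8 * p) ^ M)"
    proof -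
      have "C0 * cmod (z q) ^ M \<le> \<bar>C0\<bar> * (8 * p) ^ M"
        by (intro mult_mono power_mono zle) auto
      thus ?thesis using Rb by simp
    qed
    finally show ?thesis by (simp add: q_def power_mult_distrib mult_ac)
  qed
  ultimately show ?thesis using d(1) by blast
qed

lemma zz_half_eq:
  assumes "x \<noteq> 0"
  shows "zz (Complex (1/2) x) = of_real ((cmod (zeta (Complex (1/2) x)))\<^sup>2)"
proof -
  have s1: "Complex (1/2) x \<noteq> 1" "Complex (1/2) (- x) \<noteq> 1" by (auto simp: complex_eq_iff)
  have c: "1 - Complex (1/2) x = cnj (Complex (1/2) x)" by (simp add: complex_eq_iff)
  have "zeta (1 - Complex (1/2) x) = cnj (zeta (Complex (1/2) x))"
    unfolding c using s1 by (simp add: zeta_eq_zeta_em zeta_em_cnj complex_cnj flip: zeta_em_cnj)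
  thus ?thesis unfolding zz_def by (simp add: complex_mult_cnj cmod_power2)
qed

lemma lap_far: "\<exists>C. \<forall>p\<ge>1. cmod (lap (1/2) (of_real p)) \<le> C * exp (- 1 * p)"
proof -
  obtain K where K: "K \<ge> 0" "\<And>w. -1/2 \<le> Re w \<Longrightarrow> Re w \<le> 3/2 \<Longrightarrow> Im w \<ge> 1/2 \<Longrightarrow> cmod (zz w) \<le> K * (4 + Im w) ^ 4"
    using zz_bound by blast
  define C where "C = (LINT x:{1..}|lborel. K * (4 + x) ^ 4 * exp (- 1 * x)) * exp 1"
  have "cmod (lap (1/2) (of_real p)) \<le> C * exp (- 1 * p)" if p: "p \<ge> 1" for p
  proof -
    have i: "set_integrable lborel {1..} (\<lambda>x. zz (Complex (1/2) x) * exp (- (of_real p * of_real x)))"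
      by (rule lap_integrable) (use p in auto)
    have j: "set_integrable lborel {1..} (\<lambda>x. exp (- (p - 1)) * (K * (4 + x) ^ 4 * exp (- 1 * x)))"
      by (intro set_integrable_mult_right poly_exp_integrable) auto
    have "cmod (lap (1/2) (of_real p)) \<le> (LINT x:{1..}|lborel. norm (zz (Complex (1/2) x) * exp (- (of_real p * of_real x))))"
      unfolding lap_def by (rule set_integral_norm_bound[OF i])
    also have "\<dots> \<le> (LINT x:{1..}|lborel. exp (- (p - 1)) * (K * (4 + x) ^ 4 * exp (- 1 * x)))"
    proof (rule set_integral_mono[OF set_integrable_norm[OF i] j])
      fix x :: real assume x: "x \<in> {1..}"
      \<comment> \<open>Rearranged, this splits off the decay in p: exp(-p x) \<le> exp(-(p-1))
        exp(-x) for p, x \<ge> 1.\<close>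
      have "0 \<le> (p - 1) * (x - 1)" using p x by simp
      hence "- (p * x) \<le> - (p - 1) + - 1 * x" by (simp add: algebra_simps)
      hence "exp (- (p * x)) \<le> exp (- (p - 1)) * exp (- 1 * x)" by (simp flip: exp_add)
      hence "cmod (zz (Complex (1/2) x)) * exp (- (p * x)) \<le> (K * (4 + x) ^ 4) * (exp (- (p - 1)) * exp (- 1 * x))"
        using K(2)[of "Complex (1/2) x"] K(1) x by (intro mult_mono) auto
      thus "norm (zz (Complex (1/2) x) * exp (- (of_real p * of_real x))) \<le> exp (- (p - 1)) * (K * (4 + x) ^ 4 * exp (- 1 * x))"
        by (simp add: norm_mult mult_ac)
    qed
    also have "\<dots> = exp (- (p - 1)) * (LINT x:{1..}|lborel. K * (4 + x) ^ 4 * exp (- 1 * x))"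
      by (rule set_integral_mult_right)
    also have "exp (- (p - 1)) = exp 1 * exp (- 1 * p)" by (simp flip: exp_add)
    finally show ?thesis by (simp add: C_def mult_ac)
  qed
  thus ?thesis by blast
qed

lemma lap_mellin:
  fixes N :: nat
  obtains \<Phi> where
    "\<Phi> meromorphic_on {s. Re s > - real N}"
    "\<Phi> holomorphic_on ({s. Re s > - real N} - {s. \<exists>n::nat. s = 1 - of_nat n})"
    "\<And>s. Re s > 1 \<Longrightarrow> set_integrable lborel {0<..} (\<lambda>p. lap (1/2) (of_real p) * of_real p powr (s - 1))"
    "\<And>s. Re s > 1 \<Longrightarrow> \<Phi> s = (LINT p:{0<..}|lborel. lap (1/2) (of_real p) * of_real p powr (s - 1))"
    "\<And>\<alpha> \<beta>. \<alpha> > - real N \<Longrightarrow> \<exists>K. \<forall>s. \<alpha> \<le> Re s \<and> Re s \<le> \<beta> \<and> 1 \<le> \<bar>Im s\<bar> \<longrightarrow> cmod (\<Phi> s) \<le> K"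
proof -
  obtain a b d C where abd: "d > 0" "a holomorphic_on ball 0 d" "b holomorphic_on ball 0 d"
     "\<And>p. 0 < p \<Longrightarrow> p < d \<Longrightarrow>
        cmod (of_real p * lap (1/2) (of_real p) - (a (of_real p) + b (of_real p) * of_real (ln p))) \<le> C * p ^ (N + 2)"
    using lap_expansion[of "N + 2"] by blast
  obtain C' where C': "\<And>p. p \<ge> 1 \<Longrightarrow> cmod (lap (1/2) (of_real p)) \<le> C' * exp (- 1 * p)"
    using lap_far by blast
  have "continuous_on {0<..} (lap (1/2) \<circ> complex_of_real)"
    by (intro continuous_on_compose continuous_intros holomorphic_on_imp_continuous_on[OF holomorphic_on_subset[OF lap_holomorphic]]) auto
  hence cont: "continuous_on {0<..} (\<lambda>p. lap (1/2) (complex_of_real p))" by (simp add: comp_def)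
  show ?thesis
    by (rule mellin_continuation[OF cont abd(2,3,1,4) C' zero_less_one]) (assumption | rule that)+
qed

subsection \<open>The continuation of \<open>Z\<^sub>1\<close>\<close>

definition zint :: "complex \<Rightarrow> complex" where
  "zint s = (LINT x:{1..}|lborel. zz (Complex (1/2) x) * of_real x powr (- s))"

lemma mellin_exp_scaled:
  assumes "Re s > 0" "x > 0"
  shows "set_integrable lborel {0<..} (\<lambda>p. exp (- (of_real p * of_real x)) * complex_of_real p powr (s - 1))"
    and "(LINT p:{0<..}|lborel. exp (- (of_real p * of_real x)) * complex_of_real p powr (s - 1)) = Gamma s * of_real x powr (- s)"
proof -
  note S = set_integral_Ioi_scale[OF mellin_exp(1)[OF assms(1)] assms(2)]
  have eq: "of_real (exp (- (x * p))) * complex_of_real (x * p) powr (s - 1) = of_real x powr (s - 1) * (exp (- (of_real p * of_real x)) * complex_of_real p powr (s - 1))" if "p \<in> {0<..}" for p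
    using that assms(2) by (simp add: powr_times_real exp_of_real[symmetric] mult_ac)
  have nz: "complex_of_real x powr (s - 1) \<noteq> 0" using assms by simp
  have 1: "set_integrable lborel {0<..} (\<lambda>p. of_real x powr (s - 1) * (exp (- (of_real p * of_real x)) * complex_of_real p powr (s - 1)))"
    using S(1) by (rule set_integrable_cong[THEN iffD1, OF refl refl, rotated]) (rule eq)
  have "set_integrable lborel {0<..} (\<lambda>p. (1 / of_real x powr (s - 1)) * (of_real x powr (s - 1) * (exp (- (of_real p * of_real x)) * complex_of_real p powr (s - 1))))"
    by (rule set_integrable_mult_right) (rule 1)
  thus "set_integrable lborel {0<..} (\<lambda>p. exp (- (of_real p * of_real x)) * complex_of_real p powr (s - 1))"
    using nz by (simp del: powr_eq_0_iff)
  have "of_real x powr (s - 1) * (LINT p:{0<..}|lborel. exp (- (of_real p * of_real x)) * complex_of_real p powr (s - 1)) = Gamma s / of_real x"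
    unfolding set_integral_mult_right[symmetric] mellin_exp(2)[OF assms(1), symmetric] S(2)[symmetric]
    by (rule set_lebesgue_integral_cong) (use eq in auto)
  hence "(LINT p:{0<..}|lborel. exp (- (of_real p * of_real x)) * complex_of_real p powr (s - 1)) = Gamma s * (1 / (of_real x powr (s - 1) * of_real x))"
    using nz assms by (simp add: field_simps)
  also have "1 / (complex_of_real x powr (s - 1) * of_real x) = of_real x powr (- s)"
    using assms by (simp add: powr_diff powr_minus field_simps)
  finally show "(LINT p:{0<..}|lborel. exp (- (of_real p * of_real x)) * complex_of_real p powr (s - 1)) = Gamma s * of_real x powr (- s)" .
qed

text \<open>Because \<open>zz\<close> is nonnegative on the critical line, the absolute inner
  integral over x is \<open>lap (1/2)\<close> itself, whose Mellin integral already converges for Re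
  s > 1. Fubini thus also yields convergence of the integral defining \<open>Z1\<close>, without a
  separate mean value theorem for zeta.\<close>

lemma zint_mellin:
  assumes s: "Re s > 1"
  shows "set_integrable lborel {1..} (\<lambda>x. zz (Complex (1/2) x) * of_real x powr (- s))"
    and "(LINT p:{0<..}|lborel. lap (1/2) (of_real p) * of_real p powr (s - 1)) = Gamma s * zint s"
proof -
  define F where "F = (\<lambda>p x. (indicat_real {0<..} p *\<^sub>R (complex_of_real p powr (s - 1))) * (indicat_real {1..} x *\<^sub>R zz (Complex (1/2) x)) * exp (- (of_real p * of_real x)))"
  obtain \<Phi> where Li: "set_integrable lborel {0<..} (\<lambda>p. lap (1/2) (of_real p) * of_real p powr (s - 1))"
    using lap_mellin[of 0] s by metis
  have zm: "(\<lambda>x. indicat_real {1..} x *\<^sub>R zz (Complex (1/2) x)) \<in> borel_measurable borel"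
    by (rule borel_measurable_continuous_on_indicator) (auto intro: continuous_on_subset[OF zz_line_continuous])
  have pm: "(\<lambda>p. indicat_real {0<..} p *\<^sub>R (complex_of_real p powr (s - 1))) \<in> borel_measurable borel"
    by (rule borel_measurable_continuous_on_indicator) (auto intro!: continuous_intros)
  have Fm: "case_prod F \<in> borel_measurable (lborel \<Otimes>\<^sub>M lborel)"
  proof -
    have 1: "(\<lambda>z::real\<times>real. indicat_real {1..} (snd z) *\<^sub>R zz (Complex (1/2) (snd z))) \<in> borel_measurable (lborel \<Otimes>\<^sub>M lborel)"
      by (rule measurable_compose[OF _ zm]) simp
    have 2: "(\<lambda>z::real\<times>real. exp (- (complex_of_real (fst z) * of_real (snd z)))) \<in> borel_measurable (lborel \<Otimes>\<^sub>M lborel)"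
      by measurable
    have 3: "(\<lambda>z::real\<times>real. indicat_real {0<..} (fst z) *\<^sub>R (complex_of_real (fst z) powr (s - 1))) \<in> borel_measurable (lborel \<Otimes>\<^sub>M lborel)"
      by (rule measurable_compose[OF _ pm]) simp
    show ?thesis unfolding F_def split_beta using 1 2 3 by (intro borel_measurable_times)
  qed
  \<comment> \<open>Nonnegativity of the integrand, stated as equality with its modulus.\<close>
  have zn: "zz (Complex (1/2) x) = of_real (cmod (zz (Complex (1/2) x)))" if "x \<ge> 1" for x
  proof -
    have e: "zz (Complex (1/2) x) = of_real ((cmod (zeta (Complex (1/2) x)))\<^sup>2)"
      by (rule zz_half_eq) (use that in simp)
    show ?thesis unfolding e norm_of_real by simp
  qed
  have laz: "(LINT x|lborel. indicat_real {1..} x * (cmod (zz (Complex (1/2) x)) * exp (- (p * x)))) = cmod (lap (1/2) (of_real p))" if p: "p > 0" for p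
  proof -
    have "lap (1/2) (of_real p) = (LINT x:{1..}|lborel. complex_of_real (cmod (zz (Complex (1/2) x)) * exp (- (p * x))))"
      unfolding lap_def
    proof (rule set_lebesgue_integral_cong)
      show "\<forall>x. x \<in> {1..} \<longrightarrow> zz (Complex (1/2) x) * exp (- (of_real p * of_real x)) = of_real (cmod (zz (Complex (1/2) x)) * exp (- (p * x)))"
      proof (intro allI impI)
        fix x :: real assume "x \<in> {1..}"
        thus "zz (Complex (1/2) x) * exp (- (of_real p * of_real x)) = of_real (cmod (zz (Complex (1/2) x)) * exp (- (p * x)))"
          using zn[of x] by (simp add: exp_of_real[symmetric])
      qed
    qed auto
    also have "\<dots> = of_real (LINT x:{1..}|lborel. cmod (zz (Complex (1/2) x)) * exp (- (p * x)))"
      by (rule set_integral_complex_of_real)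
    finally have "cmod (lap (1/2) (of_real p)) = \<bar>LINT x:{1..}|lborel. cmod (zz (Complex (1/2) x)) * exp (- (p * x))\<bar>" by simp
    also have "\<dots> = (LINT x:{1..}|lborel. cmod (zz (Complex (1/2) x)) * exp (- (p * x)))"
      by (rule abs_of_nonneg) (auto simp: set_lebesgue_integral_def intro!: Bochner_Integration.integral_nonneg)
    finally show ?thesis by (simp add: set_lebesgue_integral_def)
  qed
  have FI: "integrable (lborel \<Otimes>\<^sub>M lborel) (case_prod F)"
  proof (rule lborel_pair.Fubini_integrable[OF Fm])
    have "(LINT x|lborel. norm (case_prod F (p, x))) = norm (indicat_real {0<..} p *\<^sub>R (lap (1/2) (of_real p) * of_real p powr (s - 1)))" for p
    proof (cases "p > 0")
      case True
      have "norm (case_prod F (p, x)) = p powr (Re s - 1) * (indicat_real {1..} x * (cmod (zz (Complex (1/2) x)) * exp (- (p * x))))" for x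
        using True by (simp add: F_def norm_mult norm_of_real_powr)
      hence "(LINT x|lborel. norm (case_prod F (p, x))) = p powr (Re s - 1) * cmod (lap (1/2) (of_real p))"
        by (simp only: integral_mult_right_zero laz[OF True])
      thus ?thesis using True by (simp add: norm_mult norm_of_real_powr)
    qed (simp add: F_def)
    thus "integrable lborel (\<lambda>p. LINT x|lborel. norm (case_prod F (p, x)))"
      using integrable_norm[OF Li[unfolded set_integrable_def]] by simp
    have "integrable lborel (\<lambda>x. case_prod F (p, x))" for p
    proof (cases "p > 0")
      case True
      have "set_integrable lborel {1..} (\<lambda>x. zz (Complex (1/2) x) * exp (- (of_real p * of_real x)))"
        by (rule lap_integrable) (use True in auto)
      hence "integrable lborel (\<lambda>x. (complex_of_real p powr (s - 1)) * (indicat_real {1..} x *\<^sub>R (zz (Complex (1/2) x) * exp (- (of_real p * of_real x)))))"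
        unfolding set_integrable_def by (rule integrable_mult_right)
      thus ?thesis using True by (simp add: F_def mult_ac)
    qed (simp add: F_def)
    thus "AE p in lborel. integrable lborel (\<lambda>x. case_prod F (p, x))" by simp
  qed
  have FIx: "(LINT x|lborel. F p x) = indicat_real {0<..} p *\<^sub>R (lap (1/2) (of_real p) * of_real p powr (s - 1))" for p
  proof -
    have "F p x = (indicat_real {0<..} p *\<^sub>R (complex_of_real p powr (s - 1))) * (indicat_real {1..} x *\<^sub>R (zz (Complex (1/2) x) * exp (- (of_real p * of_real x))))" for x
      by (simp add: F_def)
    hence "(LINT x|lborel. F p x) = (indicat_real {0<..} p *\<^sub>R (complex_of_real p powr (s - 1))) * lap (1/2) (of_real p)"
      by (simp only: integral_mult_right_zero lap_def set_lebesgue_integral_def)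
    thus ?thesis by (simp add: mult_ac)
  qed
  have FIp: "(LINT p|lborel. F p x) = Gamma s * (indicat_real {1..} x *\<^sub>R (zz (Complex (1/2) x) * of_real x powr (- s)))" for x
  proof (cases "x \<ge> 1")
    case True
    have "F p x = zz (Complex (1/2) x) * (indicat_real {0<..} p *\<^sub>R (exp (- (of_real p * of_real x)) * complex_of_real p powr (s - 1)))" for p
      using True by (simp add: F_def mult_ac)
    hence "(LINT p|lborel. F p x) = zz (Complex (1/2) x) * (LINT p:{0<..}|lborel. exp (- (of_real p * of_real x)) * complex_of_real p powr (s - 1))"
      by (simp only: integral_mult_right_zero set_lebesgue_integral_def)
    also have "\<dots> = zz (Complex (1/2) x) * (Gamma s * of_real x powr (- s))"
      by (subst mellin_exp_scaled(2)) (use True s in auto)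
    finally show ?thesis using True by simp
  qed (simp add: F_def)
  have G0: "Gamma s \<noteq> 0" using s by (auto simp: Gamma_eq_zero_iff elim!: nonpos_Ints_cases)
  have "integrable lborel (\<lambda>x. LINT p|lborel. F p x)" by (rule lborel_pair.integrable_snd[OF FI])
  hence "integrable lborel (\<lambda>x. (1 / Gamma s) * (LINT p|lborel. F p x))" by (rule integrable_mult_right)
  thus "set_integrable lborel {1..} (\<lambda>x. zz (Complex (1/2) x) * of_real x powr (- s))"
    unfolding FIp set_integrable_def using G0 by simp
  have "(LINT x|lborel. (LINT p|lborel. F p x)) = (LINT p|lborel. (LINT x|lborel. F p x))"
    by (rule lborel_pair.Fubini_integral[OF FI])
  thus "(LINT p:{0<..}|lborel. lap (1/2) (of_real p) * of_real p powr (s - 1)) = Gamma s * zint s"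
    unfolding FIp FIx zint_def set_lebesgue_integral_def by (simp only: integral_mult_right_zero)
qed

text \<open>On 1 \<le> Re w \<le> 2 \<open>Gamma\<close> is bounded by its values on the real
  segment. Reflection with |sin(pi z)| \<le> exp(4 |z|) bounds \<open>rGamma\<close> for -1 \<le> Re
  z \<le> 0, and the recurrence moves right while dividing by |z - 1| \<ge> 1.\<close>

lemma rGamma_growth:
  "\<exists>K\<ge>0. \<forall>s. 0 \<le> Re s \<and> Re s \<le> B \<and> 1 \<le> Im s \<longrightarrow> cmod (rGamma s) \<le> K * exp (4 * cmod s)"
proof -
  have "continuous_on {1..2::real} (\<lambda>\<sigma>. Gamma (complex_of_real \<sigma>))"
  proof -
    have "complex_of_real \<sigma> \<notin> \<int>\<^sub>\<le>\<^sub>0" if "\<sigma> \<in> {1..2}" for \<sigma>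
      using that by (auto elim!: nonpos_Ints_cases simp: complex_eq_iff)
    hence "complex_of_real ` {1..2} \<inter> \<int>\<^sub>\<le>\<^sub>0 = {}" by blast
    hence "continuous_on {1..2} (Gamma \<circ> complex_of_real)"
      by (intro continuous_on_compose continuous_intros holomorphic_on_imp_continuous_on holomorphic_Gamma) auto
    thus ?thesis by (simp add: comp_def)
  qed
  then obtain M where M: "\<And>\<sigma>. \<sigma> \<in> {1..2} \<Longrightarrow> cmod (Gamma (complex_of_real \<sigma>)) \<le> M"
    using compact_norm_bound[OF compact_Icc] by blast
  have M0: "M \<ge> 0" using M[of 1] norm_ge_zero order_trans by fastforce
  have G: "cmod (Gamma w) \<le> M" if w: "1 \<le> Re w" "Re w \<le> 2" for w
  proof -
    have w0: "Re w > 0" "Re (complex_of_real (Re w)) > 0" using w by auto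
    define I where "I = (LINT u:{0<..}|lborel. norm (of_real (exp (- u)) * complex_of_real u powr (w - 1)))"
    have 1: "cmod (Gamma w) \<le> I"
      unfolding mellin_exp(2)[OF w0(1), symmetric] I_def by (rule set_integral_norm_bound[OF mellin_exp(1)[OF w0(1)]])
    have "complex_of_real I = (LINT u:{0<..}|lborel. complex_of_real (norm (of_real (exp (- u)) * complex_of_real u powr (w - 1))))"
      unfolding I_def by (rule set_integral_complex_of_real[symmetric])
    also have "\<dots> = (LINT u:{0<..}|lborel. of_real (exp (- u)) * complex_of_real u powr (of_real (Re w) - 1))"
    proof (rule set_lebesgue_integral_cong)
      show "\<forall>u. u \<in> {0<..} \<longrightarrow> complex_of_real (norm (of_real (exp (- u)) * complex_of_real u powr (w - 1))) = of_real (exp (- u)) * complex_of_real u powr (of_real (Re w) - 1)"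
      proof (intro allI impI)
        fix u :: real assume u: "u \<in> {0<..}"
        have "complex_of_real u powr (of_real (Re w) - 1) = of_real (u powr (Re w - 1))"
          using powr_of_real[of u "Re w - 1"] u by simp
        thus "complex_of_real (norm (of_real (exp (- u)) * complex_of_real u powr (w - 1))) = of_real (exp (- u)) * complex_of_real u powr (of_real (Re w) - 1)"
          using u by (simp add: norm_mult norm_of_real_powr)
      qed
    qed auto
    also have "\<dots> = Gamma (complex_of_real (Re w))" by (rule mellin_exp(2)[OF w0(2)])
    finally have "\<bar>I\<bar> = cmod (Gamma (complex_of_real (Re w)))" by (metis norm_of_real)
    thus ?thesis using M[of "Re w"] w 1 by auto
  qed
  have base: "cmod (rGamma z) \<le> M * exp (4 * cmod z)" if z: "-1 \<le> Re z" "Re z \<le> 0" for z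
  proof -
    define y where "y = of_real pi * z"
    have "1 - z \<notin> \<int>\<^sub>\<le>\<^sub>0" using z by (auto elim!: nonpos_Ints_cases simp: complex_eq_iff)
    hence "rGamma (1 - z) * Gamma (1 - z) = 1" by (simp add: rGamma_inverse_Gamma Gamma_eq_zero_iff)
    hence "rGamma z = (rGamma z * rGamma (1 - z)) * Gamma (1 - z)" by (simp add: mult.assoc)
    also have "rGamma z * rGamma (1 - z) = sin y / of_real pi" unfolding y_def by (rule rGamma_reflection_complex)
    finally have "cmod (rGamma z) = cmod (sin y) / pi * cmod (Gamma (1 - z))" by (simp add: norm_mult norm_divide)
    also have "\<dots> \<le> exp (4 * cmod z) * M"
    proof (intro mult_mono G)
      have "cmod (sin y) \<le> (cmod (exp (\<i> * y)) + cmod (exp (- (\<i> * y)))) / 2"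
        unfolding sin_exp_eq norm_divide using norm_triangle_ineq4[of "exp (\<i> * y)" "exp (- (\<i> * y))"]
        by (simp add: norm_mult del: norm_exp_eq_Re)
      also have "\<dots> \<le> (exp (cmod y) + exp (cmod y)) / 2"
        using norm_exp[of "\<i> * y"] norm_exp[of "- (\<i> * y)"]
        by (intro divide_right_mono add_mono) (simp_all add: norm_mult del: norm_exp_eq_Re)
      also have "\<dots> = exp (cmod y)" by simp
      also have "\<dots> \<le> exp (4 * cmod z)" unfolding y_def norm_mult using pi_less_4 by (simp add: mult_right_mono)
      finally have "cmod (sin y) \<le> exp (4 * cmod z) * 1" by simp
      also have "\<dots> \<le> exp (4 * cmod z) * pi" using pi_gt3 by (intro mult_left_mono) auto
      finally show "cmod (sin y) / pi \<le> exp (4 * cmod z)" by (simp add: divide_le_eq)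
    qed (use z M0 in auto)
    finally show ?thesis by (simp add: mult.commute)
  qed
  have step: "cmod (rGamma z) \<le> M * exp (4 * (cmod z + real m))" if "-1 \<le> Re z - real m" "Re z - real m \<le> 0" "Im z \<ge> 1" for z m
    using that
  proof (induction m arbitrary: z)
    case 0
    thus ?case using base[of z] by simp
  next
    case (Suc m)
    have ih: "cmod (rGamma (z - 1)) \<le> M * exp (4 * (cmod (z - 1) + real m))"
      using Suc.prems by (intro Suc.IH) auto
    have "(z - 1) * rGamma (z - 1 + 1) = rGamma (z - 1)" by (rule rGamma_plus1)
    hence "cmod (z - 1) * cmod (rGamma z) = cmod (rGamma (z - 1))" by (simp flip: norm_mult)
    moreover have "cmod (z - 1) \<ge> 1" using abs_Im_le_cmod[of "z - 1"] Suc.prems by simp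
    hence "1 * cmod (rGamma z) \<le> cmod (z - 1) * cmod (rGamma z)" by (intro mult_right_mono) auto
    ultimately have "cmod (rGamma z) \<le> M * exp (4 * (cmod (z - 1) + real m))" using ih by simp
    also have "\<dots> \<le> M * exp (4 * (cmod z + real (Suc m)))"
      using M0 norm_triangle_ineq4[of z 1] by (intro mult_left_mono) auto
    finally show ?case .
  qed
  have "cmod (rGamma s) \<le> (M * exp (4 * (\<bar>B\<bar> + 1))) * exp (4 * cmod s)" if s: "0 \<le> Re s" "Re s \<le> B" "1 \<le> Im s" for s
  proof -
    define m where "m = nat \<lceil>Re s\<rceil>"
    have m: "-1 \<le> Re s - real m" "Re s - real m \<le> 0" using s unfolding m_def by linarith+
    have "cmod (rGamma s) \<le> M * exp (4 * (cmod s + real m))" by (rule step[OF m s(3)])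
    also have "\<dots> \<le> M * exp (4 * (cmod s + (\<bar>B\<bar> + 1)))" using M0 m s by (intro mult_left_mono) auto
    also have "\<dots> = (M * exp (4 * (\<bar>B\<bar> + 1))) * exp (4 * cmod s)" by (simp add: algebra_simps flip: exp_add)
    finally show ?thesis .
  qed
  thus ?thesis using M0 by (intro exI[of _ "M * exp (4 * (\<bar>B\<bar> + 1))"]) auto
qed

lemma rGamma_mult_Gamma: "Re s > 0 \<Longrightarrow> rGamma s * Gamma s = 1"
proof -
  assume "Re s > 0"
  hence "s \<notin> \<int>\<^sub>\<le>\<^sub>0" by (auto elim!: nonpos_Ints_cases)
  thus ?thesis by (simp add: rGamma_inverse_Gamma Gamma_eq_zero_iff)
qed

text \<open>As for \<open>zeta\<close>, the definite description needs an exhibited continuation: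
  \<open>rGamma\<close> times the continued Mellin transform of \<open>lap (1/2)\<close>, glued over
  all N.\<close>

lemma Z1_props:
  shows Z1_nicely_meromorphic: "Z1 nicely_meromorphic_on UNIV"
    and Z1_eq_zint: "\<And>s. Re s > 1 \<Longrightarrow> Z1 s = zint s"
proof -
  have H: "\<exists>h. h meromorphic_on {s. Re s > - real N} \<and> (\<forall>s. Re s > 1 \<and> Re s > - real N \<longrightarrow> h s = zint s)" for N
  proof -
    obtain \<Phi> where \<Phi>: "\<Phi> meromorphic_on {s. Re s > - real N}"
      "\<Phi> holomorphic_on ({s. Re s > - real N} - {s. \<exists>n::nat. s = 1 - of_nat n})"
      "\<And>s. Re s > 1 \<Longrightarrow> set_integrable lborel {0<..} (\<lambda>p. lap (1/2) (of_real p) * of_real p powr (s - 1))"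
      "\<And>s. Re s > 1 \<Longrightarrow> \<Phi> s = (LINT p:{0<..}|lborel. lap (1/2) (of_real p) * of_real p powr (s - 1))"
      "\<And>\<alpha> \<beta>. \<alpha> > - real N \<Longrightarrow> \<exists>K. \<forall>s. \<alpha> \<le> Re s \<and> Re s \<le> \<beta> \<and> 1 \<le> \<bar>Im s\<bar> \<longrightarrow> cmod (\<Phi> s) \<le> K"
      by (rule lap_mellin[of N]) (rule that, assumption+)
    have "rGamma meromorphic_on {s. Re s > - real N}"
      by (intro analytic_on_imp_meromorphic_on analytic_intros)
    hence "(\<lambda>s. rGamma s * \<Phi> s) meromorphic_on {s. Re s > - real N}"
      by (intro meromorphic_intros \<Phi>(1))
    moreover have "rGamma s * \<Phi> s = zint s" if "Re s > 1" for s
      using \<Phi>(4)[OF that] zint_mellin(2)[OF that] rGamma_mult_Gamma[of s] that by (simp flip: mult.assoc)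
    ultimately show ?thesis by blast
  qed
  have "zint holomorphic_on {s. Re s > 1}"
  proof -
    obtain \<Phi> where \<Phi>: "\<Phi> meromorphic_on {s. Re s > - real 0}"
      "\<Phi> holomorphic_on ({s. Re s > - real 0} - {s. \<exists>n::nat. s = 1 - of_nat n})"
      "\<And>s. Re s > 1 \<Longrightarrow> set_integrable lborel {0<..} (\<lambda>p. lap (1/2) (of_real p) * of_real p powr (s - 1))"
      "\<And>s. Re s > 1 \<Longrightarrow> \<Phi> s = (LINT p:{0<..}|lborel. lap (1/2) (of_real p) * of_real p powr (s - 1))"
      "\<And>\<alpha> \<beta>. \<alpha> > - real 0 \<Longrightarrow> \<exists>K. \<forall>s. \<alpha> \<le> Re s \<and> Re s \<le> \<beta> \<and> 1 \<le> \<bar>Im s\<bar> \<longrightarrow> cmod (\<Phi> s) \<le> K"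
      by (rule lap_mellin[of 0]) (rule that, assumption+)
    have "\<Phi> holomorphic_on {s. Re s > 1}" by (rule holomorphic_on_subset[OF \<Phi>(2)]) auto
    hence "(\<lambda>s. rGamma s * \<Phi> s) holomorphic_on {s. Re s > 1}" by (intro holomorphic_intros)
    thus ?thesis
    proof (rule holomorphic_transform)
      show "rGamma s * \<Phi> s = zint s" if "s \<in> {s. Re s > 1}" for s
        using \<Phi>(4)[of s] zint_mellin(2)[of s] rGamma_mult_Gamma[of s] that by (simp flip: mult.assoc)
    qed
  qed
  then obtain g where g: "g nicely_meromorphic_on UNIV" "\<And>s. Re s > 1 \<Longrightarrow> g s = zint s"
    using meromorphic_glue[of zint 1] H by blast
  have "Z1 = g" unfolding Z1_def
  proof (rule meromorphic_continuation_eqI[OF g(1)])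
    show "open {s. Re s > 1}" by (rule open_halfspace_Re_gt)
    have "2 \<in> {s. Re s > 1}" by simp
    thus "{s. Re s > 1} \<noteq> {}" by blast
    show "g s = (LINT x:{1..}|lborel. of_real ((cmod (zeta (Complex (1/2) x)))\<^sup>2) * of_real x powr (- s))" if "s \<in> {s. Re s > 1}" for s
    proof -
      have "zint s = (LINT x:{1..}|lborel. of_real ((cmod (zeta (Complex (1/2) x)))\<^sup>2) * of_real x powr (- s))"
        unfolding zint_def by (rule set_lebesgue_integral_cong) (auto simp: zz_half_eq)
      thus ?thesis using g(2) that by simp
    qed
  qed
  thus "Z1 nicely_meromorphic_on UNIV" "\<And>s. Re s > 1 \<Longrightarrow> Z1 s = zint s" using g by auto
qed

text \<open>The case N = 0: among the possible poles 1 - n only s = 1 has positive real part. The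
  Mellin transform is bounded in vertical strips away from the real axis, so all growth comes from
  \<open>rGamma\<close>.\<close>

lemma Z1_half_plane:
  shows Z1_holomorphic: "Z1 holomorphic_on {s. Re s > 0} - {1}"
    and Z1_growth: "\<And>B. \<exists>K\<ge>0. \<forall>s. 1/2 \<le> Re s \<and> Re s \<le> B \<and> 1 \<le> Im s \<longrightarrow> cmod (Z1 s) \<le> K * exp (4 * cmod s)"
proof -
  obtain \<Phi> where \<Phi>: "\<Phi> meromorphic_on {s. Re s > - real 0}"
      "\<Phi> holomorphic_on ({s. Re s > - real 0} - {s. \<exists>n::nat. s = 1 - of_nat n})"
      "\<And>s. Re s > 1 \<Longrightarrow> set_integrable lborel {0<..} (\<lambda>p. lap (1/2) (of_real p) * of_real p powr (s - 1))"
      "\<And>s. Re s > 1 \<Longrightarrow> \<Phi> s = (LINT p:{0<..}|lborel. lap (1/2) (of_real p) * of_real p powr (s - 1))"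
      "\<And>\<alpha> \<beta>. \<alpha> > - real 0 \<Longrightarrow> \<exists>K. \<forall>s. \<alpha> \<le> Re s \<and> Re s \<le> \<beta> \<and> 1 \<le> \<bar>Im s\<bar> \<longrightarrow> cmod (\<Phi> s) \<le> K"
      by (rule lap_mellin[of 0]) (rule that, assumption+)
  define S where "S = {s::complex. Re s > 0} - {1}"
  have openS: "open S" unfolding S_def by (intro open_Diff open_halfspace_Re_gt) auto
  have connS: "connected S" unfolding S_def
    by (intro connected_open_delete open_halfspace_Re_gt connected_halfplane_Re_gt) auto
  define h where "h = (\<lambda>s. rGamma s * \<Phi> s)"
  have "S \<subseteq> {s. Re s > - real 0} - {s. \<exists>n::nat. s = 1 - of_nat n}"
  proof
    fix s assume s: "s \<in> S"
    have False if "s = 1 - of_nat n" for n :: nat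
    proof -
      have "n \<noteq> 0" "real n < 1" using s that by (auto simp: S_def intro!: gr0I)
      thus False by simp
    qed
    thus "s \<in> {s. Re s > - real 0} - {s. \<exists>n::nat. s = 1 - of_nat n}" using s by (auto simp: S_def)
  qed
  hence hh: "h holomorphic_on S" unfolding h_def by (intro holomorphic_intros holomorphic_on_subset[OF \<Phi>(2)])
  have eq: "Z1 s = h s" if "s \<in> S" for s
  proof (rule nicely_meromorphic_eqI[where f = Z1 and g = h and z = s and S = S and A = "{s. Re s > 1}"])
    show "Z1 nicely_meromorphic_on S" by (rule nicely_meromorphic_on_subset[OF Z1_nicely_meromorphic]) auto
    show "h nicely_meromorphic_on S" using hh openS
      by (intro analytic_on_imp_nicely_meromorphic_on) (auto simp: analytic_on_open)
    have "2 \<in> {s. Re s > 1}" by simp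
    thus "{s. Re s > 1} \<noteq> {}" by blast
    show "Z1 s = h s" if "s \<in> {s. Re s > 1}" for s
      using \<Phi>(4)[of s] zint_mellin(2)[of s] rGamma_mult_Gamma[of s] Z1_eq_zint[of s] that
      by (simp add: h_def flip: mult.assoc)
  qed (use that openS connS in \<open>auto simp: S_def open_halfspace_Re_gt\<close>)
  show "Z1 holomorphic_on {s. Re s > 0} - {1}"
    using hh eq unfolding S_def[symmetric] by (metis holomorphic_transform)
  fix B :: real
  obtain K1 where K1: "K1 \<ge> 0" "\<And>s. 0 \<le> Re s \<Longrightarrow> Re s \<le> B \<Longrightarrow> 1 \<le> Im s \<Longrightarrow> cmod (rGamma s) \<le> K1 * exp (4 * cmod s)"
    using rGamma_growth[of B] by blast
  obtain K2 where K2: "\<And>s. 1/2 \<le> Re s \<Longrightarrow> Re s \<le> B \<Longrightarrow> 1 \<le> \<bar>Im s\<bar> \<Longrightarrow> cmod (\<Phi> s) \<le> K2"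
    using \<Phi>(5)[of "1/2" B] by auto
  show "\<exists>K\<ge>0. \<forall>s. 1/2 \<le> Re s \<and> Re s \<le> B \<and> 1 \<le> Im s \<longrightarrow> cmod (Z1 s) \<le> K * exp (4 * cmod s)"
  proof (intro exI[of _ "K1 * \<bar>K2\<bar>"] conjI allI impI)
    fix s assume s: "1/2 \<le> Re s \<and> Re s \<le> B \<and> 1 \<le> Im s"
    have "s \<in> S" using s by (auto simp: S_def)
    hence "cmod (Z1 s) = cmod (rGamma s) * cmod (\<Phi> s)" by (simp add: eq h_def norm_mult)
    also have "\<dots> \<le> (K1 * exp (4 * cmod s)) * \<bar>K2\<bar>"
      using s K1 K2[of s] by (intro mult_mono) auto
    finally show "cmod (Z1 s) \<le> K1 * \<bar>K2\<bar> * exp (4 * cmod s)" by (simp add: mult_ac)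
  qed (use K1 in auto)
qed

lemma islimpt_vertical_segment: "Complex c 1 islimpt Complex c ` {3/4..5/4}"
proof (rule islimpt_isCont_image[where f = "Complex c"])
  show "(1::real) islimpt {3/4..5/4}" by (rule islimpt_subset[of _ "{3/4<..<5/4}"]) (auto intro!: open_imp_islimpt)
  show "\<forall>\<^sub>F y in at (1::real). Complex c y \<noteq> Complex c 1"
    by (auto simp: eventually_at_filter)
  show "isCont (Complex c) 1" unfolding Complex_eq by (intro continuous_intros)
qed

text \<open>Otherwise the identity theorem would give zeta(2) = 0, contradicting its series of
  positive terms.\<close>

lemma zeta_line_nonzero: "\<exists>x>1. zeta (Complex (1/2) x) \<noteq> 0"
proof (rule ccontr)
  assume "\<not> ?thesis"
  hence z: "zeta (Complex (1/2) x) = 0" if "x > 1" for x using that by blast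
  define S where "S = {s::complex. Re s > -1} - {1}"
  have openS: "open S" unfolding S_def by (intro open_Diff open_halfspace_Re_gt) auto
  have connS: "connected S" unfolding S_def
    by (intro connected_open_delete open_halfspace_Re_gt connected_halfplane_Re_gt) auto
  have lp: "Complex (1/2) 2 islimpt Complex (1/2) ` {1<..<3}"
  proof (rule islimpt_isCont_image[where f = "Complex (1/2)"])
    show "(2::real) islimpt {1<..<3}" by (rule open_imp_islimpt) auto
    show "\<forall>\<^sub>F y in at (2::real). Complex (1/2) y \<noteq> Complex (1/2) 2"
      by (auto simp: eventually_at_filter)
    show "isCont (Complex (1/2)) 2" unfolding Complex_eq by (intro continuous_intros)
  qed
  have hol: "zeta_em holomorphic_on S" unfolding S_def by (rule zeta_em_holomorphic)
  have "zeta_em 2 = 0"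
  proof (rule analytic_continuation[OF hol openS connS _ _ lp])
    show "zeta_em s = 0" if "s \<in> Complex (1/2) ` {1<..<3}" for s
    proof -
      obtain x where x: "s = Complex (1/2) x" "x > 1" using \<open>s \<in> _\<close> by auto
      have "s \<noteq> 1" using x by (auto simp: complex_eq_iff)
      thus ?thesis using z[OF x(2)] zeta_eq_zeta_em[of s] x(1) by simp
    qed
  qed (auto simp: S_def complex_eq_iff)
  hence "dzeta 2 = 0" using zeta_em_eq_dzeta[of 2] by simp
  moreover have "(\<lambda>n. of_nat (Suc n) powr (- 2)) sums dzeta 2" by (rule dzeta_sums) simp
  ultimately have "(\<lambda>n. complex_of_real (real (Suc n) powr (- 2))) sums of_real 0"
    using powr_of_real[of "real (Suc _)" "-2"] by (simp del: of_nat_Suc)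
  hence "(\<lambda>n. real (Suc n) powr (- 2)) sums 0" unfolding sums_of_real_iff .
  moreover have "(\<Sum>n. real (Suc n) powr (- 2)) > 0"
    by (intro suminf_pos summable_Suc_powr) auto
  ultimately show False by (simp add: sums_iff)
qed

text \<open>Otherwise \<open>Z1 2\<close> = 0, although it is the integral of a continuous
  nonnegative function that is positive somewhere. The segment is used because for t near 1 the
  window of half-width t^\<epsilon> contains it, whatever \<epsilon> is.\<close>

lemma Z1_not_zero_on_segment: "\<exists>v\<in>{3/4..5/4}. Z1 (Complex (1/2) v) \<noteq> 0"
proof (rule ccontr)
  assume "\<not> ?thesis"
  hence z: "Z1 s = 0" if "s \<in> Complex (1/2) ` {3/4..5/4}" for s using that by blast
  define S where "S = {s::complex. Re s > 0} - {1}"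
  have openS: "open S" unfolding S_def by (intro open_Diff open_halfspace_Re_gt) auto
  have connS: "connected S" unfolding S_def
    by (intro connected_open_delete open_halfspace_Re_gt connected_halfplane_Re_gt) auto
  have "Z1 2 = 0"
    by (rule analytic_continuation[OF Z1_holomorphic[folded S_def] openS connS _ _ islimpt_vertical_segment z])
       (auto simp: S_def complex_eq_iff)
  hence zi: "zint 2 = 0" using Z1_eq_zint[of 2] by simp
  define g where "g = (\<lambda>x. cmod (zz (Complex (1/2) x)) * x powr (-2))"
  have geq: "zz (Complex (1/2) x) * of_real x powr (- 2) = of_real (g x)" if "x \<in> {1..}" for x
  proof -
    have e: "zz (Complex (1/2) x) = of_real ((cmod (zeta (Complex (1/2) x)))\<^sup>2)"
      by (rule zz_half_eq) (use that in simp)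
    have "complex_of_real x powr (- 2) = of_real (x powr (- 2))" using powr_of_real[of x "-2"] that by simp
    thus ?thesis unfolding g_def e norm_of_real by simp
  qed
  have gi: "set_integrable lborel {1..} g"
  proof -
    have "set_integrable lborel {1..} (\<lambda>x. norm (zz (Complex (1/2) x) * of_real x powr (- 2)))"
      by (rule set_integrable_norm[OF zint_mellin(1)]) simp
    thus ?thesis by (rule set_integrable_cong[THEN iffD1, OF refl refl, rotated]) (simp add: g_def norm_mult norm_of_real_powr)
  qed
  have "zint 2 = (LINT x:{1..}|lborel. complex_of_real (g x))"
    unfolding zint_def by (rule set_lebesgue_integral_cong) (use geq in auto)
  also have "\<dots> = of_real (LINT x:{1..}|lborel. g x)" by (rule set_integral_complex_of_real)
  finally have g0: "(LINT x:{1..}|lborel. g x) = 0" using zi by simp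
  have gnn: "g x \<ge> 0" for x by (simp add: g_def)
  obtain x0 where x0: "x0 > 1" "zeta (Complex (1/2) x0) \<noteq> 0" using zeta_line_nonzero by blast
  have gx0: "g x0 > 0" using x0 zz_half_eq[of x0] by (simp add: g_def)
  have cg: "continuous_on {0<..} g" unfolding g_def by (intro continuous_intros zz_line_continuous) auto
  hence "isCont g x0" using x0 by (simp add: continuous_on_eq_continuous_at)
  then obtain \<delta> where \<delta>: "\<delta> > 0" "\<And>x. dist x x0 < \<delta> \<Longrightarrow> dist (g x) (g x0) < g x0 / 2"
    unfolding continuous_at_eps_delta using gx0 half_gt_zero by blast
  have "(LINT x:{x0..x0+\<delta>/2}|lborel. g x0 / 2) \<le> (LINT x:{x0..x0+\<delta>/2}|lborel. g x)"
  proof (rule set_integral_mono)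
    have "set_integrable lborel {x0..x0 + \<delta>/2} (\<lambda>_. K)" for K :: real
      unfolding set_integrable_def by (simp add: integrable_indicator_iff emeasure_lborel_Icc_eq)
    thus "set_integrable lborel {x0..x0 + \<delta>/2} (\<lambda>_. g x0 / 2)" .
    show "set_integrable lborel {x0..x0 + \<delta>/2} g" by (rule set_integrable_subset[OF gi]) (use x0 in auto)
    show "g x0 / 2 \<le> g x" if "x \<in> {x0..x0 + \<delta>/2}" for x
      using \<delta>(2)[of x] \<delta>(1) that by (simp add: dist_real_def abs_if split: if_splits)
  qed
  also have "\<dots> \<le> (LINT x:{1..}|lborel. g x)"
    unfolding set_lebesgue_integral_def
  proof (rule integral_mono)
    show "integrable lborel (\<lambda>x. indicat_real {x0..x0+\<delta>/2} x *\<^sub>R g x)"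
      using set_integrable_subset[OF gi, of "{x0..x0+\<delta>/2}"] x0 by (auto simp: set_integrable_def)
    show "integrable lborel (\<lambda>x. indicat_real {1..} x *\<^sub>R g x)" using gi by (simp add: set_integrable_def)
    show "indicat_real {x0..x0+\<delta>/2} x *\<^sub>R g x \<le> indicat_real {1..} x *\<^sub>R g x" for x
      using x0 gnn[of x] by (auto simp: indicator_def)
  qed
  also have "(LINT x:{x0..x0+\<delta>/2}|lborel. g x0 / 2) = \<delta>/2 * (g x0 / 2)"
    using \<delta>(1) by (simp add: set_lebesgue_integral_def)
  finally show False using g0 gx0 \<delta>(1) by (simp add: mult_le_0_iff)
qed

subsection \<open>Repeated integration by parts\<close>

text \<open>From 4 + x \<le> 5x come the factor 625 = 5^4 and, for Re s \<ge> 6, the majorant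
  x^(4-6).\<close>

lemma mellin_Ici_bound:
  fixes f :: "real \<Rightarrow> complex"
  assumes cont: "continuous_on {1..} f" and bd: "\<And>x. x \<ge> 1 \<Longrightarrow> cmod (f x) \<le> C * (4 + x) ^ 4"
    and s: "Re s \<ge> 6"
  shows "set_integrable lborel {1..} (\<lambda>x. f x * of_real x powr (- s))"
    and "cmod (LINT x:{1..}|lborel. f x * of_real x powr (- s)) \<le> 625 * C * (LINT x:{1..}|lborel. x powr (- 2))"
proof -
  have C: "C \<ge> 0"
  proof -
    have "cmod (f 1) \<le> C * (4 + 1) ^ 4" using bd[of 1] by simp
    hence "0 \<le> C * (4 + 1) ^ 4" using norm_ge_zero order_trans by blast
    thus ?thesis by simp
  qed
  have pt: "cmod (f x * of_real x powr (- s)) \<le> 625 * C * x powr (- 2)" if x: "x \<ge> 1" for x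
  proof -
    have "(4 + x) ^ 4 \<le> (5 * x) ^ 4" using x by (intro power_mono) auto
    also have "\<dots> = 625 * x powr 4" using x by (simp add: power_mult_distrib)
    finally have 1: "(4 + x) ^ 4 \<le> 625 * x powr 4" .
    have 2: "x powr (- Re s) \<le> x powr (- 6)" using x s by (intro powr_mono) auto
    have "cmod (f x * of_real x powr (- s)) = cmod (f x) * x powr (- Re s)"
      using x by (simp add: norm_mult norm_of_real_powr)
    also have "\<dots> \<le> (C * (625 * x powr 4)) * x powr (- 6)"
      by (intro mult_mono 2 order_trans[OF bd[OF x]] mult_left_mono 1) (use C x in auto)
    also have "\<dots> = 625 * C * (x powr 4 * x powr (- 6))" by (simp only: mult_ac)
    also have "x powr 4 * x powr (- 6) = x powr (- 2)" by (simp flip: powr_add)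
    finally show ?thesis .
  qed
  have "set_integrable lborel {1..} (\<lambda>u. norm (complex_of_real u powr (- 1 - 1)))"
    by (intro set_integrable_norm integral_Ici_powr) simp
  moreover have "norm (complex_of_real u powr (- 1 - 1)) = u powr (- 2)" if "u \<in> {1..}" for u
    using that by (simp add: norm_of_real_powr)
  ultimately have i2: "set_integrable lborel {1..} (\<lambda>u::real. u powr (- 2))"
    by (metis (no_types, lifting) set_integrable_cong)
  have i3: "set_integrable lborel {1..} (\<lambda>u::real. 625 * C * u powr (- 2))"
    by (intro set_integrable_mult_right i2)
  show i: "set_integrable lborel {1..} (\<lambda>x. f x * of_real x powr (- s))"
    by (rule set_integrable_continuous_bound[OF _ _ i3]) (use pt in \<open>auto intro!: continuous_intros cont\<close>)
  have "cmod (LINT x:{1..}|lborel. f x * of_real x powr (- s)) \<le> (LINT x:{1..}|lborel. cmod (f x * of_real x powr (- s)))"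
    by (rule set_integral_norm_bound[OF i])
  also have "\<dots> \<le> (LINT x:{1..}|lborel. 625 * C * x powr (- 2))"
    by (rule set_integral_mono[OF set_integrable_norm[OF i] i3]) (use pt in auto)
  finally show "cmod (LINT x:{1..}|lborel. f x * of_real x powr (- s)) \<le> 625 * C * (LINT x:{1..}|lborel. x powr (- 2))"
    by simp
qed

text \<open>A neighbourhood of the ray [1, \<infinity>) that is shrunk at each differentiation, to
  leave room for Cauchy discs.\<close>

definition half_strip :: "real \<Rightarrow> real \<Rightarrow> complex set" where
  "half_strip a b = {z. a < Re z \<and> \<bar>Im z\<bar> < b}"

lemma open_half_strip: "open (half_strip a b)"
proof -
  have "half_strip a b = {z. a < Re z} \<inter> {z. Im z < b} \<inter> {z. - b < Im z}" by (auto simp: half_strip_def)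
  thus ?thesis by (auto intro!: open_Int open_halfspace_Re_gt open_halfspace_Im_lt open_halfspace_Im_gt)
qed

text \<open>The fundamental theorem for f(x) x^(1-s), which vanishes at infinity. The bound 7 on Re
  s keeps Re (s - 1) \<ge> 6, as the integral of the derivative requires.\<close>

lemma mellin_Ici_by_parts:
  assumes hol: "f holomorphic_on half_strip a b" and ab: "a < 1" "0 < b"
    and bd: "\<And>x. x \<ge> 1 \<Longrightarrow> cmod (f (of_real x)) \<le> C * (4 + x) ^ 4"
    and bd': "\<And>x. x \<ge> 1 \<Longrightarrow> cmod (deriv f (of_real x)) \<le> C' * (4 + x) ^ 4"
    and s: "Re s \<ge> 7"
  shows "(s - 1) * (LINT x:{1..}|lborel. f (of_real x) * of_real x powr (- s)) =
         f 1 + (LINT x:{1..}|lborel. deriv f (of_real x) * of_real x powr (- (s - 1)))"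
proof -
  have mem: "complex_of_real x \<in> half_strip a b" if "x \<ge> 1" for x using that ab by (auto simp: half_strip_def)
  have hol': "deriv f holomorphic_on half_strip a b" by (rule holomorphic_deriv[OF hol open_half_strip])
  have cont: "continuous_on {1..} (\<lambda>x. g (complex_of_real x))" if "g holomorphic_on half_strip a b" for g
    by (rule continuous_on_compose2[OF holomorphic_on_imp_continuous_on[OF that]]) (use mem in \<open>auto intro!: continuous_intros\<close>)
  have i1: "set_integrable lborel {1..} (\<lambda>x. f (of_real x) * of_real x powr (- s))"
    by (rule mellin_Ici_bound(1)[OF cont[OF hol] bd]) (use s in auto)
  have i2: "set_integrable lborel {1..} (\<lambda>x. deriv f (of_real x) * of_real x powr (- (s - 1)))"
    by (rule mellin_Ici_bound(1)[OF cont[OF hol'] bd']) (use s in auto)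
  define G where "G = (\<lambda>x. f (complex_of_real x) * complex_of_real x powr (1 - s))"
  define g where "g = (\<lambda>x. deriv f (of_real x) * of_real x powr (- (s - 1)) - (s - 1) * (f (of_real x) * complex_of_real x powr (- s)))"
  have "(LINT x:{1..}|lborel. g x) = - G 1"
  proof (rule integral_Ici_FTC)
    fix x :: real assume x: "x \<ge> 1"
    have "(f has_field_derivative deriv f (of_real x)) (at (of_real x))"
      using hol mem[OF x] open_half_strip holomorphic_derivI by blast
    hence "((\<lambda>z. f z * z powr (1 - s)) has_field_derivative
        deriv f (of_real x) * of_real x powr (1 - s) + ((1 - s) * of_real x powr (1 - s - 1)) * f (of_real x)) (at (complex_of_real x))"
      using x by (intro DERIV_mult has_field_derivative_powr) (auto simp: complex_nonpos_Reals_iff)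
    hence "((\<lambda>z. f z * z powr (1 - s)) has_field_derivative g x) (at (complex_of_real x))"
      by (simp add: g_def algebra_simps)
    from has_vector_derivative_real_field[OF this] show "(G has_vector_derivative g x) (at x)"
      by (simp add: G_def)
  next
    show "continuous_on {1..} g" unfolding g_def
      by (intro continuous_intros cont hol hol') auto
    show "set_integrable lborel {1..} g" unfolding g_def
      by (intro set_integral_diff set_integrable_mult_right i1 i2)
    have "((\<lambda>x::real. C * (4 + x) ^ 4 * x powr (- 6)) \<longlongrightarrow> 0) at_top" by real_asymp
    moreover have "eventually (\<lambda>x. cmod (G x) \<le> C * (4 + x) ^ 4 * x powr (- 6)) at_top"
      using eventually_ge_at_top[of 1]
    proof eventually_elim
      case (elim x)
      have "cmod (G x) = cmod (f (of_real x)) * x powr (1 - Re s)"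
        using elim by (simp add: G_def norm_mult norm_of_real_powr)
      also have "\<dots> \<le> (C * (4 + x) ^ 4) * x powr (- 6)"
        using order_trans[OF norm_ge_zero bd[OF elim]] s elim by (intro mult_mono bd powr_mono) auto
      finally show ?case .
    qed
    ultimately show "(G \<longlongrightarrow> 0) at_top" by (rule Lim_null_comparison[rotated])
  qed
  moreover have "(LINT x:{1..}|lborel. g x) = (LINT x:{1..}|lborel. deriv f (of_real x) * of_real x powr (- (s - 1))) -
      (s - 1) * (LINT x:{1..}|lborel. f (of_real x) * of_real x powr (- s))"
    unfolding g_def by (subst set_integral_diff(2)[OF i2 set_integrable_mult_right[OF i1]]) (rule refl | simp)+
  ultimately show ?thesis by (simp add: G_def algebra_simps)
qed

lemma deriv_half_strip_bound:
  assumes hol: "f holomorphic_on half_strip a b" and ab: "0 \<le> a" "a < 1" "0 < b"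
    and bd: "\<And>z. z \<in> half_strip a b \<Longrightarrow> cmod (f z) \<le> C * (4 + Re z) ^ 4"
  obtains C' where "\<And>z. z \<in> half_strip ((a + 1) / 2) (b / 2) \<Longrightarrow> cmod (deriv f z) \<le> C' * (4 + Re z) ^ 4"
proof -
  \<comment> \<open>Half the margin lost when the strip shrinks, so the closed discs stay inside the
    old strip.\<close>
  define r where "r = min ((1 - a) / 2) (b / 2) / 2"
  have r: "0 < r" "r \<le> (1 - a) / 4" "r \<le> b / 4" "r \<le> 1" using ab min.cobounded1[of "(1 - a) / 2" "b / 2"] min.cobounded2[of "(1 - a) / 2" "b / 2"]
    unfolding r_def by simp_all
  have C: "C \<ge> 0"
  proof -
    have "cmod (f 1) \<le> C * (4 + Re 1) ^ 4" using bd[of 1] ab by (simp add: half_strip_def)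
    hence "0 \<le> C * (4 + Re 1) ^ 4" using norm_ge_zero order_trans by blast
    thus ?thesis by simp
  qed
  have "cmod (deriv f z) \<le> (16 * C / r) * (4 + Re z) ^ 4" if z: "z \<in> half_strip ((a + 1) / 2) (b / 2)" for z
  proof -
    have sub: "w \<in> half_strip a b \<and> Re w \<le> Re z + r" if "cmod (z - w) \<le> r" for w
    proof -
      have "\<bar>Re z - Re w\<bar> \<le> r" "\<bar>Im z - Im w\<bar> \<le> r"
        using abs_Re_le_cmod[of "z - w"] abs_Im_le_cmod[of "z - w"] that by auto
      thus ?thesis using z r ab unfolding half_strip_def mem_Collect_eq by (auto simp: field_simps abs_le_iff)
    qed
    have hb: "f holomorphic_on cball z r"
      by (rule holomorphic_on_subset[OF hol]) (use sub in \<open>auto simp: dist_norm\<close>)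
    have "cmod ((deriv ^^ 1) f z) \<le> fact 1 * (16 * C * (4 + Re z) ^ 4) / r ^ 1"
    proof (rule Cauchy_inequality)
      show "f holomorphic_on ball z r" using hb by (rule holomorphic_on_subset) auto
      show "continuous_on (cball z r) f" using hb by (rule holomorphic_on_imp_continuous_on)
      fix w assume "cmod (z - w) = r"
      hence w: "w \<in> half_strip a b" "Re w \<le> Re z + r" using sub[of w] by auto
      have "0 \<le> Re w" "0 \<le> Re z" using w z ab by (auto simp: half_strip_def)
      \<comment> \<open>Since r \<le> 1, moving to the circle at most doubles 4 + Re z, which is the
        origin of the factor 16.\<close>
      hence "(4 + Re w) ^ 4 \<le> (2 * (4 + Re z)) ^ 4" using w r by (intro power_mono) auto
      hence "C * (4 + Re w) ^ 4 \<le> C * (2 * (4 + Re z)) ^ 4" using C by (intro mult_left_mono)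
      also have "\<dots> = 16 * C * (4 + Re z) ^ 4" unfolding power_mult_distrib by simp
      finally show "cmod (f w) \<le> 16 * C * (4 + Re z) ^ 4" using bd[OF w(1)] by linarith
    qed (rule r)
    thus ?thesis by simp
  qed
  thus ?thesis by (rule that)
qed

text \<open>Each integration by parts puts a boundary term into \<open>R\<close>, divides by s - 1,
  and passes to the derivative at s - 1; hence the abscissa k + 6. The function \<open>R\<close>
  built this way is rational with real poles, so it is available in the whole upper half-plane
  although the integral is not.\<close>

lemma mellin_Ici_expansion:
  assumes "f holomorphic_on half_strip a b" "0 \<le> a" "a < 1" "0 < b"
    and "\<And>z. z \<in> half_strip a b \<Longrightarrow> cmod (f z) \<le> C * (4 + Re z) ^ 4"
  shows "\<exists>R K. K \<ge> 0 \<and> R holomorphic_on {s. Im s > 0} \<and> (\<forall>s. Im s \<ge> 1 \<longrightarrow> cmod (R s) \<le> K / Im s) \<and>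
      (\<forall>s. Re s \<ge> real k + 6 \<and> Im s \<ge> 1 \<longrightarrow>
        cmod ((LINT x:{1..}|lborel. f (of_real x) * of_real x powr (- s)) - R s) \<le> K / Im s ^ k)"
  using assms
proof (induction k arbitrary: f a b C)
  case 0
  have mem: "complex_of_real x \<in> half_strip a b" if "x \<ge> 1" for x using that 0 by (auto simp: half_strip_def)
  have c: "continuous_on {1..} (\<lambda>x. f (complex_of_real x))"
    by (rule continuous_on_compose2[OF holomorphic_on_imp_continuous_on[OF 0(1)]]) (use mem in \<open>auto intro!: continuous_intros\<close>)
  have bd: "cmod (f (of_real x)) \<le> C * (4 + x) ^ 4" if "x \<ge> 1" for x using 0(5)[OF mem[OF that]] by simp
  define K where "K = \<bar>625 * C * (LINT x:{1..}|lborel. x powr (- 2))\<bar>"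
  have "cmod (LINT x:{1..}|lborel. f (of_real x) * of_real x powr (- s)) \<le> K" if "Re s \<ge> 6" for s
    unfolding K_def by (rule order_trans[OF mellin_Ici_bound(2)[OF c bd that] abs_ge_self])
  thus ?case by (intro exI[of _ "\<lambda>_. 0"] exI[of _ K]) (auto simp: K_def)
next
  case (Suc k)
  note hol = Suc.prems(1) and ab = Suc.prems(2-4) and bd = Suc.prems(5)
  obtain C' where C': "\<And>z. z \<in> half_strip ((a + 1) / 2) (b / 2) \<Longrightarrow> cmod (deriv f z) \<le> C' * (4 + Re z) ^ 4"
    using deriv_half_strip_bound[OF hol ab bd] by blast
  have "half_strip ((a + 1) / 2) (b / 2) \<subseteq> half_strip a b" using ab by (auto simp: half_strip_def)
  hence hol': "deriv f holomorphic_on half_strip ((a + 1) / 2) (b / 2)"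
    by (rule holomorphic_on_subset[OF holomorphic_deriv[OF hol open_half_strip]])
  have ab': "0 \<le> (a + 1) / 2" "(a + 1) / 2 < 1" "0 < b / 2" using ab by auto
  obtain R K where RK: "K \<ge> 0" "R holomorphic_on {s. Im s > 0}" "\<And>s. Im s \<ge> 1 \<Longrightarrow> cmod (R s) \<le> K / Im s"
    "\<And>s. Re s \<ge> real k + 6 \<Longrightarrow> Im s \<ge> 1 \<Longrightarrow>
        cmod ((LINT x:{1..}|lborel. deriv f (of_real x) * of_real x powr (- s)) - R s) \<le> K / Im s ^ k"
    using Suc.IH[OF hol' ab' C'] by blast
  \<comment> \<open>One step of the recursion; |s - 1| \<ge> Im s supplies the extra factor 1 / Im s
    in both estimates.\<close>
  define Q where "Q = (\<lambda>s. (f 1 + R (s - 1)) / (s - 1))"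
  define L where "L = cmod (f 1) + K"
  have lb: "cmod (s - 1) \<ge> Im s" for s using abs_Im_le_cmod[of "s - 1"] by simp
  have "Q holomorphic_on {s. Im s > 0}"
  proof -
    have "(R \<circ> (\<lambda>s. s - 1)) holomorphic_on {s. Im s > 0}"
      by (rule holomorphic_on_compose_gen[OF _ RK(2)]) (auto intro!: holomorphic_intros)
    thus ?thesis unfolding Q_def comp_def by (intro holomorphic_intros) auto
  qed
  moreover have "cmod (Q s) \<le> L / Im s" if s: "Im s \<ge> 1" for s
  proof -
    have "K / Im s \<le> K / 1" using s RK(1) by (intro divide_left_mono) auto
    hence "cmod (f 1 + R (s - 1)) \<le> L"
      using RK(3)[of "s - 1"] s norm_triangle_ineq[of "f 1" "R (s - 1)"] by (simp add: L_def)
    thus ?thesis unfolding Q_def norm_divide using lb[of s] s RK(1) by (intro frac_le) (auto simp: L_def)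
  qed
  moreover have "cmod ((LINT x:{1..}|lborel. f (of_real x) * of_real x powr (- s)) - Q s) \<le> L / Im s ^ Suc k"
    if s: "Re s \<ge> real (Suc k) + 6" "Im s \<ge> 1" for s
  proof -
    define I where "I = (LINT x:{1..}|lborel. f (of_real x) * of_real x powr (- s))"
    define J where "J = (LINT x:{1..}|lborel. deriv f (of_real x) * of_real x powr (- (s - 1)))"
    have "(s - 1) * I = f 1 + J" unfolding I_def J_def
    proof (rule mellin_Ici_by_parts[OF hol ab(2,3)])
      show "cmod (f (of_real x)) \<le> C * (4 + x) ^ 4" if "x \<ge> 1" for x
        using bd[of "of_real x"] that ab by (simp add: half_strip_def)
      show "cmod (deriv f (of_real x)) \<le> C' * (4 + x) ^ 4" if "x \<ge> 1" for x
        using C'[of "of_real x"] that ab by (simp add: half_strip_def)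
    qed (use s in simp)
    moreover have "s - 1 \<noteq> 0" using lb[of s] s by auto
    ultimately have "I = (f 1 + J) / (s - 1)" by (simp add: field_simps)
    hence "I - Q s = (J - R (s - 1)) / (s - 1)" by (simp add: Q_def flip: diff_divide_distrib)
    hence "cmod (I - Q s) = cmod (J - R (s - 1)) / cmod (s - 1)" by (simp add: norm_divide)
    also have "\<dots> \<le> (K / Im s ^ k) / Im s"
      using RK(4)[of "s - 1"] s lb[of s] RK(1) by (intro frac_le) (auto simp: J_def)
    also have "\<dots> = K / Im s ^ Suc k" by simp
    also have "\<dots> \<le> L / Im s ^ Suc k" using s by (intro divide_right_mono) (auto simp: L_def)
    finally show ?thesis by (simp add: I_def)
  qed
  ultimately show ?case using RK(1) by (intro exI[of _ Q] exI[of _ L]) (auto simp: L_def)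
qed

text \<open>The squared modulus of zeta is not holomorphic, but z \<mapsto> zz(1/2 + i z) extends it
  off the ray. On \<open>half_strip (1/2) 1\<close> the argument stays within -1/2 < Re w < 3/2 and
  Im w > 1/2, the range of \<open>zz_bound\<close>.\<close>

lemma Z1_approx:
  obtains R K where "K \<ge> 0" "R holomorphic_on {s. Im s > 0}" "\<And>s. Im s \<ge> 1 \<Longrightarrow> cmod (R s) \<le> K / Im s"
    "\<And>s. Re s \<ge> real k + 6 \<Longrightarrow> Im s \<ge> 1 \<Longrightarrow> cmod (Z1 s - R s) \<le> K / Im s ^ k"
proof -
  define f where "f = (\<lambda>z. zz (1/2 + \<i> * z))"
  obtain K0 where K0: "K0 \<ge> 0"
    "\<And>w. -1/2 \<le> Re w \<Longrightarrow> Re w \<le> 3/2 \<Longrightarrow> Im w \<ge> 1/2 \<Longrightarrow> cmod (zz w) \<le> K0 * (4 + Im w) ^ 4"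
    using zz_bound by blast
  have "(zz \<circ> (\<lambda>z. 1/2 + \<i> * z)) holomorphic_on half_strip (1/2) 1"
    by (rule holomorphic_on_compose_gen[OF _ zz_holomorphic]) (auto intro!: holomorphic_intros simp: half_strip_def)
  hence "f holomorphic_on half_strip (1/2) 1" by (simp add: f_def comp_def)
  moreover have "cmod (f z) \<le> K0 * (4 + Re z) ^ 4" if "z \<in> half_strip (1/2) 1" for z
    using K0(2)[of "1/2 + \<i> * z"] that by (auto simp: f_def half_strip_def)
  ultimately have "\<exists>R K. K \<ge> 0 \<and> R holomorphic_on {s. Im s > 0} \<and> (\<forall>s. Im s \<ge> 1 \<longrightarrow> cmod (R s) \<le> K / Im s) \<and>
      (\<forall>s. Re s \<ge> real k + 6 \<and> Im s \<ge> 1 \<longrightarrow>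
        cmod ((LINT x:{1..}|lborel. f (of_real x) * of_real x powr (- s)) - R s) \<le> K / Im s ^ k)"
    by (intro mellin_Ici_expansion) auto
  then obtain R K where RK: "K \<ge> 0" "R holomorphic_on {s. Im s > 0}" "\<And>s. Im s \<ge> 1 \<Longrightarrow> cmod (R s) \<le> K / Im s"
    "\<And>s. Re s \<ge> real k + 6 \<Longrightarrow> Im s \<ge> 1 \<Longrightarrow>
        cmod ((LINT x:{1..}|lborel. f (of_real x) * of_real x powr (- s)) - R s) \<le> K / Im s ^ k"
    by blast
  have fe: "f (of_real x) = zz (Complex (1/2) x)" for x by (simp add: f_def Complex_eq)
  have "cmod (Z1 s - R s) \<le> K / Im s ^ k" if "Re s \<ge> real k + 6" "Im s \<ge> 1" for s
    using RK(4)[OF that] that by (simp add: Z1_eq_zint zint_def fe)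
  thus ?thesis using RK that by blast
qed

subsection \<open>The estimate\<close>

text \<open>Re cos w = cos(Re w) cosh(Im w), where cos(Re w) \<ge> 1/2 because 1 < pi/3, and cosh y
  \<ge> exp |y| / 2.\<close>

lemma Re_cos_scaled:
  assumes "\<bar>Re w\<bar> \<le> 1"
  shows "Re (cos w) \<ge> exp \<bar>Im w\<bar> / 4"
proof -
  have "cos 1 \<le> cos (Re w)"
    using assms pi_gt3 cos_monotone_0_pi_le[of "\<bar>Re w\<bar>" 1] by (simp add: abs_le_iff)
  moreover have "cos (pi / 3) \<le> cos (1::real)" using pi_gt3 by (intro cos_monotone_0_pi_le) auto
  ultimately have c: "1 / 2 \<le> cos (Re w)" by (simp add: cos_60)
  have "exp \<bar>Im w\<bar> \<le> exp (Im w) + exp (- Im w)" by (cases "Im w \<ge> 0") auto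
  hence "(1 / 2) * (exp \<bar>Im w\<bar> / 2) \<le> cos (Re w) * ((exp (Im w) + exp (- Im w)) / 2)"
    using c by (intro mult_mono) auto
  thus ?thesis by (simp add: Re_cos)
qed

text \<open>The maximum principle for \<open>D(z) X\<^sup>z\<^sup>-\<^sup>s exp(-cos((z-s)/B))\<close>: the last factor decays doubly
  exponentially along the horizontal sides.\<close>
lemma rectangle_bound:
  fixes D :: "complex \<Rightarrow> complex"
  assumes hol: "D holomorphic_on cbox (Complex (1/2) (t - \<delta>)) (Complex B (t + \<delta>))"
    and \<sigma>: "1/2 \<le> \<sigma>" "\<sigma> \<le> 1" and B: "B \<ge> 1" and X: "X \<ge> 1" and \<delta>: "\<delta> \<ge> 0"
    and left: "\<And>v. v \<in> {t - \<delta>..t + \<delta>} \<Longrightarrow> cmod (D (Complex (1/2) v)) \<le> ML"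
    and right: "\<And>v. v \<in> {t - \<delta>..t + \<delta>} \<Longrightarrow> cmod (D (Complex B v)) \<le> MR"
    and horiz: "\<And>u v. u \<in> {1/2..B} \<Longrightarrow> v \<in> {t - \<delta>, t + \<delta>} \<Longrightarrow> cmod (D (Complex u v)) \<le> MH"
  shows "cmod (D (Complex \<sigma> t)) \<le>
           exp 1 * (ML * X powr (1/2 - \<sigma>) + MR * X powr (B - \<sigma>) + MH * (X powr B * exp (- (exp (\<delta> / B) / 4))))"
proof -
  define s where "s = Complex \<sigma> t"
  define S where "S = cbox (Complex (1/2) (t - \<delta>)) (Complex B (t + \<delta>))"
  define G where "G = (\<lambda>z. D z * exp ((z - s) * of_real (ln X)) * exp (- cos ((z - s) / of_real B)))"
  have memS: "z \<in> S \<longleftrightarrow> 1/2 \<le> Re z \<and> Re z \<le> B \<and> t - \<delta> \<le> Im z \<and> Im z \<le> t + \<delta>" for z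
    by (auto simp: S_def in_cbox_complex_iff)
  have nonneg: "ML \<ge> 0" "MR \<ge> 0" "MH \<ge> 0"
    using order_trans[OF norm_ge_zero left[of t]] order_trans[OF norm_ge_zero right[of t]]
      order_trans[OF norm_ge_zero horiz[of B "t + \<delta>"]] \<delta> B by auto
  have norm_G: "cmod (G z) \<le> cmod (D z) * X powr (Re z - \<sigma>) * exp (- (exp (\<bar>Im z - t\<bar> / B) / 4))" if z: "z \<in> S" for z
  proof -
    \<comment> \<open>Dividing by the width \<open>B\<close> brings the real part of the cosine's
      argument into [-1, 1].\<close>
    have "\<bar>Re z - \<sigma>\<bar> \<le> B" using z \<sigma> B unfolding memS abs_le_iff by auto
    hence "\<bar>Re ((z - s) / of_real B)\<bar> \<le> 1" using B by (simp add: s_def)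
    from Re_cos_scaled[OF this]
    have "exp (\<bar>Im z - t\<bar> / B) / 4 \<le> Re (cos ((z - s) / of_real B))" using B by (simp add: s_def)
    moreover have "exp ((Re z - \<sigma>) * ln X) = X powr (Re z - \<sigma>)" using X by (simp add: powr_def)
    ultimately show ?thesis unfolding G_def norm_mult norm_exp_eq_Re
      by (intro mult_mono) (auto simp: s_def)
  qed
  define T where "T = ML * X powr (1/2 - \<sigma>) + MR * X powr (B - \<sigma>) + MH * (X powr B * exp (- (exp (\<delta> / B) / 4)))"
  have terms: "0 \<le> ML * X powr (1/2 - \<sigma>)" "0 \<le> MR * X powr (B - \<sigma>)" "0 \<le> MH * (X powr B * exp (- (exp (\<delta> / B) / 4)))"
    using nonneg by auto
  have "cmod (G s) \<le> T"
  proof (rule maximum_modulus_frontier[where S = S and f = G and \<xi> = s])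
    have hG: "G holomorphic_on S" unfolding G_def S_def using B by (intro holomorphic_intros hol) auto
    show "G holomorphic_on interior S" by (rule holomorphic_on_subset[OF hG interior_subset])
    show "continuous_on (closure S) G"
      using holomorphic_on_imp_continuous_on[OF hG] by (simp add: S_def)
    show "bounded S" by (simp add: S_def)
    show "s \<in> S" using \<sigma> B \<delta> by (simp add: memS s_def)
    fix z assume "z \<in> frontier S"
    hence z: "z \<in> S" and nb: "z \<notin> box (Complex (1/2) (t - \<delta>)) (Complex B (t + \<delta>))"
      by (auto simp: S_def frontier_cbox)
    have zc: "z = Complex (Re z) (Im z)" by simp
    have e1: "exp (- (exp (\<bar>Im z - t\<bar> / B) / 4)) \<le> 1" by simp
    consider "Re z = 1/2" | "Re z = B" | "Im z = t - \<delta> \<or> Im z = t + \<delta>"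
      using z nb unfolding memS in_box_complex_iff by force
    thus "cmod (G z) \<le> T"
    proof cases
      case 1
      have "z = Complex (1/2) (Im z)" using 1 by (simp add: complex_eq_iff)
      hence "cmod (D z) \<le> ML" using left[of "Im z"] z by (simp add: memS)
      hence "cmod (G z) \<le> ML * X powr (1/2 - \<sigma>) * 1"
        using nonneg by (intro order_trans[OF norm_G[OF z, unfolded 1]] mult_mono e1) auto
      thus ?thesis using terms by (simp add: T_def)
    next
      case 2
      have "cmod (D z) \<le> MR" using right[of "Im z"] z 2 zc by (simp add: memS)
      hence "cmod (G z) \<le> MR * X powr (B - \<sigma>) * 1"
        using nonneg 2 by (intro order_trans[OF norm_G[OF z]] mult_mono e1) auto
      thus ?thesis using terms by (simp add: T_def)
    next
      case 3
      have "cmod (D z) \<le> MH" using horiz[of "Re z" "Im z"] z 3 zc by (simp add: memS)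
      moreover have "X powr (Re z - \<sigma>) \<le> X powr B" using z X \<sigma> by (intro powr_mono) (auto simp: memS)
      moreover have "\<bar>Im z - t\<bar> = \<delta>" using 3 \<delta> by auto
      ultimately have "cmod (G z) \<le> MH * X powr B * exp (- (exp (\<delta> / B) / 4))"
        using nonneg by (intro order_trans[OF norm_G[OF z]] mult_mono) auto
      thus ?thesis using terms by (simp add: T_def mult.assoc)
    qed
  qed
  hence "exp 1 * cmod (G s) \<le> exp 1 * T" by (intro mult_left_mono) auto
  \<comment> \<open>At z = s the damping factor is exp(-cos 0) = exp(-1), which accounts for the
    factor exp 1 in the bound.\<close>
  moreover have "cmod (G s) = cmod (D s) * exp (- 1)" by (simp add: G_def norm_mult)
  hence "exp 1 * cmod (G s) = cmod (D s) * (exp 1 * exp (- 1))" by (simp only: mult_ac)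
  hence "exp 1 * cmod (G s) = cmod (D s)" by (simp flip: exp_add)
  ultimately have "cmod (D s) \<le> exp 1 * T" by simp
  thus ?thesis unfolding s_def T_def .
qed

abbreviation (input) Z1_sup :: "real \<Rightarrow> real \<Rightarrow> real" where
  "Z1_sup \<epsilon> t \<equiv> (SUP v\<in>{t - t powr \<epsilon>..t + t powr \<epsilon>}. cmod (Z1 (Complex (1/2) v)))"

text \<open>A real supremum dominates its set only if the set is bounded above. The window may also
  contain v \<le> 0, but 1/2 + i v never meets the pole at 1, so continuity on a compact interval
  suffices.\<close>

lemma Z1_line_bdd_above: "bdd_above ((\<lambda>v. cmod (Z1 (Complex (1/2) v))) ` {a..b})"
proof -
  have "continuous_on UNIV (\<lambda>v. Z1 (Complex (1/2) v))"
  proof (rule continuous_on_compose2[OF holomorphic_on_imp_continuous_on[OF Z1_holomorphic]])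
    show "continuous_on UNIV (Complex (1/2))" unfolding Complex_eq by (intro continuous_intros)
  qed (auto simp: complex_eq_iff)
  hence "continuous_on {a..b} (\<lambda>v. cmod (Z1 (Complex (1/2) v)))"
    by (intro continuous_intros) (rule continuous_on_subset, auto)
  thus ?thesis
    by (intro bounded_imp_bdd_above compact_imp_bounded compact_continuous_image compact_Icc)
qed

lemma Z1_le_sup: "v \<in> {t - t powr \<epsilon>..t + t powr \<epsilon>} \<Longrightarrow> cmod (Z1 (Complex (1/2) v)) \<le> Z1_sup \<epsilon> t"
  by (rule cSUP_upper[OF _ Z1_line_bdd_above])

lemma Z1_sup_nonneg: "Z1_sup \<epsilon> t \<ge> 0"
  using order_trans[OF norm_ge_zero Z1_le_sup[of t t \<epsilon>]] by simp

section \<open>The estimate for large t\<close>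

text \<open>The restriction \<epsilon> \<le> 1/2 keeps the window within [t/2, 3t/2] for t \<ge> 4;
  larger exponents are reduced to it afterwards by monotonicity.\<close>

lemma Z1_large_bound:
  assumes \<epsilon>: "0 < \<epsilon>" "\<epsilon> \<le> 1/2"
  shows "\<exists>C\<ge>0. eventually (\<lambda>t. \<forall>\<sigma>. 1/2 \<le> \<sigma> \<and> \<sigma> \<le> 1 \<longrightarrow>
           cmod (Z1 (Complex \<sigma> t)) \<le> C * (t powr (1/2 - \<sigma> + \<epsilon>) * Z1_sup \<epsilon> t + 1 / t)) at_top"
proof -
  \<comment> \<open>The right side requires (1 - \<epsilon>)(k + 6) \<le> k - 1, which follows from
    \<epsilon> k \<ge> 8.\<close>
  define k where "k = nat \<lceil>8 / \<epsilon>\<rceil>"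
  define B where "B = real k + 6"
  have "8 / \<epsilon> \<le> real k" unfolding k_def by linarith
  hence k: "8 \<le> \<epsilon> * real k" using \<epsilon> by (simp add: field_simps)
  have B: "B \<ge> 1" "B > 0" by (simp_all add: B_def)
  obtain R K where RK: "K \<ge> 0" "R holomorphic_on {s. Im s > 0}" "\<And>s. Im s \<ge> 1 \<Longrightarrow> cmod (R s) \<le> K / Im s"
    "\<And>s. Re s \<ge> B \<Longrightarrow> Im s \<ge> 1 \<Longrightarrow> cmod (Z1 s - R s) \<le> K / Im s ^ k"
    by (rule Z1_approx[of k, folded B_def]) (rule that, assumption+)
  obtain Kg where Kg: "Kg \<ge> 0" "\<And>s. 1/2 \<le> Re s \<Longrightarrow> Re s \<le> B \<Longrightarrow> 1 \<le> Im s \<Longrightarrow> cmod (Z1 s) \<le> Kg * exp (4 * cmod s)"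
    using Z1_growth[of B] by blast
  define L where "L = Kg + K"
  define C where "C = exp 1 * (1 + 2 * K + K * 2 ^ k + L) + K"
  have L0: "L \<ge> 0" and C0: "C \<ge> 0" using Kg RK by (auto simp: L_def C_def)
  \<comment> \<open>The growth bound at heights up to 2t, times X^B \<le> t^B, times the damping.
    The extra factor t makes the horizontal sides contribute at most a multiple of 1/t.\<close>
  have "((\<lambda>t::real. exp (4 * (B + 2 * t)) * (t powr B * exp (- (exp (t powr \<epsilon> / B) / 4))) * t) \<longlongrightarrow> 0) at_top"
    using \<epsilon> B by real_asymp
  hence "eventually (\<lambda>t::real. exp (4 * (B + 2 * t)) * (t powr B * exp (- (exp (t powr \<epsilon> / B) / 4))) * t < 1) at_top"
    by (rule order_tendstoD) simp
  hence "eventually (\<lambda>t. \<forall>\<sigma>. 1/2 \<le> \<sigma> \<and> \<sigma> \<le> 1 \<longrightarrow>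
           cmod (Z1 (Complex \<sigma> t)) \<le> C * (t powr (1/2 - \<sigma> + \<epsilon>) * Z1_sup \<epsilon> t + 1 / t)) at_top"
    using eventually_ge_at_top[of 4]
  proof eventually_elim
    case (elim t)
    show ?case
    proof (intro allI impI)
      fix \<sigma> :: real assume \<sigma>: "1/2 \<le> \<sigma> \<and> \<sigma> \<le> 1"
      define \<delta> where "\<delta> = t powr \<epsilon>"
      define X where "X = t powr (1 - \<epsilon>)"
      define M where "M = Z1_sup \<epsilon> t"
      define E where "E = t powr (1/2 - \<sigma> + \<epsilon>) * M"
      have t: "t \<ge> 4" by (rule elim)
      have "\<delta> \<le> t powr (1/2)" unfolding \<delta>_def using \<epsilon> t by (intro powr_mono) auto
      also have "\<dots> = sqrt t" using t by (simp add: powr_half_sqrt)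
      also have "\<dots> \<le> t / 2" by (rule real_le_lsqrt) (use t in \<open>auto simp: power2_eq_square field_simps\<close>)
      finally have \<delta>: "0 \<le> \<delta>" "\<delta> \<le> t / 2" by (simp_all add: \<delta>_def)
      have X1: "X \<ge> 1" unfolding X_def using t \<epsilon> by (intro ge_one_powr_ge_zero) auto
      have M0: "M \<ge> 0" unfolding M_def by (rule Z1_sup_nonneg)
      have E0: "E \<ge> 0" using M0 by (simp add: E_def)
      have Rb: "cmod (R z) \<le> 2 * K / t" if "Im z \<ge> t - \<delta>" for z
      proof -
        have "cmod (R z) \<le> K / Im z" using RK(3)[of z] that \<delta> t by simp
        also have "\<dots> \<le> K / (t / 2)" using that \<delta> t RK(1) by (intro divide_left_mono) auto
        finally show ?thesis by (simp add: mult.commute)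
      qed
      have "cmod (Z1 (Complex \<sigma> t) - R (Complex \<sigma> t)) \<le> exp 1 * ((M + 2 * K / t) * X powr (1/2 - \<sigma>) +
          (K * 2 ^ k / t ^ k) * X powr (B - \<sigma>) + (L * exp (4 * (B + 2 * t))) * (X powr B * exp (- (exp (\<delta> / B) / 4))))"
      proof (rule rectangle_bound[where D = "\<lambda>z. Z1 z - R z"])
        show "(\<lambda>z. Z1 z - R z) holomorphic_on cbox (Complex (1/2) (t - \<delta>)) (Complex B (t + \<delta>))"
          using \<delta> t
          by (intro holomorphic_intros holomorphic_on_subset[OF Z1_holomorphic] holomorphic_on_subset[OF RK(2)])
             (auto simp: in_cbox_complex_iff)
        show "cmod (Z1 (Complex (1/2) v) - R (Complex (1/2) v)) \<le> M + 2 * K / t" if "v \<in> {t - \<delta>..t + \<delta>}" for v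
          using norm_triangle_ineq4[of "Z1 (Complex (1/2) v)" "R (Complex (1/2) v)"] Rb[of "Complex (1/2) v"]
            Z1_le_sup[of v t \<epsilon>] that by (simp add: M_def \<delta>_def)
        show "cmod (Z1 (Complex B v) - R (Complex B v)) \<le> K * 2 ^ k / t ^ k" if v: "v \<in> {t - \<delta>..t + \<delta>}" for v
        proof -
          have "cmod (Z1 (Complex B v) - R (Complex B v)) \<le> K / v ^ k"
            using RK(4)[of "Complex B v"] v \<delta> t by simp
          also have "\<dots> \<le> K / (t / 2) ^ k"
            using v \<delta> t RK(1) by (intro divide_left_mono power_mono mult_pos_pos zero_less_power) auto
          finally show ?thesis by (simp add: power_divide)
        qed
        show "cmod (Z1 (Complex u v) - R (Complex u v)) \<le> L * exp (4 * (B + 2 * t))"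
          if uv: "u \<in> {1/2..B}" "v \<in> {t - \<delta>, t + \<delta>}" for u v
        proof -
          have v1: "1 \<le> v" "v \<le> 2 * t" using uv \<delta> t by auto
          have "cmod (Complex u v) \<le> B + 2 * t"
            using cmod_le[of "Complex u v"] uv v1 by simp
          hence "cmod (Z1 (Complex u v)) \<le> Kg * exp (4 * (B + 2 * t))"
            using Kg uv v1 by (intro order_trans[OF Kg(2)] mult_left_mono) auto
          moreover have "cmod (R (Complex u v)) \<le> K * exp (4 * (B + 2 * t))"
          proof -
            have "cmod (R (Complex u v)) \<le> K / v" using RK(3)[of "Complex u v"] v1 by simp
            also have "\<dots> \<le> K / 1" using v1 RK(1) by (intro divide_left_mono) auto
            also have "\<dots> \<le> K * exp (4 * (B + 2 * t))" using RK(1) B t by (simp add: mult_le_cancel_left1)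
            finally show ?thesis .
          qed
          ultimately show ?thesis
            using norm_triangle_ineq4[of "Z1 (Complex u v)" "R (Complex u v)"] by (simp add: L_def algebra_simps)
        qed
      qed (use \<sigma> B X1 \<delta> in auto)
      also have "\<dots> \<le> exp 1 * ((E + 2 * K / t) + K * 2 ^ k / t + L / t)"
      proof (intro mult_left_mono add_mono)
        \<comment> \<open>Using X = t^(1 - \<epsilon>) in place of t changes the exponent 1/2 -
          \<sigma> by \<epsilon> (\<sigma> - 1/2), which is at most \<epsilon>.\<close>
        have Xe: "X powr (1/2 - \<sigma>) = t powr ((1 - \<epsilon>) * (1/2 - \<sigma>))" by (simp add: X_def powr_powr)
        have "\<epsilon> * (\<sigma> - 1/2) \<le> \<epsilon> * 1" using \<epsilon> \<sigma> by (intro mult_left_mono) auto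
        moreover have "(1 - \<epsilon>) * (1/2 - \<sigma>) = 1/2 - \<sigma> + \<epsilon> * (\<sigma> - 1/2)" by (simp add: field_simps)
        ultimately have "(1 - \<epsilon>) * (1/2 - \<sigma>) \<le> 1/2 - \<sigma> + \<epsilon>" by linarith
        hence "X powr (1/2 - \<sigma>) \<le> t powr (1/2 - \<sigma> + \<epsilon>)" unfolding Xe using t by (intro powr_mono) auto
        moreover have "X powr (1/2 - \<sigma>) \<le> X powr 0" using X1 \<sigma> by (intro powr_mono) auto
        hence "X powr (1/2 - \<sigma>) \<le> 1" using X1 by simp
        ultimately have "M * X powr (1/2 - \<sigma>) + (2 * K / t) * X powr (1/2 - \<sigma>) \<le> M * t powr (1/2 - \<sigma> + \<epsilon>) + (2 * K / t) * 1"
          using M0 RK(1) t by (intro add_mono mult_left_mono) auto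
        thus "(M + 2 * K / t) * X powr (1/2 - \<sigma>) \<le> E + 2 * K / t" by (simp add: E_def algebra_simps)
        have "X powr (B - \<sigma>) \<le> X powr B" using X1 \<sigma> by (intro powr_mono) auto
        also have "\<dots> = t powr ((1 - \<epsilon>) * B)" by (simp add: X_def powr_powr)
        also have "\<dots> \<le> t powr (real k - 1)" using k \<epsilon> t by (intro powr_mono) (auto simp: B_def algebra_simps)
        also have "\<dots> = t ^ k / t" using t by (simp add: powr_diff powr_realpow)
        finally have "K * 2 ^ k / t ^ k * X powr (B - \<sigma>) \<le> K * 2 ^ k / t ^ k * (t ^ k / t)"
          using RK(1) t by (intro mult_left_mono) auto
        thus "K * 2 ^ k / t ^ k * X powr (B - \<sigma>) \<le> K * 2 ^ k / t" using t by simp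
        have "X \<le> t powr 1" unfolding X_def using t \<epsilon> by (intro powr_mono) auto
        hence "X powr B \<le> t powr B" using X1 t B by (intro powr_mono2) auto
        hence "exp (4 * (B + 2 * t)) * (X powr B * exp (- (exp (\<delta> / B) / 4))) \<le>
            exp (4 * (B + 2 * t)) * (t powr B * exp (- (exp (\<delta> / B) / 4)))"
          by (intro mult_left_mono mult_right_mono) auto
        also have "\<dots> \<le> 1 / t" using elim(1) t by (simp add: \<delta>_def field_simps)
        finally have "L * (exp (4 * (B + 2 * t)) * (X powr B * exp (- (exp (\<delta> / B) / 4)))) \<le> L * (1 / t)"
          using L0 by (intro mult_left_mono)
        thus "L * exp (4 * (B + 2 * t)) * (X powr B * exp (- (exp (\<delta> / B) / 4))) \<le> L / t"
          by (simp add: mult.assoc)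
      qed auto
      finally have "cmod (Z1 (Complex \<sigma> t) - R (Complex \<sigma> t)) \<le> exp 1 * ((E + 2 * K / t) + K * 2 ^ k / t + L / t)" .
      moreover have "cmod (R (Complex \<sigma> t)) \<le> K / t" using RK(3)[of "Complex \<sigma> t"] t by simp
      moreover have "cmod (Z1 (Complex \<sigma> t)) \<le> cmod (Z1 (Complex \<sigma> t) - R (Complex \<sigma> t)) + cmod (R (Complex \<sigma> t))"
        using norm_triangle_ineq[of "Z1 (Complex \<sigma> t) - R (Complex \<sigma> t)" "R (Complex \<sigma> t)"] by simp
      ultimately have "cmod (Z1 (Complex \<sigma> t)) \<le> exp 1 * ((E + 2 * K / t) + K * 2 ^ k / t + L / t) + K / t" by linarith
      also have "\<dots> = exp 1 * E + (C - exp 1) / t" by (simp add: C_def algebra_simps add_divide_distrib)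
      also have "\<dots> \<le> C * E + C / t"
      proof (rule add_mono)
        have "exp 1 \<le> C" using RK(1) L0 by (simp add: C_def distrib_left)
        thus "exp 1 * E \<le> C * E" using E0 by (intro mult_right_mono)
        show "(C - exp 1) / t \<le> C / t" using t by (intro divide_right_mono) auto
      qed
      finally show "cmod (Z1 (Complex \<sigma> t)) \<le> C * (t powr (1/2 - \<sigma> + \<epsilon>) * Z1_sup \<epsilon> t + 1 / t)"
        by (simp add: E_def M_def distrib_left)
    qed
  qed
  thus ?thesis using C0 by blast
qed

text \<open>The absolute value makes the expression nonnegative also for t < 1, which occurs when t0
  < 1.\<close>

definition bound_rhs :: "real \<Rightarrow> real \<Rightarrow> real \<Rightarrow> real" where
  "bound_rhs \<epsilon> \<sigma> t = t powr (1/2 - \<sigma> + \<epsilon>) * Z1_sup \<epsilon> t + (t powr ((9 - 16 * \<sigma>) / 7) + t powr (-1)) * \<bar>ln t\<bar>"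

lemma bound_rhs_ge:
  shows "t powr (1/2 - \<sigma> + \<epsilon>) * Z1_sup \<epsilon> t + t powr (-1) * \<bar>ln t\<bar> \<le> bound_rhs \<epsilon> \<sigma> t"
    and "t powr (1/2 - \<sigma> + \<epsilon>) * Z1_sup \<epsilon> t \<le> bound_rhs \<epsilon> \<sigma> t"
    and "t powr (-1) * \<bar>ln t\<bar> \<le> bound_rhs \<epsilon> \<sigma> t"
    and "0 \<le> bound_rhs \<epsilon> \<sigma> t"
proof -
  have 1: "0 \<le> t powr (1/2 - \<sigma> + \<epsilon>) * Z1_sup \<epsilon> t" by (intro mult_nonneg_nonneg Z1_sup_nonneg) auto
  have 2: "0 \<le> t powr (-1) * \<bar>ln t\<bar>" "0 \<le> t powr ((9 - 16 * \<sigma>) / 7) * \<bar>ln t\<bar>" by auto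
  show "t powr (1/2 - \<sigma> + \<epsilon>) * Z1_sup \<epsilon> t + t powr (-1) * \<bar>ln t\<bar> \<le> bound_rhs \<epsilon> \<sigma> t"
    using 2 unfolding bound_rhs_def distrib_right by linarith
  show "t powr (1/2 - \<sigma> + \<epsilon>) * Z1_sup \<epsilon> t \<le> bound_rhs \<epsilon> \<sigma> t"
    using 2 unfolding bound_rhs_def distrib_right by linarith
  show "t powr (-1) * \<bar>ln t\<bar> \<le> bound_rhs \<epsilon> \<sigma> t"
    using 1 2 unfolding bound_rhs_def distrib_right by linarith
  show "0 \<le> bound_rhs \<epsilon> \<sigma> t"
    using 1 2 unfolding bound_rhs_def distrib_right by linarith
qed

text \<open>For t \<ge> 1 both the power of t and the supremum over the window increase with the
  exponent, so the bound for min(\<epsilon>, 1/2) implies the one for \<epsilon>.\<close>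

lemma Z1_large_bound_rhs:
  assumes "\<epsilon> > 0"
  obtains C T where "C \<ge> 0" "T \<ge> 2"
    "\<And>\<sigma> t. 1/2 \<le> \<sigma> \<Longrightarrow> \<sigma> \<le> 1 \<Longrightarrow> t \<ge> T \<Longrightarrow> cmod (Z1 (Complex \<sigma> t)) \<le> C * bound_rhs \<epsilon> \<sigma> t"
proof -
  define e where "e = min \<epsilon> (1/2)"
  have e: "0 < e" "e \<le> 1/2" "e \<le> \<epsilon>" using assms by (auto simp: e_def)
  obtain C T where C: "C \<ge> 0" "\<And>t \<sigma>. t \<ge> T \<Longrightarrow> 1/2 \<le> \<sigma> \<Longrightarrow> \<sigma> \<le> 1 \<Longrightarrow>
      cmod (Z1 (Complex \<sigma> t)) \<le> C * (t powr (1/2 - \<sigma> + e) * Z1_sup e t + 1 / t)"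
    using Z1_large_bound[OF e(1,2)] unfolding eventually_at_top_linorder by blast
  have "cmod (Z1 (Complex \<sigma> t)) \<le> C * bound_rhs \<epsilon> \<sigma> t" if \<sigma>: "1/2 \<le> \<sigma>" "\<sigma> \<le> 1" and t: "t \<ge> max T 3" for \<sigma> t
  proof -
    have "t powr e \<le> t powr \<epsilon>" using e t by (intro powr_mono) auto
    hence "Z1_sup e t \<le> Z1_sup \<epsilon> t"
      by (intro cSUP_subset_mono Z1_line_bdd_above) auto
    moreover have "t powr (1/2 - \<sigma> + e) \<le> t powr (1/2 - \<sigma> + \<epsilon>)" using e t by (intro powr_mono) auto
    ultimately have 1: "t powr (1/2 - \<sigma> + e) * Z1_sup e t \<le> t powr (1/2 - \<sigma> + \<epsilon>) * Z1_sup \<epsilon> t"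
      by (intro mult_mono Z1_sup_nonneg) auto
    \<comment> \<open>From t \<ge> 3 > e; this absorbs the term 1/t into t^(-1) |ln t|.\<close>
    have "ln t \<ge> 1" using t exp_le by (subst ln_ge_iff) auto
    hence "1 / t \<le> t powr (-1) * \<bar>ln t\<bar>" using t by (simp add: powr_minus field_simps)
    hence "t powr (1/2 - \<sigma> + e) * Z1_sup e t + 1 / t \<le> bound_rhs \<epsilon> \<sigma> t"
      using 1 bound_rhs_ge(1)[of t \<sigma> \<epsilon>] by linarith
    hence "C * (t powr (1/2 - \<sigma> + e) * Z1_sup e t + 1 / t) \<le> C * bound_rhs \<epsilon> \<sigma> t"
      using C(1) by (rule mult_left_mono)
    thus ?thesis using C(2)[of t \<sigma>] t \<sigma> by simp
  qed
  thus ?thesis using that[OF C(1), of "max T 3"] by simp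
qed

section \<open>Bounded t\<close>

text \<open>Away from t = 1 the term t^(-1) |ln t| is bounded below. Near t = 1 the window has
  half-width close to 1 and contains the segment of \<open>Z1_not_zero_on_segment\<close>, so the
  supremum is bounded below.\<close>

lemma bound_rhs_lower:
  assumes \<epsilon>: "\<epsilon> > 0" and t0: "t0 > 0"
  obtains m where "m > 0" "\<And>\<sigma> t. 1/2 \<le> \<sigma> \<Longrightarrow> \<sigma> \<le> 1 \<Longrightarrow> t0 \<le> t \<Longrightarrow> t \<le> T \<Longrightarrow> m \<le> bound_rhs \<epsilon> \<sigma> t"
proof -
  obtain v0 where v0: "v0 \<in> {3/4..5/4}" "Z1 (Complex (1/2) v0) \<noteq> 0" using Z1_not_zero_on_segment by blast
  have "((\<lambda>t::real. t - t powr \<epsilon>) \<longlongrightarrow> 1 - 1 powr \<epsilon>) (at 1)" by (intro tendsto_intros) auto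
  hence "eventually (\<lambda>t::real. t - t powr \<epsilon> < 3/4) (at 1)" by (rule order_tendstoD) simp
  moreover have "((\<lambda>t::real. t + t powr \<epsilon>) \<longlongrightarrow> 1 + 1 powr \<epsilon>) (at 1)" by (intro tendsto_intros) auto
  hence "eventually (\<lambda>t::real. t + t powr \<epsilon> > 5/4) (at 1)" by (rule order_tendstoD) simp
  ultimately have "eventually (\<lambda>t::real. t - t powr \<epsilon> < 3/4 \<and> t + t powr \<epsilon> > 5/4) (at 1)"
    by (rule eventually_conj)
  then obtain d where d: "d > 0" "\<And>t::real. t \<noteq> 1 \<Longrightarrow> dist t 1 < d \<Longrightarrow> t - t powr \<epsilon> < 3/4 \<and> t + t powr \<epsilon> > 5/4"
    unfolding eventually_at by blast
  define \<eta> where "\<eta> = min d (1/2)"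
  have \<eta>: "0 < \<eta>" "\<eta> \<le> d" "\<eta> \<le> 1/2" using d by (auto simp: \<eta>_def)
  define m1 where "m1 = exp (- (1 + \<epsilon>)) * cmod (Z1 (Complex (1/2) v0))"
  \<comment> \<open>The least value of |ln t| outside (1 - \<eta>, 1 + \<eta>), times the least
    value of 1/t up to T.\<close>
  define m2 where "m2 = \<bar>T\<bar> powr (-1) * min (ln (1 + \<eta>)) (- ln (1 - \<eta>))"
  have m1: "m1 > 0" using v0 by (simp add: m1_def)
  have near: "m1 \<le> bound_rhs \<epsilon> \<sigma> t" if \<sigma>: "1/2 \<le> \<sigma>" "\<sigma> \<le> 1" and t: "\<bar>t - 1\<bar> < \<eta>" for \<sigma> t
  proof -
    have "t - t powr \<epsilon> < 3/4 \<and> t + t powr \<epsilon> > 5/4"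
      using d(2)[of t] t \<eta> by (cases "t = 1") (auto simp: dist_real_def)
    hence Z: "cmod (Z1 (Complex (1/2) v0)) \<le> Z1_sup \<epsilon> t" using v0 by (intro Z1_le_sup) auto
    have t': "1/2 \<le> t" "t \<le> 3/2" using t \<eta> by (auto simp: abs_less_iff)
    have "ln t \<le> t - 1" using t' by (intro ln_le_minus_one) auto
    moreover have "- ln t \<le> 1"
    proof -
      have "ln (inverse t) \<le> inverse t - 1" using t' by (intro ln_le_minus_one) auto
      moreover have "inverse t \<le> 2" using t' by (simp add: field_simps)
      ultimately show ?thesis using t' by (simp add: ln_inverse)
    qed
    ultimately have l: "\<bar>ln t\<bar> \<le> 1" using t' by auto
    have a: "\<bar>1/2 - \<sigma> + \<epsilon>\<bar> \<le> 1 + \<epsilon>" using \<sigma> \<epsilon> by auto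
    have "\<bar>(1/2 - \<sigma> + \<epsilon>) * ln t\<bar> \<le> (1 + \<epsilon>) * 1" unfolding abs_mult using a l \<epsilon> by (intro mult_mono) auto
    hence "exp (- (1 + \<epsilon>)) \<le> t powr (1/2 - \<sigma> + \<epsilon>)" using t' by (simp add: powr_def abs_le_iff)
    hence "m1 \<le> t powr (1/2 - \<sigma> + \<epsilon>) * Z1_sup \<epsilon> t" unfolding m1_def using Z by (intro mult_mono) auto
    thus ?thesis using bound_rhs_ge(2)[of t \<sigma> \<epsilon>] by linarith
  qed
  have far: "m2 > 0 \<and> m2 \<le> bound_rhs \<epsilon> \<sigma> t" if t: "t0 \<le> t" "t \<le> T" "\<not> \<bar>t - 1\<bar> < \<eta>" for \<sigma> t
  proof -
    have tp: "t > 0" "T > 0" using t t0 by auto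
    have "m2 > 0" using tp \<eta> by (auto simp: m2_def intro!: mult_pos_pos)
    have "min (ln (1 + \<eta>)) (- ln (1 - \<eta>)) \<le> \<bar>ln t\<bar>"
    proof (cases "t \<ge> 1")
      case True
      hence "ln (1 + \<eta>) \<le> ln t" using t \<eta> by (subst ln_le_cancel_iff) auto
      thus ?thesis by linarith
    next
      case False
      hence "ln t \<le> ln (1 - \<eta>)" using t \<eta> tp by (subst ln_le_cancel_iff) auto
      thus ?thesis by linarith
    qed
    moreover have "\<bar>T\<bar> powr (-1) \<le> t powr (-1)" using tp t by (simp add: powr_minus)
    ultimately have "m2 \<le> t powr (-1) * \<bar>ln t\<bar>" unfolding m2_def using \<eta> by (intro mult_mono) auto
    thus ?thesis using bound_rhs_ge(3)[of t \<epsilon> \<sigma>] \<open>m2 > 0\<close> by linarith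
  qed
  \<comment> \<open>\<open>m2\<close> can fail to be positive only if T = 0. Then no t lies between
    t0 and T, and \<open>m1\<close> serves.\<close>
  define m where "m = (if m2 > 0 then min m1 m2 else m1)"
  have "m > 0" using m1 by (simp add: m_def)
  moreover have "m \<le> bound_rhs \<epsilon> \<sigma> t" if "1/2 \<le> \<sigma>" "\<sigma> \<le> 1" "t0 \<le> t" "t \<le> T" for \<sigma> t
  proof (cases "\<bar>t - 1\<bar> < \<eta>")
    case True
    thus ?thesis using near[OF that(1,2) True] by (auto simp: m_def)
  next
    case False
    thus ?thesis using far[OF that(3,4) False, of \<sigma>] by (auto simp: m_def)
  qed
  ultimately show ?thesis by (rule that)
qed

lemma Z1_compact_bound:
  assumes "t0 > 0"
  obtains M where "M \<ge> 0" "\<And>\<sigma> t. 1/2 \<le> \<sigma> \<Longrightarrow> \<sigma> \<le> 1 \<Longrightarrow> t0 \<le> t \<Longrightarrow> t \<le> T \<Longrightarrow> cmod (Z1 (Complex \<sigma> t)) \<le> M"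
proof -
  define S where "S = cbox (Complex (1/2) t0) (Complex 1 T)"
  have "continuous_on S Z1"
    by (rule continuous_on_subset[OF holomorphic_on_imp_continuous_on[OF Z1_holomorphic]])
       (use assms in \<open>auto simp: S_def in_cbox_complex_iff\<close>)
  moreover have "compact S" by (simp add: S_def)
  ultimately obtain M where M: "\<And>z. z \<in> S \<Longrightarrow> cmod (Z1 z) \<le> M"
    using compact_norm_bound[of S Z1] by blast
  have "cmod (Z1 (Complex \<sigma> t)) \<le> \<bar>M\<bar>" if "1/2 \<le> \<sigma>" "\<sigma> \<le> 1" "t0 \<le> t" "t \<le> T" for \<sigma> t
    using M[of "Complex \<sigma> t"] that by (auto simp: S_def in_cbox_complex_iff)
  thus ?thesis using that[of "\<bar>M\<bar>"] by simp
qed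

theorem theorem2:
  fixes t0 :: real
  assumes "t0 > 0"
  shows "\<forall>\<epsilon>::real. \<epsilon> > 0 \<longrightarrow> (\<exists>C::real. C > 0 \<and>
    (\<forall>\<sigma> t :: real. 1/2 \<le> \<sigma> \<and> \<sigma> \<le> 1 \<and> t \<ge> t0 \<longrightarrow>
      cmod (Z1 (Complex \<sigma> t)) \<le>
        C * (t powr (1/2 - \<sigma> + \<epsilon>) *
               (SUP v\<in>{t - t powr \<epsilon>..t + t powr \<epsilon>}. cmod (Z1 (Complex (1/2) v)))
             + (t powr ((9 - 16 * \<sigma>) / 7) + t powr (-1)) * \<bar>ln t\<bar>)))"
proof (intro allI impI)
  fix \<epsilon> :: real assume \<epsilon>: "\<epsilon> > 0"
  obtain C T where C: "C \<ge> 0" "T \<ge> 2"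
    "\<And>\<sigma> t. 1/2 \<le> \<sigma> \<Longrightarrow> \<sigma> \<le> 1 \<Longrightarrow> t \<ge> T \<Longrightarrow> cmod (Z1 (Complex \<sigma> t)) \<le> C * bound_rhs \<epsilon> \<sigma> t"
    using Z1_large_bound_rhs[OF \<epsilon>] by blast
  obtain M where M: "M \<ge> 0" "\<And>\<sigma> t. 1/2 \<le> \<sigma> \<Longrightarrow> \<sigma> \<le> 1 \<Longrightarrow> t0 \<le> t \<Longrightarrow> t \<le> T \<Longrightarrow> cmod (Z1 (Complex \<sigma> t)) \<le> M"
    using Z1_compact_bound[OF assms] by blast
  obtain m where m: "m > 0" "\<And>\<sigma> t. 1/2 \<le> \<sigma> \<Longrightarrow> \<sigma> \<le> 1 \<Longrightarrow> t0 \<le> t \<Longrightarrow> t \<le> T \<Longrightarrow> m \<le> bound_rhs \<epsilon> \<sigma> t"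
    using bound_rhs_lower[OF \<epsilon> assms] by blast
  \<comment> \<open>C serves for t \<ge> T; below T the quotient M/m compares the bound on the
    compact rectangle with the lower bound of the right side; the summand 1 makes the constant
    positive.\<close>
  define A where "A = C + M / m + 1"
  have "cmod (Z1 (Complex \<sigma> t)) \<le> A * bound_rhs \<epsilon> \<sigma> t" if "1/2 \<le> \<sigma> \<and> \<sigma> \<le> 1 \<and> t \<ge> t0" for \<sigma> t
  proof (cases "t \<ge> T")
    case True
    have "C * bound_rhs \<epsilon> \<sigma> t \<le> A * bound_rhs \<epsilon> \<sigma> t"
      using M(1) m(1) by (intro mult_right_mono bound_rhs_ge) (auto simp: A_def)
    thus ?thesis using C(3)[of \<sigma> t] that True by linarith
  next
    case False
    hence "cmod (Z1 (Complex \<sigma> t)) \<le> M / m * m" using M(2)[of \<sigma> t] that m(1) by simp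
    also have "\<dots> \<le> A * bound_rhs \<epsilon> \<sigma> t"
      using C(1) M(1) m(1) m(2)[of \<sigma> t] that False by (intro mult_mono) (auto simp: A_def)
    finally show ?thesis .
  qed
  moreover have "A > 0" using C(1) M(1) m(1) by (simp add: A_def add_nonneg_pos)
  ultimately show "\<exists>C::real. C > 0 \<and>
    (\<forall>\<sigma> t :: real. 1/2 \<le> \<sigma> \<and> \<sigma> \<le> 1 \<and> t \<ge> t0 \<longrightarrow>
      cmod (Z1 (Complex \<sigma> t)) \<le>
        C * (t powr (1/2 - \<sigma> + \<epsilon>) *
               (SUP v\<in>{t - t powr \<epsilon>..t + t powr \<epsilon>}. cmod (Z1 (Complex (1/2) v)))
             + (t powr ((9 - 16 * \<sigma>) / 7) + t powr (-1)) * \<bar>ln t\<bar>))"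
    unfolding bound_rhs_def by blast
qed

end
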